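(* There exist smooth strongly polyconvex functions $F\colon\mathbb M^{2\times 2}\to\mathbb R$ (of the form $F(A)=\frac{\nu}{2}|A|^2+G(A,\det A)$ with $\nu>0$ and $G\colon\mathbb M^{2\times2}\times\mathbb R\to\mathbb R$ convex) with the following property. Let $\Omega\subset\mathbb R^2$ be a bounded domain and $T>0$. For every $\phi\in C^1_0(\Omega;\mathbb R^2)$ there is $\epsilon_0>0$ such that for every $\epsilon$ with $|\epsilon|<\epsilon_0$ the initial-boundary value problem $$\partial_t u=\operatorname{div} DF(Du)\ \text{ in }\Omega_T,\qquad u|_{\partial'\Omega_T}=0$$ possesses infinitely many Lipschitz weak solutions $u\colon\Omega_T\to\mathbb R^2$ satisfying $u(x,T)=\epsilon\phi(x)$ for $x\in\Omega$ and such that $Du$ is continuous at no point of $\Omega_T$.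
   Context: $\mathbb M^{2\times 2}$ is the space of real $2\times 2$ matrices with inner product $A:B=\operatorname{tr}(A^TB)$ and norm $|A|$. For $F\in C^1$, $DF(A)=(\partial F(A)/\partial A^i_k)$. $\Omega_T=\Omega\times(0,T)$ and $\partial'\Omega_T=(\Omega\times\{0\})\cup(\partial\Omega\times(0,T))$ is the parabolic boundary. For $u\colon\Omega_T\to\mathbb R^2$, $Du=(\partial u^i/\partial x_k)$ is the spatial Jacobian and for a matrix field $w$, $(\operatorname{div} w)^i=\sum_{k}\partial w^i_k/\partial x_k$. A Lipschitz function $u\colon\Omega_T\to\mathbb R^2$ is a weak solution of $\partial_t u=\operatorname{div}DF(Du)$ if $$\int_\Omega (u\cdot\varphi)\big|_{t=0}^{t=T}\,dx=\int_{\Omega_T}\big(u\cdot\partial_t\varphi-DF(Du):D\varphi\big)\,dx\,dt$$ for all $\varphi\in C^1([0,T];C^\infty_c(\Omega;\mathbb R^2))$, with $u(\cdot,0),u(\cdot,T)$ taken in the trace sense; the boundary condition $u|_{\partial'\Omega_T}=0$ is in the trace sense. *)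

theory Defs
  imports "HOL-Analysis.Analysis"
begin

text \<open>Matrices in M^{2x2} are elements of real^2^2, indexed A $ i $ k.
  The inner product on this type is the Frobenius product A:B = tr(A^T B),
  and norm is the Frobenius norm |A|.\<close>

type_synonym mat2 = "real^2^2"

fun diter :: "('a::real_normed_vector \<Rightarrow> 'b::real_normed_vector) \<Rightarrow> 'a list \<Rightarrow> 'a \<Rightarrow> 'b" where
  "diter f [] = f"
| "diter f (v # vs) = (\<lambda>x. frechet_derivative (diter f vs) (at x) v)"

definition smooth_fun :: "('a::real_normed_vector \<Rightarrow> 'b::real_normed_vector) \<Rightarrow> bool" where
  "smooth_fun f \<longleftrightarrow> (\<forall>vs x. diter f vs differentiable (at x))"

definition C1_fun :: "('a::euclidean_space \<Rightarrow> 'b::real_normed_vector) \<Rightarrow> bool" where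
  "C1_fun f \<longleftrightarrow> (\<exists>f'. continuous_on UNIV f' \<and> (\<forall>x. (f has_derivative blinfun_apply (f' x)) (at x)))"

definition DF :: "(mat2 \<Rightarrow> real) \<Rightarrow> mat2 \<Rightarrow> mat2" where
  "DF F A = (\<chi> i k. frechet_derivative F (at A) (axis i (axis k 1)))"

definition strongly_polyconvex_form :: "(mat2 \<Rightarrow> real) \<Rightarrow> bool" where
  "strongly_polyconvex_form F \<longleftrightarrow>
     (\<exists>\<nu>::real. \<exists>G :: mat2 \<times> real \<Rightarrow> real. \<nu> > 0 \<and> convex_on UNIV G \<and>
        (\<forall>A. F A = \<nu> / 2 * (norm A)\<^sup>2 + G (A, det A)))"

definition Dx :: "((real^2) \<times> real \<Rightarrow> real^2) \<Rightarrow> (real^2) \<times> real \<Rightarrow> mat2" where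
  "Dx u z = matrix (frechet_derivative (\<lambda>y. u (y, snd z)) (at (fst z)))"

definition Dt :: "((real^2) \<times> real \<Rightarrow> real^2) \<Rightarrow> (real^2) \<times> real \<Rightarrow> real^2" where
  "Dt \<psi> z = vector_derivative (\<lambda>s. \<psi> (fst z, s)) (at (snd z))"

text \<open>Admissible test functions: C^1 in (x,t), supported in K x R for a compact K in Omega.
  (This class contains C^1([0,T]; C_c^infty(Omega;R^2)), after extension in t.)\<close>
definition test_fun :: "(real^2) set \<Rightarrow> ((real^2) \<times> real \<Rightarrow> real^2) \<Rightarrow> bool" where
  "test_fun \<Omega> \<psi> \<longleftrightarrow> C1_fun \<psi> \<and>
     (\<exists>K. compact K \<and> K \<subseteq> \<Omega> \<and> (\<forall>x t. x \<notin> K \<longrightarrow> \<psi> (x, t) = 0))"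

text \<open>Lipschitz weak solution of u_t = div DF(Du) in Omega_T with u = 0 on the parabolic
  boundary.  u is Lipschitz on closure(Omega) x [0,T] (its unique Lipschitz extension),
  so traces are values of u.\<close>
definition weak_solution :: "(mat2 \<Rightarrow> real) \<Rightarrow> (real^2) set \<Rightarrow> real \<Rightarrow> ((real^2) \<times> real \<Rightarrow> real^2) \<Rightarrow> bool" where
  "weak_solution F \<Omega> T u \<longleftrightarrow>
     (\<exists>L. L-lipschitz_on (closure \<Omega> \<times> {0..T}) u) \<and>
     (\<forall>x\<in>\<Omega>. u (x, 0) = 0) \<and>
     (\<forall>x\<in>frontier \<Omega>. \<forall>t\<in>{0<..<T}. u (x, t) = 0) \<and>
     (\<forall>\<psi>. test_fun \<Omega> \<psi> \<longrightarrow>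
        integral \<Omega> (\<lambda>x. u (x, T) \<bullet> \<psi> (x, T) - u (x, 0) \<bullet> \<psi> (x, 0)) =
        integral (\<Omega> \<times> {0<..<T}) (\<lambda>z. u z \<bullet> Dt \<psi> z - DF F (Dx u z) \<bullet> Dx \<psi> z))"

text \<open>Du is continuous at no point of Omega_T: at no point does Du have an essential limit
  (i.e. no representative of the a.e.-defined Du is continuous there).\<close>
definition nowhere_continuous_grad :: "(real^2) set \<Rightarrow> real \<Rightarrow> ((real^2) \<times> real \<Rightarrow> real^2) \<Rightarrow> bool" where
  "nowhere_continuous_grad \<Omega> T u \<longleftrightarrow>
     (\<forall>z \<in> \<Omega> \<times> {0<..<T}. \<not> (\<exists>L::mat2. \<forall>e>0. \<exists>\<delta>>0.
        AE w in lborel. w \<in> ball z \<delta> \<longrightarrow> norm (Dx u w - L) < e))"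

end

theory Submission
  imports Defs "HOL-Computational_Algebra.Polynomial"
begin

text \<open>The energy is \<open>F = |A|\<^sup>2 / 2\<close> plus a smooth convex function of \<open>(A, det A)\<close>, chosen so that
  \<open>DF B = B + Zs i\<close> near each of five matrices \<open>As i\<close>.  In the variables \<open>A = Du\<close> and \<open>Z = DF(Du) - Du\<close>
  the equation is the linear system \<open>u\<^sub>t = div (A + Z)\<close> together with a pointwise inclusion of \<open>(A, Z)\<close> in the
  graph of \<open>DF - id\<close>, and the wave cone contains all directions \<open>(- (D v) \<otimes> v, D)\<close>.  The five points form a
  \<open>T\<^sub>5\<close>-configuration for this cone, stable under perturbation, so every state in the open set \<open>U 1\<close> can be
  split along the cone into two states that are on average closer to the graph by a fixed factor.
  Starting from \<open>\<epsilon> (t / T) \<phi>\<close> and a flux near \<open>Z0\<close>, highly oscillating compactly supported waves realise such a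
  splitting on almost all of the domain; the distances to the graph and the gradient increments are summable in
  \<open>L\<^sup>1\<close>, so the iteration converges almost everywhere to a Lipschitz solution.  The increments are chosen so small in
  the weak topology that on every ball the average of \<open>nr i \<bullet> (Z - Zs i)\<close> stays positive; hence no single germ
  occurs on a ball, and the gradient has no essential limit anywhere.\<close>

text \<open>Near \<open>As i\<close> the relation \<open>DF B = B + Zs i\<close> makes the graph
  flat: it contains \<open>cball (As i) r\<close> times the single point \<open>Zs i\<close>. So
  only the \<open>Z\<close>-component has to reach isolated values, while the
  \<open>A\<close>-component has room. The five values \<open>Zs i\<close> span a simplex in the
  four-dimensional matrix space, hence the \<open>Z\<close>-part of a loop is explicit barycentric
  algebra. For the \<open>A\<close>-part, a wave with purely spatial frequency \<open>v\<close> has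
  no time derivative at leading order, so the system only asks that \<open>B + \<zeta>\<close>
  annihilate \<open>v\<close>; each \<open>D\<close> therefore admits a whole circle of partners
  \<open>v\<close>. Five free angles face the four equations that close a loop in \<open>A\<close>,
  and this surplus makes the hull open in all eight dimensions. The obstacle is strong convergence
  of the gradients. Along an arm of a loop a symmetric splitting preserves the mean weight of the
  unresolved vertex, so this weight alone gives no decay; its square root, being strictly concave,
  contracts on average.\<close>

section \<open>Iterated differentiability and its closure rules\<close>

primrec ndiff :: "nat \<Rightarrow> ('a::real_normed_vector \<Rightarrow> 'b::real_normed_vector) \<Rightarrow> bool" where
  "ndiff 0 f = True"
| "ndiff (Suc n) f = ((\<forall>x. f differentiable (at x)) \<and>
     (\<forall>v. ndiff n (\<lambda>x. frechet_derivative f (at x) v)))"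

text \<open>\<open>diter\<close> takes the derivative along the last list entry first, while
  \<open>ndiff\<close> peels derivatives off from the inside. This identity matches the two orders,
  so that \<open>rev_induct\<close> on the list of directions applies. The inside-first order is
  what lets sums, products and compositions be treated by one induction on the number of
  derivatives.\<close>

lemma diter_append_single:
  "diter f (vs @ [v]) = diter (\<lambda>x. frechet_derivative f (at x) v) vs"
  by (induction vs) auto

lemma smooth_fun_ndiff:
  assumes "\<And>n. ndiff n f"
  shows "smooth_fun f"
proof -
  have "\<forall>f :: 'a \<Rightarrow> 'b. (\<forall>n. ndiff n f) \<longrightarrow> (\<forall>x. diter f vs differentiable (at x))" for vs
  proof (induction vs rule: rev_induct)
    case Nil
    show ?case
    proof (intro allI impI)
      fix f :: "'a \<Rightarrow> 'b" and x assume "\<forall>n. ndiff n f"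
      then have "ndiff (Suc 0) f" by blast
      then show "diter f [] differentiable (at x)" by simp
    qed
  next
    case (snoc v vs)
    show ?case
    proof (intro allI impI)
      fix f :: "'a \<Rightarrow> 'b" and x assume *: "\<forall>n. ndiff n f"
      have "ndiff n (\<lambda>x. frechet_derivative f (at x) v)" for n
        using *[rule_format, of "Suc n"] by simp
      then show "diter f (vs @ [v]) differentiable (at x)"
        using snoc.IH unfolding diter_append_single by blast
    qed
  qed
  then show ?thesis using assms unfolding smooth_fun_def by blast
qed

lemma ndiff_SucI:
  assumes "\<And>x. (f has_derivative f' x) (at x)" "\<And>v. ndiff n (\<lambda>x. f' x v)"
  shows "ndiff (Suc n) f"
proof -
  have "frechet_derivative f (at x) = f' x" for x
    using frechet_derivative_at[OF assms(1)[of x]] by simp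
  then show ?thesis using assms by (auto simp: differentiable_def)
qed

lemma ndiff_mono: "ndiff (Suc n) f \<Longrightarrow> ndiff n f"
  by (induction n arbitrary: f) auto

lemma ndiff_has_derivative:
  "ndiff (Suc n) f \<Longrightarrow> (f has_derivative frechet_derivative f (at x)) (at x)"
  by (simp add: frechet_derivative_works[symmetric])

lemma ndiff_const: "ndiff n (\<lambda>x. c)"
proof (induction n arbitrary: c)
  case (Suc n)
  show ?case by (rule ndiff_SucI[where f' = "\<lambda>x v. 0"]) (use Suc in auto)
qed simp

lemma ndiff_bounded_linear:
  assumes "bounded_linear f" shows "ndiff n f"
proof (cases n)
  case (Suc m)
  show ?thesis unfolding Suc
    by (rule ndiff_SucI[where f' = "\<lambda>x. f"])
      (auto intro: bounded_linear_imp_has_derivative assms ndiff_const)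
qed simp

lemma ndiff_add: "ndiff n f \<Longrightarrow> ndiff n g \<Longrightarrow> ndiff n (\<lambda>x. f x + g x)"
proof (induction n arbitrary: f g)
  case (Suc n)
  show ?case
    by (rule ndiff_SucI[OF has_derivative_add[OF ndiff_has_derivative[OF Suc.prems(1)]
          ndiff_has_derivative[OF Suc.prems(2)]]]) (use Suc in auto)
qed simp

lemma ndiff_mult:
  fixes f g :: "'a::real_normed_vector \<Rightarrow> real"
  shows "ndiff n f \<Longrightarrow> ndiff n g \<Longrightarrow> ndiff n (\<lambda>x. f x * g x)"
proof (induction n arbitrary: f g)
  case (Suc n)
  show ?case
  proof (rule ndiff_SucI[OF has_derivative_mult[OF ndiff_has_derivative[OF Suc.prems(1)]
          ndiff_has_derivative[OF Suc.prems(2)]]])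
    fix v
    show "ndiff n (\<lambda>x. f x * frechet_derivative g (at x) v + frechet_derivative f (at x) v * g x)"
      using Suc.prems ndiff_mono[OF Suc.prems(1)] ndiff_mono[OF Suc.prems(2)]
      by (intro ndiff_add Suc.IH) auto
  qed
qed simp

lemma ndiff_diff:
  fixes f g :: "'a::real_normed_vector \<Rightarrow> real"
  assumes "ndiff n f" "ndiff n g" shows "ndiff n (\<lambda>x. f x - g x)"
  using ndiff_add[OF assms(1) ndiff_mult[OF ndiff_const[of n "-1"] assms(2)]] by simp

lemma ndiff_compose:
  fixes f :: "'a::real_normed_vector \<Rightarrow> real" and h :: "real \<Rightarrow> real"
  shows "ndiff n h \<Longrightarrow> ndiff n f \<Longrightarrow> ndiff n (\<lambda>x. h (f x))"
proof (induction n arbitrary: f h)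
  case (Suc n)
  have lin: "frechet_derivative h (at y) w = frechet_derivative h (at y) 1 * w" for y w
  proof -
    have "linear (frechet_derivative h (at y))"
      using Suc.prems(1) linear_frechet_derivative by auto
    from linear_scale[OF this, of w 1] show ?thesis by simp
  qed
  show ?case
  proof (rule ndiff_SucI[OF has_derivative_compose[OF ndiff_has_derivative[OF Suc.prems(2)]
          ndiff_has_derivative[OF Suc.prems(1)]]])
    fix v
    have "ndiff n (\<lambda>x. frechet_derivative h (at (f x)) 1 * frechet_derivative f (at x) v)"
    proof (rule ndiff_mult)
      show "ndiff n (\<lambda>x. frechet_derivative h (at (f x)) 1)"
        using Suc.prems ndiff_mono[OF Suc.prems(2)]
        by (intro Suc.IH[where h = "\<lambda>y. frechet_derivative h (at y) 1"]) auto
    qed (use Suc.prems in auto)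
    then show "ndiff n (\<lambda>x. frechet_derivative h (at (f x)) (frechet_derivative f (at x) v))"
      by (subst lin)
  qed
qed simp

lemma ndiff_sum: "finite I \<Longrightarrow> (\<And>i. i \<in> I \<Longrightarrow> ndiff n (f i)) \<Longrightarrow> ndiff n (\<lambda>x. \<Sum>i\<in>I. f i x)"
  by (induction I rule: finite_induct) (auto intro: ndiff_const ndiff_add)

lemma ndiff_antiderivative:
  fixes f g :: "real \<Rightarrow> real"
  assumes "\<And>x. (f has_real_derivative g x) (at x)" "\<And>n. ndiff n g"
  shows "ndiff n f"
proof (cases n)
  case (Suc m)
  show ?thesis unfolding Suc
  proof (rule ndiff_SucI)
    show "(f has_derivative (\<lambda>h. g x * h)) (at x)" for x
      using assms(1)[of x] by (simp add: has_field_derivative_def)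
    show "ndiff m (\<lambda>x. g x * v)" for v
      by (intro ndiff_mult assms ndiff_const)
  qed
qed simp

section \<open>Smooth steps, ramps and caps on the real line\<close>

text \<open>The functions \<open>p(1/x) exp(-1/x)\<close>, extended by zero, form a family closed
  under differentiation, so one induction gives the smoothness of all of them; \<open>p = 1\<close>
  is the usual flat function.\<close>

definition expflat :: "real poly \<Rightarrow> real \<Rightarrow> real" where
  "expflat p x = (if x > 0 then poly p (1/x) * exp (- (1/x)) else 0)"

lemma poly_exp_tendsto_0: "((\<lambda>y. poly p y * exp (- y)) \<longlongrightarrow> (0::real)) at_top"
proof -
  have "((\<lambda>y. \<Sum>i\<le>degree p. coeff p i * (y ^ i / exp y)) \<longlongrightarrow> (\<Sum>i\<le>degree p. coeff p i * 0)) at_top"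
    by (intro tendsto_sum tendsto_mult tendsto_const tendsto_power_div_exp_0)
  then show ?thesis
    by (simp add: poly_altdef sum_distrib_right exp_minus divide_inverse mult.assoc)
qed

lemma expflat_deriv:
  "(expflat p has_real_derivative expflat ([:0,0,1:] * (p - pderiv p)) x) (at x)"
proof (cases x "0::real" rule: linorder_cases)
  case less
  show ?thesis
    by (rule has_field_derivative_transform_within_open[of "\<lambda>x. 0" _ _ "{..<0}"])
      (use less in \<open>auto simp: expflat_def\<close>)
next
  case greater
  have "((\<lambda>x. poly p (1/x) * exp (- (1/x))) has_real_derivative
      expflat ([:0,0,1:] * (p - pderiv p)) x) (at x)"
    using greater unfolding expflat_def
    by (auto intro!: derivative_eq_intros DERIV_chain2[OF poly_DERIV] simp: field_simps power2_eq_square)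
  then show ?thesis
    by (rule has_field_derivative_transform_within_open[of _ _ _ "{0<..}"])
      (use greater in \<open>auto simp: expflat_def\<close>)
next
  case equal
  \<comment> \<open>At the origin both one-sided difference quotients vanish in the limit. On the
    right, the substitution \<open>1/x\<close> turns the quotient into a polynomial times
    \<open>exp (- y)\<close> at infinity; the extra factor \<open>[:0,1:]\<close> comes from
    dividing by \<open>y\<close>.\<close>
  have R: "((\<lambda>y. expflat p y / y) \<longlongrightarrow> 0) (at_right 0)"
  proof -
    have "((\<lambda>y. poly ([:0,1:] * p) (inverse y) * exp (- inverse y)) \<longlongrightarrow> (0::real)) (at_right 0)"
      by (rule filterlim_compose[OF poly_exp_tendsto_0 filterlim_inverse_at_top_right])
    moreover have "\<forall>\<^sub>F y in at_right 0. poly ([:0,1:] * p) (inverse y) * exp (- inverse y) = expflat p y / (y::real)"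
      using eventually_at_right_less[of "0::real"]
      by eventually_elim (auto simp: expflat_def field_simps)
    ultimately show ?thesis by (rule Lim_transform_eventually)
  qed
  have L: "((\<lambda>y. expflat p y / y) \<longlongrightarrow> 0) (at_left 0)"
  proof -
    have "((\<lambda>y::real. 0::real) \<longlongrightarrow> 0) (at_left 0)" by simp
    moreover have "\<forall>\<^sub>F y in at_left 0. 0 = expflat p y / (y::real)"
      by (auto simp: expflat_def eventually_at_filter)
    ultimately show ?thesis by (rule Lim_transform_eventually)
  qed
  have "((\<lambda>y. expflat p y / y) \<longlongrightarrow> 0) (at 0)"
    using R L filterlim_at_split by blast
  then show ?thesis using equal by (simp add: has_field_derivative_iff expflat_def)
qed

lemma ndiff_expflat: "ndiff n (expflat p)"
proof (induction n arbitrary: p)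
  case (Suc n)
  show ?case
  proof (rule ndiff_SucI)
    show "(expflat p has_derivative (\<lambda>h. expflat ([:0,0,1:] * (p - pderiv p)) x * h)) (at x)" for x
      using expflat_deriv[of p x] by (simp add: has_field_derivative_def)
    show "ndiff n (\<lambda>x. expflat ([:0,0,1:] * (p - pderiv p)) x * v)" for v
      by (intro ndiff_mult Suc.IH ndiff_const)
  qed
qed simp

lemma continuous_antiderivative:
  fixes f :: "real \<Rightarrow> real"
  assumes "continuous_on UNIV f"
  obtains F where "\<And>x. (F has_real_derivative f x) (at x)" "F 0 = 0"
proof -
  have "\<exists>F. \<forall>x. -\<infinity> < ereal x \<longrightarrow> ereal x < \<infinity> \<longrightarrow> (F has_vector_derivative f x) (at x)"
    by (rule einterval_antiderivative) (use assms in \<open>auto simp: continuous_on_eq_continuous_at\<close>)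
  then obtain F where "\<And>x. (F has_real_derivative f x) (at x)"
    by (auto simp: has_real_derivative_iff_has_vector_derivative)
  then show ?thesis
    by (intro that[of "\<lambda>x. F x - F 0"]) (auto intro!: derivative_eq_intros)
qed

lemma ndiff_continuous: "(\<And>n. ndiff n f) \<Longrightarrow> continuous_on S f"
  using ndiff_has_derivative[of 0 f] has_derivative_continuous
  by (metis continuous_at_imp_continuous_on)

lemma ndiff_affine_real: "ndiff n (\<lambda>x::real. a + b * x)"
  by (intro ndiff_add ndiff_mult ndiff_const ndiff_bounded_linear bounded_linear_ident)

lemma real_deriv_zero_eq:
  fixes f :: "real \<Rightarrow> real"
  assumes "convex S" "\<And>y. y \<in> S \<Longrightarrow> (f has_real_derivative 0) (at y)" "x \<in> S" "z \<in> S"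
  shows "f x = f z"
proof -
  obtain c where "\<And>y. y \<in> S \<Longrightarrow> f y = c"
    using has_field_derivative_zero_constant[of S f] assms has_field_derivative_at_within by blast
  then show ?thesis using assms by simp
qed

lemma smooth_step_exists:
  obtains st :: "real \<Rightarrow> real" where "\<And>n. ndiff n st" "\<And>x. 0 \<le> st x" "\<And>x. st x \<le> 1"
    "\<And>x. x \<le> 0 \<Longrightarrow> st x = 0" "\<And>x. x \<ge> 1 \<Longrightarrow> st x = 1" "mono st"
proof -
  \<comment> \<open>A bump that is positive exactly on the open unit interval; the step is its
    primitive, divided by the total mass.\<close>
  define b where "b x = expflat 1 x * expflat 1 (1 - x)" for x
  have b1: "ndiff n b" for n
  proof -
    have "ndiff n (\<lambda>x. expflat 1 (1 + (-1) * x))"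
      by (rule ndiff_compose[OF ndiff_expflat ndiff_affine_real])
    then have "ndiff n (\<lambda>x. expflat 1 (1 - x))" by simp
    then show ?thesis unfolding b_def[abs_def] by (intro ndiff_mult ndiff_expflat)
  qed
  have b0: "b x \<ge> 0" for x by (auto simp: b_def expflat_def)
  have bp: "b x > 0" if "0 < x" "x < 1" for x using that by (auto simp: b_def expflat_def)
  have bz: "b x = 0" if "x \<le> 0 \<or> x \<ge> 1" for x using that by (auto simp: b_def expflat_def)
  obtain B where B: "\<And>x. (B has_real_derivative b x) (at x)" "B 0 = 0"
    using continuous_antiderivative[OF ndiff_continuous[OF b1]] by blast
  have Bm: "mono B"
    by (rule monoI, rule DERIV_nonneg_imp_nondecreasing) (use B b0 in auto)
  have B1: "B 1 > 0"
  proof -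
    have c: "continuous_on {0..1} B"
      by (rule continuous_at_imp_continuous_on) (use B(1) DERIV_isCont in blast)
    have "B 0 < B 1"
      using DERIV_pos_imp_increasing_open[OF zero_less_one _ c] B(1) bp by blast
    then show ?thesis using B by simp
  qed
  have Bl: "B x = 0" if "x \<le> 0" for x
    using real_deriv_zero_eq[of "{..0}" B x 0] B bz that by (metis atMost_iff convex_real_interval(2) order_refl)
  have Br: "B x = B 1" if "x \<ge> 1" for x
    using real_deriv_zero_eq[of "{1..}" B x 1] B bz that by (metis atLeast_iff convex_real_interval(1) order_refl)
  show ?thesis
  proof (rule that[of "\<lambda>x. B x * (1 / B 1)"])
    show "ndiff n (\<lambda>x. B x * (1 / B 1))" for n
      by (intro ndiff_mult ndiff_const ndiff_antiderivative[OF B(1) b1])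
    show "0 \<le> B x * (1 / B 1)" for x
      using monoD[OF Bm, of 0 x] B(2) Bl[of x] B1 by (cases "x \<le> 0") auto
    show "B x * (1 / B 1) \<le> 1" for x
      using monoD[OF Bm, of x 1] Br[of x] B1 by (cases "x \<le> 1") auto
    show "mono (\<lambda>x. B x * (1 / B 1))"
      using Bm B1 by (auto simp: mono_def divide_right_mono)
    show "B x * (1 / B 1) = 0" if "x \<le> 0" for x using Bl[OF that] by simp
    show "B x * (1 / B 1) = 1" if "x \<ge> 1" for x unfolding Br[OF that] using B1 by simp
  qed
qed

text \<open>The primitive of a smooth step. It serves as a smoothed positive part: where its
  argument is nonpositive a summand disappears, where the argument is at least 1 it is reproduced up
  to a constant, and monotone convexity preserves the convexity of the argument.\<close>

lemma smooth_ramp_exists: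
  obtains h :: "real \<Rightarrow> real" and c where "\<And>n. ndiff n h" "mono h" "convex_on UNIV h"
    "\<And>x. x \<le> 0 \<Longrightarrow> h x = 0" "\<And>x. x \<ge> 1 \<Longrightarrow> h x = x - c"
proof -
  obtain st :: "real \<Rightarrow> real" where st: "\<And>n. ndiff n st" "\<And>x. 0 \<le> st x" "\<And>x. st x \<le> 1"
    "\<And>x. x \<le> 0 \<Longrightarrow> st x = 0" "\<And>x. x \<ge> 1 \<Longrightarrow> st x = 1" "mono st"
    using smooth_step_exists by blast
  obtain B where B: "\<And>x. (B has_real_derivative st x) (at x)" "B 0 = 0"
    using continuous_antiderivative[OF ndiff_continuous[OF st(1)]] by blast
  show ?thesis
  proof (rule that[of B "1 - B 1"])
    show "ndiff n B" for n by (rule ndiff_antiderivative[OF B(1) st(1)])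
    show "mono B"
      by (rule monoI, rule DERIV_nonneg_imp_nondecreasing) (use B st in auto)
    show "convex_on UNIV B"
    proof (rule convex_on_realI[where f' = st])
      show "st x \<le> st y" if "x \<le> y" for x y using monoD[OF st(6) that] .
    qed (use B in auto)
    show "B x = 0" if "x \<le> 0" for x
      using real_deriv_zero_eq[of "{..0}" B x 0] B st(4) that by (metis atMost_iff convex_real_interval(2) order_refl)
    show "B x = x - (1 - B 1)" if "x \<ge> 1" for x
    proof -
      have "((\<lambda>x. B x - x) has_real_derivative 0) (at y)" if "y \<in> {1..}" for y
        using B(1)[of y] st(5)[of y] that by (auto intro!: derivative_eq_intros)
      then have "B x - x = B 1 - 1"
        using real_deriv_zero_eq[of "{1..}" "\<lambda>x. B x - x" x 1] that by auto
      then show ?thesis by simp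
    qed
  qed
qed

text \<open>The second primitive of a plateau function that equals 1 on \<open>[-1, 1]\<close> and
  vanishes off \<open>[-2, 2]\<close>. It is exactly quadratic near zero but grows only linearly, so
  a rescaled copy keeps the quadratic germ and is small at any fixed distance.\<close>

lemma smooth_cap_exists:
  obtains h :: "real \<Rightarrow> real" and C where "\<And>n. ndiff n h" "convex_on UNIV h"
    "\<And>x. \<bar>x\<bar> \<le> 1 \<Longrightarrow> h x = x\<^sup>2 / 2" "\<And>x. h x \<le> C * \<bar>x\<bar>" "C \<ge> 0"
proof -
  obtain st :: "real \<Rightarrow> real" where st: "\<And>n. ndiff n st" "\<And>x. 0 \<le> st x" "\<And>x. st x \<le> 1"
    "\<And>x. x \<le> 0 \<Longrightarrow> st x = 0" "\<And>x. x \<ge> 1 \<Longrightarrow> st x = 1" "mono st"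
    using smooth_step_exists by blast
  define g where "g x = st (2 + x) * st (2 - x)" for x
  have g1: "ndiff n g" for n
    using ndiff_mult[OF ndiff_compose[OF st(1) ndiff_affine_real[of n 2 1]]
        ndiff_compose[OF st(1) ndiff_affine_real[of n 2 "-1"]]]
    by (simp add: g_def[abs_def])
  have g0: "g x \<ge> 0" for x by (simp add: g_def st)
  have gz: "g x = 0" if "\<bar>x\<bar> \<ge> 2" for x using that st(4)[of "2+x"] st(4)[of "2-x"] unfolding g_def by (cases "x \<ge> 0") auto
  have go: "g x = 1" if "\<bar>x\<bar> \<le> 1" for x using that st(5)[of "2+x"] st(5)[of "2-x"] by (auto simp: g_def)
  obtain B where B: "\<And>x. (B has_real_derivative g x) (at x)" "B 0 = 0"
    using continuous_antiderivative[OF ndiff_continuous[OF g1]] by blast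
  have B1: "ndiff n B" for n by (rule ndiff_antiderivative[OF B(1) g1])
  obtain A where A: "\<And>x. (A has_real_derivative B x) (at x)" "A 0 = 0"
    using continuous_antiderivative[OF ndiff_continuous[OF B1]] by blast
  have Bm: "mono B"
    by (rule monoI, rule DERIV_nonneg_imp_nondecreasing) (use B g0 in auto)
  have const: "f x = f 0" if "\<bar>x\<bar> \<le> 1" "\<And>y. \<bar>y\<bar> \<le> 1 \<Longrightarrow> (f has_real_derivative 0) (at y)" for f and x :: real
    by (rule real_deriv_zero_eq[of "{-1..1}"]) (use that in auto)
  have "((\<lambda>x. B x - x) has_real_derivative 0) (at y)" if "\<bar>y\<bar> \<le> 1" for y
    using B(1)[of y] go[OF that] by (auto intro!: derivative_eq_intros)
  then have Bi: "B x = x" if "\<bar>x\<bar> \<le> 1" for x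
    using const[OF that, of "\<lambda>x. B x - x"] B(2) by simp
  have "((\<lambda>x. A x - x\<^sup>2 / 2) has_real_derivative 0) (at y)" if "\<bar>y\<bar> \<le> 1" for y
    using A(1)[of y] Bi[OF that] by (auto intro!: derivative_eq_intros)
  then have Ai: "A x = x\<^sup>2 / 2" if "\<bar>x\<bar> \<le> 1" for x
    using const[OF that, of "\<lambda>x. A x - x\<^sup>2 / 2"] A(2) by simp
  have "(B has_real_derivative 0) (at y)" if "\<bar>y\<bar> \<ge> 2" for y
    using B(1)[of y] gz[OF that] by simp
  note Bc = this
  have Br: "B x = B 2" if "x > 2" for x
    by (rule real_deriv_zero_eq[of "{2..}"]) (use Bc that in auto)
  have Bl: "B x = B (-2)" if "x < -2" for x
    by (rule real_deriv_zero_eq[of "{..-2}"]) (use Bc that in auto)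
  define C where "C = max \<bar>B 2\<bar> \<bar>B (-2)\<bar>"
  have Bb: "\<bar>B x\<bar> \<le> C" for x
    using monoD[OF Bm, of x 2] monoD[OF Bm, of "-2" x] Br[of x] Bl[of x] unfolding C_def by (smt (verit))
  have Ab: "\<bar>A x - A 0\<bar> \<le> C * \<bar>x - 0\<bar>" for x
    using field_differentiable_bound[of UNIV A B C x 0] A(1) Bb by simp
  show ?thesis
  proof (rule that[of A C])
    show "ndiff n A" for n by (rule ndiff_antiderivative[OF A(1) B1])
    show "convex_on UNIV A"
    proof (rule convex_on_realI[where f' = B])
      show "B x \<le> B y" if "x \<le> y" for x y using monoD[OF Bm that] .
    qed (use A in auto)
    show "A x \<le> C * \<bar>x\<bar>" for x using Ab[of x] A(2) by simp
    show "C \<ge> 0" by (simp add: C_def)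
  qed (use Ai in auto)
qed

section \<open>A smooth polyconvex energy with prescribed quadratic germs\<close>

definition mk :: "real \<Rightarrow> real \<Rightarrow> real \<Rightarrow> real \<Rightarrow> mat2" where
  "mk a b c d = vector [vector [a, b], vector [c, d]]"

lemma mk_sel [simp]:
  "mk a b c d $ 1 $ 1 = a" "mk a b c d $ 1 $ 2 = b" "mk a b c d $ 2 $ 1 = c" "mk a b c d $ 2 $ 2 = d"
  by (simp_all add: mk_def)

lemma mat2_eq_iff:
  "(A :: mat2) = B \<longleftrightarrow> A$1$1 = B$1$1 \<and> A$1$2 = B$1$2 \<and> A$2$1 = B$2$1 \<and> A$2$2 = B$2$2"
  by (auto simp: vec_eq_iff forall_2)

lemma mat2_inner:
  "(A :: mat2) \<bullet> B = A$1$1 * B$1$1 + A$1$2 * B$1$2 + A$2$1 * B$2$1 + A$2$2 * B$2$2"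
  by (simp add: inner_vec_def sum_2)

lemma convex_on_mono_compose:
  fixes f :: "'a::real_vector \<Rightarrow> real" and h :: "real \<Rightarrow> real"
  assumes "convex_on UNIV h" "mono h" "convex_on UNIV f"
  shows "convex_on UNIV (\<lambda>x. h (f x))"
proof (rule convex_onI)
  fix t :: real and x y assume t: "0 < t" "t < 1"
  have "h (f ((1 - t) *\<^sub>R x + t *\<^sub>R y)) \<le> h ((1 - t) *\<^sub>R f x + t *\<^sub>R f y)"
    using convex_onD[OF assms(3), of t x y] t by (intro monoD[OF assms(2)]) auto
  also have "\<dots> \<le> (1 - t) * h (f x) + t * h (f y)"
    using convex_onD[OF assms(1), of t "f x" "f y"] t by auto
  finally show "h (f ((1 - t) *\<^sub>R x + t *\<^sub>R y)) \<le> (1 - t) * h (f x) + t * h (f y)" .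
qed simp

lemma convex_on_linear_compose:
  fixes f :: "'b::real_vector \<Rightarrow> real" and l :: "'a::real_vector \<Rightarrow> 'b"
  assumes "convex_on UNIV f" "linear l"
  shows "convex_on UNIV (\<lambda>x. f (l x + c))"
proof (rule convex_onI)
  fix t :: real and x y assume t: "0 < t" "t < 1"
  have "l ((1 - t) *\<^sub>R x + t *\<^sub>R y) + c = (1 - t) *\<^sub>R (l x + c) + t *\<^sub>R (l y + c)"
    unfolding linear_add[OF assms(2)] linear_scale[OF assms(2)] by (simp add: algebra_simps)
  then show "f (l ((1 - t) *\<^sub>R x + t *\<^sub>R y) + c) \<le> (1 - t) * f (l x + c) + t * f (l y + c)"
    using convex_onD[OF assms(1), of t "l x + c" "l y + c"] t by auto
qed simp

lemma convex_on_affine: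
  fixes l :: "'a::real_vector \<Rightarrow> real"
  assumes "linear l" shows "convex_on UNIV (\<lambda>x. l x + c)"
proof (rule convex_onI)
  fix t :: real and x y
  show "l ((1 - t) *\<^sub>R x + t *\<^sub>R y) + c \<le> (1 - t) * (l x + c) + t * (l y + c)"
    unfolding linear_add[OF assms] linear_scale[OF assms] by (simp add: algebra_simps)
qed simp

lemma convex_on_sum_functions:
  assumes "finite I" "\<And>i. i \<in> I \<Longrightarrow> convex_on UNIV (f i)"
  shows "convex_on UNIV (\<lambda>x::'a::real_vector. \<Sum>i\<in>I. f i x :: real)"
  using assms by (induction I rule: finite_induct) (auto intro!: convex_on_add simp: convex_on_const)

text \<open>The minimum of finitely many admissible sizes; it merges finitely many requirements of
  the form "small enough" into one.\<close>

lemma uniform_radius: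
  fixes I :: "'i set" and P :: "'i \<Rightarrow> real \<Rightarrow> bool"
  assumes "finite I" "\<And>i. i \<in> I \<Longrightarrow> \<exists>r>0. P i r"
    and "\<And>i r s. P i r \<Longrightarrow> 0 < s \<Longrightarrow> s \<le> r \<Longrightarrow> P i s"
  obtains r where "r > 0" "\<And>i. i \<in> I \<Longrightarrow> P i r"
proof -
  have "\<exists>r>0. \<forall>i\<in>I. P i r"
    using assms(1,2)
  proof (induction I rule: finite_induct)
    case empty show ?case by (rule exI[of _ 1]) simp
  next
    case (insert i I)
    then obtain r s where "r > 0" "\<forall>i\<in>I. P i r" "s > 0" "P i s" by (metis insertI1 insertI2)
    then show ?case by (intro exI[of _ "min r s"]) (auto intro: assms(3))
  qed
  then show ?thesis using that by blast
qed

lemma DF_of_quadratic: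
  fixes F :: "mat2 \<Rightarrow> real"
  assumes "\<And>B. dist B A < r \<Longrightarrow> F B = (B \<bullet> B) / 2 + Z \<bullet> B + c" "dist B A < r"
  shows "DF F B = B + Z"
proof -
  have "((\<lambda>B. (B \<bullet> B) / 2 + Z \<bullet> B + c) has_derivative (\<lambda>H. B \<bullet> H + Z \<bullet> H)) (at B)"
    by (auto intro!: derivative_eq_intros simp: inner_commute)
  then have "(F has_derivative (\<lambda>H. B \<bullet> H + Z \<bullet> H)) (at B)"
    by (rule has_derivative_transform_within_open[of _ _ _ UNIV "ball A r"])
      (use assms in \<open>auto simp: dist_commute\<close>)
  then have *: "frechet_derivative F (at B) = (\<lambda>H. B \<bullet> H + Z \<bullet> H)"
    using frechet_derivative_at by force
  have "B \<bullet> axis i (axis k 1) = B $ i $ k" for B :: mat2 and i k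
    by (simp add: inner_axis)
  then show ?thesis unfolding DF_def * by (simp add: vec_eq_iff)
qed

text \<open>The form \<open>k/2 |B|^2 - t det B\<close> becomes diagonal in the four sums and
  differences of opposite entries, with the weights \<open>(k - t)/2\<close> and
  \<open>(k + t)/2\<close>, which are nonnegative for \<open>\<bar>t\<bar> \<le> k\<close>.
  Replacing each square by a convex function of linear growth keeps the form convex and makes it
  small far away.\<close>

definition cap_form :: "(real \<Rightarrow> real) \<Rightarrow> real \<Rightarrow> real \<Rightarrow> mat2 \<Rightarrow> real" where
  "cap_form b k t B = (k - t) / 2 * (b (B$1$1 + B$2$2) + b (B$1$2 - B$2$1))
     + (k + t) / 2 * (b (B$1$1 - B$2$2) + b (B$1$2 + B$2$1))"

lemma cap_form_quadratic:
  assumes "\<And>x. \<bar>x\<bar> \<le> \<rho> \<Longrightarrow> b x = x\<^sup>2 / 2" "norm B \<le> \<rho> / 2"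
  shows "cap_form b k t B = k / 2 * (B \<bullet> B) - t * det B"
proof -
  have c: "\<bar>B $ i $ j\<bar> \<le> \<rho> / 2" for i j
    using component_le_norm_cart[of "B $ i" j] Finite_Cartesian_Product.norm_nth_le[of B i] assms(2) by linarith
  have "b (B$1$1 + B$2$2) = (B$1$1 + B$2$2)\<^sup>2 / 2" "b (B$1$2 - B$2$1) = (B$1$2 - B$2$1)\<^sup>2 / 2"
    "b (B$1$1 - B$2$2) = (B$1$1 - B$2$2)\<^sup>2 / 2" "b (B$1$2 + B$2$1) = (B$1$2 + B$2$1)\<^sup>2 / 2"
    by (rule assms(1), use c[of 1 1] c[of 1 2] c[of 2 1] c[of 2 2] in linarith)+
  note eqs = this
  show ?thesis
    unfolding cap_form_def eqs by (simp add: mat2_inner det_2 power2_eq_square field_simps)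
qed

lemma cap_form_le:
  assumes "\<And>x. b x \<le> C * \<bar>x\<bar>" "C \<ge> 0" "\<bar>t\<bar> \<le> k" "k \<le> 1"
  shows "cap_form b k t B \<le> 8 * C * norm B"
proof -
  have c: "\<bar>B $ i $ j\<bar> \<le> norm B" for i j
    using component_le_norm_cart[of "B $ i" j] Finite_Cartesian_Product.norm_nth_le[of B i] by linarith
  have y: "b x \<le> C * (2 * norm B)" if "\<bar>x\<bar> \<le> 2 * norm B" for x
    using assms(1)[of x] mult_left_mono[OF that assms(2)] by linarith
  have s: "b x + b x' \<le> 4 * C * norm B" if "\<bar>x\<bar> \<le> 2 * norm B" "\<bar>x'\<bar> \<le> 2 * norm B" for x x'
    using y[OF that(1)] y[OF that(2)] by linarith
  have n: "0 \<le> 4 * C * norm B" using assms by simp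
  have e: "a * (x::real) \<le> 4 * C * norm B" if "0 \<le> a" "a \<le> 1" "x \<le> 4 * C * norm B" for a x
    using mult_left_mono[OF that(3,1)] mult_right_mono[OF that(2) n] by linarith
  have "(k - t) / 2 * (b (B$1$1 + B$2$2) + b (B$1$2 - B$2$1)) \<le> 4 * C * norm B"
    by (rule e[OF _ _ s]) (use assms c[of 1 1] c[of 1 2] c[of 2 1] c[of 2 2] in auto)
  moreover have "(k + t) / 2 * (b (B$1$1 - B$2$2) + b (B$1$2 + B$2$1)) \<le> 4 * C * norm B"
    by (rule e[OF _ _ s]) (use assms c[of 1 1] c[of 1 2] c[of 2 1] c[of 2 2] in auto)
  ultimately show ?thesis unfolding cap_form_def by linarith
qed

lemma bounded_linear_entry: "bounded_linear (\<lambda>B::mat2. B $ i $ j)"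
  using bounded_linear_compose[OF bounded_linear_vec_nth[of j] bounded_linear_vec_nth[of i]] by simp

text \<open>Besides \<open>\<nu>/2 |B|^2\<close> the energy is a smoothed maximum of pieces, each
  affine in \<open>(B, det B)\<close> plus a truncated convex quadratic. The germ at
  \<open>A i\<close> contains no determinant, yet the affine piece may carry the slope
  \<open>t i\<close> in the determinant variable, because the quadratic part contains
  \<open>- t i * det (B - A i)\<close> and is still convex. This freedom is what makes the
  separation inequality \<open>sep\<close> satisfiable: piece \<open>i\<close> must be negative at
  the other points.\<close>

lemma polyconvex_germs:
  fixes A Z :: "nat \<Rightarrow> mat2" and t :: "nat \<Rightarrow> real" and \<nu> :: real
  assumes nu: "0 < \<nu>" and t: "\<And>i. i < n \<Longrightarrow> \<bar>t i\<bar> \<le> 1 - \<nu>"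
    and sep: "\<And>i j. i < n \<Longrightarrow> j < n \<Longrightarrow> i \<noteq> j \<Longrightarrow>
      (Z i + (1 - \<nu>) *\<^sub>R A i) \<bullet> (A j - A i) + t i * det (A j - A i) < 0"
  obtains F r where "smooth_fun F" "strongly_polyconvex_form F" "r > 0"
    "\<And>i B. i < n \<Longrightarrow> dist B (A i) < r \<Longrightarrow> DF F B = B + Z i"
proof -
  obtain h :: "real \<Rightarrow> real" and c where h: "\<And>n. ndiff n h" "mono h" "convex_on UNIV h"
    "\<And>x. x \<le> 0 \<Longrightarrow> h x = 0" "\<And>x. x \<ge> 1 \<Longrightarrow> h x = x - c"
    using smooth_ramp_exists by blast
  obtain b0 :: "real \<Rightarrow> real" and C where b0: "\<And>n. ndiff n b0" "convex_on UNIV b0"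
    "\<And>x. \<bar>x\<bar> \<le> 1 \<Longrightarrow> b0 x = x\<^sup>2 / 2" "\<And>x. b0 x \<le> C * \<bar>x\<bar>" "C \<ge> 0"
    using smooth_cap_exists by blast
  \<comment> \<open>The matrix subtracted here is \<open>t i\<close> times the cofactor matrix of
    \<open>A i\<close>. It absorbs the mixed terms of \<open>det (B - A i)\<close>, so that
    \<open>lin\<close> is affine in \<open>B\<close> and in the independent determinant variable
    \<open>d\<close>.\<close>
  define Y where "Y i = Z i + (1 - \<nu>) *\<^sub>R A i - t i *\<^sub>R mk (A i$2$2) (- A i$2$1) (- A i$1$2) (A i$1$1)" for i
  define lin where "lin i B d = Y i \<bullet> (B - A i) + t i * (d - det (A i))" for i B d
  have lin_det: "lin i B (det B) = (Z i + (1 - \<nu>) *\<^sub>R A i) \<bullet> (B - A i) + t i * det (B - A i)" for i B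
    unfolding lin_def Y_def by (simp add: mat2_inner det_2 algebra_simps)
  obtain m where m: "m > 0" "\<And>i j. i < n \<Longrightarrow> j < n \<Longrightarrow> i \<noteq> j \<Longrightarrow> lin i (A j) (det (A j)) \<le> - m"
  proof -
    have "\<exists>m>0. \<forall>p\<in>{p. fst p < n \<and> snd p < n \<and> fst p \<noteq> snd p}. lin (fst p) (A (snd p)) (det (A (snd p))) \<le> - m"
    proof (rule uniform_radius[where I = "{p. fst p < n \<and> snd p < n \<and> fst p \<noteq> snd p}"
          and P = "\<lambda>p m. lin (fst p) (A (snd p)) (det (A (snd p))) \<le> - m"])
      show "finite {p. fst p < n \<and> snd p < n \<and> fst p \<noteq> snd p}"
        by (rule finite_subset[of _ "{..<n} \<times> {..<n}"]) auto
      fix p assume "p \<in> {p. fst p < n \<and> snd p < n \<and> fst p \<noteq> snd p}"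
      then have "lin (fst p) (A (snd p)) (det (A (snd p))) < 0" unfolding lin_det using sep by auto
      then show "\<exists>m>0. lin (fst p) (A (snd p)) (det (A (snd p))) \<le> - m"
        by (intro exI[of _ "- lin (fst p) (A (snd p)) (det (A (snd p)))"]) auto
    qed auto
    then show ?thesis using that by auto
  qed
  define M where "M = (\<Sum>i<n. \<Sum>j<n. norm (A j - A i))"
  have M: "norm (A j - A i) \<le> M" if "i < n" "j < n" for i j
  proof -
    have "norm (A j - A i) \<le> (\<Sum>j<n. norm (A j - A i))"
      by (rule member_le_sum) (use that in auto)
    also have "\<dots> \<le> M" unfolding M_def
      by (rule member_le_sum[where f = "\<lambda>i. \<Sum>j<n. norm (A j - A i)"]) (use that in \<open>auto intro: sum_nonneg\<close>)
    finally show ?thesis .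
  qed
  have M0: "0 \<le> M" unfolding M_def by (intro sum_nonneg) auto
  \<comment> \<open>A cap of width \<open>\<rho>\<close> grows at a rate of order
    \<open>C * \<rho>\<close>; over the distances up to \<open>M\<close> between the points it then
    uses up at most half of the separation margin \<open>m\<close>.\<close>
  define \<rho> where "\<rho> = m / (16 * C * M + 1)"
  have rho: "\<rho> > 0" "8 * (C * \<rho>) * M \<le> m / 2"
  proof -
    have "0 < 16 * C * M + 1" using M0 b0(5) by (simp add: add_nonneg_pos)
    then show "\<rho> > 0" "8 * (C * \<rho>) * M \<le> m / 2" using m(1) by (auto simp: \<rho>_def field_simps)
  qed
  define b where "b x = \<rho>\<^sup>2 * b0 (1 / \<rho> * x)" for x
  have b: "\<And>n. ndiff n b" "convex_on UNIV b"
    "\<And>x. \<bar>x\<bar> \<le> \<rho> \<Longrightarrow> b x = x\<^sup>2 / 2" "\<And>x. b x \<le> (C * \<rho>) * \<bar>x\<bar>"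
  proof -
    show "ndiff n b" for n unfolding b_def[abs_def]
      by (intro ndiff_mult ndiff_const ndiff_compose[OF b0(1)] ndiff_bounded_linear bounded_linear_ident)
    have "convex_on UNIV (\<lambda>x. b0 (1 / \<rho> * x + 0))"
      by (rule convex_on_linear_compose[OF b0(2)]) (auto intro!: linearI simp: algebra_simps add_divide_distrib)
    then show "convex_on UNIV b" unfolding b_def[abs_def]
      by (intro convex_on_cmul) auto
    show "b x = x\<^sup>2 / 2" if "\<bar>x\<bar> \<le> \<rho>" for x
      unfolding b_def using b0(3)[of "1 / \<rho> * x"] that rho(1) by (auto simp: field_simps power2_eq_square)
    show "b x \<le> (C * \<rho>) * \<bar>x\<bar>" for x
    proof -
      have "b x \<le> \<rho>\<^sup>2 * (C * \<bar>1 / \<rho> * x\<bar>)" unfolding b_def by (intro mult_left_mono b0) auto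
      also have "\<dots> = (C * \<rho>) * \<bar>x\<bar>" using rho(1) by (simp add: abs_mult field_simps power2_eq_square)
      finally show ?thesis .
    qed
  qed
  \<comment> \<open>At another point the argument is at most \<open>8/m * (- m/2) + 2 = -2\<close>,
    where the ramp vanishes; at its own point it equals 2, where the ramp is affine.\<close>
  define s where "s = 8 / m"
  have s0: "s > 0" using m by (simp add: s_def)
  define arg where "arg i B d = s * (lin i B d + cap_form b (1 - \<nu>) (t i) (B - A i)) + 2" for i B d
  define G where "G p = (\<Sum>i<n. 1 / s * h (arg i (fst p) (snd p)))" for p
  define F where "F B = \<nu> / 2 * (norm B)\<^sup>2 + G (B, det B)" for B
  have ent: "ndiff k (\<lambda>B. (B - A i) $ a $ b)" for k i a b
    unfolding vector_minus_component
    by (intro ndiff_diff ndiff_const ndiff_bounded_linear bounded_linear_entry)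
  have sm_cap: "ndiff k (\<lambda>B. cap_form b (1 - \<nu>) (t i) (B - A i))" for k i
    unfolding cap_form_def
    by (intro ndiff_add ndiff_diff ndiff_mult ndiff_const ndiff_compose[OF b(1)] ent)
  have sm_det: "ndiff k (det :: mat2 \<Rightarrow> real)" for k
    unfolding det_2[abs_def]
    by (intro ndiff_diff ndiff_mult ndiff_bounded_linear bounded_linear_entry)
  have sm_arg: "ndiff k (\<lambda>B. arg i B (det B))" for k i
    unfolding arg_def lin_def inner_diff_right
    by (intro ndiff_add ndiff_diff ndiff_mult ndiff_const ndiff_bounded_linear bounded_linear_inner_right
        sm_det sm_cap)
  have smF: "smooth_fun F"
  proof (rule smooth_fun_ndiff)
    fix k
    have "ndiff k (\<lambda>B::mat2. \<nu> / 2 * (B$1$1 * B$1$1 + B$1$2 * B$1$2 + B$2$1 * B$2$1 + B$2$2 * B$2$2)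
        + (\<Sum>i<n. 1 / s * h (arg i B (det B))))"
      by (intro ndiff_add ndiff_mult ndiff_const ndiff_bounded_linear bounded_linear_entry ndiff_sum
          ndiff_compose[OF h(1)] sm_arg) auto
    then show "ndiff k F"
      by (simp add: F_def[abs_def] G_def power2_norm_eq_inner mat2_inner)
  qed
  have cv_cap: "convex_on UNIV (\<lambda>p::mat2 \<times> real. cap_form b (1 - \<nu>) (t i) (fst p - A i))" if "i < n" for i
  proof -
    have l: "convex_on UNIV (\<lambda>p::mat2 \<times> real. b (l (fst p) - l (A i)))" if "linear l" for l :: "mat2 \<Rightarrow> real"
      using convex_on_linear_compose[OF b(2), of "\<lambda>p::mat2 \<times> real. l (fst p)" "- l (A i)"]
        linear_compose[OF linear_fst that] by (simp add: o_def)
    note e = bounded_linear.linear[OF bounded_linear_entry]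
    have d: "(B - A i)$1$1 + (B - A i)$2$2 = (B$1$1 + B$2$2) - (A i$1$1 + A i$2$2)"
      "(B - A i)$1$2 - (B - A i)$2$1 = (B$1$2 - B$2$1) - (A i$1$2 - A i$2$1)"
      "(B - A i)$1$1 - (B - A i)$2$2 = (B$1$1 - B$2$2) - (A i$1$1 - A i$2$2)"
      "(B - A i)$1$2 + (B - A i)$2$1 = (B$1$2 + B$2$1) - (A i$1$2 + A i$2$1)" for B by auto
    show ?thesis
      unfolding cap_form_def d
      by (intro convex_on_add convex_on_cmul l linear_compose_add linear_compose_sub e)
        (use t[OF that] in auto)
  qed
  have cvG: "convex_on UNIV G"
    unfolding G_def
  proof (intro convex_on_sum_functions)
    show "convex_on UNIV (\<lambda>p. 1 / s * h (arg i (fst p) (snd p)))" if "i \<in> {..<n}" for i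
    proof (intro convex_on_cmul convex_on_mono_compose[OF h(3,2)])
      have l: "linear (\<lambda>p::mat2 \<times> real. Y i \<bullet> fst p + t i * snd p)"
        by (auto intro!: linearI simp: inner_add_right algebra_simps)
      have "convex_on UNIV (\<lambda>p::mat2 \<times> real. s * ((Y i \<bullet> fst p + t i * snd p + (- (Y i \<bullet> A i) - t i * det (A i)))
           + cap_form b (1 - \<nu>) (t i) (fst p - A i)))"
        by (intro convex_on_cmul convex_on_add convex_on_affine[OF l] cv_cap) (use s0 that in auto)
      from convex_on_add[OF this convex_on_const[of UNIV 2, THEN iffD2, OF convex_UNIV]]
      show "convex_on UNIV (\<lambda>p. arg i (fst p) (snd p))"
        unfolding arg_def lin_def by (simp add: inner_diff_right algebra_simps)
    qed (use s0 in auto)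
  qed auto
  have pcF: "strongly_polyconvex_form F"
    unfolding strongly_polyconvex_form_def using nu cvG by (intro exI[of _ \<nu>] exI[of _ G]) (auto simp: F_def)
  have cont: "isCont (\<lambda>B. arg i B (det B)) B" for i B
    using ndiff_continuous[of "\<lambda>B. arg i B (det B)" UNIV, OF sm_arg] by (simp add: continuous_on_eq_continuous_at)
  have tn: "((\<lambda>B. arg i B (det B)) \<longlongrightarrow> arg i B (det B)) (nhds B)" for i B
    using cont[of B i] unfolding isCont_def by (rule tendsto_at_iff_tendsto_nhds[THEN iffD1])
  have ex_r: "\<exists>r>0. \<forall>B. dist B (A i) < r \<longrightarrow> norm (B - A i) \<le> \<rho> / 2 \<and>
      arg i B (det B) \<ge> 1 \<and> (\<forall>j<n. j \<noteq> i \<longrightarrow> arg j B (det B) \<le> 0)" if i: "i < n" for i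
  proof -
    have z: "cap_form b (1 - \<nu>) (t i) 0 = 0"
      using cap_form_quadratic[of \<rho> b 0 "1 - \<nu>" "t i"] b(3) rho(1) by (simp add: det_2)
    have "arg i (A i) (det (A i)) = 2" unfolding arg_def lin_def by (simp add: z)
    then have e1: "\<forall>\<^sub>F B in nhds (A i). arg i B (det B) > 1"
      using order_tendstoD(1)[OF tn[of i "A i"], of 1] by simp
    have "arg j (A i) (det (A i)) < 0" if "j < n" "j \<noteq> i" for j
    proof -
      have "cap_form b (1 - \<nu>) (t j) (A i - A j) \<le> 8 * (C * \<rho>) * norm (A i - A j)"
        by (rule cap_form_le) (use b(4) b0(5) rho t[OF that(1)] nu in auto)
      also have "\<dots> \<le> 8 * (C * \<rho>) * M" by (intro mult_left_mono M) (use i that b0(5) rho in auto)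
      finally have "lin j (A i) (det (A i)) + cap_form b (1 - \<nu>) (t j) (A i - A j) \<le> - m / 2"
        using m(2)[OF that(1) i that(2)] rho(2) by linarith
      then have "s * (lin j (A i) (det (A i)) + cap_form b (1 - \<nu>) (t j) (A i - A j)) \<le> s * (- m / 2)"
        using s0 by (intro mult_left_mono) auto
      then show ?thesis unfolding arg_def s_def using m(1) by simp
    qed
    then have "\<forall>\<^sub>F B in nhds (A i). arg j B (det B) < 0" if "j \<in> {j. j < n \<and> j \<noteq> i}" for j
      using order_tendstoD(2)[OF tn[of j "A i"], of 0] that by simp
    then have e2: "\<forall>\<^sub>F B in nhds (A i). \<forall>j\<in>{j. j < n \<and> j \<noteq> i}. arg j B (det B) < 0"
      by (intro eventually_ball_finite) auto
    have e3: "\<forall>\<^sub>F B in nhds (A i). norm (B - A i) \<le> \<rho> / 2"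
      unfolding eventually_nhds_metric using rho(1) by (intro exI[of _ "\<rho>/2"]) (auto simp: dist_norm)
    have "\<forall>\<^sub>F B in nhds (A i). norm (B - A i) \<le> \<rho> / 2 \<and> arg i B (det B) \<ge> 1 \<and> (\<forall>j<n. j \<noteq> i \<longrightarrow> arg j B (det B) \<le> 0)"
      using e1 e2 e3 by eventually_elim (auto intro: less_imp_le)
    then show ?thesis unfolding eventually_nhds_metric by blast
  qed
  obtain r where r: "r > 0" "\<And>i. i < n \<Longrightarrow> \<forall>B. dist B (A i) < r \<longrightarrow> norm (B - A i) \<le> \<rho> / 2 \<and>
      arg i B (det B) \<ge> 1 \<and> (\<forall>j<n. j \<noteq> i \<longrightarrow> arg j B (det B) \<le> 0)"
    using uniform_radius[where I = "{..<n}" and P = "\<lambda>i r. \<forall>B. dist B (A i) < r \<longrightarrow> norm (B - A i) \<le> \<rho> / 2 \<and>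
      arg i B (det B) \<ge> 1 \<and> (\<forall>j<n. j \<noteq> i \<longrightarrow> arg j B (det B) \<le> 0)"] ex_r
    by (smt (verit, ccfv_threshold) finite_lessThan lessThan_iff)
  show ?thesis
  proof (rule that[OF smF pcF r(1)])
    fix i B assume i: "i < n" and B: "dist B (A i) < r"
    define w where "w = (2 - c) / s"
    define k where "k = w - Z i \<bullet> A i - (1 - \<nu>) / 2 * (A i \<bullet> A i)"
    \<comment> \<open>Only piece \<open>i\<close> is active here. The determinants cancel between
      \<open>lin\<close> and \<open>cap_form\<close>, and the quadratic parts with weights
      \<open>\<nu>/2\<close> and \<open>(1 - \<nu>)/2\<close> add up to one half of the squared
      norm.\<close>
    have "F B = (B \<bullet> B) / 2 + Z i \<bullet> B + k" if "dist B (A i) < r" for B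
    proof -
      have "G (B, det B) = (\<Sum>j<n. if j = i then 1 / s * h (arg i B (det B)) else 0)"
        unfolding G_def using r(2)[OF i] that h(4) by (intro sum.cong) auto
      also have "\<dots> = 1 / s * h (arg i B (det B))" using i by simp
      also have "\<dots> = 1 / s * (arg i B (det B) - c)" using r(2)[OF i] that h(5) by auto
      also have "\<dots> = lin i B (det B) + cap_form b (1 - \<nu>) (t i) (B - A i) + w"
        using s0 unfolding arg_def w_def by (simp add: field_simps)
      also have "cap_form b (1 - \<nu>) (t i) (B - A i) = (1 - \<nu>) / 2 * ((B - A i) \<bullet> (B - A i)) - t i * det (B - A i)"
        by (rule cap_form_quadratic[OF b(3)]) (use r(2)[OF i] that in auto)
      finally show ?thesis
        unfolding F_def lin_det k_def power2_norm_eq_inner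
        by (simp add: inner_diff_left inner_diff_right inner_add_left inner_add_right inner_commute field_simps)
    qed
    then show "DF F B = B + Z i" by (rule DF_of_quadratic) (use B in auto)
  qed
qed

section \<open>Directions of the wave cone as projections onto a line\<close>

definition outer :: "real^2 \<Rightarrow> real^2 \<Rightarrow> mat2" where
  "outer b v = (\<chi> i k. b $ i * v $ k)"

definition flip1 :: "mat2 \<Rightarrow> mat2" where "flip1 D = mk (D$1$1) (- D$1$2) (D$2$1) (- D$2$2)"
definition flip2 :: "mat2 \<Rightarrow> mat2" where "flip2 D = mk (D$1$2) (D$1$1) (D$2$2) (D$2$1)"

text \<open>\<open>pr D f\<close> is the product of \<open>D\<close> with the orthogonal projection onto the line at angle \<open>f / 2\<close>;
  \<open>dpr D f\<close> is its derivative in \<open>f\<close>.\<close>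

definition pr :: "mat2 \<Rightarrow> real \<Rightarrow> mat2" where
  "pr D f = (1/2) *\<^sub>R (D + cos f *\<^sub>R flip1 D + sin f *\<^sub>R flip2 D)"
definition dpr :: "mat2 \<Rightarrow> real \<Rightarrow> mat2" where
  "dpr D f = (1/2) *\<^sub>R (- sin f *\<^sub>R flip1 D + cos f *\<^sub>R flip2 D)"

lemma norm_mat2: "norm (A :: mat2) = sqrt (A \<bullet> A)" by (simp add: norm_eq_sqrt_inner)

lemma norm_flip [simp]: "norm (flip1 D) = norm D" "norm (flip2 D) = norm D"
  by (simp_all add: norm_mat2 mat2_inner flip1_def flip2_def algebra_simps)

lemma linear_flip: "linear flip1" "linear flip2"
  by (auto intro!: linearI simp: mat2_eq_iff flip1_def flip2_def algebra_simps)

lemma bounded_linear_flip: "bounded_linear flip1" "bounded_linear flip2"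
  using linear_flip by (auto simp: linear_conv_bounded_linear)

lemmas continuous_flip [continuous_intros] =
  bounded_linear.continuous_on[OF bounded_linear_flip(1)] bounded_linear.continuous_on[OF bounded_linear_flip(2)]
  bounded_linear.isCont[OF bounded_linear_flip(1)] bounded_linear.isCont[OF bounded_linear_flip(2)]

lemma tendsto_flip [tendsto_intros]:
  "(f \<longlongrightarrow> l) F \<Longrightarrow> ((\<lambda>x. flip1 (f x)) \<longlongrightarrow> flip1 l) F"
  "(f \<longlongrightarrow> l) F \<Longrightarrow> ((\<lambda>x. flip2 (f x)) \<longlongrightarrow> flip2 l) F"
  using bounded_linear.tendsto[OF bounded_linear_flip(1)] bounded_linear.tendsto[OF bounded_linear_flip(2)] by auto

lemma tendsto_pr [tendsto_intros]:
  "(D \<longlongrightarrow> D0) F \<Longrightarrow> (f \<longlongrightarrow> f0) F \<Longrightarrow> ((\<lambda>x. pr (D x) (f x)) \<longlongrightarrow> pr D0 f0) F"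
  "(D \<longlongrightarrow> D0) F \<Longrightarrow> (f \<longlongrightarrow> f0) F \<Longrightarrow> ((\<lambda>x. dpr (D x) (f x)) \<longlongrightarrow> dpr D0 f0) F"
  unfolding pr_def dpr_def by (auto intro!: tendsto_intros isCont_tendsto_compose[OF isCont_cos] isCont_tendsto_compose[OF isCont_sin])

lemma linear_pr: "linear (\<lambda>D. pr D f)"
  unfolding pr_def
  by (intro linear_compose_scale_right linear_compose_add linear_flip) (auto intro: linear_id[unfolded id_def])

lemma pr_scale: "pr (c *\<^sub>R D) f = c *\<^sub>R pr D f" using linear_scale[OF linear_pr] .
lemma pr_diff: "pr (D - E) f = pr D f - pr E f" using linear_diff[OF linear_pr] .

lemma norm_pr_le: "norm (pr D f) \<le> 2 * norm D"
proof -
  have "norm (D + cos f *\<^sub>R flip1 D + sin f *\<^sub>R flip2 D) \<le> norm D + norm (cos f *\<^sub>R flip1 D) + norm (sin f *\<^sub>R flip2 D)"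
    by (meson norm_triangle_le order_refl norm_triangle_mono)
  also have "\<dots> \<le> norm D + norm D + norm D"
    by (intro add_mono) (auto intro!: mult_left_le_one_le)
  finally show ?thesis unfolding pr_def using norm_ge_zero[of D] by (simp del: norm_ge_zero)
qed

text \<open>The half-angle formulas: for \<open>v = (cos (f/2), sin (f/2))\<close> the projection
  \<open>v \<otimes> v\<close> is affine in \<open>cos f\<close> and \<open>sin f\<close>, and the
  same \<open>v\<close> serves every \<open>D\<close>. Using \<open>f\<close> as the parameter gives
  simple derivatives and lets rational points of the circle be used as exact data.\<close>

lemma pr_outer:
  obtains v :: "real^2" where "norm v = 1" "\<And>D. pr D f = outer (D *v v) v"
proof
  let ?v = "vector [cos (f/2), sin (f/2)] :: real^2"
  show "norm ?v = 1" by (simp add: norm_eq_sqrt_inner inner_vec_def sum_2 power2_eq_square[symmetric])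
  have c: "cos f = 2 * (cos (f/2))\<^sup>2 - 1" "cos f = 1 - 2 * (sin (f/2))\<^sup>2" "sin f = 2 * sin (f/2) * cos (f/2)"
    using cos_double_cos[of "f/2"] cos_double_sin[of "f/2"] sin_double[of "f/2"] by auto
  have "(1 + cos f) / 2 = cos (f/2) * cos (f/2)" unfolding c(1) by (simp add: power2_eq_square)
  moreover have "(1 - cos f) / 2 = sin (f/2) * sin (f/2)" unfolding c(2) by (simp add: power2_eq_square)
  moreover have "sin f / 2 = cos (f/2) * sin (f/2)" unfolding c(3) by simp
  ultimately have e: "(1 + cos f) / 2 = cos (f/2) * cos (f/2)" "(1 - cos f) / 2 = sin (f/2) * sin (f/2)"
    "sin f / 2 = cos (f/2) * sin (f/2)" by auto
  show "pr D f = outer (D *v ?v) ?v" for D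
  proof -
    have "pr D f = mk (D$1$1 * ((1 + cos f) / 2) + D$1$2 * (sin f / 2)) (D$1$2 * ((1 - cos f) / 2) + D$1$1 * (sin f / 2))
      (D$2$1 * ((1 + cos f) / 2) + D$2$2 * (sin f / 2)) (D$2$2 * ((1 - cos f) / 2) + D$2$1 * (sin f / 2))"
      by (simp add: mat2_eq_iff pr_def flip1_def flip2_def field_simps)
    then show ?thesis unfolding e
      by (simp add: mat2_eq_iff outer_def matrix_vector_mult_def sum_2 algebra_simps)
  qed
qed

section \<open>Five-armed loops, the hull they generate and its stability\<close>

text \<open>The functions \<open>w0 j + w1 j \<bullet> p\<close> are the barycentric coordinates of
  \<open>p\<close> in the simplex spanned by the five \<open>Z\<close>. All data are 5-periodic, so
  a loop can be started at any of its vertices. The matrices \<open>R\<close> fix the four-parameter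
  variation of the five angles that will be used to close perturbed loops.\<close>

locale five_points =
  fixes Z A :: "nat \<Rightarrow> mat2" and w0 :: "nat \<Rightarrow> real" and w1 :: "nat \<Rightarrow> mat2" and R :: "nat \<Rightarrow> mat2"
    and r M :: real
  assumes per: "Z (k + 5) = Z k" "A (k + 5) = A k" "w0 (k + 5) = w0 k" "w1 (k + 5) = w1 k" "R (k + 5) = R k"
    and r: "r > 0"
    and w_Z: "j < 5 \<Longrightarrow> k < 5 \<Longrightarrow> w0 (i + j) + w1 (i + j) \<bullet> Z (i + k) = (if j = k then 1 else 0)"
    and w_sum: "(\<Sum>j<5. w0 (i + j) + w1 (i + j) \<bullet> p) = 1"
    and w_bary: "(\<Sum>j<5. (w0 (i + j) + w1 (i + j) \<bullet> p) *\<^sub>R Z (i + j)) = p"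
    and Z_bound: "norm (Z k) < M"
    and A_bound: "norm (A k) < M"
begin

definition w :: "nat \<Rightarrow> mat2 \<Rightarrow> real" where "w j p = w0 j + w1 j \<bullet> p"

text \<open>The \<open>A\<close>-component at the far end of arm \<open>k\<close>: moving from the
  vertex \<open>(a k, p k)\<close> along the cone until the \<open>Z\<close>-component reaches
  \<open>Z (i + k)\<close> leads here. The loop itself follows the arm only for the fraction
  \<open>q k\<close>.\<close>

definition X :: "nat \<Rightarrow> (nat \<Rightarrow> mat2) \<Rightarrow> (nat \<Rightarrow> mat2) \<Rightarrow> (nat \<Rightarrow> real) \<Rightarrow> nat \<Rightarrow> mat2" where
  "X i p a f k = a k - pr (Z (i + k) - p k) (f k)"

definition loop_eqs :: "nat \<Rightarrow> (nat \<Rightarrow> mat2) \<Rightarrow> (nat \<Rightarrow> mat2) \<Rightarrow> (nat \<Rightarrow> real) \<Rightarrow> (nat \<Rightarrow> real) \<Rightarrow> bool" where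
  "loop_eqs i p a q f \<longleftrightarrow>
     (\<forall>k. p (k + 5) = p k \<and> a (k + 5) = a k \<and> q (k + 5) = q k \<and> f (k + 5) = f k \<and>
        p (Suc k) = p k + q k *\<^sub>R (Z (i + k) - p k) \<and>
        a (Suc k) = a k - q k *\<^sub>R pr (Z (i + k) - p k) (f k))"

text \<open>All conditions are strict inequalities and hence survive small perturbations. The lower
  bound on \<open>q k\<close> keeps each vertex well inside the preceding arm (see
  \<open>U_vertex\<close>), and \<open>w j < 1\<close> keeps the vertices off the corners of the
  simplex.\<close>

definition loop_opens :: "nat \<Rightarrow> (nat \<Rightarrow> mat2) \<Rightarrow> (nat \<Rightarrow> mat2) \<Rightarrow> (nat \<Rightarrow> real) \<Rightarrow> (nat \<Rightarrow> real) \<Rightarrow> bool" where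
  "loop_opens i p a q f \<longleftrightarrow>
     (\<forall>k<5. 3/10 < q k \<and> q k < 1 \<and> dist (X i p a f k) (A (i + k)) < r \<and> (\<forall>j<5. w j (p k) < 1) \<and>
        norm (p k) < M \<and> norm (a k) < M)"

text \<open>The derivative at \<open>y = 0\<close> of the closing defect in \<open>A\<close> when
  the angles are \<open>f k + R (i + k) \<bullet> y\<close>.\<close>

definition clos_deriv :: "nat \<Rightarrow> (nat \<Rightarrow> mat2) \<Rightarrow> (nat \<Rightarrow> real) \<Rightarrow> (nat \<Rightarrow> real) \<Rightarrow> mat2 \<Rightarrow> mat2" where
  "clos_deriv i p q f y = (\<Sum>k<5. (R (i + k) \<bullet> y) *\<^sub>R (q k *\<^sub>R dpr (Z (i + k) - p k) (f k)))"

text \<open>Nearness to the identity, rather than mere invertibility, is an open condition directly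
  usable with a fixed point theorem. \<open>R\<close> is normalised so that the explicit loop has
  derivative exactly the identity; the bound 1/2 leaves room for two further errors of 1/4.\<close>

definition nondeg :: "nat \<Rightarrow> (nat \<Rightarrow> mat2) \<Rightarrow> (nat \<Rightarrow> real) \<Rightarrow> (nat \<Rightarrow> real) \<Rightarrow> bool" where
  "nondeg i p q f \<longleftrightarrow> (\<exists>\<kappa><1/2. \<forall>y. norm (clos_deriv i p q f y - y) \<le> \<kappa> * norm y)"

definition loop :: "nat \<Rightarrow> (nat \<Rightarrow> mat2) \<Rightarrow> (nat \<Rightarrow> mat2) \<Rightarrow> (nat \<Rightarrow> real) \<Rightarrow> (nat \<Rightarrow> real) \<Rightarrow> bool" where
  "loop i p a q f \<longleftrightarrow> loop_eqs i p a q f \<and> loop_opens i p a q f \<and> nondeg i p q f"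

text \<open>States on the first arm of some loop, \<open>x\<close> being the weight of the vertex
  and \<open>1 - x\<close> that of the far end. The level \<open>c\<close> bounds the square root of
  \<open>x\<close>: symmetric splittings preserve the mean of \<open>x\<close>, but decrease the
  mean of its square root.\<close>

definition U :: "real \<Rightarrow> (mat2 \<times> mat2) set" where
  "U c = {(x *\<^sub>R a 0 + (1 - x) *\<^sub>R X i p a f 0, x *\<^sub>R p 0 + (1 - x) *\<^sub>R Z i) | x i p a q f.
     0 < x \<and> x < 1 \<and> x < c\<^sup>2 \<and> loop i p a q f}"

lemma U_I:
  assumes "loop i p a q f" "0 < x" "x < 1" "x < c\<^sup>2"
    "\<xi> = (x *\<^sub>R a 0 + (1 - x) *\<^sub>R X i p a f 0, x *\<^sub>R p 0 + (1 - x) *\<^sub>R Z i)"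
  shows "\<xi> \<in> U c"
  unfolding U_def using assms by blast

lemma periodic_all: "(\<And>k. P (k + 5) = P k) \<Longrightarrow> (\<And>k. k < 5 \<Longrightarrow> P k) \<Longrightarrow> P (k::nat)"
  by (induction k rule: less_induct) (metis add.commute le_add_diff_inverse2 less_imp_diff_less not_less zero_less_diff
      add_diff_cancel_right' diff_less zero_less_numeral order_less_le_trans)

lemma loop_opens_all:
  assumes "loop_eqs i p a q f" "loop_opens i p a q f"
  shows "3/10 < q k \<and> q k < 1 \<and> dist (X i p a f k) (A (i + k)) < r \<and> (\<forall>j<5. w j (p k) < 1) \<and>
        norm (p k) < M \<and> norm (a k) < M"
proof -
  let ?P = "\<lambda>k. 3/10 < q k \<and> q k < 1 \<and> dist (X i p a f k) (A (i + k)) < r \<and> (\<forall>j<5. w j (p k) < 1) \<and>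
        norm (p k) < M \<and> norm (a k) < M"
  have e: "p (k + 5) = p k" "a (k + 5) = a k" "q (k + 5) = q k" "f (k + 5) = f k" for k
    using assms(1) unfolding loop_eqs_def by blast+
  have "X i p a f (k + 5) = X i p a f k" for k
    using per(1)[of "i + k"] by (simp add: X_def e add.assoc)
  moreover have "A (i + (k + 5)) = A (i + k)" for k using per(2)[of "i + k"] by (simp add: add.assoc)
  ultimately have "?P (k + 5) = ?P k" for k by (simp only: e)
  moreover have "?P k" if "k < 5" for k using assms(2) that unfolding loop_opens_def by blast
  ultimately show ?thesis by (rule periodic_all[of ?P])
qed

lemma sum5: "(\<Sum>k<5. g k) = g 0 + g 1 + g 2 + g 3 + g (4::nat)" for g :: "nat \<Rightarrow> 'b::comm_monoid_add"
  by (simp add: numeral_eq_Suc)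

text \<open>Modulo 5 a shift by 4 is a step back, so the preceding arm becomes the first one. The
  sum \<open>clos_deriv\<close> runs over a full period and does not change.\<close>

lemma loop_shift:
  assumes "loop i p a q f"
  shows "loop (i + 4) (\<lambda>k. p (k + 4)) (\<lambda>k. a (k + 4)) (\<lambda>k. q (k + 4)) (\<lambda>k. f (k + 4))"
proof -
  have eqs: "loop_eqs i p a q f" and op: "loop_opens i p a q f" and nd: "nondeg i p q f"
    using assms unfolding loop_def by auto
  have X: "X (i + 4) (\<lambda>k. p (k + 4)) (\<lambda>k. a (k + 4)) (\<lambda>k. f (k + 4)) k = X i p a f (k + 4)" for k
    by (simp add: X_def add.commute add.left_commute)
  have per': "p (k + 5) = p k" "q (k + 5) = q k" "f (k + 5) = f k" for k
    using eqs unfolding loop_eqs_def by blast+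
  have "loop_eqs (i + 4) (\<lambda>k. p (k + 4)) (\<lambda>k. a (k + 4)) (\<lambda>k. q (k + 4)) (\<lambda>k. f (k + 4))"
    unfolding loop_eqs_def
  proof
    fix k
    show "p (k + 5 + 4) = p (k + 4) \<and> a (k + 5 + 4) = a (k + 4) \<and> q (k + 5 + 4) = q (k + 4) \<and> f (k + 5 + 4) = f (k + 4) \<and>
      p (Suc k + 4) = p (k + 4) + q (k + 4) *\<^sub>R (Z (i + 4 + k) - p (k + 4)) \<and>
      a (Suc k + 4) = a (k + 4) - q (k + 4) *\<^sub>R pr (Z (i + 4 + k) - p (k + 4)) (f (k + 4))"
      using eqs[unfolded loop_eqs_def, rule_format, of "k + 4"] by (simp add: add.commute add.left_commute)
  qed
  moreover have "loop_opens (i + 4) (\<lambda>k. p (k + 4)) (\<lambda>k. a (k + 4)) (\<lambda>k. q (k + 4)) (\<lambda>k. f (k + 4))"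
    unfolding loop_opens_def X
  proof (intro allI impI)
    fix k :: nat
    show "3/10 < q (k + 4) \<and> q (k + 4) < 1 \<and> dist (X i p a f (k + 4)) (A (i + 4 + k)) < r \<and> (\<forall>j<5. w j (p (k + 4)) < 1) \<and>
        norm (p (k + 4)) < M \<and> norm (a (k + 4)) < M"
      using loop_opens_all[OF eqs op, of "k + 4"] by (simp add: add.commute add.left_commute)
  qed
  moreover have "clos_deriv (i + 4) (\<lambda>k. p (k + 4)) (\<lambda>k. q (k + 4)) (\<lambda>k. f (k + 4)) y = clos_deriv i p q f y" for y
  proof -
    define g where "g k = (R (i + k) \<bullet> y) *\<^sub>R (q k *\<^sub>R dpr (Z (i + k) - p k) (f k))" for k
    have g: "g (k + 5) = g k" for k
      using per(1,5)[of "i + k"] by (simp add: g_def per' add.assoc)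
    have "clos_deriv (i + 4) (\<lambda>k. p (k + 4)) (\<lambda>k. q (k + 4)) (\<lambda>k. f (k + 4)) y = (\<Sum>k<5. g (k + 4))"
      unfolding clos_deriv_def g_def by (simp add: add.commute add.left_commute)
    also have "\<dots> = (\<Sum>k<5. g k)"
      using g[of 0] g[of 1] g[of 2] g[of 3] by (simp add: sum5 algebra_simps)
    finally show ?thesis unfolding clos_deriv_def g_def .
  qed
  ultimately show ?thesis using nd unfolding loop_def nondeg_def by simp
qed

lemma U_mono: "0 < c \<Longrightarrow> c \<le> d \<Longrightarrow> U c \<subseteq> U d"
  unfolding U_def by (smt (verit) Collect_mono power_mono)

lemma w_affine: "w j (x *\<^sub>R p + (1 - x) *\<^sub>R p') = x * w j p + (1 - x) * w j p'"
  by (simp add: w_def inner_add_right algebra_simps)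

text \<open>The distance to the far end is \<open>x\<close> times the length of the arm, and
  \<open>x < c\<^sup>2 \<le> c\<close>. The arm has length at most \<open>2 * M\<close> in
  \<open>Z\<close>, and \<open>norm_pr_le\<close> costs another factor 2 in
  \<open>A\<close>.\<close>

lemma U_near:
  assumes "(A', Z') \<in> U c" "0 < c" "c \<le> 1"
  shows "\<exists>i x. dist x (A i) < r \<and> norm (A' - x) \<le> 4 * M * c \<and> norm (Z' - Z i) \<le> 4 * M * c"
proof -
  obtain x i p a q f where 1: "A' = x *\<^sub>R a 0 + (1 - x) *\<^sub>R X i p a f 0" "Z' = x *\<^sub>R p 0 + (1 - x) *\<^sub>R Z i"
    "0 < x" "x < 1" "x < c\<^sup>2" and l: "loop i p a q f" using assms(1) unfolding U_def by auto
  have o: "dist (X i p a f 0) (A i) < r" "norm (p 0) < M"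
    using l unfolding loop_def loop_opens_def by (auto dest: spec[of _ 0])
  have xc: "x \<le> c" using 1 assms by (smt (verit) mult_left_le power2_eq_square)
  have M0: "0 \<le> M" using o(2) norm_ge_zero[of "p 0"] by linarith
  have b: "norm (Z i - p 0) \<le> 2 * M" using norm_triangle_ineq4[of "Z i" "p 0"] Z_bound[of i] o(2) by linarith
  have "A' - X i p a f 0 = x *\<^sub>R pr (Z i - p 0) (f 0)" unfolding 1 X_def by (simp add: algebra_simps)
  then have "norm (A' - X i p a f 0) = x * norm (pr (Z i - p 0) (f 0))" using 1 by simp
  also have "\<dots> \<le> c * (2 * (2 * M))"
    using norm_pr_le[of "Z i - p 0" "f 0"] b 1 xc M0 by (intro mult_mono) auto
  finally have e1: "norm (A' - X i p a f 0) \<le> 4 * M * c" by (simp add: mult_ac)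
  have "Z' - Z i = x *\<^sub>R (p 0 - Z i)" unfolding 1 by (simp add: algebra_simps)
  then have "norm (Z' - Z i) = x * norm (Z i - p 0)" using 1 by (simp add: norm_minus_commute)
  also have "\<dots> \<le> c * (2 * M)" using b 1 xc M0 by (intro mult_mono) auto
  also have "\<dots> \<le> 4 * M * c" using M0 assms by (simp add: mult_ac)
  finally show ?thesis using e1 o(1) by blast
qed

lemma w_Z_le: "j < 5 \<Longrightarrow> w j (Z i) \<le> 1"
proof -
  assume j: "j < 5"
  have "w j (Z i) \<le> 1"
  proof (rule periodic_all[of "\<lambda>i. w j (Z i) \<le> 1"])
    show "(w j (Z (k + 5)) \<le> 1) = (w j (Z k) \<le> 1)" for k by (simp add: per)
    show "w j (Z k) \<le> 1" if "k < 5" for k using w_Z[OF j that, of 0] by (simp add: w_def)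
  qed
  then show ?thesis .
qed

text \<open>A hull state has positive weight on a vertex of a loop, where every coordinate is
  strictly below 1, so it never sits at a corner of the simplex. The gap \<open>1 - w j\<close>
  later prevents germ \<open>j\<close> from filling a ball.\<close>

lemma U_w: "(A', Z') \<in> U c \<Longrightarrow> j < 5 \<Longrightarrow> w j Z' < 1"
proof -
  assume "(A', Z') \<in> U c" and j: "j < 5"
  then obtain x i p a q f where 1: "Z' = x *\<^sub>R p 0 + (1 - x) *\<^sub>R Z i"
    "0 < x" "x < 1" and l: "loop i p a q f" unfolding U_def by auto
  have "w j (p 0) < 1" using l j unfolding loop_def loop_opens_def by (auto dest: spec[of _ 0])
  then have "x * w j (p 0) < x * 1" using 1 by (intro mult_strict_left_mono) auto
  moreover have "(1 - x) * w j (Z i) \<le> (1 - x) * 1" using 1 w_Z_le[OF j] by (intro mult_left_mono) auto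
  ultimately show ?thesis unfolding 1 w_affine by simp
qed

lemma U_bounded: "bounded (U c)"
proof -
  have "norm A' \<le> 2 * M + r \<and> norm Z' \<le> 2 * M" if m: "(A', Z') \<in> U c" for A' Z'
  proof -
    obtain x i p a q f where 1: "A' = x *\<^sub>R a 0 + (1 - x) *\<^sub>R X i p a f 0" "Z' = x *\<^sub>R p 0 + (1 - x) *\<^sub>R Z i"
      "0 < x" "x < 1" and l: "loop i p a q f" using m unfolding U_def by auto
    have o: "dist (X i p a f 0) (A i) < r" "norm (p 0) < M" "norm (a 0) < M"
      using l unfolding loop_def loop_opens_def by (auto dest: spec[of _ 0])
    have X0: "norm (X i p a f 0) \<le> M + r"
      using o(1) A_bound[of i] norm_triangle_ineq2[of "X i p a f 0" "A i"] by (simp add: dist_norm)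
    have c: "norm (x *\<^sub>R u + (1 - x) *\<^sub>R v) \<le> norm u + norm v" for u v :: mat2
    proof -
      have "norm (x *\<^sub>R u + (1 - x) *\<^sub>R v) \<le> x * norm u + (1 - x) * norm v"
        using norm_triangle_ineq[of "x *\<^sub>R u" "(1 - x) *\<^sub>R v"] 1 by simp
      also have "\<dots> \<le> 1 * norm u + 1 * norm v" using 1 by (intro add_mono mult_right_mono) auto
      finally show ?thesis by simp
    qed
    show ?thesis unfolding 1 using c[of "a 0" "X i p a f 0"] c[of "p 0" "Z i"] X0 o Z_bound[of i] by linarith
  qed
  then have "U c \<subseteq> cball 0 (2 * M + r) \<times> cball 0 (2 * M)" by auto
  then show ?thesis using bounded_Times bounded_cball bounded_subset by blast
qed

text \<open>A vertex is also a point of the preceding arm, where the weight of the earlier vertex is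
  \<open>1 - q 4 < 7/10 < (837/1000)^2\<close>.\<close>

lemma U_vertex:
  assumes l: "loop i p a q f"
  shows "(a 0, p 0) \<in> U (837/1000)"
proof -
  have eqs: "loop_eqs i p a q f" and op: "loop_opens i p a q f" using l unfolding loop_def by auto
  define p' where "p' = (\<lambda>k. p (k + 4))"
  define a' where "a' = (\<lambda>k. a (k + 4))"
  define f' where "f' = (\<lambda>k. f (k + 4))"
  have l': "loop (i + 4) p' a' (\<lambda>k. q (k + 4)) f'" unfolding p'_def a'_def f'_def by (rule loop_shift[OF l])
  have q4: "3/10 < q 4" "q 4 < 1" using loop_opens_all[OF eqs op, of 4] by auto
  have p5: "p 0 = p 4 + q 4 *\<^sub>R (Z (i + 4) - p 4)" "a 0 = a 4 - q 4 *\<^sub>R pr (Z (i + 4) - p 4) (f 4)"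
    using eqs[unfolded loop_eqs_def, rule_format, of 4] eqs[unfolded loop_eqs_def, rule_format, of 0]
    by (auto simp: eval_nat_numeral)
  have "(a 0, p 0) = ((1 - q 4) *\<^sub>R a' 0 + (1 - (1 - q 4)) *\<^sub>R X (i + 4) p' a' f' 0, (1 - q 4) *\<^sub>R p' 0 + (1 - (1 - q 4)) *\<^sub>R Z (i + 4))"
    unfolding X_def p'_def a'_def f'_def by (simp add: p5 algebra_simps)
  moreover have "1 - q 4 < (837/1000)\<^sup>2" using q4 by (simp add: power2_eq_square)
  ultimately show ?thesis using q4 by (intro U_I[OF l']) auto
qed

text \<open>Both new states lie on the same arm. For \<open>x \<le> 3/4\<close> the splitting
  \<open>x \<plusminus> x/4\<close> lowers the mean level because the mean of
  \<open>sqrt (3/4)\<close> and \<open>sqrt (5/4)\<close> is below 199/200. Closer to the vertex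
  there is no room to overshoot, so one of the new states is the vertex itself, which
  \<open>U_vertex\<close> places at the lower level 837/1000. This passage from one arm to the
  preceding one is where the cyclic structure enters.\<close>

lemma U_split:
  assumes "\<xi> \<in> U c" "0 < c" "c \<le> 1"
  shows "\<exists>D v e1 e2. norm v = 1 \<and> 0 < e1 \<and> e1 \<le> 1 \<and> 0 < e2 \<and> e2 \<le> 1 \<and> e1 + e2 \<le> 2 * (199/200) * c \<and>
    norm D \<le> 2 * M * c \<and> (\<forall>s. \<bar>s\<bar> \<le> 1 \<longrightarrow> \<xi> + s *\<^sub>R (- outer (D *v v) v, D) \<in> U 1) \<and>
    \<xi> + (- outer (D *v v) v, D) \<in> U e1 \<and> \<xi> - (- outer (D *v v) v, D) \<in> U e2"
proof -
  obtain x i p a q f where xi: "\<xi> = (x *\<^sub>R a 0 + (1 - x) *\<^sub>R X i p a f 0, x *\<^sub>R p 0 + (1 - x) *\<^sub>R Z i)"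
    and x: "0 < x" "x < 1" "x < c\<^sup>2" and l: "loop i p a q f" using assms(1) unfolding U_def by auto
  define pt where "pt y = (y *\<^sub>R a 0 + (1 - y) *\<^sub>R X i p a f 0, y *\<^sub>R p 0 + (1 - y) *\<^sub>R Z i)" for y
  have o: "norm (p 0) < M" using l unfolding loop_def loop_opens_def by (auto dest: spec[of _ 0])
  have b: "norm (Z i - p 0) \<le> 2 * M" using norm_triangle_ineq4[of "Z i" "p 0"] Z_bound[of i] o by linarith
  have ptU: "pt y \<in> U d" if "0 < y" "y < 1" "y < d\<^sup>2" for y d
    unfolding U_def pt_def using that l by blast
  obtain v where v: "norm v = 1" "\<And>D. pr D (f 0) = outer (D *v v) v" using pr_outer[of "f 0"] by blast
  have mv: "\<xi> + s *\<^sub>R (- outer (D *v v) v, D) = pt (x - s * t)" if "D = t *\<^sub>R (Z i - p 0)" for s t D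
    unfolding v(2)[symmetric] that xi pt_def X_def pr_scale by (simp add: algebra_simps)
  have mv1: "\<xi> + (- outer (D *v v) v, D) = pt (x - t)" "\<xi> - (- outer (D *v v) v, D) = pt (x + t)"
    if "D = t *\<^sub>R (Z i - p 0)" for t D
    using mv[OF that, of 1] mv[OF that, of "-1"] by (simp_all add: diff_conv_add_uminus del: add_uminus_conv_diff)
  have nD: "norm (t *\<^sub>R (Z i - p 0)) \<le> 2 * M * c" if "0 \<le> t" "t \<le> c" for t
  proof -
    have "t * norm (Z i - p 0) \<le> c * (2 * M)" using that b assms by (intro mult_mono) auto
    then show ?thesis using that by (simp add: mult_ac)
  qed
  show ?thesis
  proof (cases "x \<le> 3/4")
    case True
    define D where "D = (x / 4) *\<^sub>R (Z i - p 0)"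
    define e1 where "e1 = c * sqrt (3/4)"
    \<comment> \<open>Capping at 1 is harmless, since \<open>x + x/4 \<le> 15/16\<close> in this
      case.\<close>
    define e2 where "e2 = min 1 (c * sqrt (5/4))"
    have s1: "sqrt (3/4) \<le> 867/1000" by (rule real_le_lsqrt) (auto simp: power2_eq_square)
    have s2: "sqrt (5/4) \<le> 1119/1000" by (rule real_le_lsqrt) (auto simp: power2_eq_square)
    have "e1 + e2 \<le> c * (867/1000) + c * (1119/1000)"
      unfolding e1_def e2_def using s1 s2 assms by (intro add_mono min.coboundedI2 mult_left_mono) auto
    then have es: "e1 + e2 \<le> 2 * (199/200) * c" using assms by simp
    have e1: "0 < e1" "e1 \<le> 1" unfolding e1_def using assms s1 mult_mono[of c 1 "sqrt (3/4)" 1] by auto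
    have e2: "0 < e2" "e2 \<le> 1" unfolding e2_def using assms by auto
    have q1: "x - x / 4 < e1\<^sup>2" using x unfolding e1_def by (simp add: power_mult_distrib)
    have q2: "x + x / 4 < e2\<^sup>2" using x True unfolding e2_def by (simp add: power_mult_distrib min_def)
    have "x - s * (x / 4) \<in> {0<..<1}" if "\<bar>s\<bar> \<le> 1" for s
    proof -
      have "\<bar>s * (x / 4)\<bar> \<le> 1 * (x / 4)" unfolding abs_mult using that x by (intro mult_mono) auto
      then have "- (x / 4) \<le> s * (x / 4)" "s * (x / 4) \<le> x / 4" by linarith+
      then have "0 < x - s * (x / 4)" "x - s * (x / 4) < 1" using x True by linarith+
      then show ?thesis unfolding greaterThanLessThan_iff by (rule conjI)
    qed
    then have "\<forall>s. \<bar>s\<bar> \<le> 1 \<longrightarrow> \<xi> + s *\<^sub>R (- outer (D *v v) v, D) \<in> U 1"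
      unfolding mv[OF D_def] by (auto intro!: ptU)
    moreover have "pt (x - x / 4) \<in> U e1" "pt (x + x / 4) \<in> U e2"
      using q1 q2 x True by (auto intro!: ptU)
    moreover have "norm D \<le> 2 * M * c"
      unfolding D_def
    proof (rule nD)
      have "c\<^sup>2 \<le> c" using assms by (simp add: power2_eq_square mult_left_le)
      then show "x / 4 \<le> c" using x by linarith
    qed (use x in auto)
    ultimately show ?thesis
      using v(1) e1 e2 es mv1[OF D_def] by (intro exI[of _ D] exI[of _ v] exI[of _ e1] exI[of _ e2]) simp
  next
    case False
    define D where "D = (1 - x) *\<^sub>R (Z i - p 0)"
    define e2 where "e2 = (837/1000 :: real)"
    \<comment> \<open>\<open>x > 3/4\<close> forces a high level, and for such \<open>c\<close> the
      value 837/1000 is below \<open>99/100 * c\<close>, as the bound on the sum of the levels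
      requires.\<close>
    have c: "c > 866/1000"
    proof (rule ccontr)
      assume "\<not> c > 866/1000"
      then have "c\<^sup>2 \<le> (866/1000)\<^sup>2" using assms by (intro power_mono) auto
      then show False using x False by (simp add: power2_eq_square)
    qed
    have pt1: "pt 1 \<in> U e2" using U_vertex[OF l] by (simp add: pt_def e2_def)
    then have pt1': "pt 1 \<in> U 1" using U_mono[of e2 1] by (auto simp: e2_def)
    have "pt (x - s * (1 - x)) \<in> U 1" if "\<bar>s\<bar> \<le> 1" for s
    proof (cases "s = -1")
      case True then show ?thesis using pt1' by simp
    next
      case sF: False
      define y where "y = s * (1 - x)"
      have "s * (1 - x) \<le> 1 * (1 - x)" using that x by (intro mult_right_mono) auto
      then have "y \<le> 1 - x" by (simp add: y_def)
      moreover have "(-1) * (1 - x) < s * (1 - x)" using that x sF by (intro mult_strict_right_mono) auto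
      then have "- (1 - x) < y" by (simp add: y_def)
      ultimately have "0 < x - y" "x - y < 1" using False by linarith+
      then have "0 < x - s * (1 - x)" "x - s * (1 - x) < 1" by (simp_all add: y_def)
      then show ?thesis by (intro ptU) auto
    qed
    then have "\<forall>s. \<bar>s\<bar> \<le> 1 \<longrightarrow> \<xi> + s *\<^sub>R (- outer (D *v v) v, D) \<in> U 1"
      unfolding mv[OF D_def] by auto
    moreover have "pt (x - (1 - x)) \<in> U c" using x False by (intro ptU) auto
    moreover have "norm D \<le> 2 * M * c" unfolding D_def using x False c by (intro nD) auto
    moreover have "c + e2 \<le> 2 * (199/200) * c" unfolding e2_def using c by simp
    ultimately show ?thesis
      using v(1) mv1[OF D_def] pt1 assms
      by (intro exI[of _ D] exI[of _ v] exI[of _ c] exI[of _ e2]) (simp add: e2_def)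
  qed
qed

text \<open>The prescribed start \<open>\<zeta>\<close> determines the fractions through its
  barycentric coordinates, and with them the closed loop in \<open>Z\<close>. The four equations
  that close the loop in \<open>A\<close> are solved for the angles by Brouwer's theorem, and a
  translation in \<open>A\<close> finally puts the required point of the arm at
  \<open>B\<close>.\<close>

lemma perturb_loop:
  assumes l: "loop i p a q f" and x: "0 < x" "x < 1"
  shows "\<exists>d>0. \<forall>B \<zeta>. dist \<zeta> (p 0) < d \<longrightarrow> dist B (x *\<^sub>R a 0 + (1 - x) *\<^sub>R X i p a f 0) < d \<longrightarrow>
    (\<exists>p' a' q' f'. loop i p' a' q' f' \<and> p' 0 = \<zeta> \<and> B = x *\<^sub>R a' 0 + (1 - x) *\<^sub>R X i p' a' f' 0)"
proof -
  have eqs: "loop_eqs i p a q f" and op: "loop_opens i p a q f" and nd: "nondeg i p q f"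
    using l unfolding loop_def by auto
  have pe: "p (k + 5) = p k" "a (k + 5) = a k" "q (k + 5) = q k" "f (k + 5) = f k"
    "p (Suc k) = p k + q k *\<^sub>R (Z (i + k) - p k)" "a (Suc k) = a k - q k *\<^sub>R pr (Z (i + k) - p k) (f k)" for k
    using eqs unfolding loop_eqs_def by blast+
  have qk: "3/10 < q k" "q k < 1" for k using loop_opens_all[OF eqs op, of k] by auto
  have qmod: "q (k mod 5) = q k" for k
    by (rule periodic_all[of "\<lambda>k. q (k mod 5) = q k"]) (auto simp: pe)
  \<comment> \<open>\<open>Q k\<close> is the coefficient with which \<open>p k\<close> survives
    until the end of the round.\<close>
  define Q where "Q k = (\<Prod>l\<in>{k..<5}. 1 - q l)" for k
  have Qpos: "Q k > 0" for k unfolding Q_def using qk by (intro prod_pos) auto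
  have Q5: "Q 5 = 1" by (simp add: Q_def)
  have QS: "Q k = (1 - q k) * Q (Suc k)" if "k < 5" for k
    unfolding Q_def using that by (subst prod.atLeast_Suc_lessThan) auto
  define \<rho> where "\<rho> = 1 - Q 0"
  \<comment> \<open>After scaling by \<open>Q k\<close>, the coordinate with index
    \<open>i + m\<close> changes only at step \<open>m\<close>. Closing the round turns this into a
    formula that determines the fractions from the starting point.\<close>
  have wp: "\<rho> * w (i + m) (p 0) = Q (Suc m) - Q m" if m: "m < 5" for m
  proof -
    have "Q k * w (i + m) (p k) = Q 0 * w (i + m) (p 0) + (if m < k then Q (Suc m) - Q m else 0)" if "k \<le> 5" for k
      using that
    proof (induction k)
      case (Suc k)
      then have k: "k < 5" by simp
      have we: "w (i + m) (p (Suc k)) = (1 - q k) * w (i + m) (p k) + q k * (if m = k then 1 else 0)"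
        using arg_cong[OF w_Z[OF m k, of i], of "\<lambda>t. q k * t"] unfolding pe w_def
        by (simp add: inner_add_right inner_diff_right algebra_simps)
      have "Q (Suc k) * w (i + m) (p (Suc k)) = Q k * w (i + m) (p k) + q k * Q (Suc k) * (if m = k then 1 else 0)"
        unfolding QS[OF k] we by (simp add: algebra_simps)
      also have "\<dots> = Q 0 * w (i + m) (p 0) + (if m < k then Q (Suc m) - Q m else 0) + q k * Q (Suc k) * (if m = k then 1 else 0)"
        using Suc by simp
      also have "\<dots> = Q 0 * w (i + m) (p 0) + (if m < Suc k then Q (Suc m) - Q m else 0)"
        using QS[OF k] by (auto simp: algebra_simps less_Suc_eq)
      finally show ?case .
    qed simp
    from this[of 5] have "w (i + m) (p 5) = Q 0 * w (i + m) (p 0) + (Q (Suc m) - Q m)" using m by (simp add: Q5)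
    then show ?thesis using pe(1)[of 0] by (simp add: \<rho>_def algebra_simps)
  qed
  \<comment> \<open>The formula \<open>wp\<close> solved backwards for an arbitrary start, keeping
    the total \<open>\<rho>\<close> of the given loop.\<close>
  define Q' where "Q' \<zeta> k = 1 - \<rho> * (\<Sum>l\<in>{k..<5}. w (i + l) \<zeta>)" for \<zeta> k
  have Q'0: "Q' (p 0) k = Q k" if "k \<le> 5" for k
  proof -
    have "\<rho> * (\<Sum>l\<in>{k..<5}. w (i + l) (p 0)) = (\<Sum>l\<in>{k..<5}. Q (Suc l) - Q l)"
      unfolding sum_distrib_left by (intro sum.cong) (auto simp: wp)
    also have "\<dots> = Q 5 - Q k" by (rule sum_Suc_diff') (use that in auto)
    finally show ?thesis by (simp add: Q'_def Q5)
  qed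
  have Q'5: "Q' \<zeta> 5 = 1" for \<zeta> by (simp add: Q'_def)
  have Q'z: "Q' \<zeta> 0 = 1 - \<rho>" for \<zeta>
    using w_sum[of i \<zeta>] by (simp add: Q'_def w_def atLeast0LessThan)
  have Q'd: "Q' \<zeta> (Suc k) - Q' \<zeta> k = \<rho> * w (i + k) \<zeta>" if "k < 5" for \<zeta> k
    unfolding Q'_def using that by (subst (2) sum.atLeast_Suc_lessThan) (auto simp: algebra_simps)
  define q' where "q' \<zeta> k = 1 - Q' \<zeta> (k mod 5) / Q' \<zeta> (Suc (k mod 5))" for \<zeta> k
  have q'0: "q' (p 0) k = q k" for k
  proof -
    have "k mod 5 < 5" by simp
    then show ?thesis
      using Q'0[of "k mod 5"] Q'0[of "Suc (k mod 5)"] QS[of "k mod 5"] Qpos[of "Suc (k mod 5)"] qmod[of k]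
      by (simp add: q'_def)
  qed
  define P where "P \<zeta> = rec_nat \<zeta> (\<lambda>k y. y + q' \<zeta> k *\<^sub>R (Z (i + k) - y))" for \<zeta>
  have P0: "P \<zeta> 0 = \<zeta>" and PS: "P \<zeta> (Suc k) = P \<zeta> k + q' \<zeta> k *\<^sub>R (Z (i + k) - P \<zeta> k)" for \<zeta> k
    by (simp_all add: P_def)
  have Pp: "P (p 0) k = p k" for k by (induction k) (simp_all add: P0 PS q'0 pe)
  \<comment> \<open>Telescoping gives \<open>(1 - \<rho>) *\<^sub>R \<zeta>\<close> plus
    \<open>\<rho>\<close> times the barycentric representation of \<open>\<zeta>\<close>, so the
    \<open>Z\<close>-loop closes for every admissible start.\<close>
  have P5: "P \<zeta> 5 = \<zeta>" if nz: "\<And>k. k < 5 \<Longrightarrow> Q' \<zeta> (Suc k) \<noteq> 0" for \<zeta>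
  proof -
    have "Q' \<zeta> k *\<^sub>R P \<zeta> k = Q' \<zeta> 0 *\<^sub>R \<zeta> + (\<Sum>l<k. (Q' \<zeta> (Suc l) - Q' \<zeta> l) *\<^sub>R Z (i + l))" if "k \<le> 5" for k
      using that
    proof (induction k)
      case (Suc k)
      then have k: "k < 5" by simp
      have "Q' \<zeta> (Suc k) * q' \<zeta> k = Q' \<zeta> (Suc k) - Q' \<zeta> k"
        using nz[OF k] k by (simp add: q'_def field_simps)
      then have "Q' \<zeta> (Suc k) *\<^sub>R P \<zeta> (Suc k) = Q' \<zeta> (Suc k) *\<^sub>R P \<zeta> k + (Q' \<zeta> (Suc k) - Q' \<zeta> k) *\<^sub>R (Z (i + k) - P \<zeta> k)"
        unfolding PS scaleR_add_right scaleR_scaleR by simp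
      also have "\<dots> = Q' \<zeta> k *\<^sub>R P \<zeta> k + (Q' \<zeta> (Suc k) - Q' \<zeta> k) *\<^sub>R Z (i + k)" by (simp add: algebra_simps)
      finally show ?case using Suc by simp
    qed (simp add: P0)
    from this[of 5] have "P \<zeta> 5 = (1 - \<rho>) *\<^sub>R \<zeta> + (\<Sum>l<5. (\<rho> * w (i + l) \<zeta>) *\<^sub>R Z (i + l))"
      by (simp add: Q'5 Q'z Q'd)
    also have "(\<Sum>l<5. (\<rho> * w (i + l) \<zeta>) *\<^sub>R Z (i + l)) = \<rho> *\<^sub>R (\<Sum>l<5. w (i + l) \<zeta> *\<^sub>R Z (i + l))"
      by (simp add: scaleR_sum_right)
    also have "(\<Sum>l<5. w (i + l) \<zeta> *\<^sub>R Z (i + l)) = \<zeta>" using w_bary[of i \<zeta>] by (simp add: w_def)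
    finally show ?thesis by (simp add: algebra_simps)
  qed
  define f' where "f' y k = f k + R (i + k) \<bullet> y" for y k
  define D where "D \<zeta> k = q' \<zeta> k *\<^sub>R (Z (i + k) - P \<zeta> k)" for \<zeta> k
  \<comment> \<open>The start is chosen such that the point of weight \<open>x\<close> on the first
    arm is \<open>B\<close> for every \<open>y\<close>; only the closing of the loop remains as a
    condition on \<open>y\<close>.\<close>
  define a' where "a' \<zeta> y B k = B + (1 - x) *\<^sub>R pr (Z i - \<zeta>) (f' y 0) - (\<Sum>l<k. pr (D \<zeta> l) (f' y l))" for \<zeta> y B k
  define B0 where "B0 = x *\<^sub>R a 0 + (1 - x) *\<^sub>R X i p a f 0"
  have f'0: "f' 0 k = f k" for k by (simp add: f'_def)
  have a'0: "a' (p 0) 0 B0 k = a k" for k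
  proof (induction k)
    case 0 show ?case by (simp add: a'_def B0_def X_def f'0 algebra_simps)
  next
    case (Suc k)
    have "a' (p 0) 0 B0 (Suc k) = a' (p 0) 0 B0 k - q k *\<^sub>R pr (Z (i + k) - p k) (f k)"
      by (simp add: a'_def f'0 D_def Pp q'0 pr_scale)
    then show ?case using Suc by (simp add: pe(6))
  qed
  define \<theta>0 :: "mat2 \<times> mat2 \<times> mat2" where "\<theta>0 = (p 0, 0, B0)"
  define g1 g2 g3 :: "mat2 \<times> mat2 \<times> mat2 \<Rightarrow> mat2" where
    "g1 = fst" and "g2 = (\<lambda>t. fst (snd t))" and "g3 = (\<lambda>t. snd (snd t))"
  have id: "((\<lambda>t. t) \<longlongrightarrow> \<theta>0) (nhds \<theta>0)" by (rule filterlim_ident)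
  have tg: "(g1 \<longlongrightarrow> p 0) (nhds \<theta>0)" "(g2 \<longlongrightarrow> 0) (nhds \<theta>0)" "(g3 \<longlongrightarrow> B0) (nhds \<theta>0)"
    using tendsto_fst[OF id] tendsto_fst[OF tendsto_snd[OF id]] tendsto_snd[OF tendsto_snd[OF id]]
    by (simp_all add: g1_def g2_def g3_def \<theta>0_def)
  have tw: "((\<lambda>t. w j (h t)) \<longlongrightarrow> w j h0) F" if "(h \<longlongrightarrow> h0) F" for j h h0 and F :: "'z filter"
    unfolding w_def by (intro tendsto_intros that)
  have tQ: "((\<lambda>t. Q' (h t) k) \<longlongrightarrow> Q' h0 k) F" if "(h \<longlongrightarrow> h0) F" for k h h0 and F :: "'z filter"
    unfolding Q'_def by (intro tendsto_intros tw that)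
  have tq: "((\<lambda>t. q' (h t) k) \<longlongrightarrow> q k) F" if "(h \<longlongrightarrow> p 0) F" for k h and F :: "'z filter"
  proof -
    have "Q' (p 0) (Suc (k mod 5)) \<noteq> 0" using Q'0[of "Suc (k mod 5)"] Qpos[of "Suc (k mod 5)"] by simp
    then have "((\<lambda>t. q' (h t) k) \<longlongrightarrow> q' (p 0) k) F"
      unfolding q'_def by (intro tendsto_intros tQ that)
    then show ?thesis by (simp add: q'0)
  qed
  have tP: "((\<lambda>t. P (h t) k) \<longlongrightarrow> p k) F" if "(h \<longlongrightarrow> p 0) F" for k h and F :: "'z filter"
  proof (induction k)
    case 0 then show ?case using that by (simp add: P0)
  next
    case (Suc k) show ?case unfolding PS pe(5) by (intro tendsto_intros Suc tq that)
  qed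
  have tD: "((\<lambda>t. D (h t) k) \<longlongrightarrow> q k *\<^sub>R (Z (i + k) - p k)) F" if "(h \<longlongrightarrow> p 0) F" for k h and F :: "'z filter"
    unfolding D_def by (intro tendsto_intros tq tP that)
  have tf: "((\<lambda>t. f' (g2 t) k) \<longlongrightarrow> f k) (nhds \<theta>0)" for k
    unfolding f'_def using tendsto_add[OF tendsto_const[of "f k"] tendsto_inner[OF tendsto_const[of "R (i + k)"] tg(2)]] by simp
  have ta: "((\<lambda>t. a' (g1 t) (g2 t) (g3 t) k) \<longlongrightarrow> a k) (nhds \<theta>0)" for k
  proof -
    have "((\<lambda>t. a' (g1 t) (g2 t) (g3 t) k) \<longlongrightarrow> B0 + (1 - x) *\<^sub>R pr (Z i - p 0) (f 0) -
        (\<Sum>l<k. pr (q l *\<^sub>R (Z (i + l) - p l)) (f l))) (nhds \<theta>0)"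
      unfolding a'_def by (intro tendsto_intros tg tf tD)
    then show ?thesis using a'0[of k] by (simp add: a'_def f'0 D_def q'0 Pp algebra_simps)
  qed
  have tX: "((\<lambda>t. X i (P (g1 t)) (a' (g1 t) (g2 t) (g3 t)) (f' (g2 t)) k) \<longlongrightarrow> X i p a f k) (nhds \<theta>0)" for k
    unfolding X_def by (intro tendsto_intros ta tP tf tg)
  have opk: "3/10 < q k \<and> q k < 1 \<and> dist (X i p a f k) (A (i + k)) < r \<and> (\<forall>j<5. w j (p k) < 1) \<and>
        norm (p k) < M \<and> norm (a k) < M" for k by (rule loop_opens_all[OF eqs op])
  have ev1: "\<forall>\<^sub>F t in nhds \<theta>0. loop_opens i (P (g1 t)) (a' (g1 t) (g2 t) (g3 t)) (q' (g1 t)) (f' (g2 t))"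
  proof -
    have "\<forall>\<^sub>F t in nhds \<theta>0. \<forall>k\<in>{..<5}. 3/10 < q' (g1 t) k \<and> q' (g1 t) k < 1 \<and>
       dist (X i (P (g1 t)) (a' (g1 t) (g2 t) (g3 t)) (f' (g2 t)) k) (A (i + k)) < r \<and>
       (\<forall>j\<in>{..<5}. w j (P (g1 t) k) < 1) \<and> norm (P (g1 t) k) < M \<and> norm (a' (g1 t) (g2 t) (g3 t) k) < M"
    proof (rule eventually_ball_finite; (intro ballI eventually_conj)?)
      fix k
      show "\<forall>\<^sub>F t in nhds \<theta>0. 3/10 < q' (g1 t) k" "\<forall>\<^sub>F t in nhds \<theta>0. q' (g1 t) k < 1"
        using order_tendstoD[OF tq[OF tg(1)]] opk[of k] by blast+
      show "\<forall>\<^sub>F t in nhds \<theta>0. dist (X i (P (g1 t)) (a' (g1 t) (g2 t) (g3 t)) (f' (g2 t)) k) (A (i + k)) < r"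
        using order_tendstoD(2)[OF tendsto_dist[OF tX tendsto_const]] opk[of k] by blast
      show "\<forall>\<^sub>F t in nhds \<theta>0. \<forall>j\<in>{..<5}. w j (P (g1 t) k) < 1"
        by (rule eventually_ball_finite) (use order_tendstoD(2)[OF tw[OF tP[OF tg(1)]]] opk[of k] in auto)
      show "\<forall>\<^sub>F t in nhds \<theta>0. norm (P (g1 t) k) < M"
        using order_tendstoD(2)[OF tendsto_norm[OF tP[OF tg(1)]]] opk[of k] by blast
      show "\<forall>\<^sub>F t in nhds \<theta>0. norm (a' (g1 t) (g2 t) (g3 t) k) < M"
        using order_tendstoD(2)[OF tendsto_norm[OF ta]] opk[of k] by blast
    qed simp
    then show ?thesis by eventually_elim (auto simp: loop_opens_def)
  qed
  obtain \<kappa> where kap: "\<kappa> < 1/2" "\<And>y. norm (clos_deriv i p q f y - y) \<le> \<kappa> * norm y"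
    using nd unfolding nondeg_def by blast
  have ev2: "\<forall>\<^sub>F t in nhds \<theta>0. nondeg i (P (g1 t)) (q' (g1 t)) (f' (g2 t))"
  proof -
    define E where "E t k = q' (g1 t) k *\<^sub>R dpr (Z (i + k) - P (g1 t) k) (f' (g2 t) k)" for t k
    define E0 where "E0 k = q k *\<^sub>R dpr (Z (i + k) - p k) (f k)" for k
    have "((\<lambda>t. \<Sum>k<5. norm (R (i + k)) * norm (E t k - E0 k)) \<longlongrightarrow> (\<Sum>k<5. norm (R (i + k)) * norm (E0 k - E0 k))) (nhds \<theta>0)"
      unfolding E_def E0_def by (intro tendsto_intros tq tP tg tf)
    then have "\<forall>\<^sub>F t in nhds \<theta>0. (\<Sum>k<5. norm (R (i + k)) * norm (E t k - E0 k)) < 1/2 - \<kappa>"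
      by (rule order_tendstoD(2)) (use kap in simp)
    then show ?thesis
    proof eventually_elim
      case (elim t)
      let ?S = "\<Sum>k<5. norm (R (i + k)) * norm (E t k - E0 k)"
      have "norm (clos_deriv i (P (g1 t)) (q' (g1 t)) (f' (g2 t)) y - y) \<le> (?S + \<kappa>) * norm y" for y
      proof -
        have "clos_deriv i (P (g1 t)) (q' (g1 t)) (f' (g2 t)) y - y =
          (\<Sum>k<5. (R (i + k) \<bullet> y) *\<^sub>R (E t k - E0 k)) + (clos_deriv i p q f y - y)"
          unfolding clos_deriv_def E_def[symmetric] E0_def[symmetric]
          by (simp add: scaleR_diff_right sum_subtractf)
        then have "norm (clos_deriv i (P (g1 t)) (q' (g1 t)) (f' (g2 t)) y - y) \<le>
          norm (\<Sum>k<5. (R (i + k) \<bullet> y) *\<^sub>R (E t k - E0 k)) + \<kappa> * norm y"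
          using norm_triangle_ineq kap(2) by (smt (verit))
        also have "norm (\<Sum>k<5. (R (i + k) \<bullet> y) *\<^sub>R (E t k - E0 k)) \<le> (\<Sum>k<5. norm (R (i + k)) * norm (E t k - E0 k) * norm y)"
        proof (rule sum_norm_le)
          fix k
          have "\<bar>R (i + k) \<bullet> y\<bar> * norm (E t k - E0 k) \<le> (norm (R (i + k)) * norm y) * norm (E t k - E0 k)"
            by (intro mult_right_mono Cauchy_Schwarz_ineq2) auto
          then show "norm ((R (i + k) \<bullet> y) *\<^sub>R (E t k - E0 k)) \<le> norm (R (i + k)) * norm (E t k - E0 k) * norm y"
            by (simp add: mult_ac)
        qed
        finally show ?thesis by (simp add: sum_distrib_right distrib_right)
      qed
      then show ?case unfolding nondeg_def using elim by (intro exI[of _ "?S + \<kappa>"]) auto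
    qed
  qed
  have ev3: "\<forall>\<^sub>F t in nhds \<theta>0. \<forall>k\<in>{..<5}. Q' (g1 t) (Suc k) > 0"
  proof (rule eventually_ball_finite; (intro ballI)?)
    fix k :: nat assume "k \<in> {..<5}"
    then have "Q' (p 0) (Suc k) > 0" using Q'0[of "Suc k"] Qpos[of "Suc k"] by simp
    then show "\<forall>\<^sub>F t in nhds \<theta>0. Q' (g1 t) (Suc k) > 0" using order_tendstoD(1)[OF tQ[OF tg(1)]] by blast
  qed simp
  have "\<forall>\<^sub>F t in nhds \<theta>0. loop_opens i (P (g1 t)) (a' (g1 t) (g2 t) (g3 t)) (q' (g1 t)) (f' (g2 t)) \<and>
     nondeg i (P (g1 t)) (q' (g1 t)) (f' (g2 t)) \<and> (\<forall>k<5. Q' (g1 t) (Suc k) \<noteq> 0)"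
    using ev1 ev2 ev3 by eventually_elim force
  then obtain d where d: "d > 0" "\<And>\<zeta> y B. dist (\<zeta>, y, B) \<theta>0 < d \<Longrightarrow> loop_opens i (P \<zeta>) (a' \<zeta> y B) (q' \<zeta>) (f' y) \<and>
     nondeg i (P \<zeta>) (q' \<zeta>) (f' y) \<and> (\<forall>k<5. Q' \<zeta> (Suc k) \<noteq> 0)"
    unfolding eventually_nhds_metric g1_def g2_def g3_def by force
  \<comment> \<open>A fixed point of \<open>y - C \<zeta> y\<close> is a zero of the closing defect
    \<open>C \<zeta>\<close>. On a small ball this map is a self-map: the change of
    \<open>\<zeta>\<close>, the linearisation error and the distance of the derivative from the
    identity contribute at most a quarter, a quarter and a half of the radius.\<close>
  have brouwer: "\<exists>\<delta>>0. \<forall>\<zeta>. dist \<zeta> (p 0) < \<delta> \<longrightarrow> (\<exists>y. norm y \<le> \<epsilon> \<and> (\<Sum>k<5. pr (D \<zeta> k) (f' y k)) = 0)" if eps: "\<epsilon> > 0" for \<epsilon>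
  proof -
    define C where "C \<zeta> y = (\<Sum>k<5. pr (D \<zeta> k) (f' y k))" for \<zeta> y
    have dC: "(C (p 0) has_derivative clos_deriv i p q f) (at 0)"
      unfolding C_def pr_def f'_def clos_deriv_def dpr_def D_def q'0 Pp
      by (auto intro!: derivative_eq_intros simp: linear_scale[OF linear_flip(1)] linear_scale[OF linear_flip(2)]
          linear_diff[OF linear_flip(1)] linear_diff[OF linear_flip(2)] scaleR_add_right scaleR_diff_right fun_eq_iff algebra_simps)
    have C0: "C (p 0) 0 = 0"
    proof -
      have "C (p 0) 0 = (\<Sum>k<5. a k - a (Suc k))"
        unfolding C_def D_def q'0 Pp f'0 by (simp add: pe(6) pr_scale)
      also have "\<dots> = a 0 - a 5" by (rule sum_lessThan_telescope')
      finally show ?thesis using pe(2)[of 0] by simp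
    qed
    from dC[unfolded has_derivative_at_alt, THEN conjunct2, rule_format, of "1/4"] C0
    obtain e where e: "e > 0" "\<And>y. norm y < e \<Longrightarrow> norm (C (p 0) y - clos_deriv i p q f y) \<le> 1/4 * norm y" by auto
    define e1 where "e1 = min \<epsilon> (e / 2)"
    have e1: "e1 > 0" "e1 \<le> \<epsilon>" "e1 < e" using e eps by (auto simp: e1_def)
    have "((\<lambda>\<zeta>. \<Sum>k<5. 2 * norm (D \<zeta> k - D (p 0) k)) \<longlongrightarrow> (\<Sum>k<5. 2 * norm (q k *\<^sub>R (Z (i + k) - p k) - D (p 0) k))) (nhds (p 0))"
      by (intro tendsto_intros tD) (rule filterlim_ident)
    then have "\<forall>\<^sub>F \<zeta> in nhds (p 0). (\<Sum>k<5. 2 * norm (D \<zeta> k - D (p 0) k)) < e1 / 4"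
      by (rule order_tendstoD(2)) (use e1 in \<open>simp add: D_def q'0 Pp\<close>)
    then obtain \<delta> where dl: "\<delta> > 0" "\<And>\<zeta>. dist \<zeta> (p 0) < \<delta> \<Longrightarrow> (\<Sum>k<5. 2 * norm (D \<zeta> k - D (p 0) k)) < e1 / 4"
      unfolding eventually_nhds_metric by blast
    show ?thesis
    proof (intro exI[of _ \<delta>] conjI dl(1) allI impI)
      fix \<zeta> assume z: "dist \<zeta> (p 0) < \<delta>"
      have "continuous_on (cball 0 e1) (\<lambda>y. y - C \<zeta> y)"
        unfolding C_def pr_def f'_def by (intro continuous_intros)
      moreover have "y - C \<zeta> y \<in> cball 0 e1" if y: "y \<in> cball 0 e1" for y
      proof -
        have ny: "norm y \<le> e1" using y by simp
        have "norm (C \<zeta> y - C (p 0) y) \<le> (\<Sum>k<5. 2 * norm (D \<zeta> k - D (p 0) k))"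
          unfolding C_def sum_subtractf[symmetric] pr_diff[symmetric] by (intro sum_norm_le norm_pr_le)
        then have 1: "norm (C \<zeta> y - C (p 0) y) \<le> e1 / 4" using dl(2)[OF z] by linarith
        have 2: "norm (C (p 0) y - clos_deriv i p q f y) \<le> e1 / 4" using e(2)[of y] ny e1 by linarith
        have "\<kappa> * norm y \<le> 1/2 * norm y" using kap(1) by (intro mult_right_mono) auto
        then have 3: "norm (clos_deriv i p q f y - y) \<le> e1 / 2" using kap(2)[of y] ny by linarith
        have "y - C \<zeta> y = - ((C \<zeta> y - C (p 0) y) + (C (p 0) y - clos_deriv i p q f y) + (clos_deriv i p q f y - y))" by simp
        then have "norm (y - C \<zeta> y) \<le> e1 / 4 + e1 / 4 + e1 / 2"
          using 1 2 3 by (metis (no_types, lifting) norm_minus_cancel norm_triangle_mono)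
        then show ?thesis by simp
      qed
      ultimately obtain y where "y \<in> cball 0 e1" "y - C \<zeta> y = y"
        using brouwer_ball[of e1 0 "\<lambda>y. y - C \<zeta> y"] e1(1) by blast
      then show "\<exists>y. norm y \<le> \<epsilon> \<and> (\<Sum>k<5. pr (D \<zeta> k) (f' y k)) = 0"
        using e1(2) by (intro exI[of _ y]) (auto simp: C_def)
    qed
  qed
  obtain \<delta> where dl: "\<delta> > 0" "\<And>\<zeta>. dist \<zeta> (p 0) < \<delta> \<Longrightarrow> \<exists>y. norm y \<le> d / 4 \<and> (\<Sum>k<5. pr (D \<zeta> k) (f' y k)) = 0"
    using brouwer[of "d / 4"] d(1) by auto
  show ?thesis
  proof (intro exI[of _ "min \<delta> (d / 4)"] conjI allI impI)
    show "min \<delta> (d / 4) > 0" using dl d by simp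
    fix B \<zeta> assume z: "dist \<zeta> (p 0) < min \<delta> (d / 4)" and "dist B (x *\<^sub>R a 0 + (1 - x) *\<^sub>R X i p a f 0) < min \<delta> (d / 4)"
    then have B: "dist B B0 < d / 4" by (simp add: B0_def)
    obtain y where y: "norm y \<le> d / 4" "(\<Sum>k<5. pr (D \<zeta> k) (f' y k)) = 0" using dl(2) z by auto
    have "dist (\<zeta>, y, B) \<theta>0 \<le> dist \<zeta> (p 0) + dist (y, B) (0, B0)"
      unfolding \<theta>0_def dist_Pair_Pair[of \<zeta>] by (rule sqrt_sum_squares_le_sum) auto
    also have "dist (y, B) (0, B0) \<le> dist y 0 + dist B B0"
      unfolding dist_Pair_Pair by (rule sqrt_sum_squares_le_sum) auto
    finally have "dist (\<zeta>, y, B) \<theta>0 < d" using z B y d(1) by simp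
    from d(2)[OF this] have lo: "loop_opens i (P \<zeta>) (a' \<zeta> y B) (q' \<zeta>) (f' y)" "nondeg i (P \<zeta>) (q' \<zeta>) (f' y)"
      "\<And>k. k < 5 \<Longrightarrow> Q' \<zeta> (Suc k) \<noteq> 0" by auto
    have q5: "q' \<zeta> (k + 5) = q' \<zeta> k" for k by (simp add: q'_def)
    have f5: "f' y (k + 5) = f' y k" for k using per(5)[of "i + k"] by (simp add: f'_def pe(4) add.assoc)
    have Z5: "Z (i + (k + 5)) = Z (i + k)" for k using per(1)[of "i + k"] by (simp add: add.assoc)
    have p5: "P \<zeta> (k + 5) = P \<zeta> k" for k
    proof (induction k)
      case 0 show ?case using P5[OF lo(3)] by (simp add: P0)
    next
      case (Suc k) then show ?case using PS[of \<zeta> "k + 5"] PS[of \<zeta> k] q5 Z5 by simp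
    qed
    have aS: "a' \<zeta> y B (Suc k) = a' \<zeta> y B k - pr (D \<zeta> k) (f' y k)" for k by (simp add: a'_def)
    have D5: "D \<zeta> (k + 5) = D \<zeta> k" for k by (simp add: D_def q5 Z5 p5)
    have a5: "a' \<zeta> y B (k + 5) = a' \<zeta> y B k" for k
    proof (induction k)
      case 0 show ?case using y(2) by (simp add: a'_def)
    next
      case (Suc k) then show ?case using aS[of "k + 5"] aS[of k] D5[of k] f5[of k] by simp
    qed
    have "loop_eqs i (P \<zeta>) (a' \<zeta> y B) (q' \<zeta>) (f' y)"
      unfolding loop_eqs_def using p5 a5 q5 f5 PS aS by (simp add: D_def pr_scale)
    then have "loop i (P \<zeta>) (a' \<zeta> y B) (q' \<zeta>) (f' y)" using lo unfolding loop_def by blast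
    moreover have "B = x *\<^sub>R a' \<zeta> y B 0 + (1 - x) *\<^sub>R X i (P \<zeta>) (a' \<zeta> y B) (f' y) 0"
      by (simp add: a'_def X_def P0 algebra_simps)
    ultimately show "\<exists>p' a' q' f'. loop i p' a' q' f' \<and> p' 0 = \<zeta> \<and> B = x *\<^sub>R a' 0 + (1 - x) *\<^sub>R X i p' a' f' 0"
      using P0 by blast
  qed
qed

lemma U_open: "open (U c)"
  unfolding open_dist
proof
  fix \<xi> assume "\<xi> \<in> U c"
  then obtain x i p a q f where xi: "\<xi> = (x *\<^sub>R a 0 + (1 - x) *\<^sub>R X i p a f 0, x *\<^sub>R p 0 + (1 - x) *\<^sub>R Z i)"
    and x: "0 < x" "x < 1" "x < c\<^sup>2" and l: "loop i p a q f" unfolding U_def by auto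
  obtain d where d: "d > 0" "\<And>B \<zeta>. dist \<zeta> (p 0) < d \<Longrightarrow> dist B (x *\<^sub>R a 0 + (1 - x) *\<^sub>R X i p a f 0) < d \<Longrightarrow>
    (\<exists>p' a' q' f'. loop i p' a' q' f' \<and> p' 0 = \<zeta> \<and> B = x *\<^sub>R a' 0 + (1 - x) *\<^sub>R X i p' a' f' 0)"
    using perturb_loop[OF l x(1,2)] by blast
  show "\<exists>e>0. \<forall>\<eta>. dist \<eta> \<xi> < e \<longrightarrow> \<eta> \<in> U c"
  proof (intro exI[of _ "x * d"] conjI allI impI)
    show "x * d > 0" using x d by simp
    fix \<eta> assume e: "dist \<eta> \<xi> < x * d"
    obtain B Y where eta: "\<eta> = (B, Y)" by (cases \<eta>)
    have xd: "x * d \<le> d" using x d by (simp add: mult_left_le_one_le)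
    \<comment> \<open>The weight \<open>x\<close> is kept and the vertex is recovered from
      \<open>Y\<close>. This enlarges errors by \<open>1 / x\<close>, hence the radius
      \<open>x * d\<close>.\<close>
    define \<zeta> where "\<zeta> = (1 / x) *\<^sub>R (Y - (1 - x) *\<^sub>R Z i)"
    have Y: "Y = x *\<^sub>R \<zeta> + (1 - x) *\<^sub>R Z i" using x by (simp add: \<zeta>_def)
    have "dist B (fst \<xi>) < d" using dist_fst_le[of \<eta> \<xi>] e xd by (simp add: eta)
    moreover have "dist Y (snd \<xi>) < x * d" using dist_snd_le[of \<eta> \<xi>] e by (simp add: eta)
    then have "norm (x *\<^sub>R (\<zeta> - p 0)) < x * d" unfolding Y xi dist_norm by (simp add: algebra_simps)
    then have "dist \<zeta> (p 0) < d" using x by (simp add: dist_norm)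
    ultimately obtain p' a' q' f' where "loop i p' a' q' f'" "p' 0 = \<zeta>" "B = x *\<^sub>R a' 0 + (1 - x) *\<^sub>R X i p' a' f' 0"
      using d(2)[of \<zeta> B] by (auto simp: xi)
    then show "\<eta> \<in> U c" using x by (intro U_I[of i p' a' q' f' x]) (auto simp: eta Y)
  qed
qed

end

section \<open>An explicit rational five-point configuration\<close>

definition cyc :: "'a list \<Rightarrow> nat \<Rightarrow> 'a" where "cyc xs k = xs ! (k mod 5)"

lemma cyc_add5: "cyc xs (k + 5) = cyc xs k" by (simp add: cyc_def)

lemma cyc_sel [simp]: "cyc xs 0 = xs ! 0" "cyc xs (Suc 0) = xs ! 1" "cyc xs (Suc (Suc 0)) = xs ! 2" "cyc xs 1 = xs ! 1" "cyc xs 2 = xs ! 2"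
  "cyc xs 3 = xs ! 3" "cyc xs 4 = xs ! 4" "cyc xs 5 = xs ! 0"
  by (simp_all add: cyc_def numeral_2_eq_2)

lemma less5_cases: "k < 5 \<Longrightarrow> P 0 \<Longrightarrow> P 1 \<Longrightarrow> P 2 \<Longrightarrow> P 3 \<Longrightarrow> P 4 \<Longrightarrow> P (k::nat)"
  by (auto simp: numeral_eq_Suc less_Suc_eq)

lemma less5_disj: "k < 5 \<Longrightarrow> k = 0 \<or> k = 1 \<or> k = 2 \<or> k = 3 \<or> k = (4::nat)"
  by auto

lemma periodic5: "(\<And>k. P (k + 5) = P k) \<Longrightarrow> (\<And>k. k < 5 \<Longrightarrow> P k) \<Longrightarrow> P (k::nat)"
  by (induction k rule: less_induct) (metis add.commute le_add_diff_inverse2 less_imp_diff_less not_less zero_less_diff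
      add_diff_cancel_right' diff_less zero_less_numeral order_less_le_trans)

lemma sum_five: "(\<Sum>k<5. g k) = g 0 + g 1 + g 2 + g 3 + g (4::nat)" for g :: "nat \<Rightarrow> 'b::comm_monoid_add"
  by (simp add: numeral_eq_Suc)

lemma sum_cyc:
  fixes g :: "nat \<Rightarrow> 'b::ab_group_add"
  assumes "\<And>k. g (k + 5) = g k"
  shows "(\<Sum>j<5. g (i + j)) = (\<Sum>j<5. g j)"
proof (induction i)
  case (Suc i)
  have "(\<Sum>j<5. g (Suc i + j)) = (\<Sum>j<5. g (i + j))"
    using assms[of i] by (simp add: sum_five numeral_eq_Suc add.commute add.left_commute)
  then show ?case using Suc by simp
qed simp

text \<open>The following \<open>T\<^sub>5\<close>-configuration was found by a numerical search and then rationalised.\<close>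

definition dA :: "nat \<Rightarrow> mat2" where
  "dA = cyc [mk (-5) 10 0 0, mk (-4) 64 0 16, mk (-39) 1 (-15) (-7), mk 40 8 (-6) (-4), mk (-24) (-12) 12 6]"
definition dZ :: "nat \<Rightarrow> mat2" where
  "dZ = cyc [mk (3/2) (-9) (7/2) (-11/4), mk 3 (-251/4) (7/2) (-75/4), mk (79/2) (-9/4) (79/4) 3,
     mk (-40) (-29/4) (21/2) (-5/4), mk (43/2) (69/4) (-10) (-23/4)]"
definition dp :: "nat \<Rightarrow> mat2" where
  "dp = cyc [mk (-1) (9/4) (7/2) (-11/4), mk 1 (-27/4) (7/2) (-11/4), mk 2 (-139/4) (7/2) (-43/4),
     mk 32 (-35/4) (33/2) (1/4), mk (-16) (-31/4) (25/2) (-3/4)]"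
definition da :: "nat \<Rightarrow> mat2" where
  "da = cyc [mk 0 0 0 0, mk (-4) 8 0 0, mk (-4) 36 0 8, mk (-32) 8 (-12) (-4), mk 16 8 (-8) (-4)]"
definition dq :: "nat \<Rightarrow> real" where "dq = cyc [4/5, 1/2, 4/5, 2/3, 2/5]"
text \<open>The slopes in the determinant variable with which the separation inequality of
  \<open>polyconvex_germs\<close> holds for these points.\<close>

definition dt :: "nat \<Rightarrow> real" where "dt = cyc [-13/16, -1/16, -9/16, 1/8, -5/16]"
text \<open>Together with \<open>ds\<close>, the cosines and sines of the five angles. They are
  rational points of the unit circle, so all loop equations can be checked exactly.\<close>

definition dc :: "nat \<Rightarrow> real" where "dc = cyc [-3/5, -1, 0, 1, 3/5]"
definition ds :: "nat \<Rightarrow> real" where "ds = cyc [-4/5, 0, 1, 0, 4/5]"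
definition dw0 :: "nat \<Rightarrow> real" where
  "dw0 = cyc [47113114/26797131, -13254461/53594262, -5522090/26797131, -11151799/53594262, -2590763/26797131]"
definition dw1 :: "nat \<Rightarrow> mat2" where
  "dw1 = cyc [mk (50092/8932377) (-2310308/26797131) (-151196/924039) (9450100/26797131),
     mk (10076/8932377) (54548/26797131) (19418/924039) (-1855234/26797131),
     mk (71644/8932377) (430408/26797131) (50764/924039) (-1425752/26797131),
     mk (-143594/8932377) (860884/26797131) (58186/924039) (-2932418/26797131),
     mk (11782/8932377) (964468/26797131) (22828/924039) (-3236696/26797131)]"
text \<open>Dual to the five closing vectors, so that \<open>clos_deriv\<close> is the identity at
  this loop. The zero entry keeps the fourth angle fixed: four angles are enough to move in all
  directions.\<close>

definition dR :: "nat \<Rightarrow> mat2" where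
  "dR = cyc [mk (5854/29537) (3016/29537) (-20112/29537) (-14932/29537),
     mk (-300/29537) (350/29537) (8478/29537) (8374/29537),
     mk (-672/29537) (784/29537) (2450/29537) (4580/29537), mk 0 0 0 0,
     mk (-1056/29537) (1232/29537) (3850/29537) (-1242/29537)]"

lemmas d_defs = dA_def dZ_def dp_def da_def dq_def dt_def dc_def ds_def dw0_def dw1_def dR_def

lemma d_per: "dA (k + 5) = dA k" "dZ (k + 5) = dZ k" "dp (k + 5) = dp k" "da (k + 5) = da k" "dq (k + 5) = dq k"
  "dc (k + 5) = dc k" "ds (k + 5) = ds k" "dw0 (k + 5) = dw0 k" "dw1 (k + 5) = dw1 k" "dR (k + 5) = dR k"
  by (simp_all add: d_defs cyc_add5)

lemma d_bary: "j < 5 \<Longrightarrow> k < 5 \<Longrightarrow> dw0 j + dw1 j \<bullet> dZ k = (if j = k then 1 else 0)"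
  by (erule less5_cases; erule less5_cases) (simp_all add: d_defs mat2_inner)

lemma norm_mat2_less:
  assumes "\<bar>A$1$1\<bar> < 100" "\<bar>A$1$2\<bar> < 100" "\<bar>A$2$1\<bar> < 100" "\<bar>A$2$2\<bar> < 100"
  shows "norm (A :: mat2) < 400"
proof -
  have "norm A \<le> norm (A$1) + norm (A$2)" using L2_set_le_sum[of UNIV "\<lambda>i. norm (A$i)"] by (simp add: norm_vec_def sum_2)
  moreover have "norm (A$i) \<le> \<bar>A$i$1\<bar> + \<bar>A$i$2\<bar>" for i
    using L2_set_le_sum[of UNIV "\<lambda>k. norm (A$i$k)"] by (simp add: norm_vec_def sum_2)
  from this[of 1] this[of 2] have "norm (A$1) + norm (A$2) \<le> \<bar>A$1$1\<bar> + \<bar>A$1$2\<bar> + \<bar>A$2$1\<bar> + \<bar>A$2$2\<bar>" by linarith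
  ultimately show ?thesis using assms by linarith
qed

text \<open>Reduces the reproducing formula for all \<open>y\<close> to four matrix identities,
  which are finitely many rational equations.\<close>

lemma dual_basis:
  fixes v m :: "nat \<Rightarrow> mat2"
  assumes "(\<Sum>k<5. m k$1$1 *\<^sub>R v k) = mk 1 0 0 0" "(\<Sum>k<5. m k$1$2 *\<^sub>R v k) = mk 0 1 0 0"
    "(\<Sum>k<5. m k$2$1 *\<^sub>R v k) = mk 0 0 1 0" "(\<Sum>k<5. m k$2$2 *\<^sub>R v k) = mk 0 0 0 1"
  shows "(\<Sum>k<5. (v k \<bullet> y) *\<^sub>R m k) = y"
proof -
  have "(\<Sum>k<5. (v k \<bullet> y) *\<^sub>R m k) $ a $ b = (\<Sum>k<5. m k $ a $ b *\<^sub>R v k) \<bullet> y" for a b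
    by (simp add: inner_sum_left mult.commute)
  then show ?thesis by (simp add: mat2_eq_iff assms, simp add: mat2_inner)
qed

lemma add_mod5_eq_iff:
  assumes "j < 5" "k < 5" shows "(i + j) mod 5 = (i + k) mod 5 \<longleftrightarrow> j = (k::nat)"
proof -
  have *: "j = k" if "j \<le> k" "k < 5" "(i + k) mod 5 = (i + j) mod 5" for j k :: nat
  proof -
    have "5 dvd (i + k) - (i + j)" using that by (subst mod_eq_dvd_iff_nat[symmetric]) auto
    then have "5 dvd k - j" by simp
    then show ?thesis using that dvd_imp_le[of 5 "k - j"] by (cases "k = j") auto
  qed
  show ?thesis using *[of j k] *[of k j] assms by (cases "j \<le> k") auto
qed

lemma d_five_points:
  assumes "r > 0"
  shows "five_points dZ dA dw0 dw1 dR r 400"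
proof
  show "dw0 (i + j) + dw1 (i + j) \<bullet> dZ (i + k) = (if j = k then 1 else 0)" if "j < 5" "k < 5" for i j k :: nat
  proof -
    have m: "dw0 n = dw0 (n mod 5)" "dw1 n = dw1 (n mod 5)" "dZ n = dZ (n mod 5)" for n by (simp_all add: d_defs cyc_def)
    have "dw0 (i + j) + dw1 (i + j) \<bullet> dZ (i + k) = dw0 ((i + j) mod 5) + dw1 ((i + j) mod 5) \<bullet> dZ ((i + k) mod 5)"
      using m[of "i + j"] m[of "i + k"] by metis
    also have "\<dots> = (if (i + j) mod 5 = (i + k) mod 5 then 1 else 0)" by (rule d_bary) auto
    finally show ?thesis unfolding add_mod5_eq_iff[OF that] .
  qed
  have w1s: "(\<Sum>j<5. dw1 j) = 0" and w0s: "(\<Sum>j<5. dw0 j) = 1"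
    and w0z: "(\<Sum>j<5. dw0 j *\<^sub>R dZ j) = 0"
    by (simp_all add: sum_five d_defs mat2_eq_iff)
  show "(\<Sum>j<5. dw0 (i + j) + dw1 (i + j) \<bullet> p) = 1" for i p
    by (subst sum_cyc[of "\<lambda>j. dw0 j + dw1 j \<bullet> p"])
      (simp_all add: d_per sum.distrib w0s w1s flip: inner_sum_left)
  have db: "(\<Sum>j<5. (dw1 j \<bullet> p) *\<^sub>R dZ j) = p" for p
    by (rule dual_basis) (simp_all add: sum_five d_defs mat2_eq_iff)
  show "(\<Sum>j<5. (dw0 (i + j) + dw1 (i + j) \<bullet> p) *\<^sub>R dZ (i + j)) = p" for i p
    by (subst sum_cyc[of "\<lambda>j. (dw0 j + dw1 j \<bullet> p) *\<^sub>R dZ j"])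
      (simp_all add: d_per scaleR_add_left sum.distrib w0z db)
  show "norm (dZ k) < 400" for k
  proof (rule periodic5[of "\<lambda>k. norm (dZ k) < 400"])
    show "norm (dZ k) < 400" if "k < 5" for k
      by (rule norm_mat2_less; rule less5_cases[OF that]) (simp_all add: d_defs)
  qed (simp add: d_per)
  show "norm (dA k) < 400" for k
  proof (rule periodic5[of "\<lambda>k. norm (dA k) < 400"])
    show "norm (dA k) < 400" if "k < 5" for k
      by (rule norm_mat2_less; rule less5_cases[OF that]) (simp_all add: d_defs)
  qed (simp add: d_per)
qed (use assms in \<open>simp_all add: d_per\<close>)

lemma d_loop:
  assumes "r > 0"
  shows "\<exists>f. five_points.loop dZ dA dw0 dw1 dR r 400 0 dp da dq f"
proof -
  interpret five_points dZ dA dw0 dw1 dR r 400 by (rule d_five_points[OF assms])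
  have "\<exists>f. cos f = dc k \<and> sin f = ds k" if "k < 5" for k
  proof -
    have "(dc k)\<^sup>2 + (ds k)\<^sup>2 = 1" by (rule less5_cases[OF that]) (simp_all add: d_defs power2_eq_square)
    then show ?thesis using sincos_total_2pi by metis
  qed
  then obtain f0 where f0: "\<And>k. k < 5 \<Longrightarrow> cos (f0 k) = dc k \<and> sin (f0 k) = ds k" by metis
  define f where "f k = f0 (k mod 5)" for k
  have f: "cos (f k) = dc k" "sin (f k) = ds k" for k
    using f0[of "k mod 5"] by (simp_all add: f_def d_defs cyc_def)
  have f5: "f (k + 5) = f k" for k by (simp add: f_def)
  have prv: "pr D (f k) = (1/2) *\<^sub>R (D + dc k *\<^sub>R flip1 D + ds k *\<^sub>R flip2 D)"
    "dpr D (f k) = (1/2) *\<^sub>R (- ds k *\<^sub>R flip1 D + dc k *\<^sub>R flip2 D)" for D k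
    by (simp_all add: pr_def dpr_def f)
  have "loop_eqs 0 dp da dq f"
    unfolding loop_eqs_def
  proof
    fix k
    have rec: "dp (Suc k) = dp k + dq k *\<^sub>R (dZ k - dp k) \<and> da (Suc k) = da k - dq k *\<^sub>R pr (dZ k - dp k) (f k)"
    proof (rule periodic5)
      fix k :: nat
      show "(dp (Suc (k + 5)) = dp (k + 5) + dq (k + 5) *\<^sub>R (dZ (k + 5) - dp (k + 5)) \<and>
         da (Suc (k + 5)) = da (k + 5) - dq (k + 5) *\<^sub>R pr (dZ (k + 5) - dp (k + 5)) (f (k + 5))) =
        (dp (Suc k) = dp k + dq k *\<^sub>R (dZ k - dp k) \<and> da (Suc k) = da k - dq k *\<^sub>R pr (dZ k - dp k) (f k))"
        using d_per(3,4)[of "Suc k"] by (simp add: d_per f5)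
      assume "k < 5"
      then show "dp (Suc k) = dp k + dq k *\<^sub>R (dZ k - dp k) \<and> da (Suc k) = da k - dq k *\<^sub>R pr (dZ k - dp k) (f k)"
        unfolding prv
        by (rule less5_cases) (simp_all add: d_defs mat2_eq_iff flip1_def flip2_def cyc_def)
    qed
    then show "dp (k + 5) = dp k \<and> da (k + 5) = da k \<and> dq (k + 5) = dq k \<and> f (k + 5) = f k \<and>
       dp (Suc k) = dp k + dq k *\<^sub>R (dZ (0 + k) - dp k) \<and>
       da (Suc k) = da k - dq k *\<^sub>R pr (dZ (0 + k) - dp k) (f k)"
      by (simp add: d_per f5)
  qed
  moreover have "loop_opens 0 dp da dq f"
    unfolding loop_opens_def
  proof (intro allI impI)
    fix k :: nat assume k: "k < 5"
    have "X 0 dp da f k = dA k"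
      unfolding X_def prv
      using less5_disj[OF k] by (elim disjE) (simp_all add: d_defs mat2_eq_iff flip1_def flip2_def)
    moreover have "norm (dp k) < 400" by (rule norm_mat2_less; rule less5_cases[OF k]) (simp_all add: d_defs)
    moreover have "norm (da k) < 400" by (rule norm_mat2_less; rule less5_cases[OF k]) (simp_all add: d_defs)
    moreover have "w j (dp k) < 1" if "j < 5" for j
      unfolding w_def using less5_disj[OF k] less5_disj[OF that] by (elim disjE) (simp_all add: d_defs mat2_inner)
    moreover have "3/10 < dq k" "dq k < 1" using less5_disj[OF k] by (auto simp: d_defs)
    ultimately show "3/10 < dq k \<and> dq k < 1 \<and> dist (X 0 dp da f k) (dA (0 + k)) < r \<and>
      (\<forall>j<5. w j (dp k) < 1) \<and> norm (dp k) < 400 \<and> norm (da k) < 400" using assms by simp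
  qed
  moreover have "clos_deriv 0 dp dq f y = y" for y
    unfolding clos_deriv_def prv
    by (rule dual_basis[where v = "\<lambda>k. dR (0 + k)"])
      (simp_all add: sum_five d_defs mat2_eq_iff flip1_def flip2_def)
  then have "nondeg 0 dp dq f" unfolding nondeg_def by (intro exI[of _ 0]) auto
  ultimately show ?thesis unfolding loop_def by blast
qed

text \<open>Energy and hull together, in the form used by the iteration. The constant 1600 is
  \<open>4 * M\<close> with \<open>M = 400\<close>. The normal \<open>nr i\<close> is
  \<open>- dw1 i\<close>, so \<open>nr i \<bullet> (Z' - Zs i)\<close> is one minus the barycentric
  coordinate of corner \<open>i\<close>.\<close>

theorem relaxation_exists:
  obtains F :: "mat2 \<Rightarrow> real" and U :: "real \<Rightarrow> (mat2 \<times> mat2) set" and Z0 :: mat2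
    and Zs As nr :: "nat \<Rightarrow> mat2" and r :: real where
    "smooth_fun F" "strongly_polyconvex_form F" "r > 0"
    "\<And>c. open (U c)" "\<And>c d. 0 < c \<Longrightarrow> c \<le> d \<Longrightarrow> U c \<subseteq> U d" "\<And>c. bounded (U c)" "(0, Z0) \<in> U 1"
    "\<And>\<xi> c. \<xi> \<in> U c \<Longrightarrow> 0 < c \<Longrightarrow> c \<le> 1 \<Longrightarrow>
      \<exists>D v e1 e2. norm v = 1 \<and> 0 < e1 \<and> e1 \<le> 1 \<and> 0 < e2 \<and> e2 \<le> 1 \<and> e1 + e2 \<le> 2 * (199/200) * c \<and>
        norm D \<le> 1600 * c \<and> (\<forall>s. \<bar>s\<bar> \<le> 1 \<longrightarrow> \<xi> + s *\<^sub>R (- outer (D *v v) v, D) \<in> U 1) \<and>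
        \<xi> + (- outer (D *v v) v, D) \<in> U e1 \<and> \<xi> - (- outer (D *v v) v, D) \<in> U e2"
    "\<And>A' Z' c. (A', Z') \<in> U c \<Longrightarrow> 0 < c \<Longrightarrow> c \<le> 1 \<Longrightarrow>
      \<exists>i<5. \<exists>x. dist x (As i) < r \<and> norm (A' - x) \<le> 1600 * c \<and> norm (Z' - Zs i) \<le> 1600 * c"
    "\<And>A' Z' i. (A', Z') \<in> U 1 \<Longrightarrow> i < 5 \<Longrightarrow> nr i \<bullet> (Z' - Zs i) > 0"
    "\<And>i B. i < 5 \<Longrightarrow> dist B (As i) \<le> r \<Longrightarrow> DF F B = B + Zs i"
    "\<And>i j. i < 5 \<Longrightarrow> j < 5 \<Longrightarrow> i \<noteq> j \<Longrightarrow> dist (As i) (As j) > 4 * r"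
proof -
  have sep: "(dZ i + (1 - 1/10000) *\<^sub>R dA i) \<bullet> (dA j - dA i) + dt i * det (dA j - dA i) < 0"
    if "i < 5" "j < 5" "i \<noteq> j" for i j
    using less5_disj[OF that(1)] less5_disj[OF that(2)] that(3)
    by (elim disjE) (simp_all add: d_defs mat2_inner det_2)
  have tb: "\<bar>dt i\<bar> \<le> 1 - 1/10000" if "i < 5" for i
    using less5_disj[OF that] by (elim disjE) (simp_all add: d_defs)
  obtain F r0 where F: "smooth_fun F" "strongly_polyconvex_form F" "r0 > 0"
    "\<And>i B. i < 5 \<Longrightarrow> dist B (dA i) < r0 \<Longrightarrow> DF F B = B + dZ i"
    by (rule polyconvex_germs[of "1/10000" 5 dt dZ dA, OF _ tb sep]) auto
  \<comment> \<open>Half of \<open>r0\<close>, because the germ is needed on closed balls; and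
    \<open>4 * r < 1\<close>, because the points are told apart by their upper left entries, which
    are distinct integers.\<close>
  define r where "r = min (r0 / 2) (1/8)"
  have rr: "r > 0" "r < r0" "4 * r < 1" using F(3) by (auto simp: r_def)
  interpret five_points dZ dA dw0 dw1 dR r 400 by (rule d_five_points[OF rr(1)])
  obtain f where l: "loop 0 dp da dq f" using d_loop[OF rr(1)] by blast
  have d4: "dist (dA i) (dA j) > 4 * r" if "i < 5" "j < 5" "i \<noteq> j" for i j
  proof -
    have "\<bar>(dA i - dA j) $ 1 $ 1\<bar> \<ge> 1"
      using less5_disj[OF that(1)] less5_disj[OF that(2)] that(3) by (elim disjE) (simp_all add: d_defs)
    moreover have "\<bar>(dA i - dA j) $ 1 $ 1\<bar> \<le> norm (dA i - dA j)"
      using component_le_norm_cart[of "(dA i - dA j) $ 1" 1] Finite_Cartesian_Product.norm_nth_le[of "dA i - dA j" 1] by linarith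
    ultimately show ?thesis using rr(3) by (simp add: dist_norm)
  qed
  have m: "dZ k = dZ (k mod 5)" "dA k = dA (k mod 5)" for k by (simp_all add: d_defs cyc_def)
  show ?thesis
  proof (rule that[of F r U "dp 0" dA dZ "\<lambda>i. - dw1 i"])
    show "(0, dp 0) \<in> U 1"
    proof -
      have "da 0 = 0" by (simp add: d_defs mat2_eq_iff)
      then show ?thesis using U_vertex[OF l] U_mono[of "837/1000" 1] by auto
    qed
    show "\<exists>D v e1 e2. norm v = 1 \<and> 0 < e1 \<and> e1 \<le> 1 \<and> 0 < e2 \<and> e2 \<le> 1 \<and> e1 + e2 \<le> 2 * (199/200) * c \<and>
        norm D \<le> 1600 * c \<and> (\<forall>s. \<bar>s\<bar> \<le> 1 \<longrightarrow> \<xi> + s *\<^sub>R (- outer (D *v v) v, D) \<in> U 1) \<and>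
        \<xi> + (- outer (D *v v) v, D) \<in> U e1 \<and> \<xi> - (- outer (D *v v) v, D) \<in> U e2"
      if "\<xi> \<in> U c" "0 < c" "c \<le> 1" for \<xi> c
    proof -
      have "(2 * 400 * c \<ge> x) \<Longrightarrow> x \<le> 1600 * c" for x using that(2) by linarith
      then show ?thesis using U_split[OF that] by metis
    qed
    show "\<exists>i<5. \<exists>x. dist x (dA i) < r \<and> norm (A' - x) \<le> 1600 * c \<and> norm (Z' - dZ i) \<le> 1600 * c"
      if h: "(A', Z') \<in> U c" "0 < c" "c \<le> 1" for A' Z' c
    proof -
      obtain i x where ix: "dist x (dA i) < r" "norm (A' - x) \<le> 1600 * c" "norm (Z' - dZ i) \<le> 1600 * c"
        using U_near[OF h] by auto
      show ?thesis
        by (intro exI[of _ "i mod 5"] conjI exI[of _ x]) (use ix m[of i] in auto)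
    qed
    show "- dw1 i \<bullet> (Z' - dZ i) > 0" if "(A', Z') \<in> U 1" "i < 5" for A' Z' i
      using U_w[OF that] d_bary[OF that(2) that(2)] by (simp add: w_def inner_diff_right)
    show "DF F B = B + dZ i" if "i < 5" "dist B (dA i) \<le> r" for i B
      using F(4)[OF that(1)] that(2) rr(2) by force
  qed (use F rr U_open U_mono U_bounded d4 in auto)
qed

section \<open>Integration by parts for compactly supported functions\<close>

lemma deriv_outside_support:
  assumes "\<And>x. (F has_derivative F' x) (at x)" "closed S" "\<And>x. x \<notin> S \<Longrightarrow> F x = 0" "x \<notin> S"
  shows "F' x y = 0"
proof -
  have "((\<lambda>x. 0) has_derivative (\<lambda>y. 0)) (at x)" by simp
  then have "(F has_derivative (\<lambda>y. 0)) (at x)"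
    by (rule has_derivative_transform_within_open[of _ _ _ UNIV "- S"]) (use assms in auto)
  then show ?thesis using assms(1) has_derivative_unique by metis
qed

lemma integrable_continuous_compact_support:
  fixes f :: "'a::euclidean_space \<Rightarrow> 'b::euclidean_space"
  assumes "continuous_on UNIV f" "compact S" "\<And>x. x \<notin> S \<Longrightarrow> f x = 0"
  shows "integrable lborel f"
proof -
  have "integrable lborel (\<lambda>x. indicator S x *\<^sub>R f x)"
    by (rule borel_integrable_compact) (use assms continuous_on_subset in blast)+
  moreover have "(\<lambda>x. indicator S x *\<^sub>R f x) = f"
    using assms(3) by (auto simp: indicator_def fun_eq_iff)
  ultimately show ?thesis by simp
qed

lemma integral_translate:
  fixes f :: "'a::euclidean_space \<Rightarrow> 'b::euclidean_space"
  assumes "f \<in> borel_measurable borel"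
  shows "(\<integral>x. f (x + c) \<partial>lborel) = (\<integral>x. f x \<partial>lborel)"
proof -
  have "(\<integral>x. f x \<partial>lborel) = (\<integral>x. f x \<partial>(distr lborel borel ((+) c)))" by (simp only: lborel_distr_plus)
  also have "\<dots> = (\<integral>x. f (c + x) \<partial>lborel)" by (rule integral_distr) (use assms in auto)
  finally show ?thesis by (simp add: add.commute)
qed

lemma difference_quotient_tendsto:
  assumes "(F has_derivative F') (at x)"
  shows "(\<lambda>n. real (Suc n) *\<^sub>R (F (x + (1 / real (Suc n)) *\<^sub>R y) - F x)) \<longlonglongrightarrow> F' y"
proof -
  have "((\<lambda>t. F (x + t *\<^sub>R y)) has_vector_derivative F' y) (at 0)"
  proof -
    have "((\<lambda>t. x + t *\<^sub>R y) has_derivative (\<lambda>t. t *\<^sub>R y)) (at 0)" by (auto intro!: derivative_eq_intros)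
    then have "((\<lambda>t. F (x + t *\<^sub>R y)) has_derivative (\<lambda>t. F' (t *\<^sub>R y))) (at 0)"
      by (rule has_derivative_compose) (use assms in simp)
    then show ?thesis using linear_scale[OF has_derivative_linear[OF assms]]
      by (simp add: has_vector_derivative_def)
  qed
  then have "((\<lambda>t. norm (F (x + t *\<^sub>R y) - F x - t *\<^sub>R F' y) / norm t) \<longlongrightarrow> 0) (at 0)"
    by (simp add: has_vector_derivative_def has_derivative_at)
  moreover have "\<forall>\<^sub>F t in at 0. norm (F (x + t *\<^sub>R y) - F x - t *\<^sub>R F' y) / norm t = norm ((F (x + t *\<^sub>R y) - F x) /\<^sub>R t - F' y)"
  proof (rule eventually_at_filter[THEN iffD2, OF always_eventually], intro allI impI)
    fix t :: real assume t: "t \<noteq> 0"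
    then have "(F (x + t *\<^sub>R y) - F x) /\<^sub>R t - F' y = (F (x + t *\<^sub>R y) - F x - t *\<^sub>R F' y) /\<^sub>R t"
      by (simp add: scaleR_diff_right)
    then show "norm (F (x + t *\<^sub>R y) - F x - t *\<^sub>R F' y) / norm t = norm ((F (x + t *\<^sub>R y) - F x) /\<^sub>R t - F' y)"
      by (simp add: divide_inverse mult.commute)
  qed
  ultimately have "((\<lambda>t. norm ((F (x + t *\<^sub>R y) - F x) /\<^sub>R t - F' y)) \<longlongrightarrow> 0) (at 0)"
    by (rule Lim_transform_eventually)
  then have "((\<lambda>t. (F (x + t *\<^sub>R y) - F x) /\<^sub>R t) \<longlongrightarrow> F' y) (at 0)"
    by - (rule LIM_zero_cancel, rule tendsto_norm_zero_cancel)
  moreover have "filterlim (\<lambda>n. 1 / real (Suc n)) (at 0) sequentially"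
    using LIMSEQ_inverse_real_of_nat by (auto simp: filterlim_at inverse_eq_divide)
  ultimately have "(\<lambda>n. (F (x + (1 / real (Suc n)) *\<^sub>R y) - F x) /\<^sub>R (1 / real (Suc n))) \<longlonglongrightarrow> F' y"
    by (rule filterlim_compose)
  then show ?thesis by (simp add: inverse_eq_divide)
qed

lemma compact_support_bounded:
  fixes f :: "'a::euclidean_space \<Rightarrow> 'b::real_normed_vector"
  assumes "continuous_on UNIV f" "compact S" "\<And>x. x \<notin> S \<Longrightarrow> f x = 0"
  obtains C where "C > 0" "\<And>x. norm (f x) \<le> C"
proof -
  have "bounded (f ` S)"
    by (rule compact_imp_bounded[OF compact_continuous_image[OF continuous_on_subset[OF assms(1) subset_UNIV] assms(2)]])
  then obtain C where "C > 0" "\<And>x. x \<in> S \<Longrightarrow> norm (f x) \<le> C" by (auto simp: bounded_pos)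
  then show ?thesis using assms(3) that[of C] by (metis less_imp_le norm_zero)
qed

lemma difference_bound:
  fixes F :: "'a::euclidean_space \<Rightarrow> 'b::euclidean_space"
  assumes "\<And>x. (F has_derivative F' x) (at x)" "\<And>x. norm (F' x y) \<le> C"
  shows "norm (F (x + t *\<^sub>R y) - F x) \<le> C * \<bar>t\<bar>"
proof -
  have d: "((\<lambda>t. F (x + t *\<^sub>R y)) has_derivative (\<lambda>s. F' (x + t *\<^sub>R y) (s *\<^sub>R y))) (at t within UNIV)" for t
  proof -
    have "((\<lambda>t. x + t *\<^sub>R y) has_derivative (\<lambda>t. t *\<^sub>R y)) (at t)" by (auto intro!: derivative_eq_intros)
    then show ?thesis by (rule has_derivative_compose) (use assms(1) in simp)
  qed
  have "norm (F (x + t *\<^sub>R y) - F (x + 0 *\<^sub>R y)) \<le> C * norm (t - 0)"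
  proof (rule differentiable_bound[OF convex_UNIV d])
    fix s
    have sc: "F' (x + s *\<^sub>R y) (u *\<^sub>R y) = u *\<^sub>R F' (x + s *\<^sub>R y) y" for u
      using linear_scale[OF has_derivative_linear[OF assms(1)]] by blast
    show "onorm (\<lambda>u. F' (x + s *\<^sub>R y) (u *\<^sub>R y)) \<le> C"
    proof (rule onorm_bound)
      show "0 \<le> C" using assms(2)[of x] norm_ge_zero order_trans by blast
      show "norm (F' (x + s *\<^sub>R y) (u *\<^sub>R y)) \<le> C * norm u" for u
        unfolding sc norm_scaleR using mult_left_mono[OF assms(2), of "\<bar>u\<bar>"] by (simp add: mult.commute)
    qed
  qed auto
  then show ?thesis by simp
qed

text \<open>By translation invariance every difference quotient has integral zero; dominated
  convergence passes this on to the derivative. The quotients share the bound \<open>C\<close> and a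
  common bounded support.\<close>

lemma integral_derivative_zero:
  fixes F :: "'a::euclidean_space \<Rightarrow> 'b::euclidean_space"
  assumes d: "\<And>x. (F has_derivative F' x) (at x)" and c: "continuous_on UNIV (\<lambda>x. F' x y)"
    and S: "compact S" "\<And>x. x \<notin> S \<Longrightarrow> F x = 0"
  shows "(\<integral>x. F' x y \<partial>lborel) = 0"
proof -
  have cF: "continuous_on UNIV F" using d has_derivative_continuous_on by (metis has_derivative_at_withinI)
  have z: "F' x y = 0" if "x \<notin> S" for x
    by (rule deriv_outside_support[OF d compact_imp_closed[OF S(1)] S(2) that])
  obtain C where C: "C > 0" "\<And>x. norm (F' x y) \<le> C" using compact_support_bounded[OF c S(1) z] by blast
  obtain R0 where R0: "\<forall>x\<in>S. norm x \<le> R0" using compact_imp_bounded[OF S(1)] unfolding bounded_iff by blast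
  define R where "R = R0 + norm y"
  define q where "q n x = real (Suc n) *\<^sub>R (F (x + (1 / real (Suc n)) *\<^sub>R y) - F x)" for n x
  have mF: "F \<in> borel_measurable borel" using cF by (rule borel_measurable_continuous_onI)
  have iF: "integrable lborel F" by (rule integrable_continuous_compact_support[OF cF S])
  have qb: "norm (q n x) \<le> C * indicator (cball 0 R) x" for n x
  proof (cases "x \<in> cball 0 R")
    case True
    have "norm (q n x) = real (Suc n) * norm (F (x + (1 / real (Suc n)) *\<^sub>R y) - F x)" by (simp add: q_def)
    also have "\<dots> \<le> real (Suc n) * (C * \<bar>1 / real (Suc n)\<bar>)"
      by (intro mult_left_mono difference_bound[OF d C(2)]) auto
    finally show ?thesis using True by simp
  next
    case False
    have "norm y / real (Suc n) \<le> norm y" by (simp add: divide_le_eq mult_left_le_one_le field_simps)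
    then have "norm (x + (1 / real (Suc n)) *\<^sub>R y) \<ge> norm x - norm y"
      using norm_diff_ineq[of x "(1 / real (Suc n)) *\<^sub>R y"] by simp
    moreover have "norm x > R0 + norm y" using False by (simp add: R_def)
    ultimately have "norm (x + (1 / real (Suc n)) *\<^sub>R y) > R0" "norm x > R0" using norm_ge_zero[of y] by linarith+
    then have "x + (1 / real (Suc n)) *\<^sub>R y \<notin> S" "x \<notin> S" using R0 leD by blast+
    then show ?thesis using S(2) False by (simp add: q_def)
  qed
  have q0: "(\<integral>x. q n x \<partial>lborel) = 0" for n
  proof -
    have "integrable lborel (\<lambda>x. F (x + (1 / real (Suc n)) *\<^sub>R y))"
    proof (rule integrable_continuous_compact_support)
      show "continuous_on UNIV (\<lambda>x. F (x + (1 / real (Suc n)) *\<^sub>R y))"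
        by (rule continuous_on_compose2[OF cF]) (auto intro!: continuous_intros)
      show "compact ((\<lambda>x. x - (1 / real (Suc n)) *\<^sub>R y) ` S)"
        by (rule compact_continuous_image[OF _ S(1)]) (auto intro!: continuous_intros)
      fix x assume "x \<notin> (\<lambda>x. x - (1 / real (Suc n)) *\<^sub>R y) ` S"
      then have "x + (1 / real (Suc n)) *\<^sub>R y \<notin> S" by (auto simp: image_iff)
      then show "F (x + (1 / real (Suc n)) *\<^sub>R y) = 0" using S(2) by blast
    qed
    then have "(\<integral>x. q n x \<partial>lborel) = real (Suc n) *\<^sub>R ((\<integral>x. F (x + (1 / real (Suc n)) *\<^sub>R y) \<partial>lborel) - (\<integral>x. F x \<partial>lborel))"
      unfolding q_def using iF by (simp only: integral_scaleR_right Bochner_Integration.integral_diff)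
    then show ?thesis by (simp only: integral_translate[OF mF] diff_self scaleR_zero_right)
  qed
  have "(\<lambda>n. \<integral>x. q n x \<partial>lborel) \<longlonglongrightarrow> (\<integral>x. F' x y \<partial>lborel)"
  proof (rule integral_dominated_convergence[where w = "\<lambda>x. C * indicator (cball 0 R) x"])
    show "(\<lambda>x. F' x y) \<in> borel_measurable lborel" using borel_measurable_continuous_onI[OF c] by simp
    show "q n \<in> borel_measurable lborel" for n
      unfolding q_def[abs_def] using mF by measurable
    show "integrable lborel (\<lambda>x. C * indicator (cball 0 R) x)"
      using emeasure_bounded_finite[OF bounded_cball, of 0 R] by (intro integrable_mult_right integrable_real_indicator) auto
    show "AE x in lborel. (\<lambda>n. q n x) \<longlonglongrightarrow> F' x y"
      using difference_quotient_tendsto[OF d] by (simp add: q_def)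
  qed (use qb in auto)
  then have "(\<lambda>n::nat. 0) \<longlonglongrightarrow> (\<integral>x. F' x y \<partial>lborel)" unfolding q0 .
  then show ?thesis by (simp add: LIMSEQ_const_iff)
qed

text \<open>The symmetry of second derivatives, in weak form: neither function needs to be twice differentiable.\<close>

lemma integral_curl_zero:
  fixes q \<psi> :: "'a::euclidean_space \<Rightarrow> real"
  assumes dq: "\<And>x. (q has_derivative q' x) (at x)" and cq: "\<And>y. continuous_on UNIV (\<lambda>x. q' x y)"
    and dp: "\<And>x. (\<psi> has_derivative \<psi>' x) (at x)" and cp: "\<And>y. continuous_on UNIV (\<lambda>x. \<psi>' x y)"
    and S: "compact S" "\<And>x. x \<notin> S \<Longrightarrow> q x = 0"
  shows "(\<integral>x. q' x a * \<psi>' x b \<partial>lborel) = (\<integral>x. q' x b * \<psi>' x a \<partial>lborel)"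
proof -
  have cont_q: "continuous_on UNIV q" using dq has_derivative_continuous_on by (metis has_derivative_at_withinI)
  have cont_p: "continuous_on UNIV \<psi>" using dp has_derivative_continuous_on by (metis has_derivative_at_withinI)
  have z: "q' x y = 0" if "x \<notin> S" for x y
    by (rule deriv_outside_support[OF dq compact_imp_closed[OF S(1)] S(2) that])
  obtain C where C: "C > 0" "\<And>x. norm (q' x b) \<le> C" using compact_support_bounded[OF cq S(1) z] by blast
  obtain Ca where Ca: "Ca > 0" "\<And>x. norm (q' x a) \<le> Ca" using compact_support_bounded[OF cq S(1) z] by blast
  obtain R0 where R0: "\<forall>x\<in>S. norm x \<le> R0" using compact_imp_bounded[OF S(1)] unfolding bounded_iff by blast
  define R where "R = R0 + norm b + 1"
  define hn where "hn n = 1 / real (Suc n)" for n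
  have hn: "hn n > 0" "hn n \<le> 1" for n by (auto simp: hn_def)
  define P where "P n x = real (Suc n) * (\<psi> (x + hn n *\<^sub>R b) - \<psi> x)" for n x
  define Q where "Q n x = real (Suc n) * (q x - q (x - hn n *\<^sub>R b))" for n x
  obtain M where M: "M > 0" "\<And>x. x \<in> cball 0 (R + norm b) \<Longrightarrow> norm (\<psi>' x b) \<le> M \<and> norm (\<psi>' x a) \<le> M"
  proof -
    have "bounded ((\<lambda>x. \<psi>' x b) ` cball 0 (R + norm b))" "bounded ((\<lambda>x. \<psi>' x a) ` cball 0 (R + norm b))"
      using cp by (auto intro!: compact_imp_bounded compact_continuous_image continuous_on_subset[OF cp])
    then obtain M1 M2 where "M1 > 0" "M2 > 0" "\<And>x. x \<in> cball 0 (R + norm b) \<Longrightarrow> norm (\<psi>' x b) \<le> M1"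
      "\<And>x. x \<in> cball 0 (R + norm b) \<Longrightarrow> norm (\<psi>' x a) \<le> M2" unfolding bounded_pos by (metis imageI)
    then show ?thesis by (intro that[of "max M1 M2"]) (auto intro: max.coboundedI1 max.coboundedI2)
  qed
  \<comment> \<open>A discrete integration by parts: the derivative along \<open>a\<close> is moved
    by \<open>integral_derivative_zero\<close>, the difference quotient along \<open>b\<close> by a
    translation, which turns the forward quotient of \<open>\<psi>\<close> into the backward
    quotient of \<open>q\<close>.\<close>
  have key: "(\<integral>x. q' x a * P n x \<partial>lborel) = (\<integral>x. Q n x * \<psi>' x a \<partial>lborel)" for n
  proof -
    let ?h = "hn n *\<^sub>R b"
    let ?k = "real (Suc n)"
    have dps: "((\<lambda>x. \<psi> (x + ?h)) has_derivative \<psi>' (x + ?h)) (at x)" for x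
    proof -
      have "((\<lambda>x. x + ?h) has_derivative (\<lambda>y. y)) (at x)" by (auto intro!: derivative_eq_intros)
      from has_derivative_compose[OF this dp] show ?thesis .
    qed
    have cps: "continuous_on UNIV (\<lambda>x. \<psi>' (x + ?h) a)"
      by (rule continuous_on_compose2[OF cp]) (auto intro!: continuous_intros)
    have cpsh: "continuous_on UNIV (\<lambda>x. \<psi> (x + ?h))"
      by (rule continuous_on_compose2[OF cont_p]) (auto intro!: continuous_intros)
    have cqs: "continuous_on UNIV (\<lambda>x. q (x - ?h))"
      by (rule continuous_on_compose2[OF cont_q]) (auto intro!: continuous_intros)
    have "(\<integral>x. q x * (?k * (\<psi>' (x + ?h) a - \<psi>' x a)) + q' x a * P n x \<partial>lborel) = 0"
    proof (rule integral_derivative_zero[where F = "\<lambda>x. q x * P n x" and S = S and y = a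
          and F' = "\<lambda>x y. q x * (?k * (\<psi>' (x + ?h) y - \<psi>' x y)) + q' x y * P n x"])
      show "((\<lambda>x. q x * P n x) has_derivative (\<lambda>y. q x * (?k * (\<psi>' (x + ?h) y - \<psi>' x y)) + q' x y * P n x)) (at x)" for x
        unfolding P_def by (auto intro!: derivative_eq_intros dq dp dps)
      show "continuous_on UNIV (\<lambda>x. q x * (?k * (\<psi>' (x + ?h) a - \<psi>' x a)) + q' x a * P n x)"
        unfolding P_def by (intro continuous_intros cont_q cps cp cq cpsh cont_p)
    qed (use S in auto)
    moreover have i1: "integrable lborel (\<lambda>x. q' x a * P n x)"
      by (rule integrable_continuous_compact_support[OF _ S(1)])
        (auto simp: z P_def intro!: continuous_intros cq cpsh cont_p)
    moreover have i2: "integrable lborel (\<lambda>x. q x * \<psi>' (x + ?h) a)"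
      by (rule integrable_continuous_compact_support[OF _ S(1)]) (auto simp: S intro!: continuous_intros cont_q cps)
    moreover have i3: "integrable lborel (\<lambda>x. q x * \<psi>' x a)"
      by (rule integrable_continuous_compact_support[OF _ S(1)]) (auto simp: S intro!: continuous_intros cont_q cp)
    moreover have i4: "integrable lborel (\<lambda>x. q (x - ?h) * \<psi>' x a)"
    proof (rule integrable_continuous_compact_support)
      show "continuous_on UNIV (\<lambda>x. q (x - ?h) * \<psi>' x a)" by (intro continuous_intros cqs cp)
      show "compact ((\<lambda>x. x + ?h) ` S)" by (rule compact_continuous_image[OF _ S(1)]) (auto intro!: continuous_intros)
      fix x assume "x \<notin> (\<lambda>x. x + ?h) ` S"
      then have "x - ?h \<notin> S" by (auto simp: image_iff)
      then show "q (x - ?h) * \<psi>' x a = 0" using S(2) by simp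
    qed
    moreover have "(\<integral>x. q x * \<psi>' (x + ?h) a \<partial>lborel) = (\<integral>x. q (x - ?h) * \<psi>' x a \<partial>lborel)"
    proof -
      have "(\<lambda>x. q (x - ?h) * \<psi>' x a) \<in> borel_measurable borel"
        by (intro borel_measurable_continuous_onI continuous_intros cqs cp)
      from integral_translate[OF this, of ?h] show ?thesis by simp
    qed
    ultimately show ?thesis
      unfolding Q_def by (simp add: algebra_simps)
  qed
  have "(\<lambda>n. \<integral>x. q' x a * P n x \<partial>lborel) \<longlonglongrightarrow> (\<integral>x. q' x a * \<psi>' x b \<partial>lborel)"
  proof (rule integral_dominated_convergence[where w = "\<lambda>x. Ca * M * indicator (cball 0 R) x"])
    show "(\<lambda>x. q' x a * \<psi>' x b) \<in> borel_measurable lborel"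
      using borel_measurable_continuous_onI[OF continuous_on_mult[OF cq cp]] by simp
    have "(\<lambda>x. q' x a) \<in> borel_measurable borel" "\<psi> \<in> borel_measurable borel"
      using borel_measurable_continuous_onI cq cont_p by blast+
    then show "(\<lambda>x. q' x a * P n x) \<in> borel_measurable lborel" for n unfolding P_def by measurable
    show "integrable lborel (\<lambda>x. Ca * M * indicator (cball 0 R) x)"
      using emeasure_bounded_finite[OF bounded_cball, of 0 R] by (intro integrable_mult_right integrable_real_indicator) auto
    show "AE x in lborel. (\<lambda>n. q' x a * P n x) \<longlonglongrightarrow> q' x a * \<psi>' x b"
      using difference_quotient_tendsto[OF dp] by (auto simp: P_def hn_def intro!: tendsto_intros)
    have "norm (q' x a * P n x) \<le> Ca * M * indicator (cball 0 R) x" for n x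
    proof (cases "x \<in> S")
      case True
      then have x: "norm x \<le> R0" using R0 by auto
      have "norm (\<psi> (x + hn n *\<^sub>R b) - \<psi> (x + 0 *\<^sub>R b)) \<le> M * norm (hn n - 0)"
      proof (rule differentiable_bound[where S = "{0..hn n}"])
        show "((\<lambda>t. \<psi> (x + t *\<^sub>R b)) has_derivative (\<lambda>s. \<psi>' (x + t *\<^sub>R b) (s *\<^sub>R b))) (at t within {0..hn n})" for t
        proof -
          have "((\<lambda>t. x + t *\<^sub>R b) has_derivative (\<lambda>t. t *\<^sub>R b)) (at t within {0..hn n})" by (auto intro!: derivative_eq_intros)
          then show ?thesis by (rule has_derivative_compose) (use dp in simp)
        qed
        fix t assume t: "t \<in> {0..hn n}"
        have "norm (t *\<^sub>R b) \<le> norm b" using t hn(2)[of n] by (simp add: mult_left_le_one_le)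
        then have "x + t *\<^sub>R b \<in> cball 0 (R + norm b)" using x norm_triangle_ineq[of x "t *\<^sub>R b"] norm_ge_zero[of b] unfolding mem_cball_0 R_def by linarith
        then have m: "norm (\<psi>' (x + t *\<^sub>R b) b) \<le> M" using M(2) by blast
        have sc: "\<psi>' (x + t *\<^sub>R b) (u *\<^sub>R b) = u *\<^sub>R \<psi>' (x + t *\<^sub>R b) b" for u
          using linear_scale[OF has_derivative_linear[OF dp]] by blast
        show "onorm (\<lambda>s. \<psi>' (x + t *\<^sub>R b) (s *\<^sub>R b)) \<le> M"
        proof (rule onorm_bound)
          show "norm (\<psi>' (x + t *\<^sub>R b) (s *\<^sub>R b)) \<le> M * norm s" for s
            unfolding sc norm_scaleR using mult_left_mono[OF m, of "\<bar>s\<bar>"] by (simp add: mult.commute)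
        qed (use M in simp)
      qed (use hn[of n] in auto)
      then have "norm (P n x) \<le> real (Suc n) * (M * hn n)"
        using hn[of n] unfolding P_def by (simp add: abs_mult mult_left_mono)
      then have "norm (P n x) \<le> M" by (simp add: hn_def)
      then have "norm (q' x a * P n x) \<le> Ca * M" unfolding norm_mult using Ca by (intro mult_mono) auto
      moreover have "x \<in> cball 0 R" using x norm_ge_zero[of b] unfolding mem_cball_0 R_def by linarith
      ultimately show ?thesis by simp
    qed (use Ca M in \<open>simp add: z\<close>)
    then show "AE x in lborel. norm (q' x a * P n x) \<le> Ca * M * indicator (cball 0 R) x" for n by simp
  qed
  moreover have "(\<lambda>n. \<integral>x. Q n x * \<psi>' x a \<partial>lborel) \<longlonglongrightarrow> (\<integral>x. q' x b * \<psi>' x a \<partial>lborel)"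
  proof (rule integral_dominated_convergence[where w = "\<lambda>x. C * M * indicator (cball 0 R) x"])
    show "(\<lambda>x. q' x b * \<psi>' x a) \<in> borel_measurable lborel"
      using borel_measurable_continuous_onI[OF continuous_on_mult[OF cq cp]] by simp
    have "(\<lambda>x. \<psi>' x a) \<in> borel_measurable borel" "q \<in> borel_measurable borel"
      using borel_measurable_continuous_onI cp cont_q by blast+
    then show "(\<lambda>x. Q n x * \<psi>' x a) \<in> borel_measurable lborel" for n unfolding Q_def by measurable
    show "integrable lborel (\<lambda>x. C * M * indicator (cball 0 R) x)"
      using emeasure_bounded_finite[OF bounded_cball, of 0 R] by (intro integrable_mult_right integrable_real_indicator) auto
    have "(\<lambda>n. Q n x) \<longlonglongrightarrow> q' x b" for x
    proof -
      have "(\<lambda>n. real (Suc n) *\<^sub>R (q (x + (1 / real (Suc n)) *\<^sub>R (- b)) - q x)) \<longlonglongrightarrow> q' x (- b)"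
        by (rule difference_quotient_tendsto[OF dq])
      from tendsto_minus[OF this] show ?thesis
        using linear_neg[OF has_derivative_linear[OF dq]] by (simp add: Q_def hn_def algebra_simps)
    qed
    then show "AE x in lborel. (\<lambda>n. Q n x * \<psi>' x a) \<longlonglongrightarrow> q' x b * \<psi>' x a"
      by (auto intro!: tendsto_intros)
    have "norm (Q n x * \<psi>' x a) \<le> C * M * indicator (cball 0 R) x" for n x
    proof (cases "x \<in> cball 0 R")
      case True
      have "norm (q (x + (- hn n) *\<^sub>R b) - q x) \<le> C * \<bar>- hn n\<bar>" by (rule difference_bound[OF dq C(2)])
      then have "norm (Q n x) \<le> real (Suc n) * (C * hn n)"
        using hn[of n] unfolding Q_def by (simp add: abs_mult mult_left_mono abs_minus_commute)
      then have "norm (Q n x) \<le> C" by (simp add: hn_def)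
      moreover have "norm (\<psi>' x a) \<le> M" using M(2)[of x] True norm_ge_zero[of b] unfolding mem_cball_0 by linarith
      ultimately have "norm (Q n x * \<psi>' x a) \<le> C * M" unfolding norm_mult using C by (intro mult_mono) auto
      then show ?thesis using True by simp
    next
      case False
      have "norm (hn n *\<^sub>R b) \<le> norm b" using hn[of n] by (simp add: mult_left_le_one_le)
      then have "norm (x - hn n *\<^sub>R b) \<ge> norm x - norm b" using norm_triangle_ineq2[of x "hn n *\<^sub>R b"] by linarith
      moreover have "norm x > R0 + norm b + 1" using False by (simp add: R_def)
      ultimately have "norm (x - hn n *\<^sub>R b) > R0" "norm x > R0" using norm_ge_zero[of b] by linarith+
      then have "x - hn n *\<^sub>R b \<notin> S" "x \<notin> S" using R0 leD by blast+
      then show ?thesis using S(2) False by (simp add: Q_def)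
    qed
    then show "AE x in lborel. norm (Q n x * \<psi>' x a) \<le> C * M * indicator (cball 0 R) x" for n by simp
  qed
  ultimately show ?thesis unfolding key by (rule LIMSEQ_unique)
qed

section \<open>Square waves with bounded second primitives\<close>

lemma antiperiodic_bounded:
  fixes f :: "real \<Rightarrow> real"
  assumes c: "continuous_on UNIV f" and p: "\<And>s. f (s + pi) = - f s"
  obtains C where "C > 0" "\<And>s. \<bar>f s\<bar> \<le> C"
proof -
  have "bounded (f ` {0..pi})"
    by (rule compact_imp_bounded[OF compact_continuous_image[OF continuous_on_subset[OF c subset_UNIV] compact_Icc]])
  then obtain C where C: "C > 0" "\<And>s. s \<in> {0..pi} \<Longrightarrow> \<bar>f s\<bar> \<le> C" by (auto simp: bounded_pos)
  have up: "\<bar>f (s + real n * pi)\<bar> = \<bar>f s\<bar>" for s n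
  proof (induction n)
    case (Suc n)
    have "f (s + real (Suc n) * pi) = - f (s + real n * pi)" using p[of "s + real n * pi"] by (simp add: algebra_simps)
    then show ?case using Suc by simp
  qed simp
  have "\<bar>f s\<bar> \<le> C" for s
  proof -
    define m where "m = \<lfloor>s / pi\<rfloor>"
    define s' where "s' = s - of_int m * pi"
    have "of_int m \<le> s / pi" "s / pi < of_int m + 1" unfolding m_def by linarith+
    then have s': "s' \<in> {0..pi}" unfolding s'_def by (auto simp: field_simps)
    have "\<bar>f s\<bar> = \<bar>f s'\<bar>"
    proof (cases "m \<ge> 0")
      case True
      then show ?thesis using up[of s' "nat m"] by (simp add: s'_def)
    next
      case False
      then show ?thesis using up[of s "nat (- m)"] by (simp add: s'_def)
    qed
    then show ?thesis using C(2)[OF s'] by simp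
  qed
  then show ?thesis using that C(1) by blast
qed

text \<open>For any primitive \<open>F0\<close> the sum \<open>F0 (s + pi) + F0 s\<close> is
  constant, and subtracting half of that constant makes the primitive antiperiodic again.
  Integration can thus be repeated without losing boundedness.\<close>

lemma antiperiodic_antiderivative:
  fixes f :: "real \<Rightarrow> real"
  assumes c: "continuous_on UNIV f" and p: "\<And>s. f (s + pi) = - f s"
  obtains F where "\<And>s. (F has_real_derivative f s) (at s)" "\<And>s. F (s + pi) = - F s" "continuous_on UNIV F"
proof -
  obtain F0 where F0: "\<And>x. (F0 has_real_derivative f x) (at x)" using continuous_antiderivative[OF c] by blast
  have shift: "((\<lambda>s. F0 (s + pi)) has_real_derivative f (s + pi)) (at s)" for s
    using DERIV_shift[of F0 "f (s + pi)" s pi] F0 by simp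
  have "((\<lambda>s. F0 (s + pi) + F0 s) has_real_derivative 0) (at s)" for s
    using DERIV_add[OF shift F0, of s] p[of s] by simp
  then have k: "F0 (s + pi) + F0 s = F0 (0 + pi) + F0 0" for s
    using real_deriv_zero_eq[of UNIV "\<lambda>s. F0 (s + pi) + F0 s" s 0] by simp
  define F where "F s = F0 s - (F0 pi + F0 0) / 2" for s
  have "(F has_real_derivative f s) (at s)" for s
    unfolding F_def using F0[of s] by (auto intro!: derivative_eq_intros)
  moreover have "F (s + pi) = - F s" for s using k[of s] by (simp add: F_def field_simps)
  moreover have "continuous_on UNIV F"
    by (rule continuous_at_imp_continuous_on) (use calculation(1) DERIV_isCont in blast)
  ultimately show ?thesis using that by blast
qed

text \<open>After reducing the offset modulo \<open>pi\<close> the argument stays in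
  \<open>[0, 2 pi]\<close>, which contains two zeros of the cosine; each accounts for an interval of
  length \<open>2 * e\<close>.\<close>

lemma cos_small_measure:
  assumes e: "0 < e" "e < pi / 2"
  shows "emeasure lborel {t \<in> {0..pi}. \<bar>cos (c + t)\<bar> < sin e} \<le> ennreal (4 * e)"
proof -
  define m where "m = \<lfloor>c / pi\<rfloor>"
  define c' where "c' = c - of_int m * pi"
  have "of_int m \<le> c / pi" "c / pi < of_int m + 1" unfolding m_def by linarith+
  then have c': "0 \<le> c'" "c' < pi" unfolding c'_def by (auto simp: field_simps)
  have cs: "\<bar>cos (c + t)\<bar> = \<bar>cos (c' + t)\<bar>" for t
  proof -
    have "cos (c + t) = cos ((c' + t) + of_int m * pi)" by (simp add: c'_def algebra_simps)
    also have "\<dots> = cos (c' + t) * cos (of_int m * pi) - sin (c' + t) * sin (of_int m * pi)" by (rule cos_add)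
    also have "sin (of_int m * pi) = 0" by (simp add: sin_times_pi_eq_0)
    also have "\<bar>cos (of_int m * pi)\<bar> = 1" using \<open>sin (of_int m * pi) = 0\<close> sin_cos_squared_add[of "of_int m * pi"]
      by (metis abs_square_eq_1 add_0 power2_eq_square mult_zero_left)
    ultimately show ?thesis by (simp add: abs_mult)
  qed
  have in_int: "(\<bar>s - pi/2\<bar> \<le> e) \<or> (\<bar>s - 3*pi/2\<bar> \<le> e)" if s: "0 \<le> s" "s \<le> 2 * pi" "\<bar>cos s\<bar> < sin e" for s
  proof (rule ccontr)
    assume n: "\<not> ?thesis"
    have a: "sin e = cos (pi/2 - e)" by (simp add: sin_cos_eq)
    consider "s < pi/2 - e" | "pi/2 + e < s" "s \<le> pi" | "pi \<le> s" "s < 3*pi/2 - e" | "3*pi/2 + e < s" using n by force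
    then show False
    proof cases
      case 1
      then have "cos (pi/2 - e) \<le> cos s" using s e by (intro cos_monotone_0_pi_le) auto
      then show False using s a by simp
    next
      case 2
      then have "cos s \<le> cos (pi/2 + e)" using s e by (intro cos_monotone_0_pi_le) auto
      moreover have "cos (pi/2 + e) = - sin e" by (simp add: cos_add)
      ultimately show False using s by simp
    next
      case 3
      have "cos (s - pi) = - cos s" by (simp add: cos_diff)
      moreover have "cos (pi/2 - e) \<le> cos (s - pi)" using 3 e by (intro cos_monotone_0_pi_le) auto
      ultimately show False using s a by simp
    next
      case 4
      have "cos (2*pi - s) = cos s" by (simp add: cos_diff)
      moreover have "cos (pi/2 - e) \<le> cos (2*pi - s)" using 4 e s by (intro cos_monotone_0_pi_le) auto
      ultimately show False using s a by simp
    qed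
  qed
  have "{t \<in> {0..pi}. \<bar>cos (c + t)\<bar> < sin e} \<subseteq> {pi/2 - e - c'..pi/2 + e - c'} \<union> {3*pi/2 - e - c'..3*pi/2 + e - c'}"
  proof
    fix t assume "t \<in> {t \<in> {0..pi}. \<bar>cos (c + t)\<bar> < sin e}"
    then show "t \<in> {pi/2 - e - c'..pi/2 + e - c'} \<union> {3*pi/2 - e - c'..3*pi/2 + e - c'}"
      using in_int[of "c' + t"] cs[of t] c' by (auto simp: abs_le_iff)
  qed
  then have "emeasure lborel {t \<in> {0..pi}. \<bar>cos (c + t)\<bar> < sin e} \<le>
    emeasure lborel ({pi/2 - e - c'..pi/2 + e - c'} \<union> {3*pi/2 - e - c'..3*pi/2 + e - c'})"
    by (rule emeasure_mono) simp
  also have "\<dots> \<le> emeasure lborel {pi/2 - e - c'..pi/2 + e - c'} + emeasure lborel {3*pi/2 - e - c'..3*pi/2 + e - c'}"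
    by (rule emeasure_subadditive) auto
  also have "\<dots> = ennreal (4 * e)" using e by (simp flip: ennreal_plus)
  finally show ?thesis .
qed

text \<open>A truncated multiple of the cosine. It takes the values 1 and -1 outside a set of small
  measure, and still has antiperiodic, hence bounded, first and second primitives, from which the
  potential of a wave is built.\<close>

lemma square_wave_exists:
  assumes e: "0 < e" "e < pi / 2"
  obtains h H1 H :: "real \<Rightarrow> real" and C where
    "continuous_on UNIV h" "\<And>s. (H has_real_derivative H1 s) (at s)" "\<And>s. (H1 has_real_derivative h s) (at s)"
    "\<And>s. \<bar>h s\<bar> \<le> 1" "C > 0" "\<And>s. \<bar>H s\<bar> \<le> C" "\<And>s. \<bar>H1 s\<bar> \<le> C" "\<And>s. h (s + pi) = - h s"
    "\<And>s. \<bar>h s\<bar> \<noteq> 1 \<Longrightarrow> \<bar>cos s\<bar> < sin e"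
proof -
  have se: "sin e > 0" using e by (intro sin_gt_zero) auto
  define h where "h s = max (-1) (min 1 (cos s / sin e))" for s
  have ch: "continuous_on UNIV h" unfolding h_def by (intro continuous_intros) (use se in auto)
  have ph: "h (s + pi) = - h s" for s unfolding h_def by (simp add: max_def min_def)
  obtain H1 where H1: "\<And>s. (H1 has_real_derivative h s) (at s)" "\<And>s. H1 (s + pi) = - H1 s" "continuous_on UNIV H1"
    using antiperiodic_antiderivative[OF ch ph] by blast
  obtain H where H: "\<And>s. (H has_real_derivative H1 s) (at s)" "\<And>s. H (s + pi) = - H s" "continuous_on UNIV H"
    using antiperiodic_antiderivative[OF H1(3,2)] by blast
  obtain C1 where C1: "C1 > 0" "\<And>s. \<bar>H1 s\<bar> \<le> C1" using antiperiodic_bounded[OF H1(3,2)] by blast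
  obtain C2 where C2: "C2 > 0" "\<And>s. \<bar>H s\<bar> \<le> C2" using antiperiodic_bounded[OF H(3,2)] by blast
  show ?thesis
  proof (rule that[OF ch H(1) H1(1) _ _ _ _ ph])
    show "\<bar>h s\<bar> \<le> 1" for s by (auto simp: h_def)
    show "max C1 C2 > 0" using C1 by simp
    show "\<bar>H s\<bar> \<le> max C1 C2" for s using C2(2)[of s] by simp
    show "\<bar>H1 s\<bar> \<le> max C1 C2" for s using C1(2)[of s] by simp
    show "\<bar>cos s\<bar> < sin e" if "\<bar>h s\<bar> \<noteq> 1" for s
    proof (rule ccontr)
      assume "\<not> \<bar>cos s\<bar> < sin e"
      then have "cos s / sin e \<ge> 1 \<or> cos s / sin e \<le> -1" using se by (auto simp: field_simps abs_if split: if_splits)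
      then show False using that by (auto simp: h_def)
    qed
  qed
qed

lemma ndiff_real_derivatives:
  fixes f :: "real \<Rightarrow> real"
  assumes "\<And>n. ndiff n f"
  obtains f' where "\<And>n. ndiff n f'" "\<And>x. (f has_real_derivative f' x) (at x)"
proof
  show "ndiff n (\<lambda>x. frechet_derivative f (at x) 1)" for n using assms[of "Suc n"] by simp
  fix x
  have d: "(f has_derivative frechet_derivative f (at x)) (at x)" using ndiff_has_derivative[OF assms[of 1, unfolded One_nat_def]] .
  have "frechet_derivative f (at x) = (\<lambda>y. frechet_derivative f (at x) 1 * y)"
  proof
    fix y
    show "frechet_derivative f (at x) y = frechet_derivative f (at x) 1 * y"
      using linear_scale[OF has_derivative_linear[OF d], of y 1] by (simp add: mult.commute)
  qed
  then show "(f has_real_derivative frechet_derivative f (at x) 1) (at x)"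
    using d unfolding has_field_derivative_def by metis
qed

section \<open>Localised high-frequency potentials\<close>

lemma cutoff_exists:
  fixes z0 :: "'a::euclidean_space"
  assumes rr: "0 < \<rho>" "\<rho> < r"
  obtains cf :: "'a \<Rightarrow> real" and X :: "'a \<Rightarrow> 'a" and Y :: "'a \<Rightarrow> 'a \<Rightarrow> 'a" and C where
    "\<And>z. (cf has_derivative (\<lambda>y. X z \<bullet> y)) (at z)" "\<And>z. (X has_derivative Y z) (at z)"
    "\<And>z. 0 \<le> cf z" "\<And>z. cf z \<le> 1" "\<And>z. z \<in> cball z0 \<rho> \<Longrightarrow> cf z = 1"
    "\<And>z. z \<notin> cball z0 r \<Longrightarrow> cf z = 0 \<and> X z = 0" "\<And>y. continuous_on UNIV (\<lambda>z. Y z y)"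
    "C > 0" "\<And>z. norm (X z) \<le> C" "\<And>z y. norm (Y z y) \<le> C * norm y"
proof -
  obtain st :: "real \<Rightarrow> real" where st: "\<And>n. ndiff n st" "\<And>x. 0 \<le> st x" "\<And>x. st x \<le> 1"
    "\<And>x. x \<le> 0 \<Longrightarrow> st x = 0" "\<And>x. x \<ge> 1 \<Longrightarrow> st x = 1" using smooth_step_exists by metis
  obtain s1 where s1: "\<And>n. ndiff n s1" "\<And>x. (st has_real_derivative s1 x) (at x)" using ndiff_real_derivatives[OF st(1)] by blast
  obtain s2 where s2: "\<And>n. ndiff n s2" "\<And>x. (s1 has_real_derivative s2 x) (at x)" using ndiff_real_derivatives[OF s1(1)] by blast
  have z1: "s1 x = 0" if "x < 0" for x
  proof -
    have "(st has_real_derivative 0) (at x)"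
      by (rule has_field_derivative_transform_within_open[of "\<lambda>x. 0" _ _ "{..<0}"]) (use that st(4) in auto)
    then show ?thesis using s1(2) DERIV_unique by blast
  qed
  have z2: "s2 x = 0" if "x < 0" for x
  proof -
    have "(s1 has_real_derivative 0) (at x)"
      by (rule has_field_derivative_transform_within_open[of "\<lambda>x. 0" _ _ "{..<0}"]) (use that z1 in auto)
    then show ?thesis using s2(2) DERIV_unique by blast
  qed
  \<comment> \<open>Normalises \<open>s\<close> to be 0 on the outer sphere and at least 1 inside
    the inner one.\<close>
  define M where "M = 1 / (r\<^sup>2 - \<rho>\<^sup>2)"
  have M: "M > 0" using rr by (simp add: M_def power2_eq_square mult_strict_mono)
  define s where "s z = M * (r\<^sup>2 - (z - z0) \<bullet> (z - z0))" for z
  have ds: "(s has_derivative (\<lambda>y. (- 2 * M) * ((z - z0) \<bullet> y))) (at z)" for z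
    unfolding s_def by (auto intro!: derivative_eq_intros simp: inner_commute algebra_simps)
  have dcomp: "((\<lambda>z. f (s z)) has_derivative (\<lambda>y. f' (s z) * ((- 2 * M) * ((z - z0) \<bullet> y)))) (at z)"
    if "\<And>x. (f has_real_derivative f' x) (at x)" for f f' z
    using has_derivative_compose[OF ds, of f "\<lambda>y. f' (s z) * y"] that[of "s z"] by (simp add: has_field_derivative_def)
  have cs: "continuous_on UNIV s" unfolding s_def by (intro continuous_intros)
  have c1: "continuous_on UNIV (\<lambda>z. s1 (s z))"
    by (rule continuous_on_compose2[OF ndiff_continuous[of s1 UNIV, OF s1(1)] cs]) simp
  have c2: "continuous_on UNIV (\<lambda>z. s2 (s z))"
    by (rule continuous_on_compose2[OF ndiff_continuous[of s2 UNIV, OF s2(1)] cs]) simp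
  have out: "s z < 0" if "z \<notin> cball z0 r" for z
  proof -
    have "r < norm (z - z0)" using that by (simp add: dist_norm norm_minus_commute)
    then have "r\<^sup>2 < (norm (z - z0))\<^sup>2" using rr by (intro power_strict_mono) auto
    then show ?thesis unfolding s_def using M by (simp add: power2_norm_eq_inner mult_less_0_iff)
  qed
  obtain C1 where C1: "C1 > 0" "\<And>z. \<bar>s1 (s z)\<bar> \<le> C1"
    using compact_support_bounded[OF c1 compact_cball[of z0 r]] out z1 by (metis real_norm_def)
  obtain C2 where C2: "C2 > 0" "\<And>z. \<bar>s2 (s z)\<bar> \<le> C2"
    using compact_support_bounded[OF c2 compact_cball[of z0 r]] out z2 by (metis real_norm_def)
  define X where "X z = (s1 (s z) * (- 2 * M)) *\<^sub>R (z - z0)" for z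
  define Y where "Y z y = (s2 (s z) * ((- 2 * M) * ((z - z0) \<bullet> y)) * (- 2 * M)) *\<^sub>R (z - z0) + (s1 (s z) * (- 2 * M)) *\<^sub>R y" for z y
  have dX: "(X has_derivative Y z) (at z)" for z
    unfolding X_def Y_def by (rule derivative_eq_intros dcomp[OF s2(2)] refl | simp add: fun_eq_iff algebra_simps)+
  define C where "C = C1 * (2 * M) * r + C2 * (2 * M) * (2 * M) * r * r + C1 * (2 * M)"
  have X: "norm (X z) \<le> C1 * (2 * M) * r" for z
  proof (cases "z \<in> cball z0 r")
    case True
    then have "norm (z - z0) \<le> r" by (simp add: dist_norm norm_minus_commute)
    then show ?thesis unfolding X_def norm_scaleR abs_mult using C1 M rr by (intro mult_mono) auto
  qed (use out z1 C1 M rr in \<open>simp add: X_def\<close>)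
  have Y: "norm (Y z y) \<le> (C2 * (2 * M) * (2 * M) * r * r + C1 * (2 * M)) * norm y" for z y
  proof (cases "z \<in> cball z0 r")
    case True
    then have n: "norm (z - z0) \<le> r" by (simp add: dist_norm norm_minus_commute)
    have i: "\<bar>(z - z0) \<bullet> y\<bar> \<le> r * norm y"
      using Cauchy_Schwarz_ineq2[of "z - z0" y] mult_right_mono[OF n, of "norm y"] by simp
    have "norm ((s2 (s z) * ((- 2 * M) * ((z - z0) \<bullet> y)) * (- 2 * M)) *\<^sub>R (z - z0)) \<le> C2 * ((2 * M) * (r * norm y)) * (2 * M) * r"
      unfolding norm_scaleR abs_mult using C2 M rr n i by (intro mult_mono) auto
    moreover have "norm ((s1 (s z) * (- 2 * M)) *\<^sub>R y) \<le> C1 * (2 * M) * norm y"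
      unfolding norm_scaleR abs_mult using C1 M by (intro mult_mono) auto
    ultimately show ?thesis unfolding Y_def by (intro norm_triangle_le) (simp add: algebra_simps)
  qed (use out z1 z2 C1 C2 M rr in \<open>simp add: Y_def\<close>)
  show ?thesis
  proof (rule that[of "\<lambda>z. st (s z)" X Y C])
    show "((\<lambda>z. st (s z)) has_derivative (\<lambda>y. X z \<bullet> y)) (at z)" for z
      using dcomp[OF s1(2), of z] by (simp add: X_def mult_ac)
    show "(X has_derivative Y z) (at z)" for z by (rule dX)
    show "st (s z) = 1" if "z \<in> cball z0 \<rho>" for z
    proof (rule st(5))
      have "norm (z - z0) \<le> \<rho>" using that by (simp add: dist_norm norm_minus_commute)
      then have "(norm (z - z0))\<^sup>2 \<le> \<rho>\<^sup>2" by (intro power_mono) auto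
      then have "M * (r\<^sup>2 - \<rho>\<^sup>2) \<le> s z" unfolding s_def using M by (intro mult_left_mono) (auto simp: power2_norm_eq_inner)
      moreover have "M * (r\<^sup>2 - \<rho>\<^sup>2) = 1" using M unfolding M_def by simp
      ultimately show "1 \<le> s z" by simp
    qed
    show "st (s z) = 0 \<and> X z = 0" if "z \<notin> cball z0 r" for z
      using out[OF that] z1 st(4) by (simp add: X_def)
    show "continuous_on UNIV (\<lambda>z. Y z y)" for y unfolding Y_def by (intro continuous_intros c1 c2)
    have p: "C1 * (2 * M) * r > 0" "C2 * (2 * M) * (2 * M) * r * r > 0" "C1 * (2 * M) > 0" using C1 C2 M rr by auto
    show "C > 0" using p by (simp add: C_def)
    show "norm (X z) \<le> C" for z using X[of z] p unfolding C_def by linarith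
    show "norm (Y z y) \<le> C * norm y" for z y
      using Y[of z y] mult_right_mono[of "C2 * (2 * M) * (2 * M) * r * r + C1 * (2 * M)" C "norm y"] p unfolding C_def by force
  qed (use st in auto)
qed

type_synonym pt = "(real^2) \<times> real"

lemma has_derivative_continuous_UNIV:
  assumes "\<And>z. (f has_derivative f' z) (at z)" shows "continuous_on UNIV f"
  by (rule continuous_at_imp_continuous_on) (use assms has_derivative_continuous in blast)

text \<open>The potential is \<open>cf z * H (k * (a \<bullet> z) + \<theta>) / k^2\<close>. Every
  derivative that falls on the cutoff instead of the phase leaves a factor \<open>1 / k\<close>, so
  the Hessian is the rank-one term \<open>cf * h\<close> in direction \<open>a\<close> up to
  \<open>C / k\<close>. The constant depends neither on \<open>k\<close> nor on
  \<open>\<theta>\<close>, which keeps the phase free for a later choice.\<close>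

lemma wave_field:
  fixes a z0 :: "'a::euclidean_space"
  assumes a: "norm a = 1" and rr: "0 < \<rho>" "\<rho> < r"
    and H: "\<And>s. (H has_real_derivative H1 s) (at s)" "\<And>s. (H1 has_real_derivative h s) (at s)"
    and hc: "continuous_on UNIV h" and b: "\<And>s. \<bar>H s\<bar> \<le> C0" "\<And>s. \<bar>H1 s\<bar> \<le> C0" "C0 > 0"
  obtains cf :: "'a \<Rightarrow> real" and C where "C > 0" "\<And>z. 0 \<le> cf z" "\<And>z. cf z \<le> 1" "\<And>z. z \<in> cball z0 \<rho> \<Longrightarrow> cf z = 1"
    "\<And>k \<theta>. k \<ge> 1 \<Longrightarrow> \<exists>g G Hs. (\<forall>z. (g has_derivative (\<lambda>y. G z \<bullet> y)) (at z)) \<and> (\<forall>z. (G has_derivative Hs z) (at z)) \<and>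
      (\<forall>y. continuous_on UNIV (\<lambda>z. Hs z y)) \<and> (\<forall>z. z \<notin> cball z0 r \<longrightarrow> g z = 0 \<and> G z = 0) \<and>
      (\<forall>z. norm (G z) \<le> C / k) \<and>
      (\<forall>z y. norm (Hs z y - (cf z * h (k * (a \<bullet> z) + \<theta>) * (a \<bullet> y)) *\<^sub>R a) \<le> C / k * norm y)"
proof -
  obtain cf :: "'a \<Rightarrow> real" and X :: "'a \<Rightarrow> 'a" and Y :: "'a \<Rightarrow> 'a \<Rightarrow> 'a" and C1 where
    cf: "\<And>z. (cf has_derivative (\<lambda>y. X z \<bullet> y)) (at z)" "\<And>z. (X has_derivative Y z) (at z)"
    "\<And>z. 0 \<le> cf z" "\<And>z. cf z \<le> 1" "\<And>z. z \<in> cball z0 \<rho> \<Longrightarrow> cf z = 1"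
    "\<And>z. z \<notin> cball z0 r \<Longrightarrow> cf z = 0 \<and> X z = 0" "\<And>y. continuous_on UNIV (\<lambda>z. Y z y)"
    "C1 > 0" "\<And>z. norm (X z) \<le> C1" "\<And>z y. norm (Y z y) \<le> C1 * norm y"
    by (rule cutoff_exists[OF rr, of z0]) blast
  define C where "C = 3 * (C0 * C1) + C0"
  have C: "C > 0" using b(3) cf(8) by (simp add: C_def add_pos_pos)
  have contcf: "continuous_on UNIV cf" "continuous_on UNIV X"
    by (rule has_derivative_continuous_UNIV[OF cf(1)], rule has_derivative_continuous_UNIV[OF cf(2)])
  have "\<exists>g G Hs. (\<forall>z. (g has_derivative (\<lambda>y. G z \<bullet> y)) (at z)) \<and> (\<forall>z. (G has_derivative Hs z) (at z)) \<and>
      (\<forall>y. continuous_on UNIV (\<lambda>z. Hs z y)) \<and> (\<forall>z. z \<notin> cball z0 r \<longrightarrow> g z = 0 \<and> G z = 0) \<and>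
      (\<forall>z. norm (G z) \<le> C / k) \<and>
      (\<forall>z y. norm (Hs z y - (cf z * h (k * (a \<bullet> z) + \<theta>) * (a \<bullet> y)) *\<^sub>R a) \<le> C / k * norm y)" if k: "k \<ge> 1" for k \<theta>
  proof -
    define s where "s z = k * (a \<bullet> z) + \<theta>" for z
    have ds: "(s has_derivative (\<lambda>y. k * (a \<bullet> y))) (at z)" for z
      unfolding s_def by (auto intro!: derivative_eq_intros)
    have dcomp: "((\<lambda>z. f (s z)) has_derivative (\<lambda>y. f' (s z) * (k * (a \<bullet> y)))) (at z)"
      if "\<And>x. (f has_real_derivative f' x) (at x)" for f f' z
      using has_derivative_compose[OF ds, of f "\<lambda>y. f' (s z) * y"] that[of "s z"] by (simp add: has_field_derivative_def)
    have cs: "continuous_on UNIV s" unfolding s_def by (intro continuous_intros)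
    have cH: "continuous_on UNIV (\<lambda>z. H (s z))" "continuous_on UNIV (\<lambda>z. H1 (s z))" "continuous_on UNIV (\<lambda>z. h (s z))"
      by (rule has_derivative_continuous_UNIV[OF dcomp[OF H(1)]], rule has_derivative_continuous_UNIV[OF dcomp[OF H(2)]],
          rule continuous_on_compose2[OF hc cs], simp)
    define f where "f z = H (s z) / k\<^sup>2" for z
    define f1 where "f1 z = H1 (s z) / k" for z
    have df: "(f has_derivative (\<lambda>y. f1 z * (a \<bullet> y))) (at z)" for z
      unfolding f_def f1_def using k
      by (auto intro!: derivative_eq_intros dcomp[OF H(1)] simp: fun_eq_iff power2_eq_square)
    have df1: "(f1 has_derivative (\<lambda>y. h (s z) * (a \<bullet> y))) (at z)" for z
      unfolding f1_def using k by (auto intro!: derivative_eq_intros dcomp[OF H(2)] simp: fun_eq_iff)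
    define g where "g z = f z * cf z" for z
    define G where "G z = f z *\<^sub>R X z + (cf z * f1 z) *\<^sub>R a" for z
    define Hs where "Hs z y = f z *\<^sub>R Y z y + (f1 z * (a \<bullet> y)) *\<^sub>R X z + (cf z * (h (s z) * (a \<bullet> y)) + (X z \<bullet> y) * f1 z) *\<^sub>R a" for z y
    have fb: "\<bar>f z\<bar> \<le> C0 / k" "\<bar>f1 z\<bar> \<le> C0 / k" for z
    proof -
      have "\<bar>f z\<bar> \<le> C0 / k\<^sup>2" unfolding f_def using b(1)[of "s z"] k by (simp add: divide_right_mono)
      also have "\<dots> \<le> C0 / k" using b(3) k by (intro divide_left_mono) (auto simp: power2_eq_square)
      finally show "\<bar>f z\<bar> \<le> C0 / k" .
      show "\<bar>f1 z\<bar> \<le> C0 / k" unfolding f1_def using b(2)[of "s z"] k by (simp add: divide_right_mono)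
    qed
    have C0k: "C0 / k \<ge> 0" using b(3) k by simp
    show ?thesis
    proof (intro exI[of _ g] exI[of _ G] exI[of _ Hs] conjI allI impI)
      show "(g has_derivative (\<lambda>y. G z \<bullet> y)) (at z)" for z
        unfolding g_def G_def by (auto intro!: derivative_eq_intros df cf(1) simp: inner_add_left inner_commute algebra_simps)
      show "(G has_derivative Hs z) (at z)" for z
        unfolding G_def Hs_def by (rule derivative_eq_intros df df1 cf(1,2) refl | simp add: fun_eq_iff algebra_simps)+
      show "continuous_on UNIV (\<lambda>z. Hs z y)" for y
        unfolding Hs_def f_def f1_def using k by (intro continuous_intros cH contcf cf(7)) auto
      show "g z = 0" "G z = 0" if "z \<notin> cball z0 r" for z using cf(6)[OF that] by (auto simp: g_def G_def)
      show "norm (G z) \<le> C / k" for z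
      proof -
        have "norm (G z) \<le> \<bar>f z\<bar> * norm (X z) + (cf z * \<bar>f1 z\<bar>) * norm a"
          unfolding G_def using cf(3)[of z] by (intro norm_triangle_le) (simp add: abs_mult)
        also have "\<dots> \<le> C0 / k * C1 + (1 * (C0 / k)) * 1"
          using fb[of z] cf(3,4,8,9) C0k a by (intro add_mono mult_mono) auto
        also have "\<dots> = (C0 * C1 + C0) / k" by (simp add: add_divide_distrib)
        also have "\<dots> \<le> C / k" using k b(3) cf(8) by (intro divide_right_mono) (auto simp: C_def)
        finally show ?thesis .
      qed
      show "norm (Hs z y - (cf z * h (k * (a \<bullet> z) + \<theta>) * (a \<bullet> y)) *\<^sub>R a) \<le> C / k * norm y" for z y
      proof -
        have ay: "\<bar>a \<bullet> y\<bar> \<le> norm y" using Cauchy_Schwarz_ineq2[of a y] a by simp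
        have Xy: "\<bar>X z \<bullet> y\<bar> \<le> C1 * norm y"
          using Cauchy_Schwarz_ineq2[of "X z" y] mult_right_mono[OF cf(9)[of z], of "norm y"] by simp
        have "Hs z y - (cf z * h (k * (a \<bullet> z) + \<theta>) * (a \<bullet> y)) *\<^sub>R a =
           f z *\<^sub>R Y z y + (f1 z * (a \<bullet> y)) *\<^sub>R X z + ((X z \<bullet> y) * f1 z) *\<^sub>R a"
          unfolding Hs_def s_def by (simp add: algebra_simps)
        also have "norm \<dots> \<le> \<bar>f z\<bar> * norm (Y z y) + (\<bar>f1 z\<bar> * \<bar>a \<bullet> y\<bar>) * norm (X z) + (\<bar>X z \<bullet> y\<bar> * \<bar>f1 z\<bar>) * norm a"
          by (intro norm_triangle_le add_mono order_refl) (auto simp: abs_mult)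
        also have "\<dots> \<le> C0 / k * (C1 * norm y) + (C0 / k * norm y) * C1 + ((C1 * norm y) * (C0 / k)) * 1"
        proof -
          have n: "0 \<le> C1 * norm y" "0 \<le> C0 / k * norm y" "0 \<le> (C1 * norm y) * (C0 / k)"
            by (intro mult_nonneg_nonneg norm_ge_zero C0k less_imp_le[OF cf(8)])+
          show ?thesis
            by (intro add_mono mult_mono fb cf(9) cf(10) ay Xy n C0k abs_ge_zero norm_ge_zero zero_le_one mult_nonneg_nonneg)
              (use a in auto)
        qed
        also have "\<dots> = (3 * (C0 * C1)) / k * norm y" by (simp add: field_simps)
        also have "\<dots> \<le> C / k * norm y"
          using k b(3) by (intro mult_right_mono divide_right_mono) (auto simp: C_def)
        finally show ?thesis .
      qed
    qed
  qed
  then show ?thesis using that[of C cf] C cf(3,4,5) by blast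
qed

section \<open>Space-time derivatives and compactly supported solutions of the linear system\<close>

lemma Dt_eq:
  assumes "(\<psi> has_derivative \<psi>') (at z)"
  shows "Dt \<psi> z = \<psi>' (0, 1)"
proof -
  have 1: "((\<lambda>s. (fst z, s)) has_derivative (\<lambda>s. (0, s))) (at (snd z))"
    by (intro has_derivative_Pair has_derivative_const has_derivative_ident)
  have a: "(\<psi> has_derivative \<psi>') (at (fst z, snd z))" using assms by (simp only: prod.collapse)
  have 2: "((\<lambda>s. \<psi> (fst z, s)) has_derivative (\<lambda>s. \<psi>' (0, s))) (at (snd z))"
    by (rule has_derivative_compose[OF 1 a])
  have 3: "\<psi>' (0, s) = s *\<^sub>R \<psi>' (0, 1)" for s
  proof -
    have "\<psi>' (s *\<^sub>R (0, 1)) = s *\<^sub>R \<psi>' (0, 1)" by (rule linear_scale[OF has_derivative_linear[OF assms]])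
    then show ?thesis by (simp only: scaleR_Pair scaleR_zero_right scaleR_one real_scaleR_def mult_1_right)
  qed
  have "((\<lambda>s. \<psi> (fst z, s)) has_vector_derivative \<psi>' (0, 1)) (at (snd z))"
    unfolding has_vector_derivative_def by (rule has_derivative_eq_rhs[OF 2]) (rule ext, rule 3)
  then show ?thesis unfolding Dt_def by (rule vector_derivative_at)
qed

lemma spatial_derivative:
  fixes \<psi> :: "pt \<Rightarrow> real^2"
  assumes "(\<psi> has_derivative \<psi>') (at z)"
  shows "((\<lambda>y. \<psi> (y, snd z)) has_derivative (\<lambda>y. \<psi>' (y, 0))) (at (fst z))"
proof -
  have "((\<lambda>y. (y, snd z)) has_derivative (\<lambda>y. (y, 0))) (at (fst z))"
    by (intro has_derivative_Pair has_derivative_const has_derivative_ident)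
  then show ?thesis by (rule has_derivative_compose) (use assms in simp)
qed

lemma Dx_eq:
  assumes "(\<psi> has_derivative \<psi>') (at z)"
  shows "Dx \<psi> z $ i $ j = \<psi>' (axis j 1, 0) $ i"
proof -
  have "frechet_derivative (\<lambda>y. \<psi> (y, snd z)) (at (fst z)) = (\<lambda>y. \<psi>' (y, 0))"
    using frechet_derivative_at[OF spatial_derivative[OF assms]] by simp
  then show ?thesis unfolding Dx_def by (simp add: matrix_def)
qed

lemma C1_fun_obtain:
  assumes "C1_fun \<psi>"
  obtains \<psi>' where "\<And>z. (\<psi> has_derivative \<psi>' z) (at z)" "\<And>y. continuous_on UNIV (\<lambda>z. \<psi>' z y)"
proof -
  obtain f' where f': "continuous_on UNIV f'" "\<And>x. (\<psi> has_derivative blinfun_apply (f' x)) (at x)"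
    using assms unfolding C1_fun_def by blast
  show ?thesis
    by (rule that[OF f'(2)], rule bounded_bilinear.continuous_on[OF bounded_bilinear_blinfun_apply f'(1) continuous_on_const])
qed

lemma C1_fun_continuous:
  assumes "C1_fun \<psi>"
  shows "continuous_on UNIV \<psi>" "continuous_on UNIV (Dt \<psi>)" "continuous_on UNIV (Dx \<psi>)"
proof -
  obtain \<psi>' where p: "\<And>z. (\<psi> has_derivative \<psi>' z) (at z)" "\<And>y. continuous_on UNIV (\<lambda>z. \<psi>' z y)"
    using C1_fun_obtain[OF assms] by blast
  show "continuous_on UNIV \<psi>" by (rule has_derivative_continuous_UNIV[OF p(1)])
  have "Dt \<psi> = (\<lambda>z. \<psi>' z (0, 1))" by (rule ext) (rule Dt_eq[OF p(1)])
  then show "continuous_on UNIV (Dt \<psi>)" using p(2)[of "(0, 1)"] by simp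
  have "Dx \<psi> = (\<lambda>z. \<chi> i j. \<psi>' z (axis j 1, 0) $ i)"
    by (rule ext) (simp add: vec_eq_iff Dx_eq[OF p(1)])
  moreover have "continuous_on UNIV (\<lambda>z. \<chi> i j. \<psi>' z (axis j 1, 0) $ i)"
    by (intro continuous_on_vec_lambda continuous_on_component p(2))
  ultimately show "continuous_on UNIV (Dx \<psi>)" by simp
qed

text \<open>The weak form of \<open>V_t = div (B + \<zeta>)\<close>, where \<open>B\<close> is the
  spatial gradient and \<open>\<tau>\<close> the time derivative of \<open>V\<close>. Everything
  vanishes off \<open>S\<close>, so the identity carries no boundary terms and perturbations can be
  added freely.\<close>

definition pert :: "pt set \<Rightarrow> (pt \<Rightarrow> real^2) \<Rightarrow> (pt \<Rightarrow> mat2) \<Rightarrow> (pt \<Rightarrow> real^2) \<Rightarrow> (pt \<Rightarrow> mat2) \<Rightarrow> bool" where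
  "pert S V B \<tau> \<zeta> \<longleftrightarrow>
     (\<forall>z. (V has_derivative (\<lambda>y. B z *v fst y + snd y *\<^sub>R \<tau> z)) (at z)) \<and>
     continuous_on UNIV B \<and> continuous_on UNIV \<tau> \<and> continuous_on UNIV \<zeta> \<and>
     (\<forall>z. z \<notin> S \<longrightarrow> V z = 0 \<and> B z = 0 \<and> \<tau> z = 0 \<and> \<zeta> z = 0) \<and>
     (\<forall>\<psi>. C1_fun \<psi> \<longrightarrow> (\<integral>z. V z \<bullet> Dt \<psi> z - (B z + \<zeta> z) \<bullet> Dx \<psi> z \<partial>lborel) = 0)"

lemma pertD:
  assumes "pert S V B \<tau> \<zeta>"
  shows "\<And>z. (V has_derivative (\<lambda>y. B z *v fst y + snd y *\<^sub>R \<tau> z)) (at z)"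
    "continuous_on UNIV B" "continuous_on UNIV \<tau>" "continuous_on UNIV \<zeta>"
    "\<And>z. z \<notin> S \<Longrightarrow> V z = 0 \<and> B z = 0 \<and> \<tau> z = 0 \<and> \<zeta> z = 0"
    "\<And>\<psi>. C1_fun \<psi> \<Longrightarrow> (\<integral>z. V z \<bullet> Dt \<psi> z - (B z + \<zeta> z) \<bullet> Dx \<psi> z \<partial>lborel) = 0"
  using assms unfolding pert_def by blast+

lemma pertI:
  assumes "\<And>z. (V has_derivative (\<lambda>y. B z *v fst y + snd y *\<^sub>R \<tau> z)) (at z)"
    "continuous_on UNIV B" "continuous_on UNIV \<tau>" "continuous_on UNIV \<zeta>"
    "\<And>z. z \<notin> S \<Longrightarrow> V z = 0 \<and> B z = 0 \<and> \<tau> z = 0 \<and> \<zeta> z = 0"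
    "\<And>\<psi>. C1_fun \<psi> \<Longrightarrow> (\<integral>z. V z \<bullet> Dt \<psi> z - (B z + \<zeta> z) \<bullet> Dx \<psi> z \<partial>lborel) = 0"
  shows "pert S V B \<tau> \<zeta>"
  unfolding pert_def using assms by blast

lemma pert_continuous: "pert S V B \<tau> \<zeta> \<Longrightarrow> continuous_on UNIV V"
  by (rule has_derivative_continuous_UNIV[OF pertD(1)])

lemma pert_integrable:
  assumes "pert S V B \<tau> \<zeta>" "compact S" "C1_fun \<psi>"
  shows "integrable lborel (\<lambda>z. V z \<bullet> Dt \<psi> z - (B z + \<zeta> z) \<bullet> Dx \<psi> z)"
proof (rule integrable_continuous_compact_support[OF _ assms(2)])
  show "continuous_on UNIV (\<lambda>z. V z \<bullet> Dt \<psi> z - (B z + \<zeta> z) \<bullet> Dx \<psi> z)"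
    by (intro continuous_on_diff continuous_on_inner continuous_on_add pert_continuous[OF assms(1)]
        C1_fun_continuous[OF assms(3)] pertD[OF assms(1)])
qed (use pertD(5)[OF assms(1)] in auto)

lemma pert_zero: "pert {} (\<lambda>z. 0) (\<lambda>z. 0) (\<lambda>z. 0) (\<lambda>z. 0)"
  by (rule pertI) simp_all

lemma pert_add:
  assumes 1: "pert S V B \<tau> \<zeta>" and 2: "pert S' V' B' \<tau>' \<zeta>'" and c: "compact S" "compact S'"
  shows "pert (S \<union> S') (\<lambda>z. V z + V' z) (\<lambda>z. B z + B' z) (\<lambda>z. \<tau> z + \<tau>' z) (\<lambda>z. \<zeta> z + \<zeta>' z)"
proof -
  have d: "((\<lambda>z. V z + V' z) has_derivative (\<lambda>y. (B z + B' z) *v fst y + snd y *\<^sub>R (\<tau> z + \<tau>' z))) (at z)" for z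
  proof -
    from has_derivative_add[OF pertD(1)[OF 1] pertD(1)[OF 2]] show ?thesis
      by (simp add: matrix_vector_mult_add_rdistrib scaleR_add_right add_ac)
  qed
  have i: "(\<integral>z. (V z + V' z) \<bullet> Dt \<psi> z - ((B z + B' z) + (\<zeta> z + \<zeta>' z)) \<bullet> Dx \<psi> z \<partial>lborel) = 0" if "C1_fun \<psi>" for \<psi>
  proof -
    have "(\<integral>z. (V z \<bullet> Dt \<psi> z - (B z + \<zeta> z) \<bullet> Dx \<psi> z) + (V' z \<bullet> Dt \<psi> z - (B' z + \<zeta>' z) \<bullet> Dx \<psi> z) \<partial>lborel) = 0 + 0"
      using pertD(6)[OF 1 that] pertD(6)[OF 2 that]
      by (subst Bochner_Integration.integral_add[OF pert_integrable[OF 1 c(1) that] pert_integrable[OF 2 c(2) that]]) auto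
    then show ?thesis by (simp add: inner_add_left algebra_simps)
  qed
  show ?thesis
  proof (rule pertI[OF d])
    show "V z + V' z = 0 \<and> B z + B' z = 0 \<and> \<tau> z + \<tau>' z = 0 \<and> \<zeta> z + \<zeta>' z = 0" if "z \<notin> S \<union> S'" for z
      using pertD(5)[OF 1, of z] pertD(5)[OF 2, of z] that by simp
    show "continuous_on UNIV (\<lambda>z. B z + B' z)" by (rule continuous_on_add[OF pertD(2)[OF 1] pertD(2)[OF 2]])
    show "continuous_on UNIV (\<lambda>z. \<tau> z + \<tau>' z)" by (rule continuous_on_add[OF pertD(3)[OF 1] pertD(3)[OF 2]])
    show "continuous_on UNIV (\<lambda>z. \<zeta> z + \<zeta>' z)" by (rule continuous_on_add[OF pertD(4)[OF 1] pertD(4)[OF 2]])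
  qed (rule i)
qed

lemma pert_sum:
  assumes "finite I" "\<And>i. i \<in> I \<Longrightarrow> pert (S i) (V i) (B i) (\<tau> i) (\<zeta> i)" "\<And>i. i \<in> I \<Longrightarrow> compact (S i)"
  shows "pert (\<Union>i\<in>I. S i) (\<lambda>z. \<Sum>i\<in>I. V i z) (\<lambda>z. \<Sum>i\<in>I. B i z) (\<lambda>z. \<Sum>i\<in>I. \<tau> i z) (\<lambda>z. \<Sum>i\<in>I. \<zeta> i z)"
  using assms
proof (induction I rule: finite_induct)
  case (insert i I)
  have "pert (S i \<union> (\<Union>i\<in>I. S i)) (\<lambda>z. V i z + (\<Sum>i\<in>I. V i z)) (\<lambda>z. B i z + (\<Sum>i\<in>I. B i z))
    (\<lambda>z. \<tau> i z + (\<Sum>i\<in>I. \<tau> i z)) (\<lambda>z. \<zeta> i z + (\<Sum>i\<in>I. \<zeta> i z))"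
    by (rule pert_add) (use insert in auto)
  then show ?case using insert.hyps by simp
qed (simp add: pert_zero)

section \<open>Wave blocks\<close>

text \<open>The linear dependence of a wave block on the first derivative \<open>G\<close> and the columns \<open>P\<close>, \<open>Q\<close> of the
  spatial second derivatives of its scalar potential.\<close>

definition perp :: "real^2 \<Rightarrow> real^2" where "perp v = vector [- v$2, v$1]"
definition LB :: "mat2 \<Rightarrow> pt \<Rightarrow> pt \<Rightarrow> mat2" where
  "LB D P Q = mk (- (D *v fst P)$1) (- (D *v fst Q)$1) (- (D *v fst P)$2) (- (D *v fst Q)$2)"
definition LZ :: "mat2 \<Rightarrow> real^2 \<Rightarrow> pt \<Rightarrow> pt \<Rightarrow> pt \<Rightarrow> mat2" where
  "LZ D v G P Q = - (snd G) *\<^sub>R D - LB D P Q + outer (D *v perp v) (vector [- (v \<bullet> fst Q), v \<bullet> fst P])"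

lemma linear_LB: "linear (\<lambda>p. LB D (fst p) (snd p))"
  by (rule linearI) (simp_all add: LB_def mat2_eq_iff matrix_vector_mult_def sum_2 algebra_simps)

lemma linear_LZ: "linear (\<lambda>p. LZ D v (fst p) (fst (snd p)) (snd (snd p)))"
  by (rule linearI) (simp_all add: LZ_def LB_def outer_def mat2_eq_iff matrix_vector_mult_def sum_2 inner_vec_def algebra_simps)

lemma LB_wave: "LB D ((c * v$1) *\<^sub>R (v, 0)) ((c * v$2) *\<^sub>R (v, 0)) = - c *\<^sub>R outer (D *v v) v"
  by (simp add: LB_def outer_def mat2_eq_iff matrix_vector_mult_def sum_2 algebra_simps)

text \<open>The part \<open>- LB\<close> contributes \<open>c\<close> times \<open>D\<close>
  composed with the projection onto \<open>v\<close>, the rotated gradient contributes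
  \<open>c\<close> times \<open>D\<close> composed with the projection onto \<open>perp v\<close>,
  and the two projections add up to the identity. With \<open>LB_wave\<close> this shows that the
  leading term of a wave is exactly \<open>- c\<close> times the cone direction in \<open>B\<close>
  and \<open>c\<close> times \<open>D\<close> in \<open>\<zeta>\<close>.\<close>

lemma LZ_wave:
  assumes "norm v = 1"
  shows "LZ D v 0 ((c * v$1) *\<^sub>R (v, 0)) ((c * v$2) *\<^sub>R (v, 0)) = c *\<^sub>R D"
proof -
  have vv: "v \<bullet> v = 1" using assms by (simp add: norm_eq_1)
  then have u: "v$1 * v$1 + v$2 * v$2 = 1" by (simp add: inner_vec_def sum_2)
  have k1: "c * p * (x * p + y * q) + (x * (- q) + y * p) * (- (c * q)) = c * x"
    and k2: "c * q * (x * p + y * q) + (x * (- q) + y * p) * (c * p) = c * y"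
    if "p * p + q * q = 1" for p q x y :: real
    using that by algebra+
  show ?thesis
    unfolding mat2_eq_iff LZ_def LB_def outer_def perp_def
    using k1[OF u, of "D$1$1" "D$1$2"] k2[OF u, of "D$1$1" "D$1$2"] k1[OF u, of "D$2$1" "D$2$2"] k2[OF u, of "D$2$1" "D$2$2"]
    by (simp add: matrix_vector_mult_def sum_2 vv matrix_vector_mult_scaleR) (simp add: algebra_simps)
qed

lemma integral_bound_support:
  fixes f :: "'a::euclidean_space \<Rightarrow> 'b::euclidean_space"
  assumes "continuous_on UNIV f" "\<And>x. x \<notin> cball z0 r \<Longrightarrow> f x = 0" "\<And>x. x \<in> cball z0 r \<Longrightarrow> norm (f x) \<le> c"
  shows "norm (\<integral>x. f x \<partial>lborel) \<le> c * measure lborel (cball z0 r)"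
proof -
  have i: "integrable lborel f" by (rule integrable_continuous_compact_support[OF assms(1) compact_cball assms(2)])
  have j: "integrable lborel (\<lambda>x. c * indicator (cball z0 r) x :: real)"
    using emeasure_bounded_finite[OF bounded_cball, of z0 r] by (intro integrable_mult_right integrable_real_indicator) auto
  have "norm (\<integral>x. f x \<partial>lborel) \<le> (\<integral>x. norm (f x) \<partial>lborel)" by (rule integral_norm_bound)
  also have "\<dots> \<le> (\<integral>x. c * indicator (cball z0 r) x \<partial>lborel)"
  proof (rule integral_mono[OF integrable_norm[OF i] j])
    show "norm (f x) \<le> c * indicator (cball z0 r) x" for x
      using assms(2)[of x] assms(3)[of x] by (cases "x \<in> cball z0 r") auto
  qed
  also have "\<dots> = c * measure lborel (cball z0 r)" by simp
  finally show ?thesis .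
qed

text \<open>The form \<open>has_bochner_integral\<close> carries integrability along, so linear
  combinations of such identities need no side conditions.\<close>

lemma curl_bochner:
  fixes q \<psi> :: "'a::euclidean_space \<Rightarrow> real"
  assumes dq: "\<And>x. (q has_derivative q' x) (at x)" and cq: "\<And>y. continuous_on UNIV (\<lambda>x. q' x y)"
    and dp: "\<And>x. (\<psi> has_derivative \<psi>' x) (at x)" and cp: "\<And>y. continuous_on UNIV (\<lambda>x. \<psi>' x y)"
    and S: "compact S" "\<And>x. x \<notin> S \<Longrightarrow> q x = 0"
  shows "has_bochner_integral lborel (\<lambda>x. q' x a * \<psi>' x b - q' x b * \<psi>' x a) 0"
proof -
  have z: "q' x y = 0" if "x \<notin> S" for x y
    by (rule deriv_outside_support[OF dq compact_imp_closed[OF S(1)] S(2) that])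
  have i: "integrable lborel (\<lambda>x. q' x y * \<psi>' x y')" for y y'
    by (rule integrable_continuous_compact_support[OF continuous_on_mult[OF cq cp] S(1)]) (simp add: z)
  show ?thesis
    using has_bochner_integral_diff[OF has_bochner_integral_integrable[OF i[of a b]] has_bochner_integral_integrable[OF i[of b a]]]
      integral_curl_zero[OF dq cq dp cp S, of a b] by simp
qed

definition E1 :: pt where "E1 = (axis 1 1, 0)"
definition E2 :: pt where "E2 = (axis 2 1, 0)"
definition E3 :: pt where "E3 = (0, 1)"

lemma pt_expand: "y = (fst y $ 1) *\<^sub>R E1 + (fst y $ 2) *\<^sub>R E2 + snd y *\<^sub>R E3"
  by (simp add: prod_eq_iff E1_def E2_def E3_def vec_eq_iff forall_2 axis_def)

lemma norm_E: "norm E1 = 1" "norm E2 = 1" "norm E3 = 1"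
  by (simp_all add: E1_def E2_def E3_def norm_Pair)

lemma inner_E: "G \<bullet> E1 = fst G $ 1" "G \<bullet> E2 = fst G $ 2" "G \<bullet> E3 = snd G"
  by (simp_all add: E1_def E2_def E3_def inner_prod_def inner_axis)

text \<open>With a scalar potential \<open>g\<close>, \<open>V\<close> is \<open>- D\<close> applied
  to the spatial gradient of \<open>g\<close>, and \<open>B + \<zeta>\<close> is
  \<open>- g_t D\<close> plus \<open>D *v perp v\<close> times the rotated gradient of the
  derivative of \<open>g\<close> along \<open>v\<close>. The first summand has divergence
  \<open>V_t\<close>, the second is divergence free, so the equation holds exactly, cutoff included.
  All deviations from the ideal wave are of order \<open>1 / k\<close>, uniformly in the
  phase.\<close>

lemma wave_block:
  fixes D :: mat2 and v :: "real^2" and z0 :: pt and \<phi> :: "nat \<Rightarrow> pt \<Rightarrow> real" and \<phi>' :: "nat \<Rightarrow> pt \<Rightarrow> pt"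
  assumes v: "norm v = 1" and rr: "0 < \<rho>" "\<rho> < r"
    and H: "\<And>s. (H has_real_derivative H1 s) (at s)" "\<And>s. (H1 has_real_derivative h s) (at s)"
    and hc: "continuous_on UNIV h" and b: "\<And>s. \<bar>H s\<bar> \<le> C0" "\<And>s. \<bar>H1 s\<bar> \<le> C0" "C0 > 0" and h1: "\<And>s. \<bar>h s\<bar> \<le> 1"
    and phi: "\<And>j z. (\<phi> j has_derivative (\<lambda>y. \<phi>' j z \<bullet> y)) (at z)" "\<And>j. continuous_on UNIV (\<phi>' j)"
    and eps: "\<epsilon> > 0"
  shows "\<exists>k0\<ge>1. \<forall>k\<ge>k0. \<forall>\<theta>. \<exists>V B \<tau> \<zeta>. pert (cball z0 r) V B \<tau> \<zeta> \<and> (\<forall>z. norm (V z) \<le> \<epsilon> \<and> norm (\<tau> z) \<le> \<epsilon>) \<and>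
    (\<forall>z. \<exists>s. \<bar>s\<bar> \<le> 1 \<and> norm (B z + s *\<^sub>R outer (D *v v) v) \<le> \<epsilon> \<and> norm (\<zeta> z - s *\<^sub>R D) \<le> \<epsilon> \<and>
      (dist z0 z \<le> \<rho> \<longrightarrow> s = h (k * (v \<bullet> fst z) + \<theta>))) \<and>
    (\<forall>j<n. norm (\<integral>z. \<phi> j z *\<^sub>R \<zeta> z \<partial>lborel) \<le> \<epsilon>)"
proof -
  \<comment> \<open>The frequency has no time component; this makes the time derivative
    \<open>\<tau>\<close> small although \<open>B\<close> is of order one.\<close>
  define a :: pt where "a = (v, 0)"
  have na: "norm a = 1" using v by (simp add: a_def norm_Pair)
  have av: "a \<bullet> z = v \<bullet> fst z" for z by (simp add: a_def inner_prod_def)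
  obtain cf :: "pt \<Rightarrow> real" and C where C: "C > 0" "\<And>z. 0 \<le> cf z" "\<And>z. cf z \<le> 1" "\<And>z. z \<in> cball z0 \<rho> \<Longrightarrow> cf z = 1"
    and W: "\<And>k \<theta>. k \<ge> 1 \<Longrightarrow> \<exists>g G Hs. (\<forall>z. (g has_derivative (\<lambda>y. G z \<bullet> y)) (at z)) \<and> (\<forall>z. (G has_derivative Hs z) (at z)) \<and>
      (\<forall>y. continuous_on UNIV (\<lambda>z. Hs z y)) \<and> (\<forall>z. z \<notin> cball z0 r \<longrightarrow> g z = 0 \<and> G z = 0) \<and>
      (\<forall>z. norm (G z) \<le> C / k) \<and>
      (\<forall>z y. norm (Hs z y - (cf z * h (k * (a \<bullet> z) + \<theta>) * (a \<bullet> y)) *\<^sub>R a) \<le> C / k * norm y)"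
    by (rule wave_field[OF na rr H hc b, of z0]) (rule that, assumption+)
  obtain KB where KB: "KB > 0" "\<And>p. norm (LB D (fst p) (snd p)) \<le> KB * norm p"
    by (rule linear_bounded_pos[OF linear_LB[of D]]) (rule that, assumption+)
  obtain KZ where KZ: "KZ > 0" "\<And>p. norm (LZ D v (fst p) (fst (snd p)) (snd (snd p))) \<le> KZ * norm p"
    by (rule linear_bounded_pos[OF linear_LZ[of D v]]) (rule that, assumption+)
  obtain KD where KD: "KD > 0" "\<And>x. norm (D *v x) \<le> KD * norm x"
    by (rule linear_bounded_pos[OF matrix_vector_mul_linear[of D]]) (rule that, assumption+)
  have cphi: "continuous_on UNIV (\<phi> j)" for j by (rule has_derivative_continuous_UNIV[OF phi(1)])
  have "\<exists>c. \<forall>z\<in>cball z0 r. \<bar>\<phi> j z\<bar> \<le> c \<and> norm (\<phi>' j z) \<le> c" for j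
  proof -
    have "bounded (\<phi> j ` cball z0 r)" "bounded (\<phi>' j ` cball z0 r)"
      by (rule compact_imp_bounded[OF compact_continuous_image[OF continuous_on_subset[OF cphi subset_UNIV] compact_cball]],
          rule compact_imp_bounded[OF compact_continuous_image[OF continuous_on_subset[OF phi(2) subset_UNIV] compact_cball]])
    then obtain c1 c2 where "\<And>z. z \<in> cball z0 r \<Longrightarrow> \<bar>\<phi> j z\<bar> \<le> c1" "\<And>z. z \<in> cball z0 r \<Longrightarrow> norm (\<phi>' j z) \<le> c2"
      unfolding bounded_iff by (metis imageI real_norm_def)
    then show ?thesis by (intro exI[of _ "max c1 c2"]) (auto intro: max.coboundedI1 max.coboundedI2)
  qed
  then obtain cc where cc: "\<And>j z. z \<in> cball z0 r \<Longrightarrow> \<bar>\<phi> j z\<bar> \<le> cc j \<and> norm (\<phi>' j z) \<le> cc j" by metis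
  define Cp where "Cp = 1 + (\<Sum>j<n. \<bar>cc j\<bar>)"
  have Cp0: "Cp > 0" unfolding Cp_def by (simp add: add_pos_nonneg sum_nonneg)
  have Cp: "\<bar>\<phi> j z\<bar> \<le> Cp" "norm (\<phi>' j z) \<le> Cp" if "j < n" "z \<in> cball z0 r" for j z
  proof -
    have "\<bar>cc j\<bar> \<le> (\<Sum>j<n. \<bar>cc j\<bar>)" by (rule member_le_sum[of j "{..<n}" "\<lambda>j. \<bar>cc j\<bar>"]) (use that in auto)
    then show "\<bar>\<phi> j z\<bar> \<le> Cp" "norm (\<phi>' j z) \<le> Cp" using cc[OF that(2), of j] unfolding Cp_def by linarith+
  qed
  define vol where "vol = measure lborel (cball z0 r)"
  have vol: "vol \<ge> 0" by (simp add: vol_def)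
  define K where "K = KD + 2 * KB + 3 * KZ + 3 * KZ * (Cp * vol)"
  have K: "K > 0" "KD \<le> K" "2 * KB \<le> K" "3 * KZ \<le> K" "3 * KZ * (Cp * vol) \<le> K"
  proof -
    have "0 \<le> 3 * KZ * (Cp * vol)" using KZ Cp0 vol by simp
    then show "K > 0" "KD \<le> K" "2 * KB \<le> K" "3 * KZ \<le> K" "3 * KZ * (Cp * vol) \<le> K"
      using KD(1) KB(1) KZ(1) unfolding K_def by linarith+
  qed
  show ?thesis
  proof (intro exI[of _ "max 1 (C * K / \<epsilon>)"] conjI allI impI)
    fix k \<theta> assume "max 1 (C * K / \<epsilon>) \<le> k"
    then have k: "k \<ge> 1" "C * K / \<epsilon> \<le> k" by auto
    define d where "d = C / k"
    have d0: "d > 0" using C(1) k by (simp add: d_def)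
    have dK: "K * d \<le> \<epsilon>" using k eps by (simp add: d_def field_simps)
    have small: "x * d \<le> \<epsilon>" if "x \<le> K" for x using mult_right_mono[OF that, of d] d0 dK by linarith
    obtain g G Hs where WW: "(\<forall>z. (g has_derivative (\<lambda>y. G z \<bullet> y)) (at z)) \<and> (\<forall>z. (G has_derivative Hs z) (at z)) \<and>
      (\<forall>y. continuous_on UNIV (\<lambda>z. Hs z y)) \<and> (\<forall>z. z \<notin> cball z0 r \<longrightarrow> g z = 0 \<and> G z = 0) \<and>
      (\<forall>z. norm (G z) \<le> d) \<and>
      (\<forall>z y. norm (Hs z y - (cf z * h (k * (a \<bullet> z) + \<theta>) * (a \<bullet> y)) *\<^sub>R a) \<le> d * norm y)"
      using W[OF k(1), of \<theta>] unfolding d_def by (elim exE)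
    note dg = WW[THEN conjunct1, rule_format] and dG = WW[THEN conjunct2, THEN conjunct1, rule_format]
      and cHs = WW[THEN conjunct2, THEN conjunct2, THEN conjunct1, rule_format]
      and sup = WW[THEN conjunct2, THEN conjunct2, THEN conjunct2, THEN conjunct1, rule_format]
      and Gb = WW[THEN conjunct2, THEN conjunct2, THEN conjunct2, THEN conjunct2, THEN conjunct1, rule_format]
      and Hb = WW[THEN conjunct2, THEN conjunct2, THEN conjunct2, THEN conjunct2, THEN conjunct2, rule_format]
    have cG: "continuous_on UNIV G" by (rule has_derivative_continuous_UNIV[OF dG])
    have supH: "Hs z y = 0" if "z \<notin> cball z0 r" for z y
      by (rule deriv_outside_support[OF dG closed_cball[of z0 r] _ that]) (drule sup, simp)
    have linH: "Hs z y = (fst y $ 1) *\<^sub>R Hs z E1 + (fst y $ 2) *\<^sub>R Hs z E2 + snd y *\<^sub>R Hs z E3" for z y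
    proof -
      have l: "linear (Hs z)" by (rule has_derivative_linear[OF dG])
      have "Hs z y = Hs z ((fst y $ 1) *\<^sub>R E1 + (fst y $ 2) *\<^sub>R E2 + snd y *\<^sub>R E3)" using pt_expand[of y] by simp
      also have "\<dots> = (fst y $ 1) *\<^sub>R Hs z E1 + (fst y $ 2) *\<^sub>R Hs z E2 + snd y *\<^sub>R Hs z E3"
        by (simp only: linear_add[OF l] linear_scale[OF l])
      finally show ?thesis .
    qed
    define V where "V z = - (D *v fst (G z))" for z
    define B where "B z = LB D (Hs z E1) (Hs z E2)" for z
    define \<tau> where "\<tau> z = - (D *v fst (Hs z E3))" for z
    define \<zeta> where "\<zeta> z = LZ D v (G z) (Hs z E1) (Hs z E2)" for z
    have bl: "bounded_linear (\<lambda>p. LZ D v (fst p) (fst (snd p)) (snd (snd p)))" "bounded_linear (\<lambda>p. LB D (fst p) (snd p))"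
      "bounded_linear ((*v) D)"
      using linear_LZ[of D v] linear_LB[of D] matrix_vector_mul_linear[of D] by (simp_all add: linear_conv_bounded_linear)
    have cB: "continuous_on UNIV B"
      using bounded_linear.continuous_on[OF bl(2) continuous_on_Pair[OF cHs[of E1] cHs[of E2]]] by (simp add: B_def[abs_def])
    have cZ: "continuous_on UNIV \<zeta>"
      using bounded_linear.continuous_on[OF bl(1) continuous_on_Pair[OF cG continuous_on_Pair[OF cHs[of E1] cHs[of E2]]]]
      by (simp add: \<zeta>_def[abs_def])
    have cT: "continuous_on UNIV \<tau>"
      using continuous_on_minus[OF bounded_linear.continuous_on[OF bl(3) continuous_on_fst[OF cHs[of E3]]]] by (simp add: \<tau>_def[abs_def])
    have p: "pert (cball z0 r) V B \<tau> \<zeta>"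
    proof (rule pertI[OF _ cB cT cZ])
      fix z
      have "(V has_derivative (\<lambda>y. - (D *v fst (Hs z y)))) (at z)"
        unfolding V_def by (rule has_derivative_minus, rule bounded_linear.has_derivative[OF bl(3)], rule has_derivative_fst[OF dG])
      then show "(V has_derivative (\<lambda>y. B z *v fst y + snd y *\<^sub>R \<tau> z)) (at z)"
      proof (rule has_derivative_eq_rhs, intro ext)
        fix y
        show "- (D *v fst (Hs z y)) = B z *v fst y + snd y *\<^sub>R \<tau> z"
          unfolding linH[of z y] B_def \<tau>_def LB_def
          by (simp add: vec_eq_iff forall_2 matrix_vector_mult_def sum_2 algebra_simps)
      qed
    next
      fix z assume z: "z \<notin> cball z0 r"
      have "LB D 0 0 = 0" "LZ D v 0 0 0 = 0" using linear_0[OF linear_LB[of D]] linear_0[OF linear_LZ[of D v]] by simp_all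
      then show "V z = 0 \<and> B z = 0 \<and> \<tau> z = 0 \<and> \<zeta> z = 0"
        using sup[OF z] supH[OF z] by (simp add: V_def B_def \<tau>_def \<zeta>_def)
    next
      fix \<psi> :: "pt \<Rightarrow> real^2" assume "C1_fun \<psi>"
      then obtain \<psi>' where ps: "\<And>z. (\<psi> has_derivative \<psi>' z) (at z)" "\<And>y. continuous_on UNIV (\<lambda>z. \<psi>' z y)"
        by (rule C1_fun_obtain) (rule that, assumption+)
      have dpi: "((\<lambda>z. \<psi> z $ i) has_derivative (\<lambda>y. \<psi>' z y $ i)) (at z)" for z i
        by (rule bounded_linear.has_derivative[OF bounded_linear_vec_nth ps(1)])
      have cpi: "continuous_on UNIV (\<lambda>z. \<psi>' z y $ i)" for y i by (rule continuous_on_component[OF ps(2)])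
      have cGy: "continuous_on UNIV (\<lambda>z. G z \<bullet> y)" for y by (intro continuous_on_inner cG continuous_on_const)
      have dq: "((\<lambda>z. a \<bullet> G z) has_derivative (\<lambda>y. a \<bullet> Hs z y)) (at z)" for z
        by (rule has_derivative_inner_right[OF dG])
      have cq: "continuous_on UNIV (\<lambda>z. a \<bullet> Hs z y)" for y by (intro continuous_on_inner cHs continuous_on_const)
      \<comment> \<open>\<open>T0\<close> exchanges a space derivative of \<open>g\<close> with its
        time derivative and yields the part with \<open>g_t\<close>; \<open>T1\<close> exchanges the
        two space derivatives of \<open>a \<bullet> G\<close>, which is only known to be
        continuously differentiable once, and yields the rotated gradient.\<close>
      have T0: "has_bochner_integral lborel (\<lambda>z. (G z \<bullet> e) * (\<psi>' z E3 $ i) - (G z \<bullet> E3) * (\<psi>' z e $ i)) 0" for e i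
        by (rule curl_bochner[OF dg cGy dpi cpi compact_cball[of z0 r]]) (drule sup, simp)
      have T1: "has_bochner_integral lborel (\<lambda>z. (a \<bullet> Hs z E1) * (\<psi>' z E2 $ i) - (a \<bullet> Hs z E2) * (\<psi>' z E1 $ i)) 0" for i
        by (rule curl_bochner[OF dq cq dpi cpi compact_cball[of z0 r]]) (drule sup, simp)
      define w where "w = D *v perp v"
      have "has_bochner_integral lborel (\<lambda>z. - (
          D$1$1 * ((G z \<bullet> E1) * (\<psi>' z E3 $ 1) - (G z \<bullet> E3) * (\<psi>' z E1 $ 1)) +
          D$1$2 * ((G z \<bullet> E2) * (\<psi>' z E3 $ 1) - (G z \<bullet> E3) * (\<psi>' z E2 $ 1)) +
          D$2$1 * ((G z \<bullet> E1) * (\<psi>' z E3 $ 2) - (G z \<bullet> E3) * (\<psi>' z E1 $ 2)) +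
          D$2$2 * ((G z \<bullet> E2) * (\<psi>' z E3 $ 2) - (G z \<bullet> E3) * (\<psi>' z E2 $ 2)) +
          w$1 * ((a \<bullet> Hs z E1) * (\<psi>' z E2 $ 1) - (a \<bullet> Hs z E2) * (\<psi>' z E1 $ 1)) +
          w$2 * ((a \<bullet> Hs z E1) * (\<psi>' z E2 $ 2) - (a \<bullet> Hs z E2) * (\<psi>' z E1 $ 2))))
          (- (D$1$1 * 0 + D$1$2 * 0 + D$2$1 * 0 + D$2$2 * 0 + w$1 * 0 + w$2 * 0))"
        by (intro has_bochner_integral_minus has_bochner_integral_add has_bochner_integral_mult_right T0 T1)
      moreover have "- (
          D$1$1 * ((G z \<bullet> E1) * (\<psi>' z E3 $ 1) - (G z \<bullet> E3) * (\<psi>' z E1 $ 1)) +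
          D$1$2 * ((G z \<bullet> E2) * (\<psi>' z E3 $ 1) - (G z \<bullet> E3) * (\<psi>' z E2 $ 1)) +
          D$2$1 * ((G z \<bullet> E1) * (\<psi>' z E3 $ 2) - (G z \<bullet> E3) * (\<psi>' z E1 $ 2)) +
          D$2$2 * ((G z \<bullet> E2) * (\<psi>' z E3 $ 2) - (G z \<bullet> E3) * (\<psi>' z E2 $ 2)) +
          w$1 * ((a \<bullet> Hs z E1) * (\<psi>' z E2 $ 1) - (a \<bullet> Hs z E2) * (\<psi>' z E1 $ 1)) +
          w$2 * ((a \<bullet> Hs z E1) * (\<psi>' z E2 $ 2) - (a \<bullet> Hs z E2) * (\<psi>' z E1 $ 2)))
          = V z \<bullet> Dt \<psi> z - (B z + \<zeta> z) \<bullet> Dx \<psi> z" for z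
      proof -
        have dt: "Dt \<psi> z $ i = \<psi>' z E3 $ i" for i using Dt_eq[OF ps(1)] by (simp add: E3_def)
        have dx: "Dx \<psi> z $ i $ 1 = \<psi>' z E1 $ i" "Dx \<psi> z $ i $ 2 = \<psi>' z E2 $ i" for i
          using Dx_eq[OF ps(1)] by (simp_all add: E1_def E2_def)
        have bz: "B z + \<zeta> z = - (snd (G z)) *\<^sub>R D + outer w (vector [- (a \<bullet> Hs z E2), a \<bullet> Hs z E1])"
          unfolding B_def \<zeta>_def LZ_def w_def av by simp
        have vz: "V z \<bullet> Dt \<psi> z = - ((D$1$1 * (G z \<bullet> E1) + D$1$2 * (G z \<bullet> E2)) * (\<psi>' z E3 $ 1) + (D$2$1 * (G z \<bullet> E1) + D$2$2 * (G z \<bullet> E2)) * (\<psi>' z E3 $ 2))"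
          unfolding V_def inner_E by (simp add: inner_vec_def[of _ "Dt \<psi> z"] sum_2 dt matrix_vector_mult_def algebra_simps)
        show ?thesis
          unfolding vz bz mat2_inner dx inner_E outer_def
          by (simp add: algebra_simps)
      qed
      ultimately show "(\<integral>z. V z \<bullet> Dt \<psi> z - (B z + \<zeta> z) \<bullet> Dx \<psi> z \<partial>lborel) = 0"
        by (simp only: has_bochner_integral_integral_eq mult_zero_right add_0_right minus_zero)
    qed
    have Vb: "norm (V z) \<le> \<epsilon>" for z
    proof -
      have "norm (V z) \<le> KD * norm (fst (G z))" using KD(2)[of "fst (G z)"] by (simp add: V_def)
      also have "\<dots> \<le> KD * d" using KD(1) norm_fst_le[of "fst (G z)" "snd (G z)"] Gb[of z] by (intro mult_left_mono) auto
      also have "\<dots> \<le> \<epsilon>" by (rule small[OF K(2)])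
      finally show ?thesis .
    qed
    have Tb: "norm (\<tau> z) \<le> \<epsilon>" for z
    proof -
      have "a \<bullet> E3 = 0" by (simp add: a_def E3_def inner_prod_def)
      then have "norm (Hs z E3) \<le> d" using Hb[of z E3] by (simp add: norm_E)
      then have "norm (fst (Hs z E3)) \<le> d" using norm_fst_le[of "fst (Hs z E3)" "snd (Hs z E3)"] by simp
      then have "KD * norm (fst (Hs z E3)) \<le> KD * d" using KD(1) by (intro mult_left_mono) auto
      then show ?thesis using KD(2)[of "fst (Hs z E3)"] small[OF K(2)] by (simp add: \<tau>_def)
    qed
    have Sb: "\<exists>s. \<bar>s\<bar> \<le> 1 \<and> norm (B z + s *\<^sub>R outer (D *v v) v) \<le> \<epsilon> \<and> norm (\<zeta> z - s *\<^sub>R D) \<le> \<epsilon> \<and>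
      (dist z0 z \<le> \<rho> \<longrightarrow> s = h (k * (v \<bullet> fst z) + \<theta>))" for z
    proof -
      define s where "s = cf z * h (k * (a \<bullet> z) + \<theta>)"
      have s1: "\<bar>s\<bar> \<le> 1" unfolding s_def abs_mult using C(2,3)[of z] h1 by (intro mult_le_one) auto
      have aE: "a \<bullet> E1 = v $ 1" "a \<bullet> E2 = v $ 2" by (simp_all add: inner_E a_def)
      define P where "P = Hs z E1 - (s * v$1) *\<^sub>R a"
      define Q where "Q = Hs z E2 - (s * v$2) *\<^sub>R a"
      have PQ: "norm P \<le> d" "norm Q \<le> d"
        using Hb[of z E1] Hb[of z E2] by (simp_all add: P_def Q_def s_def norm_E aE)
      have "B z + s *\<^sub>R outer (D *v v) v = LB D P Q"
        using linear_diff[OF linear_LB[of D], of "(Hs z E1, Hs z E2)" "((s * v$1) *\<^sub>R a, (s * v$2) *\<^sub>R a)"] LB_wave[of D s v]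
        by (simp add: B_def P_def Q_def a_def)
      also have "norm \<dots> \<le> KB * norm (P, Q)" using KB(2)[of "(P, Q)"] by simp
      also have "\<dots> \<le> KB * (d + d)" using KB(1) PQ norm_Pair_le[of P Q] by (intro mult_left_mono) auto
      also have "\<dots> = (2 * KB) * d" by simp
      also have "\<dots> \<le> \<epsilon>" by (rule small[OF K(3)])
      finally have 1: "norm (B z + s *\<^sub>R outer (D *v v) v) \<le> \<epsilon>" .
      have "\<zeta> z - s *\<^sub>R D = LZ D v (G z) P Q"
        using linear_diff[OF linear_LZ[of D v], of "(G z, Hs z E1, Hs z E2)" "(0, (s * v$1) *\<^sub>R a, (s * v$2) *\<^sub>R a)"] LZ_wave[OF v, of D s]
        by (simp add: \<zeta>_def P_def Q_def a_def)
      also have "norm \<dots> \<le> KZ * norm (G z, P, Q)" using KZ(2)[of "(G z, P, Q)"] by simp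
      also have "\<dots> \<le> KZ * (d + (d + d))"
        using KZ(1) PQ Gb[of z] norm_Pair_le[of P Q] norm_Pair_le[of "G z" "(P, Q)"] by (intro mult_left_mono) auto
      also have "\<dots> = (3 * KZ) * d" by simp
      also have "\<dots> \<le> \<epsilon>" by (rule small[OF K(4)])
      finally have 2: "norm (\<zeta> z - s *\<^sub>R D) \<le> \<epsilon>" .
      have "s = h (k * (v \<bullet> fst z) + \<theta>)" if "dist z0 z \<le> \<rho>" using C(4)[of z] that by (simp add: s_def av)
      then show ?thesis using s1 1 2 by blast
    qed
    have Pb: "norm (\<integral>z. \<phi> j z *\<^sub>R \<zeta> z \<partial>lborel) \<le> \<epsilon>" if j: "j < n" for j
    proof -
      have cmp: "continuous_on UNIV (\<lambda>z. \<phi> j z *\<^sub>R f z)" if "continuous_on UNIV f" for f :: "pt \<Rightarrow> pt"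
        by (intro continuous_on_scaleR cphi that)
      have iG: "norm (\<integral>z. \<phi> j z *\<^sub>R G z \<partial>lborel) \<le> (Cp * d) * vol"
        unfolding vol_def
      proof (rule integral_bound_support[OF cmp[OF cG]])
        show "norm (\<phi> j z *\<^sub>R G z) \<le> Cp * d" if "z \<in> cball z0 r" for z
          unfolding norm_scaleR using Cp(1)[OF j that] Gb[of z] Cp0 by (intro mult_mono) auto
      qed (drule sup, simp)
      \<comment> \<open>One derivative is moved from the rapidly oscillating \<open>G\<close> to
        \<open>\<phi> j\<close>. What remains is of the size of \<open>G\<close>, that is of order
        \<open>1 / k\<close>: the flux perturbation is weakly small without being small.\<close>
      have iH: "norm (\<integral>z. \<phi> j z *\<^sub>R Hs z e \<partial>lborel) \<le> (Cp * d) * vol" if e: "norm e = 1" for e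
      proof -
        have i1: "integrable lborel (\<lambda>z. \<phi> j z *\<^sub>R Hs z e)"
          by (rule integrable_continuous_compact_support[OF cmp[OF cHs] compact_cball[of z0 r]]) (drule supH[of _ e], simp)
        have cf1: "continuous_on UNIV (\<lambda>z. (\<phi>' j z \<bullet> e) *\<^sub>R G z)"
          by (intro continuous_on_scaleR continuous_on_inner phi(2) cG continuous_on_const)
        have i2: "integrable lborel (\<lambda>z. (\<phi>' j z \<bullet> e) *\<^sub>R G z)"
          by (rule integrable_continuous_compact_support[OF cf1 compact_cball[of z0 r]]) (drule sup, simp)
        have "(\<integral>z. \<phi> j z *\<^sub>R Hs z e + (\<phi>' j z \<bullet> e) *\<^sub>R G z \<partial>lborel) = 0"
        proof (rule integral_derivative_zero[where F = "\<lambda>z. \<phi> j z *\<^sub>R G z" and F' = "\<lambda>z y. \<phi> j z *\<^sub>R Hs z y + (\<phi>' j z \<bullet> y) *\<^sub>R G z"])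
          show "((\<lambda>z. \<phi> j z *\<^sub>R G z) has_derivative (\<lambda>y. \<phi> j z *\<^sub>R Hs z y + (\<phi>' j z \<bullet> y) *\<^sub>R G z)) (at z)" for z
            by (rule has_derivative_scaleR[OF phi(1) dG])
          show "continuous_on UNIV (\<lambda>z. \<phi> j z *\<^sub>R Hs z e + (\<phi>' j z \<bullet> e) *\<^sub>R G z)"
            by (rule continuous_on_add[OF cmp[OF cHs] cf1])
          show "compact (cball z0 r)" by (rule compact_cball)
        qed (drule sup, simp)
        then have "(\<integral>z. \<phi> j z *\<^sub>R Hs z e \<partial>lborel) = - (\<integral>z. (\<phi>' j z \<bullet> e) *\<^sub>R G z \<partial>lborel)"
          using i1 i2 by (simp add: eq_neg_iff_add_eq_0)
        then have "norm (\<integral>z. \<phi> j z *\<^sub>R Hs z e \<partial>lborel) = norm (\<integral>z. (\<phi>' j z \<bullet> e) *\<^sub>R G z \<partial>lborel)" by simp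
        also have "\<dots> \<le> (Cp * d) * vol"
          unfolding vol_def
        proof (rule integral_bound_support[OF cf1])
          show "norm ((\<phi>' j z \<bullet> e) *\<^sub>R G z) \<le> Cp * d" if "z \<in> cball z0 r" for z
          proof -
            have "\<bar>\<phi>' j z \<bullet> e\<bar> \<le> Cp" using Cauchy_Schwarz_ineq2[of "\<phi>' j z" e] Cp(2)[OF j that] e by simp
            then show ?thesis unfolding norm_scaleR using Gb[of z] Cp0 by (intro mult_mono) auto
          qed
        qed (drule sup, simp)
        finally show ?thesis .
      qed
      define f where "f z = \<phi> j z *\<^sub>R (G z, Hs z E1, Hs z E2)" for z
      have fi: "integrable lborel f"
      proof (rule integrable_continuous_compact_support[OF _ compact_cball[of z0 r]])
        show "continuous_on UNIV f" unfolding f_def by (intro continuous_on_scaleR cphi continuous_on_Pair cG cHs)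
        show "f z = 0" if "z \<notin> cball z0 r" for z using sup[OF that] supH[OF that] by (simp add: f_def zero_prod_def)
      qed
      have "(\<integral>z. \<phi> j z *\<^sub>R \<zeta> z \<partial>lborel) = (\<integral>z. LZ D v (fst (f z)) (fst (snd (f z))) (snd (snd (f z))) \<partial>lborel)"
      proof -
        have "\<phi> j z *\<^sub>R \<zeta> z = LZ D v (fst (f z)) (fst (snd (f z))) (snd (snd (f z)))" for z
          using linear_scale[OF linear_LZ[of D v], of "\<phi> j z" "(G z, Hs z E1, Hs z E2)"] by (simp add: \<zeta>_def f_def)
        then show ?thesis by simp
      qed
      also have "\<dots> = LZ D v (fst (integral\<^sup>L lborel f)) (fst (snd (integral\<^sup>L lborel f))) (snd (snd (integral\<^sup>L lborel f)))"
        using integral_bounded_linear[OF bl(1) fi] by simp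
      also have "norm \<dots> \<le> KZ * norm (integral\<^sup>L lborel f)" by (rule KZ(2))
      finally have n1: "norm (\<integral>z. \<phi> j z *\<^sub>R \<zeta> z \<partial>lborel) \<le> KZ * norm (integral\<^sup>L lborel f)" .
      have sf: "integrable lborel (\<lambda>z. snd (f z))" using integrable_bounded_linear[OF bounded_linear_snd fi] by simp
      have comps: "fst (integral\<^sup>L lborel f) = (\<integral>z. \<phi> j z *\<^sub>R G z \<partial>lborel)"
        "fst (snd (integral\<^sup>L lborel f)) = (\<integral>z. \<phi> j z *\<^sub>R Hs z E1 \<partial>lborel)"
        "snd (snd (integral\<^sup>L lborel f)) = (\<integral>z. \<phi> j z *\<^sub>R Hs z E2 \<partial>lborel)"
        using integral_bounded_linear[OF bounded_linear_fst fi] integral_bounded_linear[OF bounded_linear_snd fi]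
          integral_bounded_linear[OF bounded_linear_fst sf] integral_bounded_linear[OF bounded_linear_snd sf]
        by (simp_all add: f_def)
      have "norm (integral\<^sup>L lborel f) \<le> norm (fst (integral\<^sup>L lborel f)) + norm (snd (integral\<^sup>L lborel f))"
        using norm_Pair_le[of "fst (integral\<^sup>L lborel f)" "snd (integral\<^sup>L lborel f)"] by simp
      moreover have "norm (snd (integral\<^sup>L lborel f)) \<le> norm (fst (snd (integral\<^sup>L lborel f))) + norm (snd (snd (integral\<^sup>L lborel f)))"
        using norm_Pair_le[of "fst (snd (integral\<^sup>L lborel f))" "snd (snd (integral\<^sup>L lborel f))"] by simp
      ultimately have "norm (integral\<^sup>L lborel f) \<le> 3 * ((Cp * d) * vol)"
        using iG iH[OF norm_E(1)] iH[OF norm_E(2)] unfolding comps by linarith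
      then have "KZ * norm (integral\<^sup>L lborel f) \<le> KZ * (3 * ((Cp * d) * vol))" using KZ(1) by (intro mult_left_mono) auto
      also have "\<dots> = (3 * KZ * (Cp * vol)) * d" by (simp add: mult_ac)
      also have "\<dots> \<le> \<epsilon>" by (rule small[OF K(5)])
      finally show ?thesis using n1 by linarith
    qed
    show "\<exists>V B \<tau> \<zeta>. pert (cball z0 r) V B \<tau> \<zeta> \<and> (\<forall>z. norm (V z) \<le> \<epsilon> \<and> norm (\<tau> z) \<le> \<epsilon>) \<and>
      (\<forall>z. \<exists>s. \<bar>s\<bar> \<le> 1 \<and> norm (B z + s *\<^sub>R outer (D *v v) v) \<le> \<epsilon> \<and> norm (\<zeta> z - s *\<^sub>R D) \<le> \<epsilon> \<and>
        (dist z0 z \<le> \<rho> \<longrightarrow> s = h (k * (v \<bullet> fst z) + \<theta>))) \<and>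
      (\<forall>j<n. norm (\<integral>z. \<phi> j z *\<^sub>R \<zeta> z \<partial>lborel) \<le> \<epsilon>)"
      using p Vb Tb Sb Pb by blast
  qed simp
qed

section \<open>Choosing the phase of a wave\<close>

text \<open>By Fubini the mean over \<open>\<theta>\<close> in \<open>[0, pi]\<close> of the measure
  of the transition set is at most \<open>4 * e / pi\<close> times the measure of \<open>S\<close>,
  which is less than \<open>2 * e\<close> times it; so some phase is good. The bound holds at every
  frequency and avoids an equidistribution argument.\<close>

lemma phase_choice:
  fixes a :: "'a::euclidean_space"
  assumes S: "S \<in> sets borel" "emeasure lborel S < \<infinity>" and e: "0 < e" "e < pi / 2"
  shows "\<exists>\<theta>. measure lborel {z \<in> S. \<bar>cos (k * (a \<bullet> z) + \<theta>)\<bar> < sin e} \<le> 2 * e * measure lborel S"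
proof (rule ccontr)
  assume n: "\<not> ?thesis"
  define W where "W = {p. snd p \<in> S \<and> \<bar>cos (k * (a \<bullet> snd p) + fst p)\<bar> < sin e}"
  have W[measurable]: "W \<in> sets (lborel \<Otimes>\<^sub>M lborel)"
  proof -
    have [measurable]: "S \<in> sets lborel" using S by simp
    have "W = {p \<in> space (lborel \<Otimes>\<^sub>M lborel). snd p \<in> S \<and> \<bar>cos (k * (a \<bullet> snd p) + fst p)\<bar> < sin e}"
      by (simp add: W_def space_pair_measure)
    also have "\<dots> \<in> sets (lborel \<Otimes>\<^sub>M lborel)" by measurable
    finally show ?thesis .
  qed
  define m where "m = measure lborel S"
  have m: "emeasure lborel S = ennreal m" using S(2) by (simp add: m_def emeasure_eq_ennreal_measure)
  have Sm: "{z \<in> S. \<bar>cos (k * (a \<bullet> z) + \<theta>)\<bar> < sin e} \<in> sets lborel" for \<theta>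
  proof -
    have [measurable]: "S \<in> sets borel" using S by simp
    have "{z \<in> space borel. z \<in> S \<and> \<bar>cos (k * (a \<bullet> z) + \<theta>)\<bar> < sin e} \<in> sets borel" by measurable
    then show ?thesis by simp
  qed
  have fin: "emeasure lborel {z \<in> S. \<bar>cos (k * (a \<bullet> z) + \<theta>)\<bar> < sin e} \<le> emeasure lborel S" for \<theta>
    by (rule emeasure_mono) (use S in auto)
  have big: "ennreal (2 * e * m) < emeasure lborel {z \<in> S. \<bar>cos (k * (a \<bullet> z) + \<theta>)\<bar> < sin e}" for \<theta>
  proof -
    have "2 * e * m < measure lborel {z \<in> S. \<bar>cos (k * (a \<bullet> z) + \<theta>)\<bar> < sin e}" using n by (auto simp: m_def not_le)
    moreover have "emeasure lborel {z \<in> S. \<bar>cos (k * (a \<bullet> z) + \<theta>)\<bar> < sin e} < \<infinity>" using fin[of \<theta>] S(2) by (rule order_le_less_trans)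
    ultimately show ?thesis using e by (simp add: emeasure_eq_ennreal_measure ennreal_less_iff m_def)
  qed
  have m0: "m > 0"
  proof (rule ccontr)
    assume "\<not> m > 0"
    then have "emeasure lborel S = 0" unfolding m by (simp add: ennreal_eq_0_iff not_less)
    then show False using big[of 0] fin[of 0] by (simp add: not_less)
  qed
  have "ennreal (2 * e * m * pi) = (\<integral>\<^sup>+\<theta>. ennreal (2 * e * m) * indicator {0..pi} \<theta> \<partial>lborel)"
    using e m0 by (simp add: nn_integral_cmult_indicator ennreal_mult'')
  also have "\<dots> \<le> (\<integral>\<^sup>+\<theta>. (\<integral>\<^sup>+z. indicator W (\<theta>, z) * indicator {0..pi} \<theta> \<partial>lborel) \<partial>lborel)"
  proof (rule nn_integral_mono)
    fix \<theta>
    have "(\<integral>\<^sup>+z. indicator W (\<theta>, z) * indicator {0..pi} \<theta> \<partial>lborel) = (\<integral>\<^sup>+z. indicator {z \<in> S. \<bar>cos (k * (a \<bullet> z) + \<theta>)\<bar> < sin e} z \<partial>lborel) * indicator {0..pi} \<theta>"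
      by (subst nn_integral_multc[symmetric]) (use Sm in \<open>auto simp: W_def indicator_def intro!: nn_integral_cong\<close>)
    also have "(\<integral>\<^sup>+z. indicator {z \<in> S. \<bar>cos (k * (a \<bullet> z) + \<theta>)\<bar> < sin e} z \<partial>lborel) = emeasure lborel {z \<in> S. \<bar>cos (k * (a \<bullet> z) + \<theta>)\<bar> < sin e}"
      using Sm by simp
    finally show "ennreal (2 * e * m) * indicator {0..pi} \<theta> \<le> (\<integral>\<^sup>+z. indicator W (\<theta>, z) * indicator {0..pi} \<theta> \<partial>lborel)"
      using big[of \<theta>] by (auto intro!: mult_right_mono)
  qed
  also have "\<dots> = (\<integral>\<^sup>+z. (\<integral>\<^sup>+\<theta>. indicator W (\<theta>, z) * indicator {0..pi} \<theta> \<partial>lborel) \<partial>lborel)"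
    by (rule lborel_pair.Fubini'[symmetric]) measurable
  also have "\<dots> \<le> (\<integral>\<^sup>+z. ennreal (4 * e) * indicator S z \<partial>lborel)"
  proof (rule nn_integral_mono)
    fix z
    have "(\<integral>\<^sup>+\<theta>. indicator W (\<theta>, z) * indicator {0..pi} \<theta> \<partial>lborel) = (\<integral>\<^sup>+\<theta>. indicator S z * indicator {t \<in> {0..pi}. \<bar>cos (k * (a \<bullet> z) + t)\<bar> < sin e} \<theta> \<partial>lborel)"
      by (auto simp: W_def indicator_def intro!: nn_integral_cong)
    also have "\<dots> = indicator S z * emeasure lborel {t \<in> {0..pi}. \<bar>cos (k * (a \<bullet> z) + t)\<bar> < sin e}"
    proof -
      have "{t \<in> space borel. t \<in> {0..pi} \<and> \<bar>cos (k * (a \<bullet> z) + t)\<bar> < sin e} \<in> sets borel" by measurable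
      then show ?thesis by (subst nn_integral_cmult) auto
    qed
    also have "\<dots> \<le> indicator S z * ennreal (4 * e)" by (intro mult_left_mono cos_small_measure e) auto
    finally show "(\<integral>\<^sup>+\<theta>. indicator W (\<theta>, z) * indicator {0..pi} \<theta> \<partial>lborel) \<le> ennreal (4 * e) * indicator S z"
      by (simp add: mult.commute)
  qed
  also have "\<dots> = ennreal (4 * e) * emeasure lborel S" using S(1) by (simp add: nn_integral_cmult_indicator)
  also have "\<dots> = ennreal (4 * e * m)" unfolding m using e m0 by (simp add: ennreal_mult'')
  finally have "2 * e * m * pi \<le> 4 * e * m" using e m0 by (subst (asm) ennreal_le_iff) auto
  moreover have "2 * e * m * 2 < 2 * e * m * pi" using e m0 pi_gt3 by (intro mult_strict_left_mono) auto
  ultimately show False by simp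
qed

text \<open>Shifting the phase by \<open>pi\<close> exchanges the sets where \<open>h\<close> is 1
  and -1. The sum of the two left-hand sides depends only on the total measure of these sets, which
  \<open>phase_choice\<close> controls, so one of the two phases does at least as well as the mean.
  This replaces a proof that each state occupies half of \<open>S\<close>.\<close>

lemma phase_sign_choice:
  fixes a :: "'a::euclidean_space" and h :: "real \<Rightarrow> real"
  assumes S: "S \<in> sets borel" "emeasure lborel S < \<infinity>" and e: "0 < e" "e < pi / 2"
    and h: "continuous_on UNIV h" "\<And>s. h (s + pi) = - h s" "\<And>s. \<bar>h s\<bar> \<noteq> 1 \<Longrightarrow> \<bar>cos s\<bar> < sin e"
    and e12: "0 \<le> e1" "e1 \<le> 1" "0 \<le> e2" "e2 \<le> (1::real)"
  shows "\<exists>\<theta>. measure lborel S - (1 - e1) * measure lborel {z \<in> S. h (k * (a \<bullet> z) + \<theta>) = 1}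
    - (1 - e2) * measure lborel {z \<in> S. h (k * (a \<bullet> z) + \<theta>) = -1} \<le> ((e1 + e2) / 2 + 2 * e) * measure lborel S"
proof -
  obtain \<theta> where th: "measure lborel {z \<in> S. \<bar>cos (k * (a \<bullet> z) + \<theta>)\<bar> < sin e} \<le> 2 * e * measure lborel S"
    using phase_choice[OF S e] by blast
  define P where "P \<theta> c = {z \<in> S. h (k * (a \<bullet> z) + \<theta>) = c}" for \<theta> c
  have PM: "P \<theta> c \<in> sets lborel" for \<theta> c
  proof -
    have c0: "continuous_on UNIV (\<lambda>z. h (k * (a \<bullet> z) + \<theta>))"
      by (rule continuous_on_compose2[OF h(1)]) (auto intro!: continuous_intros)
    have "closed {z. h (k * (a \<bullet> z) + \<theta>) = c}" by (rule closed_Collect_eq[OF c0 continuous_on_const])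
    then have "S \<inter> {z. h (k * (a \<bullet> z) + \<theta>) = c} \<in> sets borel" using S(1) by auto
    then show ?thesis by (simp add: P_def Int_def)
  qed
  define Bd where "Bd = {z \<in> S. \<bar>cos (k * (a \<bullet> z) + \<theta>)\<bar> < sin e}"
  have BM: "Bd \<in> sets lborel"
  proof -
    have [measurable]: "S \<in> sets borel" using S by simp
    have "{z \<in> space borel. z \<in> S \<and> \<bar>cos (k * (a \<bullet> z) + \<theta>)\<bar> < sin e} \<in> sets borel" by measurable
    then show ?thesis by (simp add: Bd_def)
  qed
  have fm: "X \<in> fmeasurable lborel" if "X \<in> sets lborel" "X \<subseteq> S" for X
    by (rule fmeasurableI[OF that(1)]) (use emeasure_mono[OF that(2), of lborel] S in \<open>auto intro: order_le_less_trans\<close>)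
  have pi_swap: "P (\<theta> + pi) c = P \<theta> (- c)" for c
    unfolding P_def using h(2) by (auto simp: add.assoc[symmetric])
  have "S \<subseteq> P \<theta> 1 \<union> P \<theta> (-1) \<union> Bd"
  proof
    fix z assume z: "z \<in> S"
    show "z \<in> P \<theta> 1 \<union> P \<theta> (-1) \<union> Bd"
    proof (cases "\<bar>h (k * (a \<bullet> z) + \<theta>)\<bar> = 1")
      case True
      then have "h (k * (a \<bullet> z) + \<theta>) = 1 \<or> h (k * (a \<bullet> z) + \<theta>) = -1" by linarith
      then show ?thesis using z by (auto simp: P_def)
    next
      case False
      then show ?thesis using z h(3) by (simp add: Bd_def)
    qed
  qed
  then have "measure lborel S \<le> measure lborel (P \<theta> 1 \<union> P \<theta> (-1) \<union> Bd)"
    by (rule measure_mono_fmeasurable) (use S PM BM in \<open>auto intro!: fm simp: P_def Bd_def\<close>)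
  also have "\<dots> \<le> measure lborel (P \<theta> 1 \<union> P \<theta> (-1)) + measure lborel Bd"
    by (rule measure_Un_le) (use PM BM in auto)
  also have "measure lborel (P \<theta> 1 \<union> P \<theta> (-1)) \<le> measure lborel (P \<theta> 1) + measure lborel (P \<theta> (-1))"
    by (rule measure_Un_le) (use PM in auto)
  finally have tot: "measure lborel S \<le> measure lborel (P \<theta> 1) + measure lborel (P \<theta> (-1)) + 2 * e * measure lborel S"
    using th by (simp add: Bd_def)
  define s p q where "s = measure lborel S" and "p = measure lborel (P \<theta> 1)" and "q = measure lborel (P \<theta> (-1))"
  have "(s - (1 - e1) * p - (1 - e2) * q) + (s - (1 - e1) * q - (1 - e2) * p) = 2 * s - (2 - e1 - e2) * (p + q)" by (simp add: algebra_simps)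
  also have "\<dots> \<le> 2 * s - (2 - e1 - e2) * (s - 2 * e * s)"
    using tot e12 by (intro diff_left_mono mult_left_mono) (auto simp: s_def p_def q_def)
  also have "\<dots> = (e1 + e2) * s + (2 - e1 - e2) * (2 * e * s)" by (simp add: algebra_simps)
  also have "\<dots> \<le> (e1 + e2) * s + 2 * (2 * e * s)"
    using e12 e by (intro add_left_mono mult_right_mono) (auto simp: s_def)
  finally have "s - (1 - e1) * p - (1 - e2) * q \<le> ((e1 + e2) / 2 + 2 * e) * s \<or> s - (1 - e1) * q - (1 - e2) * p \<le> ((e1 + e2) / 2 + 2 * e) * s"
    by (auto simp: field_simps)
  then show ?thesis
  proof
    assume "s - (1 - e1) * p - (1 - e2) * q \<le> ((e1 + e2) / 2 + 2 * e) * s"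
    then show ?thesis by (intro exI[of _ \<theta>]) (simp add: s_def p_def q_def P_def)
  next
    assume "s - (1 - e1) * q - (1 - e2) * p \<le> ((e1 + e2) / 2 + 2 * e) * s"
    then show ?thesis using pi_swap[of 1] pi_swap[of "-1"]
      by (intro exI[of _ "\<theta> + pi"]) (simp add: s_def p_def q_def P_def)
  qed
qed

section \<open>Finite disjoint ball packings, and blocks with their resolved sets\<close>

text \<open>Vitali's theorem gives countably many disjoint balls that fill \<open>Q\<close> up to a
  null set; finitely many of them already fill it up to \<open>\<eta>\<close>. A finite family keeps
  the union of the supports compact inside \<open>Q\<close>.\<close>

lemma finite_ball_cover:
  fixes Q :: "'a::euclidean_space set"
  assumes Q: "open Q" "bounded Q" and R: "\<And>z. z \<in> Q \<Longrightarrow> R z > 0 \<and> cball z (R z) \<subseteq> Q" and eta: "\<eta> > 0"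
  obtains F r where "finite F" "F \<subseteq> Q" "\<And>z. z \<in> F \<Longrightarrow> 0 < r z \<and> r z < R z"
    "\<And>z z'. z \<in> F \<Longrightarrow> z' \<in> F \<Longrightarrow> z \<noteq> z' \<Longrightarrow> disjnt (cball z (r z)) (cball z' (r z'))"
    "measure lborel (Q - (\<Union>z\<in>F. cball z (r z))) \<le> \<eta>"
proof -
  define K where "K = {p. fst p \<in> Q \<and> 0 < snd p \<and> snd p < R (fst p)}"
  obtain C where C: "countable C" "C \<subseteq> K" "pairwise (\<lambda>i j. disjnt (cball (fst i) (snd i)) (cball (fst j) (snd j))) C"
    "negligible (Q - (\<Union>i\<in>C. cball (fst i) (snd i)))"
  proof (rule Vitali_covering_theorem_cballs[of K snd Q fst])
    show "0 < snd i" if "i \<in> K" for i using that by (simp add: K_def)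
    show "\<exists>i. i \<in> K \<and> x \<in> cball (fst i) (snd i) \<and> snd i < d" if "x \<in> Q" "0 < d" for x d
      by (rule exI[of _ "(x, min (d/2) (R x / 2))"]) (use that R[of x] in \<open>auto simp: K_def\<close>)
  qed
  let ?D = "(\<lambda>i. cball (fst i) (snd i)) ` C"
  have sub: "cball (fst i) (snd i) \<subseteq> Q" if "i \<in> C" for i
    using C(2) that R[of "fst i"] by (force simp: K_def)
  have Ql: "Q \<in> lmeasurable" by (rule lmeasurable_open[OF Q(2,1)])
  have UQ: "\<Union>?D \<subseteq> Q" using sub by auto
  have Dl: "\<Union>D' \<in> lmeasurable" if "D' \<subseteq> ?D" "finite D'" for D'
    using that by (intro fmeasurable.finite_Union) auto
  obtain D' where D': "D' \<subseteq> ?D" "finite D'" "measure lebesgue (\<Union>?D) - \<eta> < measure lebesgue (\<Union>D')"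
  proof (rule measure_countable_Union_approachable[of ?D \<eta> "measure lebesgue Q"])
    show "countable ?D" using C(1) by simp
    show "measure lebesgue (\<Union>D') \<le> measure lebesgue Q" if "D' \<subseteq> ?D" "finite D'" for D'
      using that UQ Dl[OF that] Ql by (intro measure_mono_fmeasurable) auto
  qed (use eta in auto)
  obtain F0 where F0: "F0 \<subseteq> C" "finite F0" "D' = (\<lambda>i. cball (fst i) (snd i)) ` F0"
    using finite_subset_image[OF D'(2,1)] by blast
  \<comment> \<open>Two balls with the same centre would intersect, so the balls can be indexed by
    their centres.\<close>
  have inj: "inj_on fst F0"
  proof (rule inj_onI)
    fix i j assume ij: "i \<in> F0" "j \<in> F0" "fst i = fst j"
    show "i = j"
    proof (rule ccontr)
      assume "i \<noteq> j"
      moreover have "i \<in> C" "j \<in> C" using ij F0(1) by auto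
      ultimately have "disjnt (cball (fst i) (snd i)) (cball (fst j) (snd j))" using C(3)[unfolded pairwise_def] by blast
      moreover have "0 < snd i" "0 < snd j" using ij F0(1) C(2) by (auto simp: K_def)
      ultimately show False using ij(3) by (auto simp: disjnt_iff dest!: spec[of _ "fst j"])
    qed
  qed
  define F where "F = fst ` F0"
  define r where "r z = snd (inv_into F0 fst z)" for z
  have r: "r (fst i) = snd i" if "i \<in> F0" for i using inv_into_f_f[OF inj that] by (simp add: r_def)
  have UF: "(\<Union>z\<in>F. cball z (r z)) = \<Union>D'" unfolding F_def F0(3) using r by auto
  have UDl: "\<Union>D' \<in> lmeasurable" by (rule Dl[OF D'(1,2)])
  have mQ: "measure lebesgue Q \<le> measure lebesgue (\<Union>?D)"
  proof -
    have "\<Union>?D \<in> sets lebesgue" using C(1) by (intro sets.countable_Union) auto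
    then have l: "\<Union>?D \<in> lmeasurable" using UQ Ql by (metis fmeasurableI2)
    have "Q \<subseteq> \<Union>?D \<union> (Q - \<Union>?D)" by blast
    then have "measure lebesgue Q \<le> measure lebesgue (\<Union>?D \<union> (Q - \<Union>?D))"
      using l Ql by (intro measure_mono_fmeasurable fmeasurable.Un fmeasurable.Diff) auto
    also have "\<dots> \<le> measure lebesgue (\<Union>?D) + measure lebesgue (Q - \<Union>?D)"
      using l Ql by (intro measure_Un_le) auto
    also have "measure lebesgue (Q - \<Union>?D) = 0" using negligible_imp_measure0[OF C(4)] by simp
    finally show ?thesis by simp
  qed
  have small: "measure lebesgue (Q - \<Union>D') \<le> \<eta>"
  proof -
    have "\<Union>D' \<subseteq> Q" using D'(1) UQ by blast
    then have "measure lebesgue (Q - \<Union>D') = measure lebesgue Q - measure lebesgue (\<Union>D')"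
      using UDl by (intro measurable_measure_Diff[OF Ql]) auto
    then show ?thesis using D'(3) mQ by linarith
  qed
  have "Q - \<Union>D' \<in> sets borel" unfolding F0(3) using Q(1) F0(2) by (intro sets.Diff sets.finite_Union) auto
  then have "measure lborel (Q - \<Union>D') \<le> \<eta>" using small by (simp add: measure_completion)
  then show ?thesis
  proof (intro that[of F r])
    show "finite F" "F \<subseteq> Q" using F0 C(2) by (auto simp: F_def K_def)
    show "0 < r z \<and> r z < R z" if "z \<in> F" for z using that r F0(1) C(2) by (auto simp: F_def K_def)
    show "disjnt (cball z (r z)) (cball z' (r z'))" if zz: "z \<in> F" "z' \<in> F" "z \<noteq> z'" for z z'
    proof -
      obtain i j where ij: "i \<in> F0" "j \<in> F0" "z = fst i" "z' = fst j" using zz by (auto simp: F_def)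
      moreover have "i \<in> C" "j \<in> C" "i \<noteq> j" using ij F0(1) zz(3) by auto
      ultimately show ?thesis using C(3)[unfolded pairwise_def] r by simp
    qed
  qed (simp add: UF)
qed

text \<open>On \<open>Pp\<close> and \<open>Pm\<close> the wave is fully in one of its two states.
  With level \<open>e1\<close> on \<open>Pp\<close>, \<open>e2\<close> on \<open>Pm\<close> and
  level 1 elsewhere, the left-hand side of the last inequality is the integral of the level over the
  inner ball.\<close>

lemma block_with_sets:
  fixes D :: mat2 and v :: "real^2" and z0 :: pt and \<phi> :: "nat \<Rightarrow> pt \<Rightarrow> real" and \<phi>' :: "nat \<Rightarrow> pt \<Rightarrow> pt"
  assumes v: "norm v = 1" and rr: "0 < \<rho>" "\<rho> < r" and eta: "0 < \<eta>" "\<eta> < 1"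
    and e12: "0 \<le> e1" "e1 \<le> 1" "0 \<le> e2" "e2 \<le> (1::real)"
    and phi: "\<And>j z. (\<phi> j has_derivative (\<lambda>y. \<phi>' j z \<bullet> y)) (at z)" "\<And>j. continuous_on UNIV (\<phi>' j)"
    and eps: "\<epsilon> > 0"
  shows "\<exists>V B \<tau> \<zeta> Pp Pm. pert (cball z0 r) V B \<tau> \<zeta> \<and> (\<forall>z. norm (V z) \<le> \<epsilon> \<and> norm (\<tau> z) \<le> \<epsilon>) \<and>
    closed Pp \<and> closed Pm \<and> Pp \<inter> Pm = {} \<and> Pp \<union> Pm \<subseteq> cball z0 \<rho> \<and>
    (\<forall>z. \<exists>s. \<bar>s\<bar> \<le> 1 \<and> norm (B z + s *\<^sub>R outer (D *v v) v) \<le> \<epsilon> \<and> norm (\<zeta> z - s *\<^sub>R D) \<le> \<epsilon> \<and>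
      (z \<in> Pp \<longrightarrow> s = 1) \<and> (z \<in> Pm \<longrightarrow> s = -1)) \<and>
    (\<forall>j<n. norm (\<integral>z. \<phi> j z *\<^sub>R \<zeta> z \<partial>lborel) \<le> \<epsilon>) \<and>
    measure lborel (cball z0 \<rho>) - (1 - e1) * measure lborel Pp - (1 - e2) * measure lborel Pm
      \<le> ((e1 + e2) / 2 + \<eta>) * measure lborel (cball z0 \<rho>)"
proof -
  have e: "0 < \<eta> / 2" "\<eta> / 2 < pi / 2" using eta pi_gt3 by auto
  obtain h H1 H :: "real \<Rightarrow> real" and C where h: "continuous_on UNIV h"
    and H: "\<And>s. (H has_real_derivative H1 s) (at s)" "\<And>s. (H1 has_real_derivative h s) (at s)"
    and h1: "\<And>s. \<bar>h s\<bar> \<le> 1" and C: "C > 0" "\<And>s. \<bar>H s\<bar> \<le> C" "\<And>s. \<bar>H1 s\<bar> \<le> C"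
    and hp: "\<And>s. h (s + pi) = - h s" "\<And>s. \<bar>h s\<bar> \<noteq> 1 \<Longrightarrow> \<bar>cos s\<bar> < sin (\<eta> / 2)"
    by (rule square_wave_exists[OF e]) (rule that, assumption+)
  define Pr where "Pr k \<theta> \<longleftrightarrow> (\<exists>V B \<tau> \<zeta>. pert (cball z0 r) V B \<tau> \<zeta> \<and> (\<forall>z. norm (V z) \<le> \<epsilon> \<and> norm (\<tau> z) \<le> \<epsilon>) \<and>
    (\<forall>z. \<exists>s. \<bar>s\<bar> \<le> 1 \<and> norm (B z + s *\<^sub>R outer (D *v v) v) \<le> \<epsilon> \<and> norm (\<zeta> z - s *\<^sub>R D) \<le> \<epsilon> \<and>
      (dist z0 z \<le> \<rho> \<longrightarrow> s = h (k * (v \<bullet> fst z) + \<theta>))) \<and>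
    (\<forall>j<n. norm (\<integral>z. \<phi> j z *\<^sub>R \<zeta> z \<partial>lborel) \<le> \<epsilon>))" for k \<theta>
  have "\<exists>k0\<ge>1. \<forall>k\<ge>k0. \<forall>\<theta>. Pr k \<theta>"
    unfolding Pr_def by (rule wave_block[where \<phi> = \<phi> and \<phi>' = \<phi>', OF v rr H h C(2,3,1) h1 phi eps])
  then obtain k where k: "\<And>\<theta>. Pr k \<theta>" by blast
  define a :: pt where "a = (v, 0)"
  have av: "a \<bullet> z = v \<bullet> fst z" for z by (simp add: a_def inner_prod_def)
  obtain \<theta> where th: "measure lborel (cball z0 \<rho>) - (1 - e1) * measure lborel {z \<in> cball z0 \<rho>. h (k * (a \<bullet> z) + \<theta>) = 1}
    - (1 - e2) * measure lborel {z \<in> cball z0 \<rho>. h (k * (a \<bullet> z) + \<theta>) = -1} \<le> ((e1 + e2) / 2 + 2 * (\<eta> / 2)) * measure lborel (cball z0 \<rho>)"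
    using phase_sign_choice[OF _ _ e h hp e12, of "cball z0 \<rho>" k a] emeasure_bounded_finite[OF bounded_cball, of z0 \<rho>] by auto
  obtain V B \<tau> \<zeta> where VB: "pert (cball z0 r) V B \<tau> \<zeta>" "\<forall>z. norm (V z) \<le> \<epsilon> \<and> norm (\<tau> z) \<le> \<epsilon>"
    and s: "\<forall>z. \<exists>s. \<bar>s\<bar> \<le> 1 \<and> norm (B z + s *\<^sub>R outer (D *v v) v) \<le> \<epsilon> \<and> norm (\<zeta> z - s *\<^sub>R D) \<le> \<epsilon> \<and>
      (dist z0 z \<le> \<rho> \<longrightarrow> s = h (k * (v \<bullet> fst z) + \<theta>))"
    and ph: "\<forall>j<n. norm (\<integral>z. \<phi> j z *\<^sub>R \<zeta> z \<partial>lborel) \<le> \<epsilon>"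
    using k[of \<theta>] unfolding Pr_def by (elim exE conjE) (rule that, assumption+)
  define P where "P c = {z \<in> cball z0 \<rho>. h (k * (a \<bullet> z) + \<theta>) = c}" for c
  have cl: "closed (P c)" for c
  proof -
    have c0: "continuous_on UNIV (\<lambda>z. h (k * (a \<bullet> z) + \<theta>))"
      by (rule continuous_on_compose2[OF h]) (auto intro!: continuous_intros)
    have "closed (cball z0 \<rho> \<inter> {z. h (k * (a \<bullet> z) + \<theta>) = c})" by (intro closed_Int closed_cball closed_Collect_eq[OF c0 continuous_on_const])
    then show ?thesis by (simp add: P_def Int_def)
  qed
  have sP: "\<forall>z. \<exists>s. \<bar>s\<bar> \<le> 1 \<and> norm (B z + s *\<^sub>R outer (D *v v) v) \<le> \<epsilon> \<and> norm (\<zeta> z - s *\<^sub>R D) \<le> \<epsilon> \<and>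
      (z \<in> P 1 \<longrightarrow> s = 1) \<and> (z \<in> P (-1) \<longrightarrow> s = -1)"
  proof (rule allI)
    fix z
    obtain s where "\<bar>s\<bar> \<le> 1" "norm (B z + s *\<^sub>R outer (D *v v) v) \<le> \<epsilon>" "norm (\<zeta> z - s *\<^sub>R D) \<le> \<epsilon>"
      "dist z0 z \<le> \<rho> \<longrightarrow> s = h (k * (v \<bullet> fst z) + \<theta>)" using s by blast
    then show "\<exists>s. \<bar>s\<bar> \<le> 1 \<and> norm (B z + s *\<^sub>R outer (D *v v) v) \<le> \<epsilon> \<and> norm (\<zeta> z - s *\<^sub>R D) \<le> \<epsilon> \<and>
      (z \<in> P 1 \<longrightarrow> s = 1) \<and> (z \<in> P (-1) \<longrightarrow> s = -1)"
      by (intro exI[of _ s]) (auto simp: P_def av)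
  qed
  have mP: "measure lborel (cball z0 \<rho>) - (1 - e1) * measure lborel (P 1) - (1 - e2) * measure lborel (P (-1))
      \<le> ((e1 + e2) / 2 + \<eta>) * measure lborel (cball z0 \<rho>)" using th by (simp add: P_def)
  have dP: "P 1 \<inter> P (-1) = {}" "P 1 \<union> P (-1) \<subseteq> cball z0 \<rho>" by (auto simp: P_def)
  show ?thesis
    by (rule exI[of _ V], rule exI[of _ B], rule exI[of _ \<tau>], rule exI[of _ \<zeta>], rule exI[of _ "P 1"], rule exI[of _ "P (-1)"])
      (intro conjI VB cl dP sP ph mP)
qed

section \<open>One step of the iteration\<close>

lemma norm_mv_le: "norm ((D::mat2) *v x) \<le> 2 * norm D * norm x"
proof -
  have c: "\<bar>(D *v x) $ i\<bar> \<le> norm D * norm x" for i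
  proof -
    have "(D *v x) $ i = D $ i \<bullet> x" by (simp add: matrix_vector_mult_def inner_vec_def)
    then have "\<bar>(D *v x) $ i\<bar> \<le> norm (D $ i) * norm x" using Cauchy_Schwarz_ineq2[of "D $ i" x] by simp
    also have "\<dots> \<le> norm D * norm x" by (intro mult_right_mono Finite_Cartesian_Product.norm_nth_le) auto
    finally show ?thesis .
  qed
  have "norm (D *v x) \<le> \<bar>(D *v x) $ 1\<bar> + \<bar>(D *v x) $ 2\<bar>"
    using L2_set_le_sum[of UNIV "\<lambda>i. norm ((D *v x) $ i)"] by (simp add: norm_vec_def sum_2)
  then show ?thesis using c[of 1] c[of 2] by linarith
qed

lemma norm_outer_le: "norm (outer b v) \<le> 2 * norm b * norm v"
proof -
  have c: "norm (outer b v $ i) \<le> norm b * norm v" for i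
  proof -
    have "outer b v $ i = b $ i *\<^sub>R v" by (simp add: outer_def vec_eq_iff)
    then show ?thesis using component_le_norm_cart[of b i] by (simp add: mult_right_mono)
  qed
  have "norm (outer b v) \<le> norm (outer b v $ 1) + norm (outer b v $ 2)"
    using L2_set_le_sum[of UNIV "\<lambda>i. norm (outer b v $ i)"] by (simp add: norm_vec_def[of "outer b v"] sum_2)
  then show ?thesis using c[of 1] c[of 2] by linarith
qed

text \<open>The mean value theorem on a spatial segment. Only the size of \<open>B\<close> on that
  segment enters, so the bound of a single block can be used while the segment stays in its
  ball.\<close>

lemma pert_diff_bound:
  assumes p: "pert S V B \<tau> \<zeta>" and b: "\<And>s. 0 \<le> s \<Longrightarrow> s \<le> 1 \<Longrightarrow> norm (B (x + s *\<^sub>R (y - x), t)) \<le> \<beta>"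
  shows "norm (V (y, t) - V (x, t)) \<le> 2 * \<beta> * norm (y - x)"
proof -
  let ?g = "\<lambda>s. (x + s *\<^sub>R (y - x), t)"
  have "norm (V (?g 1) - V (?g 0)) \<le> (2 * \<beta> * norm (y - x)) * norm (1 - 0 :: real)"
  proof (rule differentiable_bound[where S = "{0..1::real}" and f = "\<lambda>s. V (?g s)" and f' = "\<lambda>s u. B (?g s) *v (u *\<^sub>R (y - x)) + 0 *\<^sub>R \<tau> (?g s)"])
    fix s :: real assume s: "s \<in> {0..1}"
    have g: "(?g has_derivative (\<lambda>u. (u *\<^sub>R (y - x), 0))) (at s within {0..1})"
    proof (rule has_derivative_Pair)
      have "((\<lambda>s. x + s *\<^sub>R (y - x)) has_derivative (\<lambda>u. 0 + u *\<^sub>R (y - x))) (at s within {0..1})"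
        by (intro has_derivative_add has_derivative_const has_derivative_scaleR_left has_derivative_ident)
      then show "((\<lambda>s. x + s *\<^sub>R (y - x)) has_derivative (\<lambda>u. u *\<^sub>R (y - x))) (at s within {0..1})" by simp
    qed (rule has_derivative_const)
    have "((\<lambda>s. V (?g s)) has_derivative (\<lambda>u. B (?g s) *v fst (u *\<^sub>R (y - x), 0::real) + snd (u *\<^sub>R (y - x), 0::real) *\<^sub>R \<tau> (?g s))) (at s within {0..1})"
      by (rule has_derivative_compose[OF g pertD(1)[OF p]])
    then show "((\<lambda>s. V (?g s)) has_derivative (\<lambda>u. B (?g s) *v (u *\<^sub>R (y - x)) + 0 *\<^sub>R \<tau> (?g s))) (at s within {0..1})" by simp
    show "onorm (\<lambda>u. B (?g s) *v (u *\<^sub>R (y - x)) + 0 *\<^sub>R \<tau> (?g s)) \<le> 2 * \<beta> * norm (y - x)"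
    proof (rule onorm_bound)
      have bs: "norm (B (?g s)) \<le> \<beta>" using b s by auto
      then have b0: "0 \<le> \<beta>" using norm_ge_zero order_trans by blast
      then show "0 \<le> 2 * \<beta> * norm (y - x)" by simp
      fix u
      have "norm (B (?g s) *v (u *\<^sub>R (y - x))) \<le> 2 * norm (B (?g s)) * norm (u *\<^sub>R (y - x))" by (rule norm_mv_le)
      also have "\<dots> \<le> 2 * \<beta> * norm (u *\<^sub>R (y - x))" using bs by (intro mult_right_mono mult_left_mono) auto
      finally show "norm (B (?g s) *v (u *\<^sub>R (y - x)) + 0 *\<^sub>R \<tau> (?g s)) \<le> 2 * \<beta> * norm (y - x) * norm u" by (simp add: mult_ac)
    qed
  qed auto
  then show ?thesis by simp
qed

lemma sum_single:
  assumes "finite F" "b \<in> F" "\<And>b'. b' \<in> F \<Longrightarrow> b' \<noteq> b \<Longrightarrow> f b' = 0"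
  shows "sum f F = f b"
  using sum.remove[OF assms(1,2), of f] sum.neutral[of "F - {b}" f] assms(3) by simp

lemma integrable_bounded_on:
  fixes f :: "'a::euclidean_space \<Rightarrow> real"
  assumes "f \<in> borel_measurable borel" "Q \<in> sets borel" "emeasure lborel Q < \<infinity>" "\<And>z. z \<in> Q \<Longrightarrow> \<bar>f z\<bar> \<le> c"
  shows "integrable lborel (\<lambda>z. indicator Q z * f z)"
proof (rule Bochner_Integration.integrable_bound)
  show "integrable lborel (\<lambda>z. c * indicator Q z :: real)"
    using assms(2,3) by (intro integrable_mult_right integrable_real_indicator) auto
  show "(\<lambda>z. indicator Q z * f z) \<in> borel_measurable lborel" using assms(1,2) by measurable
  show "AE z in lborel. norm (indicator Q z * f z) \<le> norm (c * indicator Q z)"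
    using assms(4) by (intro AE_I2) (auto simp: indicator_def split: if_splits intro: order_trans[OF _ abs_ge_self])
qed

lemma measure_cball_scale:
  fixes c :: "'a::euclidean_space"
  assumes "0 \<le> x" "0 \<le> r"
  shows "measure lborel (cball c (x * r)) = x ^ DIM('a) * measure lborel (cball c r)"
  using content_cball[of "x * r" c] content_cball[of r c] assms by (simp add: power_mult_distrib)

locale relax =
  fixes U :: "real \<Rightarrow> (mat2 \<times> mat2) set"
  assumes U_open: "\<And>c. open (U c)"
    and U_mono: "\<And>c d. 0 < c \<Longrightarrow> c \<le> d \<Longrightarrow> U c \<subseteq> U d"
    and U_split: "\<And>\<xi> c. \<xi> \<in> U c \<Longrightarrow> 0 < c \<Longrightarrow> c \<le> 1 \<Longrightarrow>
      \<exists>D v e1 e2. norm v = 1 \<and> 0 < e1 \<and> e1 \<le> 1 \<and> 0 < e2 \<and> e2 \<le> 1 \<and> e1 + e2 \<le> 2 * (199/200) * c \<and>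
        norm D \<le> 1600 * c \<and> (\<forall>s. \<bar>s\<bar> \<le> 1 \<longrightarrow> \<xi> + s *\<^sub>R (- outer (D *v v) v, D) \<in> U 1) \<and>
        \<xi> + (- outer (D *v v) v, D) \<in> U e1 \<and> \<xi> - (- outer (D *v v) v, D) \<in> U e2"
begin

text \<open>The tolerance \<open>\<sigma>\<close> is valid along the whole segment of the splitting
  chosen at \<open>z\<close>. One half of it is reserved for the variation of the background over
  the ball of radius \<open>R\<close>, the rest for the errors of the wave block.\<close>

definition local_data where
  "local_data Q A Z G z D v e1 e2 \<sigma> R \<longleftrightarrow>
     norm (v :: real^2) = 1 \<and> 0 < e1 \<and> e1 \<le> 1 \<and> 0 < e2 \<and> e2 \<le> 1 \<and> e1 + e2 \<le> 2 * (199/200) * G z \<and>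
     norm D \<le> 1600 * G z \<and> \<sigma> > 0 \<and> R > 0 \<and> cball z R \<subseteq> Q \<and>
     (\<forall>y\<in>cball z R. dist (A y, Z y) (A z, Z z) < \<sigma> / 2 \<and> G z \<le> G y) \<and>
     (\<forall>s \<eta>. \<bar>s\<bar> \<le> 1 \<longrightarrow> dist \<eta> ((A z, Z z) + s *\<^sub>R (- outer (D *v v) v, D)) < \<sigma> \<longrightarrow> \<eta> \<in> U 1 \<and>
        (s = 1 \<longrightarrow> \<eta> \<in> U e1) \<and> (s = -1 \<longrightarrow> \<eta> \<in> U e2))"

lemma local_data_exists:
  fixes Q :: "pt set" and G :: "pt \<Rightarrow> real"
  assumes Q: "open Q" and A: "continuous_on UNIV A" "continuous_on UNIV Z"
    and z: "z \<in> Q" "0 < G z" "G z \<le> 1" "(A z, Z z) \<in> U (G z)" and lsc: "\<forall>\<^sub>F y in nhds z. G z \<le> G y"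
  shows "\<exists>D v e1 e2 \<sigma> R. local_data Q A Z G z D v e1 e2 \<sigma> R"
proof -
  obtain D v e1 e2 where sp: "norm v = 1" "0 < e1" "e1 \<le> 1" "0 < e2" "e2 \<le> 1" "e1 + e2 \<le> 2 * (199/200) * G z"
    "norm D \<le> 1600 * G z" "\<forall>s. \<bar>s\<bar> \<le> 1 \<longrightarrow> (A z, Z z) + s *\<^sub>R (- outer (D *v v) v, D) \<in> U 1"
    "(A z, Z z) + (- outer (D *v v) v, D) \<in> U e1" "(A z, Z z) - (- outer (D *v v) v, D) \<in> U e2"
    using U_split[OF z(4,2,3)] by (elim exE conjE) (rule that, assumption+)
  define \<xi> where "\<xi> = (A z, Z z)"
  define w where "w = (- outer (D *v v) v, D)"
  have sp': "\<forall>s. \<bar>s\<bar> \<le> 1 \<longrightarrow> \<xi> + s *\<^sub>R w \<in> U 1" "\<xi> + w \<in> U e1" "\<xi> - w \<in> U e2" using sp(8-10) unfolding \<xi>_def w_def .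
  have "compact ((\<lambda>s. \<xi> + s *\<^sub>R w) ` {-1..1})" by (intro compact_continuous_image continuous_intros compact_Icc)
  moreover have "(\<lambda>s. \<xi> + s *\<^sub>R w) ` {-1..1} \<subseteq> U 1" using sp'(1) by (auto simp: abs_le_iff)
  ultimately obtain s1 where s1: "s1 > 0" "(\<Union>x\<in>(\<lambda>s. \<xi> + s *\<^sub>R w) ` {-1..1}. ball x s1) \<subseteq> U 1"
    using compact_subset_open_imp_ball_epsilon_subset[OF _ U_open] by metis
  obtain s2 where s2: "s2 > 0" "ball (\<xi> + w) s2 \<subseteq> U e1" using U_open sp'(2) open_contains_ball by metis
  obtain s3 where s3: "s3 > 0" "ball (\<xi> - w) s3 \<subseteq> U e2" using U_open sp'(3) open_contains_ball by metis
  define \<sigma> where "\<sigma> = min s1 (min s2 s3)"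
  have sg: "\<sigma> > 0" "\<sigma> \<le> s1" "\<sigma> \<le> s2" "\<sigma> \<le> s3" using s1 s2 s3 by (auto simp: \<sigma>_def)
  have c1: "\<eta> \<in> U 1 \<and> (s = 1 \<longrightarrow> \<eta> \<in> U e1) \<and> (s = -1 \<longrightarrow> \<eta> \<in> U e2)" if "\<bar>s\<bar> \<le> 1" "dist \<eta> (\<xi> + s *\<^sub>R w) < \<sigma>" for s \<eta>
  proof (intro conjI impI)
    have "\<eta> \<in> ball (\<xi> + s *\<^sub>R w) s1" using that(2) sg by (simp add: dist_commute)
    moreover have "\<xi> + s *\<^sub>R w \<in> (\<lambda>s. \<xi> + s *\<^sub>R w) ` {-1..1}" using that(1) by (auto simp: abs_le_iff)
    ultimately show "\<eta> \<in> U 1" using s1(2) by blast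
    show "\<eta> \<in> U e1" if "s = 1" using s2(2) \<open>dist \<eta> (\<xi> + s *\<^sub>R w) < \<sigma>\<close> sg that by (auto simp: dist_commute)
    show "\<eta> \<in> U e2" if "s = -1" using s3(2) \<open>dist \<eta> (\<xi> + s *\<^sub>R w) < \<sigma>\<close> sg that by (auto simp: dist_commute)
  qed
  have "continuous_on UNIV (\<lambda>y. (A y, Z y))" by (intro continuous_on_Pair A)
  then have "isCont (\<lambda>y. (A y, Z y)) z"
    by (rule continuous_on_eq_continuous_at[OF open_UNIV, THEN iffD1, rule_format, OF _ UNIV_I])
  then have "((\<lambda>y. (A y, Z y)) \<longlongrightarrow> (A z, Z z)) (at z)" unfolding isCont_def .
  then have "((\<lambda>y. (A y, Z y)) \<longlongrightarrow> (A z, Z z)) (nhds z)" by (rule tendsto_at_iff_tendsto_nhds[THEN iffD1])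
  then have "\<forall>\<^sub>F y in nhds z. dist (A y, Z y) (A z, Z z) < \<sigma> / 2" 
    by (rule tendstoD) (use sg(1) in simp)
  moreover have "\<forall>\<^sub>F y in nhds z. y \<in> Q" using Q z(1) by (simp add: eventually_nhds) blast
  ultimately have "\<forall>\<^sub>F y in nhds z. y \<in> Q \<and> dist (A y, Z y) (A z, Z z) < \<sigma> / 2 \<and> G z \<le> G y"
    using lsc by eventually_elim auto
  then obtain d where d: "d > 0" "\<And>y. dist y z < d \<Longrightarrow> y \<in> Q \<and> dist (A y, Z y) (A z, Z z) < \<sigma> / 2 \<and> G z \<le> G y"
    unfolding eventually_nhds_metric by blast
  have R: "y \<in> Q \<and> dist (A y, Z y) (A z, Z z) < \<sigma> / 2 \<and> G z \<le> G y" if "y \<in> cball z (d / 2)" for y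
    using d(2)[of y] d(1) that by (simp add: dist_commute)
  have "local_data Q A Z G z D v e1 e2 \<sigma> (d / 2)"
    unfolding local_data_def
  proof (intro conjI)
    show "\<forall>s \<eta>. \<bar>s\<bar> \<le> 1 \<longrightarrow> dist \<eta> ((A z, Z z) + s *\<^sub>R (- outer (D *v v) v, D)) < \<sigma> \<longrightarrow> \<eta> \<in> U 1 \<and>
        (s = 1 \<longrightarrow> \<eta> \<in> U e1) \<and> (s = -1 \<longrightarrow> \<eta> \<in> U e2)"
      using c1 unfolding \<xi>_def w_def by blast
    show "cball z (d / 2) \<subseteq> Q" "\<forall>y\<in>cball z (d / 2). dist (A y, Z y) (A z, Z z) < \<sigma> / 2 \<and> G z \<le> G y" using R by blast+
  qed (use sp(1-7) sg(1) d(1) in simp_all)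
  then show ?thesis by blast
qed

text \<open>\<open>Q\<close> is filled up to small measure by disjoint balls, each carrying a wave
  block for the splitting at its centre. \<open>G'\<close> records the level reached:
  \<open>e1\<close> or \<open>e2\<close> on the resolved sets, 1 elsewhere. \<open>N\<close> bounds
  the increments pointwise in \<open>z\<close>, but for difference quotients of \<open>V\<close>
  with arbitrary \<open>y\<close>; summability of such bounds at a point gives differentiability of
  the limit there.\<close>

lemma step:
  fixes Q :: "pt set" and G :: "pt \<Rightarrow> real" and \<phi> :: "nat \<Rightarrow> pt \<Rightarrow> real" and \<phi>' :: "nat \<Rightarrow> pt \<Rightarrow> pt"
  assumes Q: "open Q" "bounded Q" and A: "continuous_on UNIV A" "continuous_on UNIV Z"
    and G: "G \<in> borel_measurable borel"
    and GU: "\<And>z. z \<in> Q \<Longrightarrow> 0 < G z \<and> G z \<le> 1 \<and> (A z, Z z) \<in> U (G z) \<and> (\<forall>\<^sub>F y in nhds z. G z \<le> G y)"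
    and phi: "\<And>j z. (\<phi> j has_derivative (\<lambda>y. \<phi>' j z \<bullet> y)) (at z)" "\<And>j. continuous_on UNIV (\<phi>' j)"
    and delta: "\<delta> > 0"
  shows "\<exists>S V B \<tau> \<zeta> G' N. compact S \<and> S \<subseteq> Q \<and> pert S V B \<tau> \<zeta> \<and> (\<forall>z. norm (V z) \<le> \<delta> \<and> norm (\<tau> z) \<le> \<delta>) \<and>
    G' \<in> borel_measurable borel \<and>
    (\<forall>z\<in>Q. 0 < G' z \<and> G' z \<le> 1 \<and> (A z + B z, Z z + \<zeta> z) \<in> U (G' z) \<and> (\<forall>\<^sub>F y in nhds z. G' z \<le> G' y)) \<and>
    (\<integral>z. indicator Q z * G' z \<partial>lborel) \<le> 199/200 * (\<integral>z. indicator Q z * G z \<partial>lborel) + \<delta> \<and>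
    N \<in> borel_measurable borel \<and>
    (\<forall>z\<in>Q. 0 \<le> N z \<and> N z \<le> 13000 \<and> norm (\<zeta> z) \<le> N z \<and> norm (B z) \<le> N z \<and>
       (\<forall>y. norm (V (y, snd z) - V z) \<le> N z * norm (y - fst z))) \<and>
    (\<integral>z. indicator Q z * N z \<partial>lborel) \<le> 12800 * (\<integral>z. indicator Q z * G z \<partial>lborel) + \<delta> \<and>
    (\<forall>j<n. norm (\<integral>z. \<phi> j z *\<^sub>R \<zeta> z \<partial>lborel) \<le> \<delta>)"
proof -
  have Qs: "Q \<in> sets borel" "emeasure lborel Q < \<infinity>" using Q emeasure_bounded_finite[OF Q(2)] by auto
  define m where "m = measure lborel Q"
  have m0: "m \<ge> 0" by (simp add: m_def)
  \<comment> \<open>The largest total error is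
    \<open>3 * \<eta> * m + 13000 * (\<eta> + \<eta> * m)\<close>, in the integral of
    \<open>N\<close>; the factor 20000 covers it, and \<open>m + 1\<close> keeps the denominator
    positive.\<close>
  define \<eta> where "\<eta> = min (1/10) (\<delta> / (20000 * (m + 1)))"
  have eta: "0 < \<eta>" "\<eta> < 1" "\<eta> \<le> 1/10" "20000 * (\<eta> * (m + 1)) \<le> \<delta>"
  proof -
    show "0 < \<eta>" using delta m0 by (simp add: \<eta>_def)
    show e10: "\<eta> \<le> 1/10" unfolding \<eta>_def by (rule min.cobounded1)
    then show "\<eta> < 1" by linarith
    have "\<eta> \<le> \<delta> / (20000 * (m + 1))" unfolding \<eta>_def by (rule min.cobounded2)
    then show "20000 * (\<eta> * (m + 1)) \<le> \<delta>" using m0 by (simp add: field_simps)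
  qed
  have "\<forall>z\<in>Q. \<exists>D v e1 e2 \<sigma> R. local_data Q A Z G z D v e1 e2 \<sigma> R"
    using local_data_exists[OF Q(1) A] GU by blast
  then obtain D v e1 e2 \<sigma> R where ld: "\<And>z. z \<in> Q \<Longrightarrow> local_data Q A Z G z (D z) (v z) (e1 z) (e2 z) (\<sigma> z) (R z)"
    by metis
  have ldD: "norm (v z) = 1" "0 < e1 z" "e1 z \<le> 1" "0 < e2 z" "e2 z \<le> 1" "e1 z + e2 z \<le> 2 * (199/200) * G z"
    "norm (D z) \<le> 1600 * G z" "\<sigma> z > 0" "R z > 0" "cball z (R z) \<subseteq> Q" if "z \<in> Q" for z
    using ld[OF that] unfolding local_data_def by blast+
  have ld1: "dist (A y, Z y) (A z, Z z) < \<sigma> z / 2 \<and> G z \<le> G y" if "z \<in> Q" "y \<in> cball z (R z)" for y z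
    using ld[OF that(1)] that(2) unfolding local_data_def by blast
  have ld2: "x \<in> U 1 \<and> (s = 1 \<longrightarrow> x \<in> U (e1 z)) \<and> (s = -1 \<longrightarrow> x \<in> U (e2 z))"
    if "z \<in> Q" "\<bar>s\<bar> \<le> 1" "dist x ((A z, Z z) + s *\<^sub>R (- outer (D z *v v z) (v z), D z)) < \<sigma> z" for z s x
    using ld[OF that(1)] that(2,3) unfolding local_data_def by blast
  obtain F r where F: "finite F" "F \<subseteq> Q" and r: "\<And>b. b \<in> F \<Longrightarrow> 0 < r b \<and> r b < R b"
    and disj: "\<And>b b'. b \<in> F \<Longrightarrow> b' \<in> F \<Longrightarrow> b \<noteq> b' \<Longrightarrow> disjnt (cball b (r b)) (cball b' (r b'))"
    and cov: "measure lborel (Q - (\<Union>b\<in>F. cball b (r b))) \<le> \<eta>"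
    by (rule finite_ball_cover[OF Q, of R \<eta>]) (use ldD(9,10) eta in \<open>auto intro: that\<close>)
  have FQ: "b \<in> Q" if "b \<in> F" for b using F that by auto
  have subQ: "cball b (r b) \<subseteq> Q" if "b \<in> F" for b
    using ldD(10)[OF FQ[OF that]] r[OF that] by (meson less_imp_le order_trans subset_cball)
  \<comment> \<open>By Bernoulli's inequality, shrinking the radius by the fraction
    \<open>\<eta>\<close> over the dimension loses at most the fraction \<open>\<eta>\<close> of the
    volume.\<close>
  define \<kappa> where "\<kappa> = \<eta> / real DIM(pt)"
  have kap: "0 < \<kappa>" "\<kappa> < 1"
  proof -
    show "0 < \<kappa>" using eta by (simp add: \<kappa>_def)
    have "\<eta> < real DIM(pt)" using eta(2) by (simp add: Suc_le_eq)
    then show "\<kappa> < 1" by (simp add: \<kappa>_def)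
  qed
  define \<rho> where "\<rho> b = (1 - \<kappa>) * r b" for b
  have rho: "0 < \<rho> b" "\<rho> b < r b" if "b \<in> F" for b using kap r[OF that] by (auto simp: \<rho>_def)
  define I where "I b = cball b (\<rho> b)" for b
  define J where "J b = cball b (r b)" for b
  have IJ: "I b \<subseteq> J b" if "b \<in> F" for b using rho[OF that] by (auto simp: I_def J_def)
  have JQ: "J b \<subseteq> Q" if "b \<in> F" for b using subQ[OF that] by (simp add: J_def)
  have mI: "(1 - \<eta>) * measure lborel (J b) \<le> measure lborel (I b)" if "b \<in> F" for b
  proof -
    have "1 + real DIM(pt) * (- \<kappa>) \<le> (1 + (- \<kappa>)) ^ DIM(pt)" using kap by (intro Bernoulli_inequality) auto
    then have "1 - \<eta> \<le> (1 - \<kappa>) ^ DIM(pt)" by (simp add: \<kappa>_def)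
    then have "(1 - \<eta>) * measure lborel (J b) \<le> (1 - \<kappa>) ^ DIM(pt) * measure lborel (J b)" by (intro mult_right_mono) auto
    also have "\<dots> = measure lborel (I b)"
      using measure_cball_scale[of "1 - \<kappa>" "r b" b] kap r[OF that] by (simp add: I_def J_def \<rho>_def)
    finally show ?thesis .
  qed
  \<comment> \<open>An amplitude small against the gap between inner and outer ball: from a point of
    the inner ball to a point outside the outer one, the difference quotient of the perturbation is
    then at most \<open>\<eta>\<close>.\<close>
  obtain e0 where e0: "e0 > 0" "\<And>b. b \<in> F \<Longrightarrow> e0 \<le> \<eta> * (r b - \<rho> b) / 2"
  proof (rule uniform_radius[OF F(1), where P = "\<lambda>b e. e \<le> \<eta> * (r b - \<rho> b) / 2"])
    fix b assume "b \<in> F"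
    then show "\<exists>e>0. e \<le> \<eta> * (r b - \<rho> b) / 2" using eta(1) rho by (intro exI[of _ "\<eta> * (r b - \<rho> b) / 2"]) auto
  qed auto
  define \<epsilon> where "\<epsilon> b = min (\<sigma> b / 8) (min \<eta> (min e0 (\<delta> / (real (card F) + 1))))" for b
  have eps: "\<epsilon> b > 0" "\<epsilon> b \<le> \<sigma> b / 8" "\<epsilon> b \<le> \<eta>" "\<epsilon> b \<le> e0" "\<epsilon> b \<le> \<delta> / (real (card F) + 1)" if "b \<in> F" for b
  proof -
    have "\<delta> / (real (card F) + 1) > 0" using delta by simp
    then show "\<epsilon> b > 0" using ldD(8)[OF FQ[OF that]] eta(1) e0(1) by (simp add: \<epsilon>_def)
  qed (simp_all only: \<epsilon>_def min_le_iff_disj order_refl simp_thms)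
  have sumeps: "(\<Sum>b\<in>F. \<epsilon> b) \<le> \<delta>"
  proof -
    have "(\<Sum>b\<in>F. \<epsilon> b) \<le> real (card F) * (\<delta> / (real (card F) + 1))" by (rule sum_bounded_above) (rule eps(5))
    also have "\<dots> \<le> \<delta>" using delta by (simp add: field_simps)
    finally show ?thesis .
  qed
  define Blk where "Blk b V B \<tau> \<zeta> Pp Pm \<longleftrightarrow> pert (J b) V B \<tau> \<zeta> \<and> (\<forall>z. norm (V z) \<le> \<epsilon> b \<and> norm (\<tau> z) \<le> \<epsilon> b) \<and>
    closed Pp \<and> closed Pm \<and> Pp \<inter> Pm = {} \<and> Pp \<union> Pm \<subseteq> I b \<and>
    (\<forall>z. \<exists>s. \<bar>s\<bar> \<le> 1 \<and> norm (B z + s *\<^sub>R outer (D b *v v b) (v b)) \<le> \<epsilon> b \<and> norm (\<zeta> z - s *\<^sub>R D b) \<le> \<epsilon> b \<and>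
      (z \<in> Pp \<longrightarrow> s = 1) \<and> (z \<in> Pm \<longrightarrow> s = -1)) \<and>
    (\<forall>j<n. norm (\<integral>z. \<phi> j z *\<^sub>R \<zeta> z \<partial>lborel) \<le> \<epsilon> b) \<and>
    measure lborel (I b) - (1 - e1 b) * measure lborel Pp - (1 - e2 b) * measure lborel Pm
      \<le> ((e1 b + e2 b) / 2 + \<eta>) * measure lborel (I b)" for b V B \<tau> \<zeta> Pp Pm
  have "\<exists>V B \<tau> \<zeta> Pp Pm. Blk b V B \<tau> \<zeta> Pp Pm" if "b \<in> F" for b
    unfolding Blk_def I_def J_def
    by (rule block_with_sets[where \<phi> = \<phi> and \<phi>' = \<phi>', OF ldD(1)[OF FQ[OF that]] rho[OF that] eta(1,2)
          less_imp_le[OF ldD(2)[OF FQ[OF that]]] ldD(3)[OF FQ[OF that]] less_imp_le[OF ldD(4)[OF FQ[OF that]]]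
          ldD(5)[OF FQ[OF that]] phi eps(1)[OF that]])
  then obtain V B \<tau> \<zeta> Pp Pm where blk: "\<And>b. b \<in> F \<Longrightarrow> Blk b (V b) (B b) (\<tau> b) (\<zeta> b) (Pp b) (Pm b)" by metis
  note bk = blk[unfolded Blk_def]
  have bp: "pert (J b) (V b) (B b) (\<tau> b) (\<zeta> b)" if "b \<in> F" for b using bk[OF that] by (elim conjE)
  have bV: "norm (V b z) \<le> \<epsilon> b" "norm (\<tau> b z) \<le> \<epsilon> b" if "b \<in> F" for b z using bk[OF that, THEN conjunct2, THEN conjunct1] by blast+
  have bP: "closed (Pp b)" "closed (Pm b)" "Pp b \<inter> Pm b = {}" "Pp b \<union> Pm b \<subseteq> I b" if "b \<in> F" for b
    using bk[OF that] by blast+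
  have bs: "\<exists>s. \<bar>s\<bar> \<le> 1 \<and> norm (B b z + s *\<^sub>R outer (D b *v v b) (v b)) \<le> \<epsilon> b \<and> norm (\<zeta> b z - s *\<^sub>R D b) \<le> \<epsilon> b \<and>
      (z \<in> Pp b \<longrightarrow> s = 1) \<and> (z \<in> Pm b \<longrightarrow> s = -1)" if "b \<in> F" for b z using bk[OF that] by (elim conjE) (erule spec)
  have bphi: "norm (\<integral>z. \<phi> j z *\<^sub>R \<zeta> b z \<partial>lborel) \<le> \<epsilon> b" if "b \<in> F" "j < n" for b j
    using bk[OF that(1)] that(2) by (elim conjE) (erule allE[of _ j], erule mp)
  have bm: "measure lborel (I b) - (1 - e1 b) * measure lborel (Pp b) - (1 - e2 b) * measure lborel (Pm b)
      \<le> ((e1 b + e2 b) / 2 + \<eta>) * measure lborel (I b)" if "b \<in> F" for b using bk[OF that] by (elim conjE)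
  define VV where "VV z = (\<Sum>b\<in>F. V b z)" for z
  define BB where "BB z = (\<Sum>b\<in>F. B b z)" for z
  define TT where "TT z = (\<Sum>b\<in>F. \<tau> b z)" for z
  define ZZ where "ZZ z = (\<Sum>b\<in>F. \<zeta> b z)" for z
  define S where "S = (\<Union>b\<in>F. J b)"
  have cS: "compact S" unfolding S_def J_def using F(1) by (intro compact_UN) auto
  have SQ: "S \<subseteq> Q" unfolding S_def using JQ by blast
  have P: "pert S VV BB TT ZZ" unfolding S_def VV_def BB_def TT_def ZZ_def
    by (rule pert_sum[OF F(1) bp]) (auto simp: J_def)
  have zero: "V b z = 0" "B b z = 0" "\<tau> b z = 0" "\<zeta> b z = 0" if "b \<in> F" "z \<notin> J b" for b z
    using pertD(5)[OF bp[OF that(1)] that(2)] by auto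
  have notJ: "z \<notin> J b'" if "b \<in> F" "b' \<in> F" "b' \<noteq> b" "z \<in> J b" for b b' z
    using disj[OF that(1,2)] that(3,4) unfolding J_def disjnt_def by blast
  have loc: "VV z = V b z" "BB z = B b z" "ZZ z = \<zeta> b z" if "b \<in> F" "z \<in> J b" for b z
    unfolding VV_def BB_def ZZ_def
    by (rule sum_single[OF F(1) that(1)], rule zero, assumption, rule notJ[OF that(1) _ _ that(2)], assumption+)+
  have out: "VV z = 0" "BB z = 0" "ZZ z = 0" if "z \<notin> S" for z
    using pertD(5)[OF P that] by auto
  \<comment> \<open>The matrix-vector product and \<open>outer\<close> each cost a factor 2, hence
    6400 = 4 * 1600 for \<open>B\<close> against 1600 for \<open>\<zeta>\<close>.\<close>
  have bBn: "norm (B b z) \<le> 6400 * G b + \<epsilon> b" "norm (\<zeta> b z) \<le> 1600 * G b + \<epsilon> b" if bF: "b \<in> F" for b z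
  proof -
    obtain s where s: "\<bar>s\<bar> \<le> 1" "norm (B b z + s *\<^sub>R outer (D b *v v b) (v b)) \<le> \<epsilon> b" "norm (\<zeta> b z - s *\<^sub>R D b) \<le> \<epsilon> b"
      using bs[OF bF, of z] by blast
    have nD: "norm (D b) \<le> 1600 * G b" by (rule ldD(7)[OF FQ[OF bF]])
    have "norm (outer (D b *v v b) (v b)) \<le> 2 * norm (D b *v v b) * norm (v b)" by (rule norm_outer_le)
    also have "\<dots> \<le> 4 * norm (D b)" using norm_mv_le[of "D b" "v b"] ldD(1)[OF FQ[OF bF]] by simp
    finally have o: "norm (outer (D b *v v b) (v b)) \<le> 6400 * G b" using nD by linarith
    have "norm (s *\<^sub>R outer (D b *v v b) (v b)) \<le> 1 * norm (outer (D b *v v b) (v b))"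
      unfolding norm_scaleR using s(1) by (intro mult_right_mono) auto
    then show "norm (B b z) \<le> 6400 * G b + \<epsilon> b"
      using norm_triangle_ineq4[of "B b z + s *\<^sub>R outer (D b *v v b) (v b)" "s *\<^sub>R outer (D b *v v b) (v b)"] s(2) o by simp
    have "norm (s *\<^sub>R D b) \<le> 1 * norm (D b)" unfolding norm_scaleR using s(1) by (intro mult_right_mono) auto
    then show "norm (\<zeta> b z) \<le> 1600 * G b + \<epsilon> b"
      using norm_triangle_ineq[of "\<zeta> b z - s *\<^sub>R D b" "s *\<^sub>R D b"] s(3) nD by simp
  qed
  have Gb1: "G b \<le> 1" "0 < G b" if "b \<in> F" for b using GU[OF FQ[OF that]] by auto
  have gB: "norm (BB z) \<le> 6500" "norm (ZZ z) \<le> 6500" for z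
  proof -
    have "norm (BB z) \<le> 6500 \<and> norm (ZZ z) \<le> 6500"
    proof (cases "z \<in> S")
      case True
      then obtain b where b: "b \<in> F" "z \<in> J b" by (auto simp: S_def)
      show ?thesis using loc[OF b] bBn[OF b(1), of z] Gb1[OF b(1)] eps(3)[OF b(1)] eta(3) by simp
    qed (simp add: out)
    then show "norm (BB z) \<le> 6500" "norm (ZZ z) \<le> 6500" by auto
  qed
  define G' where "G' z = 1 - (\<Sum>b\<in>F. (1 - e1 b) * indicator (Pp b) z + (1 - e2 b) * indicator (Pm b) z)" for z
  have PJ: "z \<in> J b" if "b \<in> F" "z \<in> Pp b \<or> z \<in> Pm b" for b z using bP(4)[OF that(1)] IJ[OF that(1)] that(2) by blast
  have G'loc: "G' z = 1 - ((1 - e1 b) * indicator (Pp b) z + (1 - e2 b) * indicator (Pm b) z)" if "b \<in> F" "z \<in> J b" for b z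
  proof -
    have "(\<Sum>b\<in>F. (1 - e1 b) * indicator (Pp b) z + (1 - e2 b) * indicator (Pm b) z) = (1 - e1 b) * indicator (Pp b) z + (1 - e2 b) * indicator (Pm b) z"
    proof (rule sum_single[OF F(1) that(1)])
      fix b' assume b': "b' \<in> F" "b' \<noteq> b"
      have "z \<notin> Pp b'" "z \<notin> Pm b'" using notJ[OF that(1) b' that(2)] PJ[OF b'(1)] by blast+
      then show "(1 - e1 b') * indicator (Pp b') z + (1 - e2 b') * indicator (Pm b') z = 0" by simp
    qed
    then show ?thesis by (simp add: G'_def)
  qed
  have G'out: "G' z = 1" if "z \<notin> S" for z
  proof -
    have "z \<notin> Pp b" "z \<notin> Pm b" if "b \<in> F" for b using PJ[OF that] that \<open>z \<notin> S\<close> unfolding S_def by blast+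
    then show ?thesis unfolding G'_def by (simp add: sum.neutral)
  qed
  have mG': "G' \<in> borel_measurable borel"
  proof -
    have "Pp b \<in> sets borel" "Pm b \<in> sets borel" if "b \<in> F" for b using bP(1,2)[OF that] by auto
    then show ?thesis unfolding G'_def[abs_def] by (intro borel_measurable_diff borel_measurable_const borel_measurable_sum borel_measurable_add borel_measurable_times borel_measurable_indicator) auto
  qed
  have G'U: "0 < G' z \<and> G' z \<le> 1 \<and> (A z + BB z, Z z + ZZ z) \<in> U (G' z)" if "z \<in> Q" for z
  proof (cases "z \<in> S")
    case False
    have "(A z, Z z) \<in> U 1" using GU[OF that] U_mono[of "G z" 1] by blast
    then show ?thesis using out[OF False] G'out[OF False] by simp
  next
    case True
    then obtain b where b: "b \<in> F" "z \<in> J b" by (auto simp: S_def)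
    note bQ = FQ[OF b(1)]
    obtain s where s: "\<bar>s\<bar> \<le> 1" "norm (B b z + s *\<^sub>R outer (D b *v v b) (v b)) \<le> \<epsilon> b" "norm (\<zeta> b z - s *\<^sub>R D b) \<le> \<epsilon> b"
      "z \<in> Pp b \<longrightarrow> s = 1" "z \<in> Pm b \<longrightarrow> s = -1"
      using bs[OF b(1), of z] by blast
    have zR: "z \<in> cball b (R b)" using b(2) r[OF b(1)] by (auto simp: J_def)
    have "(A z + B b z, Z z + \<zeta> b z) - ((A b, Z b) + s *\<^sub>R (- outer (D b *v v b) (v b), D b))
      = ((A z, Z z) - (A b, Z b)) + (B b z + s *\<^sub>R outer (D b *v v b) (v b), \<zeta> b z - s *\<^sub>R D b)" by simp
    then have "dist (A z + B b z, Z z + \<zeta> b z) ((A b, Z b) + s *\<^sub>R (- outer (D b *v v b) (v b), D b))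
      \<le> dist (A z, Z z) (A b, Z b) + norm (B b z + s *\<^sub>R outer (D b *v v b) (v b), \<zeta> b z - s *\<^sub>R D b)"
      unfolding dist_norm by (metis norm_triangle_ineq)
    also have "\<dots> < \<sigma> b / 2 + (\<epsilon> b + \<epsilon> b)"
      using ld1[OF bQ zR] norm_Pair_le[of "B b z + s *\<^sub>R outer (D b *v v b) (v b)" "\<zeta> b z - s *\<^sub>R D b"] s(2,3) by linarith
    also have "\<dots> \<le> \<sigma> b" using eps(2)[OF b(1)] ldD(8)[OF bQ] by linarith
    finally have "(A z + B b z, Z z + \<zeta> b z) \<in> U 1 \<and> (s = 1 \<longrightarrow> (A z + B b z, Z z + \<zeta> b z) \<in> U (e1 b)) \<and> (s = -1 \<longrightarrow> (A z + B b z, Z z + \<zeta> b z) \<in> U (e2 b))"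
      by (rule ld2[OF bQ s(1)])
    then have u: "(A z + BB z, Z z + ZZ z) \<in> U 1" "s = 1 \<Longrightarrow> (A z + BB z, Z z + ZZ z) \<in> U (e1 b)" "s = -1 \<Longrightarrow> (A z + BB z, Z z + ZZ z) \<in> U (e2 b)"
      using loc[OF b] by auto
    consider "z \<in> Pp b" "z \<notin> Pm b" | "z \<notin> Pp b" "z \<in> Pm b" | "z \<notin> Pp b" "z \<notin> Pm b" using bP(3)[OF b(1)] by blast
    then show ?thesis
    proof cases
      case 1 then show ?thesis using G'loc[OF b] u s(4) ldD(2,3)[OF bQ] by simp
    next
      case 2 then show ?thesis using G'loc[OF b] u s(5) ldD(4,5)[OF bQ] by simp
    next
      case 3 then show ?thesis using G'loc[OF b] u by simp
    qed
  qed
  \<comment> \<open>The resolved sets are closed, so their indicators do not increase near a given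
    point, and they enter \<open>G'\<close> with coefficients that are not positive.\<close>
  have G'lsc: "\<forall>\<^sub>F y in nhds z. G' z \<le> G' y" for z
  proof -
    have ev: "\<forall>\<^sub>F y in nhds z. (indicator C y :: real) \<le> indicator C z" if "closed C" for C
    proof (cases "z \<in> C")
      case False
      then have "\<forall>\<^sub>F y in nhds z. y \<in> - C" using that by (intro eventually_nhds_in_open) auto
      then show ?thesis by eventually_elim (simp add: False)
    qed (simp add: indicator_le_1)
    have "\<forall>\<^sub>F y in nhds z. \<forall>b\<in>F. (indicator (Pp b) y :: real) \<le> indicator (Pp b) z \<and> (indicator (Pm b) y :: real) \<le> indicator (Pm b) z"
      by (intro eventually_ball_finite F(1) ballI eventually_conj ev bP)
    then show ?thesis
    proof eventually_elim
      case (elim y)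
      have "(\<Sum>b\<in>F. (1 - e1 b) * indicator (Pp b) y + (1 - e2 b) * indicator (Pm b) y) \<le> (\<Sum>b\<in>F. (1 - e1 b) * indicator (Pp b) z + (1 - e2 b) * indicator (Pm b) z)"
        using elim ldD(3,5) FQ by (intro sum_mono add_mono mult_left_mono) auto
      then show ?case by (simp add: G'_def)
    qed
  qed
  have fI: "integrable lborel (\<lambda>z. indicator (X b) z :: real)" "X b \<subseteq> Q \<Longrightarrow> X b \<inter> Q = X b" if "X b \<in> sets borel" "X b \<subseteq> Q" for X :: "pt \<Rightarrow> pt set" and b
  proof -
    have "emeasure lborel (X b) \<le> emeasure lborel Q" by (rule emeasure_mono[OF that(2)]) (use Qs in simp)
    then have "emeasure lborel (X b) < \<infinity>" using Qs(2) by (rule order_le_less_trans)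
    then show "integrable lborel (\<lambda>z. indicator (X b) z :: real)" using that(1) by (intro integrable_real_indicator) auto
  qed auto
  have IQ: "I b \<subseteq> Q" "I b \<in> sets borel" "Pp b \<subseteq> Q" "Pm b \<subseteq> Q" "Pp b \<in> sets borel" "Pm b \<in> sets borel" if "b \<in> F" for b
    using IJ[OF that] JQ[OF that] bP[OF that] by (auto simp: I_def)
  have finJ: "emeasure lborel (cball b (r b)) < top" for b :: pt
    using emeasure_bounded_finite[OF bounded_cball[of b "r b"]] unfolding infinity_ennreal_def .
  have sumJ: "(\<Sum>b\<in>F. measure lborel (J b)) \<le> m"
  proof -
    have "(\<Sum>b\<in>F. measure lborel (J b)) = measure lborel (\<Union>b\<in>F. J b)"
    proof (rule measure_finite_Union[symmetric, OF F(1)])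
      show "J ` F \<subseteq> sets lborel" by (auto simp: J_def)
      show "disjoint_family_on J F" unfolding disjoint_family_on_def J_def using disj unfolding disjnt_def by blast
      show "emeasure lborel (J b) \<noteq> \<infinity>" if "b \<in> F" for b using finJ[of b] unfolding J_def infinity_ennreal_def by (rule less_imp_neq)
    qed
    also have "\<dots> \<le> m" unfolding m_def
      by (rule measure_mono_fmeasurable) (use SQ cS Qs in \<open>auto simp: S_def[symmetric] fmeasurable_def intro: borel_closed compact_imp_closed\<close>)
    finally show ?thesis .
  qed
  define a where "a = (\<Sum>b\<in>F. measure lborel (I b))"
  have aJ: "a \<le> m"
  proof -
    have "a \<le> (\<Sum>b\<in>F. measure lborel (J b))" unfolding a_def
    proof (rule sum_mono)
      fix b assume "b \<in> F"
      then show "measure lborel (I b) \<le> measure lborel (J b)"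
        by (intro measure_mono_fmeasurable[OF IJ]) (simp_all add: I_def J_def fmeasurable_def finJ del: less_top)
    qed
    then show ?thesis using sumJ by simp
  qed
  have ma: "m - a \<le> \<eta> + \<eta> * m"
  proof -
    have "(Q - S) \<union> S = Q" using SQ by blast
    then have "m \<le> measure lborel ((Q - S) \<union> S)" by (simp add: m_def)
    also have "\<dots> \<le> measure lborel (Q - S) + measure lborel S"
      by (rule measure_Un_le) (use cS Qs in \<open>auto intro: borel_closed compact_imp_closed\<close>)
    also have "measure lborel S \<le> (\<Sum>b\<in>F. measure lborel (J b))" unfolding S_def
      by (rule measure_UNION_le[OF F(1)]) (auto simp: J_def)
    finally have 1: "m \<le> \<eta> + (\<Sum>b\<in>F. measure lborel (J b))" using cov by (simp add: S_def J_def)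
    have "(\<Sum>b\<in>F. (1 - \<eta>) * measure lborel (J b)) \<le> a" unfolding a_def by (rule sum_mono) (rule mI)
    then have "(1 - \<eta>) * (\<Sum>b\<in>F. measure lborel (J b)) \<le> a" by (simp add: sum_distrib_left)
    moreover have "\<eta> * (\<Sum>b\<in>F. measure lborel (J b)) \<le> \<eta> * m" using sumJ eta(1) by (intro mult_left_mono) auto
    ultimately show ?thesis using 1 by (simp add: algebra_simps)
  qed
  define gG where "gG = (\<integral>z. indicator Q z * G z \<partial>lborel)"
  have iG: "integrable lborel (\<lambda>z. indicator Q z * G z)"
    by (rule integrable_bounded_on[OF G Qs, of 1]) (use GU in \<open>auto simp: abs_le_iff\<close>, use GU in fastforce)
  \<comment> \<open>A lower Riemann sum: on the ball around \<open>b\<close> the function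
    \<open>G\<close> stays above \<open>G b\<close>. This is where the local minimality condition
    carried along with \<open>G\<close> is used.\<close>
  have sG: "(\<Sum>b\<in>F. G b * measure lborel (I b)) \<le> gG"
  proof -
    have "(\<Sum>b\<in>F. G b * measure lborel (I b)) = (\<integral>z. (\<Sum>b\<in>F. G b * indicator (I b) z) \<partial>lborel)"
      using fI(1)[of I] IQ by (subst Bochner_Integration.integral_sum) (auto simp: I_def)
    also have "\<dots> \<le> gG" unfolding gG_def
    proof (rule integral_mono[OF _ iG])
      show "integrable lborel (\<lambda>z. \<Sum>b\<in>F. G b * indicator (I b) z)"
        using fI(1)[of I] IQ by (intro Bochner_Integration.integrable_sum integrable_mult_right) auto
      fix z
      show "(\<Sum>b\<in>F. G b * indicator (I b) z) \<le> indicator Q z * G z"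
      proof (cases "\<exists>b\<in>F. z \<in> I b")
        case True
        then obtain b where b: "b \<in> F" "z \<in> I b" by blast
        have zJ: "z \<in> J b" using IJ b by blast
        have "(\<Sum>b\<in>F. G b * indicator (I b) z) = G b * indicator (I b) z"
        proof (rule sum_single[OF F(1) b(1)])
          fix b' assume b': "b' \<in> F" "b' \<noteq> b"
          then show "G b' * indicator (I b') z = 0" using notJ[OF b(1) b' zJ] IJ[OF b'(1)] by (auto simp: indicator_def)
        qed
        moreover have "G b \<le> G z" using ld1[OF FQ[OF b(1)], of z] zJ r[OF b(1)] by (auto simp: J_def)
        moreover have "z \<in> Q" using JQ[OF b(1)] zJ by blast
        ultimately show ?thesis using b by simp
      next
        case False
        then have "(\<Sum>b\<in>F. G b * indicator (I b) z) = 0" by (intro sum.neutral) auto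
        moreover have "0 \<le> indicator Q z * G z" using GU[of z] by (auto simp: indicator_def intro: less_imp_le)
        ultimately show ?thesis by simp
      qed
    qed
    finally show ?thesis .
  qed
  have iG': "(\<integral>z. indicator Q z * G' z \<partial>lborel) \<le> 199/200 * gG + \<delta>"
  proof -
    have e: "indicator Q z * G' z = indicator Q z - (\<Sum>b\<in>F. (1 - e1 b) * indicator (Pp b) z + (1 - e2 b) * indicator (Pm b) z)" for z
    proof (cases "z \<in> Q")
      case False
      then have "(\<Sum>b\<in>F. (1 - e1 b) * indicator (Pp b) z + (1 - e2 b) * indicator (Pm b) z) = 0"
      proof (intro sum.neutral ballI)
        fix b assume "b \<in> F"
        then have "z \<notin> Pp b" "z \<notin> Pm b" using IQ(3,4)[of b] False by blast+
        then show "(1 - e1 b) * indicator (Pp b) z + (1 - e2 b) * indicator (Pm b) z = 0" by simp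
      qed
      then show ?thesis using False by simp
    qed (simp add: G'_def)
    have iP: "integrable lborel (\<lambda>z. (1 - e1 b) * indicator (Pp b) z + (1 - e2 b) * indicator (Pm b) z)" if "b \<in> F" for b
      using fI(1)[of Pp b] fI(1)[of Pm b] IQ[OF that] by (intro Bochner_Integration.integrable_add integrable_mult_right) auto
    have "(\<integral>z. indicator Q z * G' z \<partial>lborel) = (\<integral>z. indicator Q z - (\<Sum>b\<in>F. (1 - e1 b) * indicator (Pp b) z + (1 - e2 b) * indicator (Pm b) z) \<partial>lborel)"
      using e by simp
    also have "\<dots> = (\<integral>z. indicator Q z \<partial>lborel) - (\<integral>z. (\<Sum>b\<in>F. (1 - e1 b) * indicator (Pp b) z + (1 - e2 b) * indicator (Pm b) z) \<partial>lborel)"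
      using Qs iP by (intro Bochner_Integration.integral_diff Bochner_Integration.integrable_sum) (auto intro!: integrable_real_indicator)
    also have "(\<integral>z. (\<Sum>b\<in>F. (1 - e1 b) * indicator (Pp b) z + (1 - e2 b) * indicator (Pm b) z) \<partial>lborel)
      = (\<Sum>b\<in>F. (1 - e1 b) * measure lborel (Pp b) + (1 - e2 b) * measure lborel (Pm b))"
      using iP fI(1)[of Pp] fI(1)[of Pm] IQ by (subst Bochner_Integration.integral_sum) (auto intro!: sum.cong)
    finally have v: "(\<integral>z. indicator Q z * G' z \<partial>lborel) = m - (\<Sum>b\<in>F. (1 - e1 b) * measure lborel (Pp b) + (1 - e2 b) * measure lborel (Pm b))"
      using Qs by (simp add: m_def)
    have "(\<Sum>b\<in>F. measure lborel (I b) - ((199/200) * (G b * measure lborel (I b)) + \<eta> * measure lborel (I b)))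
      \<le> (\<Sum>b\<in>F. (1 - e1 b) * measure lborel (Pp b) + (1 - e2 b) * measure lborel (Pm b))"
    proof (rule sum_mono)
      fix b assume b: "b \<in> F"
      have "((e1 b + e2 b) / 2 + \<eta>) * measure lborel (I b) \<le> (199/200 * G b + \<eta>) * measure lborel (I b)"
        using ldD(6)[OF FQ[OF b]] by (intro mult_right_mono) auto
      also have "\<dots> = (199/200) * (G b * measure lborel (I b)) + \<eta> * measure lborel (I b)" by (simp add: algebra_simps)
      finally show "measure lborel (I b) - ((199/200) * (G b * measure lborel (I b)) + \<eta> * measure lborel (I b))
        \<le> (1 - e1 b) * measure lborel (Pp b) + (1 - e2 b) * measure lborel (Pm b)" using bm[OF b] by linarith
    qed
    moreover have "(\<Sum>b\<in>F. measure lborel (I b) - ((199/200) * (G b * measure lborel (I b)) + \<eta> * measure lborel (I b)))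
      = a - ((199/200) * (\<Sum>b\<in>F. G b * measure lborel (I b)) + \<eta> * a)"
      unfolding a_def by (simp only: sum_subtractf sum.distrib sum_distrib_left)
    ultimately have "(\<integral>z. indicator Q z * G' z \<partial>lborel) \<le> (m - a) + (199/200) * gG + \<eta> * a" using v sG by linarith
    moreover have "\<eta> * a \<le> \<eta> * m" using aJ eta(1) by (intro mult_left_mono) auto
    moreover have "\<eta> + \<eta> * m + \<eta> * m \<le> 20000 * (\<eta> * (m + 1))"
    proof -
      have "0 \<le> \<eta> * m" using eta(1) m0 by simp
      then show ?thesis using eta(1) by (simp add: algebra_simps)
    qed
    ultimately show ?thesis using ma eta(4) by linarith
  qed
  \<comment> \<open>On the inner balls the spatial Lipschitz bound is \<open>2 * 6400\<close> times
    the level plus a small error. Elsewhere only the crude bound \<open>2 * 6500\<close> is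
    available, on a set of small measure.\<close>
  define N where "N z = (if z \<in> (\<Union>b\<in>F. I b) then 12800 * G z + 3 * \<eta> else 13000)" for z
  have UI: "(\<Union>b\<in>F. I b) \<in> sets borel" using IQ(2) F(1) by (intro sets.finite_UN) auto
  have mN: "N \<in> borel_measurable borel" unfolding N_def[abs_def]
    using G UI by (intro measurable_If_set borel_measurable_add borel_measurable_times borel_measurable_const) auto
  have Nz: "0 \<le> N z" "N z \<le> 13000" if "z \<in> Q" for z
    using GU[OF that] eta(1,3) by (auto simp: N_def)
  have Lip: "norm (VV (y, snd z) - VV z) \<le> 13000 * norm (y - fst z)" for y z
    using pert_diff_bound[OF P, of "fst z" y "snd z" 6500] gB(1) by simp
  have Nprop: "norm (ZZ z) \<le> N z \<and> norm (BB z) \<le> N z \<and> (\<forall>y. norm (VV (y, snd z) - VV z) \<le> N z * norm (y - fst z))" if "z \<in> Q" for z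
  proof (cases "z \<in> (\<Union>b\<in>F. I b)")
    case False
    then have "N z = 13000" by (simp only: N_def if_False)
    then show ?thesis using gB[of z] Lip[of _ z] by (auto intro: order_trans)
  next
    case True
    then obtain b where b: "b \<in> F" "z \<in> I b" by blast
    have zJ: "z \<in> J b" using IJ b by blast
    have Gz: "G b \<le> G z" using ld1[OF FQ[OF b(1)], of z] zJ r[OF b(1)] by (auto simp: J_def)
    have Nv: "N z = 12800 * G z + 3 * \<eta>" using True by (simp only: N_def if_True)
    have n1: "norm (ZZ z) \<le> N z" "norm (BB z) \<le> N z"
      using loc[OF b(1) zJ] bBn[OF b(1), of z] Gz Gb1[OF b(1)] eps(3)[OF b(1)] eta(1) unfolding Nv by auto
    have "norm (VV (y, snd z) - VV z) \<le> N z * norm (y - fst z)" for y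
    proof (cases "(y, snd z) \<in> J b")
      case yJ: True
      have "norm (VV (y, snd z) - VV (fst z, snd z)) \<le> 2 * (6400 * G b + \<epsilon> b) * norm (y - fst z)"
      proof (rule pert_diff_bound[OF P])
        fix s :: real assume s: "0 \<le> s" "s \<le> 1"
        have cv: "convex (J b)" by (simp add: J_def)
        have "(1 - s) *\<^sub>R z + s *\<^sub>R (y, snd z) \<in> J b" using convexD_alt[OF cv zJ yJ s] .
        moreover have "(1 - s) *\<^sub>R z + s *\<^sub>R (y, snd z) = (fst z + s *\<^sub>R (y - fst z), snd z)"
          by (simp add: prod_eq_iff algebra_simps)
        ultimately have "(fst z + s *\<^sub>R (y - fst z), snd z) \<in> J b" by simp
        then show "norm (BB (fst z + s *\<^sub>R (y - fst z), snd z)) \<le> 6400 * G b + \<epsilon> b" using loc(2)[OF b(1)] bBn(1)[OF b(1)] by simp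
      qed
      also have "\<dots> \<le> N z * norm (y - fst z)" unfolding Nv using Gz eps(3)[OF b(1)] eta(1) by (intro mult_right_mono) auto
      finally show ?thesis by simp
    next
      case yJ: False
      have bnd: "norm (VV p) \<le> e0" for p
      proof (cases "p \<in> S")
        case True
        then obtain b' where b': "b' \<in> F" "p \<in> J b'" by (auto simp: S_def)
        show ?thesis using loc(1)[OF b'] bV(1)[OF b'(1), of p] eps(4)[OF b'(1)] by simp
      qed (use out e0(1) in simp)
      have "dist b (y, snd z) \<le> dist b z + dist z (y, snd z)" by (rule dist_triangle)
      moreover have "dist z (y, snd z) = norm (y - fst z)" by (cases z) (simp add: dist_Pair_Pair dist_norm norm_minus_commute)
      moreover have "dist b z \<le> \<rho> b" "r b < dist b (y, snd z)" using b(2) yJ by (auto simp: I_def J_def)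
      ultimately have "r b - \<rho> b \<le> norm (y - fst z)" by linarith
      then have "\<eta> * (r b - \<rho> b) \<le> \<eta> * norm (y - fst z)" using eta(1) by (intro mult_left_mono) auto
      moreover have "norm (VV (y, snd z) - VV z) \<le> e0 + e0"
        using norm_triangle_ineq4[of "VV (y, snd z)" "VV z"] bnd[of "(y, snd z)"] bnd[of z] by linarith
      ultimately have "norm (VV (y, snd z) - VV z) \<le> \<eta> * norm (y - fst z)" using e0(2)[OF b(1)] by linarith
      also have "\<dots> \<le> N z * norm (y - fst z)" unfolding Nv using GU[OF that] eta(1) by (intro mult_right_mono) auto
      finally show ?thesis .
    qed
    then show ?thesis using n1 by blast
  qed
  have sb: "norm (\<Sum>b\<in>F. f b) \<le> \<delta>" if "\<And>b. b \<in> F \<Longrightarrow> norm (f b) \<le> \<epsilon> b" for f :: "pt \<Rightarrow> 'c::real_normed_vector"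
    using sum_norm_le[of F f \<epsilon>] that sumeps by fastforce
  have nV: "norm (VV z) \<le> \<delta>" "norm (TT z) \<le> \<delta>" for z unfolding VV_def TT_def by (rule sb, rule bV, assumption)+
  have iN: "(\<integral>z. indicator Q z * N z \<partial>lborel) \<le> 12800 * gG + \<delta>"
  proof -
    have i1: "integrable lborel (indicator Q :: pt \<Rightarrow> real)" using Qs by (intro integrable_real_indicator) auto
    have i2: "integrable lborel (\<lambda>z. \<Sum>b\<in>F. indicator (I b) z :: real)"
      using fI(1)[of I] IQ by (intro Bochner_Integration.integrable_sum) auto
    have "(\<integral>z. indicator Q z * N z \<partial>lborel) \<le> (\<integral>z. (12800 * (indicator Q z * G z) + 3 * \<eta> * indicator Q z)
        + 13000 * (indicator Q z - (\<Sum>b\<in>F. indicator (I b) z)) \<partial>lborel)"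
    proof (rule integral_mono)
      show "integrable lborel (\<lambda>z. indicator Q z * N z)"
        by (rule integrable_bounded_on[OF mN Qs, of 13000]) (use Nz in auto)
      show "integrable lborel (\<lambda>z. (12800 * (indicator Q z * G z) + 3 * \<eta> * indicator Q z)
        + 13000 * (indicator Q z - (\<Sum>b\<in>F. indicator (I b) z)))"
        using iG i1 i2 by (intro Bochner_Integration.integrable_add Bochner_Integration.integrable_diff integrable_mult_right)
      fix z
      have le1: "(\<Sum>b\<in>F. indicator (I b) z) = (if z \<in> (\<Union>b\<in>F. I b) then 1 else 0 :: real)"
      proof (cases "z \<in> (\<Union>b\<in>F. I b)")
        case True
        then obtain b where b: "b \<in> F" "z \<in> I b" by blast
        have "(\<Sum>b\<in>F. indicator (I b) z :: real) = indicator (I b) z"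
        proof (rule sum_single[OF F(1) b(1)])
          fix b' assume b': "b' \<in> F" "b' \<noteq> b"
          have "z \<in> J b" using IJ[OF b(1)] b(2) by blast
          from notJ[OF b(1) b' this] have "z \<notin> I b'" using IJ[OF b'(1)] by blast
          then show "indicator (I b') z = (0::real)" by simp
        qed
        then show ?thesis using True b(2) by simp
      qed (auto intro!: sum.neutral simp: indicator_def)
      have nQ: "z \<notin> Q \<Longrightarrow> z \<notin> (\<Union>b\<in>F. I b)" using IQ(1) by blast
      show "indicator Q z * N z \<le> (12800 * (indicator Q z * G z) + 3 * \<eta> * indicator Q z)
        + 13000 * (indicator Q z - (\<Sum>b\<in>F. indicator (I b) z))"
      proof (cases "z \<in> Q")
        case True
        then show ?thesis using GU[OF True] eta(1) unfolding le1 N_def by (cases "z \<in> (\<Union>b\<in>F. I b)") (simp_all only: if_True if_False, simp_all)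
      next
        case False
        then show ?thesis using nQ[OF False] unfolding le1 by simp
      qed
    qed
    also have "\<dots> = 12800 * gG + 3 * \<eta> * m + 13000 * (m - a)"
    proof -
      have "(\<integral>z. (\<Sum>b\<in>F. indicator (I b) z :: real) \<partial>lborel) = a"
        using fI(1)[of I] IQ by (subst Bochner_Integration.integral_sum) (auto simp: a_def I_def)
      moreover have "(\<integral>z. (indicator Q z :: real) \<partial>lborel) = m" using Qs by (simp add: m_def)
      ultimately show ?thesis using iG i1 i2
        by (simp add: gG_def)
    qed
    also have "\<dots> \<le> 12800 * gG + \<delta>"
    proof -
      define x where "x = \<eta> * m"
      have x: "0 \<le> x" "20000 * \<eta> + 20000 * x \<le> \<delta>" "m - a \<le> \<eta> + x"
        using eta(1,4) m0 ma by (auto simp: x_def algebra_simps)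
      have eq: "3 * \<eta> * m = 3 * x" by (simp add: x_def)
      have nn: "0 \<le> 7000 * \<eta> + 6997 * x" using x(1) eta(1) by (intro add_nonneg_nonneg mult_nonneg_nonneg) auto
      have eq2: "20000 * \<eta> + 20000 * x = (3 * x + 13000 * (\<eta> + x)) + (7000 * \<eta> + 6997 * x)" by (simp add: algebra_simps)
      have "3 * x + 13000 * (\<eta> + x) \<le> 20000 * \<eta> + 20000 * x" unfolding eq2 by (rule add_increasing2[OF nn order_refl])
      also note x(2)
      finally have k: "3 * x + 13000 * (\<eta> + x) \<le> \<delta>" .
      have "12800 * gG + 3 * x + 13000 * (m - a) \<le> 12800 * gG + 3 * x + 13000 * (\<eta> + x)"
        by (intro add_left_mono mult_left_mono x(3)) simp
      also have "\<dots> = 12800 * gG + (3 * x + 13000 * (\<eta> + x))" by (rule add.assoc)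
      also have "\<dots> \<le> 12800 * gG + \<delta>" using k by (rule add_left_mono)
      finally show ?thesis unfolding eq .
    qed
    finally show ?thesis .
  qed
  have ph: "norm (\<integral>z. \<phi> j z *\<^sub>R ZZ z \<partial>lborel) \<le> \<delta>" if "j < n" for j
  proof -
    have c: "integrable lborel (\<lambda>z. \<phi> j z *\<^sub>R \<zeta> b z)" if "b \<in> F" for b
      by (rule integrable_continuous_compact_support[where S = "J b"])
        (use zero(4)[OF that] pertD(4)[OF bp[OF that]] has_derivative_continuous_UNIV[OF phi(1)] in \<open>auto simp: J_def intro!: continuous_on_scaleR\<close>)
    have "(\<integral>z. \<phi> j z *\<^sub>R ZZ z \<partial>lborel) = (\<Sum>b\<in>F. \<integral>z. \<phi> j z *\<^sub>R \<zeta> b z \<partial>lborel)"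
      unfolding ZZ_def scaleR_sum_right by (rule Bochner_Integration.integral_sum[OF c])
    then show ?thesis using sb[of "\<lambda>b. \<integral>z. \<phi> j z *\<^sub>R \<zeta> b z \<partial>lborel"] bphi[OF _ that] by simp
  qed
  show ?thesis
    apply (rule exI[of _ S], rule exI[of _ VV], rule exI[of _ BB], rule exI[of _ TT], rule exI[of _ ZZ], rule exI[of _ G'], rule exI[of _ N])
    using cS SQ P nV mG' G'U G'lsc iG'[unfolded gG_def] mN Nz Nprop iN[unfolded gG_def] ph
    by (intro conjI allI ballI impI) simp_all
qed

end

section \<open>Limits of sequences with summable increments\<close>

text \<open>The sum of the functions has a finite integral, so it is finite almost everywhere. It
  turns the geometric decay of integrals into convergence of gradients at almost every
  point.\<close>

lemma AE_summable:
  fixes f :: "nat \<Rightarrow> 'a \<Rightarrow> real"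
  assumes f: "\<And>k. integrable M (f k)" "\<And>k x. 0 \<le> f k x" and s: "summable (\<lambda>k. \<integral>x. f k x \<partial>M)"
  shows "AE x in M. summable (\<lambda>k. f k x)"
proof -
  have m [measurable]: "(\<lambda>x. ennreal (f k x)) \<in> borel_measurable M" for k
    by (rule measurable_compose[OF borel_measurable_integrable[OF f(1)] measurable_ennreal])
  have "(\<integral>\<^sup>+x. (\<Sum>k. ennreal (f k x)) \<partial>M) = (\<Sum>k. \<integral>\<^sup>+x. ennreal (f k x) \<partial>M)"
    by (rule nn_integral_suminf) (rule m)
  also have "\<dots> = (\<Sum>k. ennreal (\<integral>x. f k x \<partial>M))"
    by (intro suminf_cong nn_integral_eq_integral f AE_I2)
  also have "\<dots> \<noteq> \<infinity>"
    unfolding infinity_ennreal_def by (rule ennreal_suminf_neq_top[OF s]) (intro integral_nonneg_AE AE_I2 f)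
  finally have "AE x in M. (\<Sum>k. ennreal (f k x)) \<noteq> \<infinity>"
    by (intro nn_integral_PInf_AE) measurable
  then show ?thesis
    by eventually_elim (rule summable_suminf_not_top, use f(2) in auto)
qed

lemma increments_converge:
  fixes a :: "nat \<Rightarrow> 'a::banach"
  assumes "\<And>k. norm (a (Suc k) - a k) \<le> c k" "summable c"
  shows "a \<longlonglongrightarrow> lim a"
proof -
  have "summable (\<lambda>k. a (Suc k) - a k)" by (rule summable_comparison_test'[OF assms(2)]) (rule assms(1))
  then have "(\<lambda>n. a 0 + (\<Sum>k<n. a (Suc k) - a k)) \<longlonglongrightarrow> a 0 + (\<Sum>k. a (Suc k) - a k)"
    by (intro tendsto_add tendsto_const summable_LIMSEQ)
  then have "a \<longlonglongrightarrow> a 0 + (\<Sum>k. a (Suc k) - a k)" by (simp add: sum_lessThan_telescope)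
  then show ?thesis using limI by metis
qed

lemma increments_tail_bound:
  fixes a :: "nat \<Rightarrow> 'a::real_normed_vector"
  assumes i: "\<And>k. norm (a (Suc k) - a k) \<le> c k" and c: "summable c" and l: "a \<longlonglongrightarrow> l"
  shows "norm (l - a K) \<le> (\<Sum>k. c (k + K))"
proof (rule LIMSEQ_le_const2)
  show "(\<lambda>n. norm (a (n + K) - a K)) \<longlonglongrightarrow> norm (l - a K)"
    by (intro tendsto_norm tendsto_diff tendsto_const LIMSEQ_ignore_initial_segment l)
  have c0: "0 \<le> c k" for k using i[of k] norm_ge_zero order_trans by blast
  have 1: "norm (a (n + K) - a K) \<le> (\<Sum>k<n. c (k + K))" for n
  proof (induction n)
    case (Suc n)
    have "norm (a (Suc n + K) - a K) \<le> norm (a (Suc (n + K)) - a (n + K)) + norm (a (n + K) - a K)"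
      using norm_triangle_ineq[of "a (Suc (n + K)) - a (n + K)" "a (n + K) - a K"] by simp
    then show ?case using Suc i[of "n + K"] by simp
  qed simp
  have 2: "(\<Sum>k<n. c (k + K)) \<le> (\<Sum>k. c (k + K))" for n
    by (rule sum_le_suminf) (use summable_ignore_initial_segment[OF c] c0 in auto)
  show "\<exists>N. \<forall>n\<ge>N. norm (a (n + K) - a K) \<le> (\<Sum>k. c (k + K))"
    by (intro exI[of _ 0] allI impI) (rule order_trans[OF 1 2])
qed

text \<open>Termwise differentiation at one fixed point. Uniform convergence of the derivatives near
  \<open>x\<close> is replaced by summable bounds for the difference quotients based at
  \<open>x\<close>: after index \<open>K\<close> all remaining increments together have a small
  quotient, and \<open>f K\<close> itself is differentiable.\<close>

lemma has_derivative_limit_increments: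
  fixes f :: "nat \<Rightarrow> real^2 \<Rightarrow> real^2" and B :: "nat \<Rightarrow> mat2"
  assumes d: "\<And>k. (f k has_derivative (\<lambda>h. B k *v h)) (at x)"
    and i: "\<And>k y. norm ((f (Suc k) y - f k y) - (f (Suc k) x - f k x)) \<le> N k * norm (y - x)"
    and b: "\<And>k. norm (B (Suc k) - B k) \<le> N k" and N: "summable N"
    and lim: "\<And>y. (\<lambda>k. f k y) \<longlonglongrightarrow> g y" "B \<longlonglongrightarrow> B'"
  shows "(g has_derivative (\<lambda>h. B' *v h)) (at x)"
  unfolding has_derivative_at_alt
proof (intro conjI allI impI)
  show "bounded_linear (\<lambda>h. B' *v h)" by (rule matrix_vector_mul_bounded_linear)
  fix e :: real assume e: "e > 0"
  have e4: "e / 4 > 0" using e by simp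
  obtain K where K: "\<And>n. n \<ge> K \<Longrightarrow> norm (\<Sum>k. N (k + n)) < e / 4" using suminf_exist_split[OF e4 N] by blast
  define t where "t = (\<Sum>k. N (k + K))"
  have t: "t < e / 4" using K[of K] by (simp add: t_def)
  have B: "norm (B' - B K) \<le> t" unfolding t_def by (rule increments_tail_bound[OF b N lim(2)])
  have g: "norm ((g y - g x) - (f K y - f K x)) \<le> t * norm (y - x)" for y
  proof -
    have 1: "norm ((f (Suc k) y - f (Suc k) x) - (f k y - f k x)) \<le> N k * norm (y - x)" for k
      using i[of k y] by (simp add: algebra_simps)
    have 2: "(\<lambda>k. f k y - f k x) \<longlonglongrightarrow> g y - g x" by (rule tendsto_diff[OF lim(1) lim(1)])
    have "norm ((g y - g x) - (f K y - f K x)) \<le> (\<Sum>k. N (k + K) * norm (y - x))"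
      by (rule increments_tail_bound[where a = "\<lambda>k. f k y - f k x" and c = "\<lambda>k. N k * norm (y - x)", OF 1 summable_mult2[OF N] 2])
    then show ?thesis using suminf_mult2[OF summable_ignore_initial_segment[OF N, of K], of "norm (y - x)"] by (simp add: t_def)
  qed
  obtain \<delta> where dl: "\<delta> > 0" "\<And>y. norm (y - x) < \<delta> \<Longrightarrow> norm (f K y - f K x - B K *v (y - x)) \<le> e / 4 * norm (y - x)"
    using d[of K, unfolded has_derivative_at_alt] e4 by blast
  have "norm (g y - g x - B' *v (y - x)) \<le> e * norm (y - x)" if y: "norm (y - x) < \<delta>" for y
  proof -
    have "g y - g x - B' *v (y - x) = ((g y - g x) - (f K y - f K x)) + (f K y - f K x - B K *v (y - x)) - (B' - B K) *v (y - x)"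
      by (simp add: matrix_vector_mult_diff_rdistrib)
    then have "norm (g y - g x - B' *v (y - x)) \<le> norm ((g y - g x) - (f K y - f K x)) + norm (f K y - f K x - B K *v (y - x)) + norm ((B' - B K) *v (y - x))"
      using norm_triangle_ineq4[of "((g y - g x) - (f K y - f K x)) + (f K y - f K x - B K *v (y - x))" "(B' - B K) *v (y - x)"]
        norm_triangle_ineq[of "(g y - g x) - (f K y - f K x)" "f K y - f K x - B K *v (y - x)"] by (simp only:)
    also have "\<dots> \<le> t * norm (y - x) + e / 4 * norm (y - x) + 2 * t * norm (y - x)"
      using g[of y] dl(2)[OF y] norm_mv_le[of "B' - B K" "y - x"] mult_right_mono[OF B, of "norm (y - x)"] by simp
    also have "\<dots> = (3 * t + e / 4) * norm (y - x)" by (simp add: algebra_simps)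
    also have "\<dots> \<le> e * norm (y - x)" using t by (intro mult_right_mono) auto
    finally show ?thesis .
  qed
  then show "\<exists>\<delta>>0. \<forall>y. norm (y - x) < \<delta> \<longrightarrow> norm (g y - g x - B' *v (y - x)) \<le> e * norm (y - x)" using dl(1) by blast
qed

lemma null_sets_lborel_imp_negligible: "N \<in> null_sets lborel \<Longrightarrow> negligible N"
  by (simp add: negligible_iff_null_sets null_sets_completionI)

lemma integral_pos_continuous:
  fixes f :: "'a::euclidean_space \<Rightarrow> real"
  assumes c: "continuous_on UNIV f" and i: "integrable lborel f" and n: "\<And>x. 0 \<le> f x" and a: "0 < f a"
  shows "0 < (\<integral>x. f x \<partial>lborel)"
proof (rule ccontr)
  assume "\<not> ?thesis"
  moreover have "0 \<le> (\<integral>x. f x \<partial>lborel)" by (simp add: n)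
  ultimately have "(\<integral>x. f x \<partial>lborel) = 0" by linarith
  then have "AE x in lborel. f x = 0" using integral_nonneg_eq_0_iff_AE[OF i] n by simp
  then have "AE x in lborel. \<not> 0 < f x" by eventually_elim simp
  moreover have o: "open {x. 0 < f x}" by (rule open_Collect_less[OF continuous_on_const c])
  ultimately have "{x. 0 < f x} \<in> null_sets lborel" by (subst (asm) AE_iff_null) auto
  then have "negligible {x. 0 < f x}" by (rule null_sets_lborel_imp_negligible)
  then show False using open_not_negligible[OF o] a by auto
qed

text \<open>Connects the gauge integral of the weak formulation with Lebesgue integrals. The
  integrand \<open>f\<close> may take arbitrary values on a null set, as happens with
  \<open>Dx u\<close> where \<open>u\<close> has no spatial derivative.\<close>

lemma integral_cong_AE_lborel:
  fixes h f :: "'a::euclidean_space \<Rightarrow> real"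
  assumes h: "integrable lborel h" and Q: "Q \<in> sets borel" and z: "\<And>z. z \<notin> Q \<Longrightarrow> h z = 0"
    and ae: "AE z in lborel. z \<in> Q \<longrightarrow> f z = h z"
  shows "integral Q f = (\<integral>z. h z \<partial>lborel)"
proof -
  have e: "(\<lambda>z. indicator Q z *\<^sub>R h z) = h" using z by (auto simp: indicator_def fun_eq_iff)
  have s: "set_integrable lborel Q h" unfolding set_integrable_def e by (rule h)
  obtain N where N: "{x \<in> space lborel. \<not> (x \<in> Q \<longrightarrow> f x = h x)} \<subseteq> N" "emeasure lborel N = 0" "N \<in> sets lborel"
    by (rule AE_E[OF ae])
  have "negligible N" using N(2,3) by (intro null_sets_lborel_imp_negligible) auto
  then have "integral Q f = integral Q h" by (rule integral_spike) (use N(1) in auto)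
  also have "\<dots> = (\<integral>z. h z \<partial>lborel)" using set_borel_integral_eq_integral(2)[OF s] by (simp only: set_lebesgue_integral_def e)
  finally show ?thesis .
qed

lemma integral_indicator_Icc:
  fixes f :: "real \<Rightarrow> real"
  assumes "continuous_on {a..b} f"
  shows "(\<integral>s. indicator {a..b} s * f s \<partial>lborel) = integral {a..b} f"
proof -
  have "set_integrable lborel {a..b} f" unfolding set_integrable_def by (rule borel_integrable_compact[OF compact_Icc assms])
  from set_borel_integral_eq_integral(2)[OF this] show ?thesis by (simp add: set_lebesgue_integral_def)
qed

section \<open>Integral identities on a space-time slab\<close>

lemma spatial_support_deriv:
  fixes \<psi> :: "pt \<Rightarrow> real^2"
  assumes "\<And>z. (\<psi> has_derivative \<psi>' z) (at z)" "compact K" "\<And>x t. x \<notin> K \<Longrightarrow> \<psi> (x, t) = 0" "fst z \<notin> K"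
  shows "\<psi>' z y = 0"
proof (rule deriv_outside_support[OF assms(1)])
  show "closed (K \<times> (UNIV :: real set))" by (intro closed_Times compact_imp_closed assms(2) closed_UNIV)
  show "\<psi> z = 0" if "z \<notin> K \<times> UNIV" for z using assms(3)[of "fst z" "snd z"] that by (cases z) auto
  show "z \<notin> K \<times> UNIV" using assms(4) by (cases z) auto
qed

text \<open>The weak form of the fact that the integral of \<open>g (x - s e)\<close> over
  \<open>s\<close> in \<open>[0, R]\<close> has derivative \<open>g x - g (x - R e)\<close> along
  \<open>e\<close>. For a merely continuous \<open>g\<close> the derivative is put on
  \<open>\<psi>\<close>: exchange the integrals, translate by \<open>s e\<close>, and integrate the
  derivative of \<open>\<psi>\<close> along the segment.\<close>

lemma slab_shift:
  fixes \<psi> :: "pt \<Rightarrow> real^2" and g :: "real^2 \<Rightarrow> real^2" and e :: "real^2"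
  assumes d: "\<And>z. (\<psi> has_derivative \<psi>' z) (at z)" and c: "\<And>y. continuous_on UNIV (\<lambda>z. \<psi>' z y)"
    and K: "compact K" "\<And>x t. x \<notin> K \<Longrightarrow> \<psi> (x, t) = 0" and g: "continuous_on UNIV g" and R: "0 \<le> R"
  shows "(\<integral>z. indicator {0..T} (snd z) * (integral {0..R} (\<lambda>s. g (fst z - s *\<^sub>R e)) \<bullet> \<psi>' z (e, 0)) \<partial>lborel)
    = (\<integral>z. indicator {0..T} (snd z) * (g (fst z) \<bullet> (\<psi> (fst z + R *\<^sub>R e, snd z) - \<psi> z)) \<partial>lborel)"
proof -
  obtain M where M: "\<And>x. x \<in> K \<Longrightarrow> norm x \<le> M" using compact_imp_bounded[OF K(1)] unfolding bounded_iff by blast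
  \<comment> \<open>Large enough to contain every point with a translate by \<open>s e\<close>,
    \<open>0 \<le> s \<le> R\<close>, in the support of \<open>\<psi>\<close>, so that all
    integrands live on a compact set and Fubini applies.\<close>
  define C :: "(real^2) set" where "C = cball 0 (\<bar>M\<bar> + R * norm e)"
  have KC: "x \<in> C" if "x + s *\<^sub>R e \<in> K" "0 \<le> s" "s \<le> R" for x s
  proof -
    have "norm x \<le> norm (x + s *\<^sub>R e) + norm (s *\<^sub>R e)" using norm_triangle_ineq4[of "x + s *\<^sub>R e" "s *\<^sub>R e"] by simp
    moreover have "norm (s *\<^sub>R e) \<le> R * norm e" using that(2,3) by (simp add: mult_right_mono)
    ultimately show ?thesis using M[OF that(1)] by (simp add: C_def)
  qed
  have KC0: "x \<in> C" if "x \<in> K" for x using KC[of x 0] that R by simp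
  have z0: "\<psi>' z y = 0" if "fst z \<notin> K" for z y by (rule spatial_support_deriv[OF d K that])
  define D :: "pt \<Rightarrow> real \<Rightarrow> real" where "D z s = indicator (C \<times> {0..T}) z * indicator {0..R} s" for z s
  have fub: "(\<integral>s. (\<integral>z. D z s * h z s \<partial>lborel) \<partial>lborel) = (\<integral>z. (\<integral>s. D z s * h z s \<partial>lborel) \<partial>lborel)"
    if h: "continuous_on UNIV (\<lambda>p::pt \<times> real. h (fst p) (snd p))" for h :: "pt \<Rightarrow> real \<Rightarrow> real"
  proof (rule lborel_pair.Fubini_integral)
    have "integrable lborel (\<lambda>p. indicator ((C \<times> {0..T}) \<times> {0..R}) p *\<^sub>R h (fst p) (snd p))"
      by (rule borel_integrable_compact) (auto simp: C_def intro!: compact_Times continuous_on_subset[OF h])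
    then show "integrable (lborel \<Otimes>\<^sub>M lborel) (\<lambda>(z, s). D z s * h z s)"
      unfolding lborel_prod by (simp add: case_prod_unfold D_def indicator_times)
  qed
  have c1: "continuous_on UNIV (\<lambda>p::pt \<times> real. g (fst (fst p) - snd p *\<^sub>R e) \<bullet> \<psi>' (fst p) (e, 0))"
    by (intro continuous_on_inner continuous_on_compose2[OF g] continuous_on_compose2[OF c]) (auto intro!: continuous_intros)
  have c2: "continuous_on UNIV (\<lambda>p::pt \<times> real. g (fst (fst p)) \<bullet> \<psi>' (fst (fst p) + snd p *\<^sub>R e, snd (fst p)) (e, 0))"
    by (intro continuous_on_inner continuous_on_compose2[OF g] continuous_on_compose2[OF c]) (auto intro!: continuous_intros)
  have A: "indicator {0..T} (snd z) * (integral {0..R} (\<lambda>s. g (fst z - s *\<^sub>R e)) \<bullet> \<psi>' z (e, 0))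
    = (\<integral>s. D z s * (g (fst z - s *\<^sub>R e) \<bullet> \<psi>' z (e, 0)) \<partial>lborel)" for z
  proof (cases "fst z \<in> C")
    case False
    then have "\<psi>' z (e, 0) = 0" using z0 KC0 by blast
    then show ?thesis by simp
  next
    case True
    have cg: "continuous_on {0..R} (\<lambda>s. g (fst z - s *\<^sub>R e))"
      by (intro continuous_on_compose2[OF g]) (auto intro!: continuous_intros)
    have "(\<integral>s. D z s * (g (fst z - s *\<^sub>R e) \<bullet> \<psi>' z (e, 0)) \<partial>lborel)
      = (\<integral>s. indicator {0..T} (snd z) * (indicator {0..R} s * (g (fst z - s *\<^sub>R e) \<bullet> \<psi>' z (e, 0))) \<partial>lborel)"
      using True by (simp add: D_def indicator_times mult.assoc)
    also have "\<dots> = indicator {0..T} (snd z) * integral {0..R} (\<lambda>s. g (fst z - s *\<^sub>R e) \<bullet> \<psi>' z (e, 0))"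
      unfolding integral_mult_right_zero by (subst integral_indicator_Icc) (auto intro!: continuous_on_inner cg)
    also have "integral {0..R} (\<lambda>s. g (fst z - s *\<^sub>R e) \<bullet> \<psi>' z (e, 0)) = integral {0..R} (\<lambda>s. g (fst z - s *\<^sub>R e)) \<bullet> \<psi>' z (e, 0)"
      using integral_linear[OF integrable_continuous_real[OF cg] bounded_linear_inner_left[of "\<psi>' z (e, 0)"]] by (simp add: o_def)
    finally show ?thesis by simp
  qed
  have B: "(\<integral>z. D z s * (g (fst z - s *\<^sub>R e) \<bullet> \<psi>' z (e, 0)) \<partial>lborel)
    = (\<integral>z. D z s * (g (fst z) \<bullet> \<psi>' (fst z + s *\<^sub>R e, snd z) (e, 0)) \<partial>lborel)" for s
  proof (cases "0 \<le> s \<and> s \<le> R")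
    case True
    have m: "(\<lambda>z. D z s * (g (fst z - s *\<^sub>R e) \<bullet> \<psi>' z (e, 0))) \<in> borel_measurable borel"
    proof -
      have "continuous_on UNIV (\<lambda>z::pt. g (fst z - s *\<^sub>R e) \<bullet> \<psi>' z (e, 0))"
        by (intro continuous_on_inner continuous_on_compose2[OF g] c) (auto intro!: continuous_intros)
      then have [measurable]: "(\<lambda>z::pt. g (fst z - s *\<^sub>R e) \<bullet> \<psi>' z (e, 0)) \<in> borel_measurable borel" by (rule borel_measurable_continuous_onI)
      have [measurable]: "C \<times> {0..T} \<in> sets borel" by (intro borel_closed closed_Times) (auto simp: C_def)
      show ?thesis unfolding D_def by measurable
    qed
    have "(\<integral>z. D (z + (s *\<^sub>R e, 0)) s * (g (fst (z + (s *\<^sub>R e, 0)) - s *\<^sub>R e) \<bullet> \<psi>' (z + (s *\<^sub>R e, 0)) (e, 0)) \<partial>lborel)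
      = (\<integral>z. D z s * (g (fst z - s *\<^sub>R e) \<bullet> \<psi>' z (e, 0)) \<partial>lborel)"
      by (rule integral_translate[OF m])
    moreover have "D (z + (s *\<^sub>R e, 0)) s * (g (fst (z + (s *\<^sub>R e, 0)) - s *\<^sub>R e) \<bullet> \<psi>' (z + (s *\<^sub>R e, 0)) (e, 0))
      = D z s * (g (fst z) \<bullet> \<psi>' (fst z + s *\<^sub>R e, snd z) (e, 0))" for z
    proof (cases "fst z + s *\<^sub>R e \<in> K")
      case k: True
      have "fst z \<in> C" "fst z + s *\<^sub>R e \<in> C" using KC[OF k] KC0[OF k] True by auto
      then show ?thesis by (cases z) (simp add: D_def indicator_times)
    next
      case False
      then show ?thesis using z0[of "(fst z + s *\<^sub>R e, snd z)"] by (cases z) simp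
    qed
    ultimately show ?thesis by simp
  qed (auto simp: D_def indicator_def)
  have Cc: "(\<integral>s. D z s * (g (fst z) \<bullet> \<psi>' (fst z + s *\<^sub>R e, snd z) (e, 0)) \<partial>lborel)
    = indicator {0..T} (snd z) * (g (fst z) \<bullet> (\<psi> (fst z + R *\<^sub>R e, snd z) - \<psi> z))" for z
  proof (cases "fst z \<in> C")
    case False
    then have "\<psi> (fst z + R *\<^sub>R e, snd z) = 0" "\<psi> (fst z, snd z) = 0" using K(2) KC[of "fst z" R] KC0 R by blast+
    moreover have "D z s = 0" for s using False by (auto simp: D_def indicator_def)
    ultimately show ?thesis by simp
  next
    case True
    have cg: "continuous_on {0..R} (\<lambda>s. g (fst z) \<bullet> \<psi>' (fst z + s *\<^sub>R e, snd z) (e, 0))"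
      by (intro continuous_on_inner continuous_on_const continuous_on_compose2[OF c]) (auto intro!: continuous_intros)
    have "(\<integral>s. D z s * (g (fst z) \<bullet> \<psi>' (fst z + s *\<^sub>R e, snd z) (e, 0)) \<partial>lborel)
      = (\<integral>s. indicator {0..T} (snd z) * (indicator {0..R} s * (g (fst z) \<bullet> \<psi>' (fst z + s *\<^sub>R e, snd z) (e, 0))) \<partial>lborel)"
      using True by (simp add: D_def indicator_times mult.assoc)
    also have "\<dots> = indicator {0..T} (snd z) * integral {0..R} (\<lambda>s. g (fst z) \<bullet> \<psi>' (fst z + s *\<^sub>R e, snd z) (e, 0))"
      unfolding integral_mult_right_zero by (subst integral_indicator_Icc[OF cg]) simp
    also have "integral {0..R} (\<lambda>s. g (fst z) \<bullet> \<psi>' (fst z + s *\<^sub>R e, snd z) (e, 0))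
      = g (fst z) \<bullet> \<psi> (fst z + R *\<^sub>R e, snd z) - g (fst z) \<bullet> \<psi> (fst z + 0 *\<^sub>R e, snd z)"
    proof (rule integral_unique, rule fundamental_theorem_of_calculus[OF R])
      fix s assume "s \<in> {0..R}"
      have "((\<lambda>s. (fst z + s *\<^sub>R e, snd z)) has_vector_derivative (e, 0)) (at s within {0..R})"
        by (intro has_vector_derivative_Pair) (auto intro!: derivative_eq_intros)
      from vector_derivative_diff_chain_within[OF this has_derivative_at_withinI[OF d]]
      have "((\<lambda>s. \<psi> (fst z + s *\<^sub>R e, snd z)) has_vector_derivative \<psi>' (fst z + s *\<^sub>R e, snd z) (e, 0)) (at s within {0..R})"
        by (simp add: o_def)
      from bounded_linear.has_vector_derivative[OF bounded_linear_inner_right this]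
      show "((\<lambda>s. g (fst z) \<bullet> \<psi> (fst z + s *\<^sub>R e, snd z)) has_vector_derivative g (fst z) \<bullet> \<psi>' (fst z + s *\<^sub>R e, snd z) (e, 0)) (at s within {0..R})" .
    qed
    finally show ?thesis by (simp add: inner_diff_right)
  qed
  show ?thesis unfolding A
    by (subst fub[symmetric, OF c1], subst B, subst fub[OF c2], subst Cc, rule refl)
qed

text \<open>The fundamental theorem of calculus in \<open>t\<close> for the product of
  \<open>t / T\<close> with \<open>\<phi> x \<bullet> \<psi> (x, t)\<close>; the weight
  \<open>t / T\<close> removes the term at \<open>t = 0\<close>.\<close>

lemma slab_time:
  fixes \<psi> :: "pt \<Rightarrow> real^2" and \<phi> :: "real^2 \<Rightarrow> real^2"
  assumes d: "\<And>z. (\<psi> has_derivative \<psi>' z) (at z)" and c: "\<And>y. continuous_on UNIV (\<lambda>z. \<psi>' z y)"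
    and K: "compact K" "\<And>x t. x \<notin> K \<Longrightarrow> \<psi> (x, t) = 0" and p: "continuous_on UNIV \<phi>" and T: "0 < T"
  shows "(\<integral>z. indicator {0..T} (snd z) * (snd z / T * (\<phi> (fst z) \<bullet> \<psi>' z (0, 1)) + 1 / T * (\<phi> (fst z) \<bullet> \<psi> z)) \<partial>lborel)
    = (\<integral>x. \<phi> x \<bullet> \<psi> (x, T) \<partial>lborel)"
proof -
  define h where "h z = snd z / T * (\<phi> (fst z) \<bullet> \<psi>' z (0, 1)) + 1 / T * (\<phi> (fst z) \<bullet> \<psi> z)" for z
  have ch: "continuous_on UNIV h" unfolding h_def[abs_def]
    by (intro continuous_on_add continuous_on_mult continuous_on_inner continuous_on_compose2[OF p] c has_derivative_continuous_UNIV[OF d])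
      (use T in \<open>auto intro!: continuous_intros\<close>)
  have h0: "h z = 0" if "fst z \<notin> K" for z
    using spatial_support_deriv[OF d K that] K(2)[OF that, of "snd z"] by (simp add: h_def)
  have i: "integrable (lborel \<Otimes>\<^sub>M lborel) (\<lambda>z. indicator (K \<times> {0..T}) z *\<^sub>R h z)"
    unfolding lborel_prod by (rule borel_integrable_compact) (auto intro!: compact_Times K(1) continuous_on_subset[OF ch])
  have hD: "indicator {0..T} (snd z) * h z = indicator (K \<times> {0..T}) z *\<^sub>R h z" for z
    by (cases "fst z \<in> K") (simp_all add: h0 indicator_times)
  have "(\<integral>z. indicator {0..T} (snd z) * h z \<partial>lborel) = (\<integral>z. indicator (K \<times> {0..T}) z *\<^sub>R h z \<partial>(lborel \<Otimes>\<^sub>M lborel))"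
    unfolding lborel_prod hD by (rule refl)
  also have "\<dots> = (\<integral>x. (\<integral>t. indicator (K \<times> {0..T}) (x, t) *\<^sub>R h (x, t) \<partial>lborel) \<partial>lborel)"
    by (rule lborel_pair.integral_fst'[OF i, symmetric])
  also have "\<dots> = (\<integral>x. \<phi> x \<bullet> \<psi> (x, T) \<partial>lborel)"
  proof (rule Bochner_Integration.integral_cong[OF refl])
    fix x :: "real^2"
    show "(\<integral>t. indicator (K \<times> {0..T}) (x, t) *\<^sub>R h (x, t) \<partial>lborel) = \<phi> x \<bullet> \<psi> (x, T)"
    proof (cases "x \<in> K")
      case False
      then show ?thesis using K(2)[OF False] by (simp add: indicator_times)
    next
      case True
      have ct: "continuous_on {0..T} (\<lambda>t. h (x, t))" by (intro continuous_on_compose2[OF ch]) (auto intro!: continuous_intros)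
      have "(\<integral>t. indicator (K \<times> {0..T}) (x, t) *\<^sub>R h (x, t) \<partial>lborel) = (\<integral>t. indicator {0..T} t * h (x, t) \<partial>lborel)"
        using True by (simp add: indicator_times)
      also have "\<dots> = integral {0..T} (\<lambda>t. h (x, t))" by (rule integral_indicator_Icc[OF ct])
      also have "\<dots> = T / T * (\<phi> x \<bullet> \<psi> (x, T)) - 0 / T * (\<phi> x \<bullet> \<psi> (x, 0))"
      proof (rule integral_unique, rule fundamental_theorem_of_calculus)
        show "0 \<le> T" using T by simp
        fix t assume "t \<in> {0..T}"
        have "((\<lambda>t. (x, t)) has_vector_derivative (0, 1)) (at t within {0..T})"
          by (intro has_vector_derivative_Pair) (auto intro!: derivative_eq_intros)
        from vector_derivative_diff_chain_within[OF this has_derivative_at_withinI[OF d]]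
        have "((\<lambda>t. \<psi> (x, t)) has_vector_derivative \<psi>' (x, t) (0, 1)) (at t within {0..T})" by (simp add: o_def)
        from bounded_linear.has_vector_derivative[OF bounded_linear_inner_right this]
        have 1: "((\<lambda>t. \<phi> x \<bullet> \<psi> (x, t)) has_real_derivative \<phi> x \<bullet> \<psi>' (x, t) (0, 1)) (at t within {0..T})"
          unfolding has_real_derivative_iff_has_vector_derivative .
        have "((\<lambda>t. t / T) has_real_derivative 1 / T) (at t within {0..T})" using T by (auto intro!: derivative_eq_intros)
        from DERIV_mult[OF this 1]
        have 2: "((\<lambda>t. t / T * (\<phi> x \<bullet> \<psi> (x, t))) has_real_derivative 1 / T * (\<phi> x \<bullet> \<psi> (x, t)) + \<phi> x \<bullet> \<psi>' (x, t) (0, 1) * (t / T)) (at t within {0..T})" .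
        have "h (x, t) = 1 / T * (\<phi> x \<bullet> \<psi> (x, t)) + \<phi> x \<bullet> \<psi>' (x, t) (0, 1) * (t / T)" by (simp add: h_def)
        then show "((\<lambda>t. t / T * (\<phi> x \<bullet> \<psi> (x, t))) has_vector_derivative h (x, t)) (at t within {0..T})"
          using 2 unfolding has_real_derivative_iff_has_vector_derivative by (simp only:)
      qed
      finally show ?thesis using T by simp
    qed
  qed
  finally show ?thesis by (simp add: h_def)
qed

section \<open>The iteration\<close>

locale five_states = relax +
  fixes F :: "mat2 \<Rightarrow> real" and Z0 :: mat2 and Zs As nr :: "nat \<Rightarrow> mat2" and r :: real
  assumes U_bounded: "bounded (U 1)" and Z0: "(0, Z0) \<in> U 1" and r_pos: "r > 0"
    and near: "\<And>A' Z' c. (A', Z') \<in> U c \<Longrightarrow> 0 < c \<Longrightarrow> c \<le> 1 \<Longrightarrow>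
      \<exists>i<5. \<exists>x. dist x (As i) < r \<and> norm (A' - x) \<le> 1600 * c \<and> norm (Z' - Zs i) \<le> 1600 * c"
    and side: "\<And>A' Z' i. (A', Z') \<in> U 1 \<Longrightarrow> i < 5 \<Longrightarrow> 0 < nr i \<bullet> (Z' - Zs i)"
    and germ: "\<And>B i. i < 5 \<Longrightarrow> dist B (As i) \<le> r \<Longrightarrow> DF F B = B + Zs i"
    and sep: "\<And>i j. i < 5 \<Longrightarrow> j < 5 \<Longrightarrow> i \<noteq> j \<Longrightarrow> 4 * r < dist (As i) (As j)"
begin

text \<open>The average of the distance functional from corner \<open>i\<close>, weighted by a bump
  \<open>f\<close>. It is positive as long as the states over the support stay in
  \<open>U 1\<close>, and it would be zero if germ \<open>i\<close> filled the support.\<close>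

definition wt :: "(pt \<Rightarrow> real) \<Rightarrow> nat \<Rightarrow> (pt \<Rightarrow> mat2) \<Rightarrow> real" where
  "wt f i Z = (\<integral>z. f z * (nr i \<bullet> (Z z - Zs i)) \<partial>lborel)"

text \<open>At step \<open>k\<close> only the first \<open>k\<close> bumps are monitored, which are
  finitely many constraints. The factors \<open>1 - (1/2) ^ (k + 2)\<close> have a product bounded
  away from zero, so every average keeps a positive lower bound in the limit.\<close>

definition gen where
  "gen Q A Z e k V B \<tau> \<zeta> G V' B' \<tau>' \<zeta>' (f :: nat \<Rightarrow> pt \<Rightarrow> real) N \<longleftrightarrow>
     (\<forall>z :: pt. norm (V' z - V z :: real^2) \<le> e * (1/2) ^ (k + 2) \<and> norm (\<tau>' z - \<tau> z :: real^2) \<le> e * (1/2) ^ (k + 2)) \<and>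
     N \<in> borel_measurable borel \<and>
     (\<forall>z\<in>Q. 0 \<le> N z \<and> N z \<le> 13000 \<and> norm (\<zeta>' z - \<zeta> z :: mat2) \<le> N z \<and> norm (B' z - B z :: mat2) \<le> N z \<and>
       (\<forall>y. norm ((V' (y, snd z) - V (y, snd z)) - (V' z - V z)) \<le> N z * norm (y - fst z))) \<and>
     (\<integral>z. indicator Q z * N z \<partial>lborel) \<le> 12801 * (measure lborel Q + 1) * (998/1000) ^ k \<and>
     (\<forall>j<k. \<forall>i<5. (1 - (1/2) ^ (k + 2)) * wt (f j) i (\<lambda>z. Z z + \<zeta> z) \<le> wt (f j) i (\<lambda>z. Z z + \<zeta>' z))"

text \<open>The rate 998/1000 is the contraction 199/200 plus 3/1000 for the errors of a step. The
  added 1 in \<open>measure lborel Q + 1\<close> makes these errors comparable with the main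
  term.\<close>

definition stage where
  "stage Q A Z k S V B \<tau> \<zeta> G \<longleftrightarrow> compact S \<and> S \<subseteq> Q \<and> pert S V B \<tau> \<zeta> \<and> G \<in> borel_measurable borel \<and>
     (\<forall>z\<in>Q. 0 < G z \<and> G z \<le> 1 \<and> (A z + B z, Z z + \<zeta> z) \<in> U (G z) \<and> (\<forall>\<^sub>F y in nhds z. G z \<le> G y)) \<and>
     (\<integral>z. indicator Q z * G z \<partial>lborel) \<le> (measure lborel Q + 1) * (998/1000) ^ k"

lemma wt_integrable:
  assumes "continuous_on UNIV f" "compact K" "\<And>z. z \<notin> K \<Longrightarrow> f z = 0" "continuous_on UNIV Z"
  shows "integrable lborel (\<lambda>z. f z * (nr i \<bullet> (Z z - Zs i)))"
  by (rule integrable_continuous_compact_support[where S = K]) (use assms in \<open>auto intro!: continuous_intros\<close>)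

lemma wt_pos:
  assumes f: "continuous_on UNIV f" "compact K" "\<And>z. z \<notin> K \<Longrightarrow> f z = 0" "\<And>z. 0 \<le> f z" "0 < f a"
    and Z: "continuous_on UNIV Z" "\<And>z. z \<in> K \<Longrightarrow> 0 < nr i \<bullet> (Z z - Zs i)"
  shows "0 < wt f i Z"
  unfolding wt_def
proof (rule integral_pos_continuous)
  show "integrable lborel (\<lambda>z. f z * (nr i \<bullet> (Z z - Zs i)))" by (rule wt_integrable[OF f(1-3) Z(1)])
  show "continuous_on UNIV (\<lambda>z. f z * (nr i \<bullet> (Z z - Zs i)))" using f(1) Z(1) by (auto intro!: continuous_intros)
  show "0 \<le> f z * (nr i \<bullet> (Z z - Zs i))" for z using f(3,4)[of z] Z(2)[of z] by (cases "z \<in> K") (auto intro: less_imp_le)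
  have "a \<in> K" using f(3)[of a] f(5) by (cases "a \<in> K") auto
  then show "0 < f a * (nr i \<bullet> (Z a - Zs i))" using f(5) Z(2) by simp
qed

lemma next_stage:
  fixes f :: "nat \<Rightarrow> pt \<Rightarrow> real" and f' :: "nat \<Rightarrow> pt \<Rightarrow> pt"
  assumes Q: "open Q" "bounded Q" and A: "continuous_on UNIV A" "continuous_on UNIV Z"
    and f: "\<And>j z. (f j has_derivative (\<lambda>y. f' j z \<bullet> y)) (at z)" "\<And>j. continuous_on UNIV (f' j)"
      "\<And>j. compact (K j)" "\<And>j. K j \<subseteq> Q" "\<And>j z. z \<notin> K j \<Longrightarrow> f j z = 0" "\<And>j z. 0 \<le> f j z" "\<And>j. 0 < f j (a j)"
    and e: "0 < e" and st: "stage Q A Z k S V B \<tau> \<zeta> G"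
  shows "\<exists>S' V' B' \<tau>' \<zeta>' G' N. stage Q A Z (Suc k) S' V' B' \<tau>' \<zeta>' G' \<and> gen Q A Z e k V B \<tau> \<zeta> G V' B' \<tau>' \<zeta>' f N"
proof -
  have S: "compact S" "S \<subseteq> Q" "pert S V B \<tau> \<zeta>" "G \<in> borel_measurable borel"
    "\<And>z. z \<in> Q \<Longrightarrow> 0 < G z \<and> G z \<le> 1 \<and> (A z + B z, Z z + \<zeta> z) \<in> U (G z) \<and> (\<forall>\<^sub>F y in nhds z. G z \<le> G y)"
    "(\<integral>z. indicator Q z * G z \<partial>lborel) \<le> (measure lborel Q + 1) * (998/1000) ^ k"
    using st unfolding stage_def by blast+
  note cB = pertD(2)[OF S(3)] and cZ = pertD(4)[OF S(3)]
  have cA: "continuous_on UNIV (\<lambda>z. A z + B z)" "continuous_on UNIV (\<lambda>z. Z z + \<zeta> z)"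
    by (intro continuous_on_add A cB cZ)+
  have cf: "continuous_on UNIV (f j)" for j by (rule has_derivative_continuous_UNIV[OF f(1)])
  have wp: "0 < wt (f j) i (\<lambda>z. Z z + \<zeta> z)" if "i < 5" for i j
  proof (rule wt_pos[OF cf f(3,5,6,7) cA(2)])
    fix z assume "z \<in> K j"
    then have "z \<in> Q" using f(4) by blast
    then have "(A z + B z, Z z + \<zeta> z) \<in> U 1" using S(5)[of z] U_mono[of "G z" 1] by blast
    then show "0 < nr i \<bullet> (Z z + \<zeta> z - Zs i)" by (rule side[OF _ that])
  qed
  \<comment> \<open>A step changes the average with index \<open>(j, i)\<close> by at most
    \<open>norm (nr i)\<close> times the weak size of the increment; \<open>\<kappa>\<close> keeps
    this below the permitted fraction of the present value, which is positive by
    \<open>wp\<close>.\<close>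
  obtain \<kappa> where kap: "\<kappa> > 0" "\<And>p. p \<in> {..<k} \<times> {..<5} \<Longrightarrow> norm (nr (snd p)) * \<kappa> \<le> (1/2) ^ (k + 2) * wt (f (fst p)) (snd p) (\<lambda>z. Z z + \<zeta> z)"
  proof (rule uniform_radius[where I = "{..<k} \<times> {..<5::nat}" and P = "\<lambda>p x. norm (nr (snd p)) * x \<le> (1/2) ^ (k + 2) * wt (f (fst p)) (snd p) (\<lambda>z. Z z + \<zeta> z)"])
    fix p assume "p \<in> {..<k} \<times> {..<5::nat}"
    then have "snd p < 5" by auto
    define w where "w = (1/2) ^ (k + 2) * wt (f (fst p)) (snd p) (\<lambda>z. Z z + \<zeta> z)"
    have w: "w > 0" using wp[OF \<open>snd p < 5\<close>] by (simp add: w_def)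
    have n: "0 < norm (nr (snd p)) + 1" by (rule add_nonneg_pos) auto
    have "norm (nr (snd p)) * (w / (norm (nr (snd p)) + 1)) \<le> w" using w n by (simp add: field_simps)
    moreover have "w / (norm (nr (snd p)) + 1) > 0" using w n by simp
    ultimately show "\<exists>x>0. norm (nr (snd p)) * x \<le> (1/2) ^ (k + 2) * wt (f (fst p)) (snd p) (\<lambda>z. Z z + \<zeta> z)"
      unfolding w_def by blast
  next
    fix p and x y :: real
    assume x: "norm (nr (snd p)) * x \<le> (1/2) ^ (k + 2) * wt (f (fst p)) (snd p) (\<lambda>z. Z z + \<zeta> z)" and "0 < y" and yx: "y \<le> x"
    show "norm (nr (snd p)) * y \<le> (1/2) ^ (k + 2) * wt (f (fst p)) (snd p) (\<lambda>z. Z z + \<zeta> z)"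
      by (rule order_trans[OF mult_left_mono[OF yx norm_ge_zero] x])
  qed auto
  define q :: real where "q = (998/1000) ^ k"
  have q: "q > 0" by (simp add: q_def)
  \<comment> \<open>Three requirements: uniform smallness of the increment, the loss in the
    contraction rate, and the weak smallness just obtained.\<close>
  define \<delta> where "\<delta> = min (e * (1/2) ^ (k + 2)) (min (3/1000 * q) \<kappa>)"
  have dl: "\<delta> > 0" using e q kap(1) by (simp add: \<delta>_def)
  have dle: "\<delta> \<le> e * (1/2) ^ (k + 2)" "\<delta> \<le> 3/1000 * q" "\<delta> \<le> \<kappa>" by (simp_all only: \<delta>_def min_le_iff_disj order_refl simp_thms)
  have "\<exists>S1 V1 B1 \<tau>1 \<zeta>1 G1 N. (compact S1) \<and>
    (S1 \<subseteq> Q) \<and>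
    (pert S1 V1 B1 \<tau>1 \<zeta>1) \<and>
    (\<forall>z. norm (V1 z) \<le> \<delta> \<and> norm (\<tau>1 z) \<le> \<delta>) \<and>
    (G1 \<in> borel_measurable borel) \<and>
    (\<forall>z\<in>Q. 0 < G1 z \<and> G1 z \<le> 1 \<and> (A z + B z + B1 z, Z z + \<zeta> z + \<zeta>1 z) \<in> U (G1 z) \<and> (\<forall>\<^sub>F y in nhds z. G1 z \<le> G1 y)) \<and>
    ((\<integral>z. indicator Q z * G1 z \<partial>lborel) \<le> 199/200 * (\<integral>z. indicator Q z * G z \<partial>lborel) + \<delta>) \<and>
    (N \<in> borel_measurable borel) \<and>
    (\<forall>z\<in>Q. 0 \<le> N z \<and> N z \<le> 13000 \<and> norm (\<zeta>1 z) \<le> N z \<and> norm (B1 z) \<le> N z \<and>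
       (\<forall>y. norm (V1 (y, snd z) - V1 z) \<le> N z * norm (y - fst z))) \<and>
    ((\<integral>z. indicator Q z * N z \<partial>lborel) \<le> 12800 * (\<integral>z. indicator Q z * G z \<partial>lborel) + \<delta>) \<and>
    (\<forall>j<k. norm (\<integral>z. f j z *\<^sub>R \<zeta>1 z \<partial>lborel) \<le> \<delta>)"
    by (rule step[where \<phi> = f and \<phi>' = f' and n = k, OF Q cA S(4) S(5) f(1,2) dl])
  then obtain S1 V1 B1 \<tau>1 \<zeta>1 G1 N where s1: "compact S1" "S1 \<subseteq> Q" "pert S1 V1 B1 \<tau>1 \<zeta>1" "\<forall>z. norm (V1 z) \<le> \<delta> \<and> norm (\<tau>1 z) \<le> \<delta>"
    "\<forall>z\<in>Q. 0 < G1 z \<and> G1 z \<le> 1 \<and> (A z + B z + B1 z, Z z + \<zeta> z + \<zeta>1 z) \<in> U (G1 z) \<and> (\<forall>\<^sub>F y in nhds z. G1 z \<le> G1 y)"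
    "G1 \<in> borel_measurable borel"
    "(\<integral>z. indicator Q z * G1 z \<partial>lborel) \<le> 199/200 * (\<integral>z. indicator Q z * G z \<partial>lborel) + \<delta>"
    "\<forall>z\<in>Q. 0 \<le> N z \<and> N z \<le> 13000 \<and> norm (\<zeta>1 z) \<le> N z \<and> norm (B1 z) \<le> N z \<and>
       (\<forall>y. norm (V1 (y, snd z) - V1 z) \<le> N z * norm (y - fst z))"
    "N \<in> borel_measurable borel"
    "(\<integral>z. indicator Q z * N z \<partial>lborel) \<le> 12800 * (\<integral>z. indicator Q z * G z \<partial>lborel) + \<delta>"
    "\<forall>j<k. norm (\<integral>z. f j z *\<^sub>R \<zeta>1 z \<partial>lborel) \<le> \<delta>"
    by (elim exE conjE) (rule that, assumption+)
  define m where "m = measure lborel Q"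
  have m0: "m \<ge> 0" by (simp add: m_def)
  have mq: "q \<le> (m + 1) * q" using m0 q by (simp add: algebra_simps)
  have g: "(\<integral>z. indicator Q z * G z \<partial>lborel) \<le> (m + 1) * q" using S(6) by (simp add: m_def q_def)
  have "(\<integral>z. indicator Q z * G1 z \<partial>lborel) \<le> 998/1000 * ((m + 1) * q)" using s1(7) g dle(2) mq by linarith
  then have g1: "(\<integral>z. indicator Q z * G1 z \<partial>lborel) \<le> (measure lborel Q + 1) * (998/1000) ^ Suc k" by (simp add: m_def q_def mult_ac)
  have "(\<integral>z. indicator Q z * N z \<partial>lborel) \<le> 12801 * ((m + 1) * q)" using s1(10) g dle(2) mq q by linarith
  then have n1: "(\<integral>z. indicator Q z * N z \<partial>lborel) \<le> 12801 * (measure lborel Q + 1) * (998/1000) ^ k" by (simp only: m_def q_def mult.assoc)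
  have W: "(1 - (1/2) ^ (k + 2)) * wt (f j) i (\<lambda>z. Z z + \<zeta> z) \<le> wt (f j) i (\<lambda>z. Z z + (\<zeta> z + \<zeta>1 z))" if "j < k" "i < 5" for i j
  proof -
    have i1: "integrable lborel (\<lambda>z. f j z *\<^sub>R \<zeta>1 z)"
      by (rule integrable_continuous_compact_support[OF _ f(3)[of j]]) (use f(5)[of _ j] cf[of j] pertD(4)[OF s1(3)] in \<open>auto intro!: continuous_on_scaleR\<close>)
    have iw: "integrable lborel (\<lambda>z. f j z * (nr i \<bullet> (Z z + \<zeta> z - Zs i)))"
      by (rule wt_integrable[OF cf f(3)[of j] _ cA(2)]) (rule f(5))
    have "wt (f j) i (\<lambda>z. Z z + (\<zeta> z + \<zeta>1 z)) = (\<integral>z. f j z * (nr i \<bullet> (Z z + \<zeta> z - Zs i)) + nr i \<bullet> (f j z *\<^sub>R \<zeta>1 z) \<partial>lborel)"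
      unfolding wt_def by (simp add: algebra_simps inner_diff_right inner_add_right)
    also have "\<dots> = wt (f j) i (\<lambda>z. Z z + \<zeta> z) + (\<integral>z. nr i \<bullet> (f j z *\<^sub>R \<zeta>1 z) \<partial>lborel)"
      unfolding wt_def by (rule Bochner_Integration.integral_add[OF iw]) (rule integrable_inner_right, rule i1)
    also have "(\<integral>z. nr i \<bullet> (f j z *\<^sub>R \<zeta>1 z) \<partial>lborel) = nr i \<bullet> (\<integral>z. f j z *\<^sub>R \<zeta>1 z \<partial>lborel)"
      using i1 by (intro integral_inner_right) simp
    finally have w: "wt (f j) i (\<lambda>z. Z z + (\<zeta> z + \<zeta>1 z)) = wt (f j) i (\<lambda>z. Z z + \<zeta> z) + nr i \<bullet> (\<integral>z. f j z *\<^sub>R \<zeta>1 z \<partial>lborel)" .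
    have "\<bar>nr i \<bullet> (\<integral>z. f j z *\<^sub>R \<zeta>1 z \<partial>lborel)\<bar> \<le> norm (nr i) * norm (\<integral>z. f j z *\<^sub>R \<zeta>1 z \<partial>lborel)" by (rule Cauchy_Schwarz_ineq2)
    also have "\<dots> \<le> norm (nr i) * \<kappa>" using s1(11) that(1) dle(3) by (intro mult_left_mono) auto
    also have "\<dots> \<le> (1/2) ^ (k + 2) * wt (f j) i (\<lambda>z. Z z + \<zeta> z)" using kap(2)[of "(j, i)"] that by simp
    finally have "- ((1/2) ^ (k + 2) * wt (f j) i (\<lambda>z. Z z + \<zeta> z)) \<le> nr i \<bullet> (\<integral>z. f j z *\<^sub>R \<zeta>1 z \<partial>lborel)" by (simp only: abs_le_iff) linarith
    then show ?thesis unfolding w left_diff_distrib by simp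
  qed
  have "stage Q A Z (Suc k) (S \<union> S1) (\<lambda>z. V z + V1 z) (\<lambda>z. B z + B1 z) (\<lambda>z. \<tau> z + \<tau>1 z) (\<lambda>z. \<zeta> z + \<zeta>1 z) G1"
    unfolding stage_def
  proof (intro conjI)
    show "pert (S \<union> S1) (\<lambda>z. V z + V1 z) (\<lambda>z. B z + B1 z) (\<lambda>z. \<tau> z + \<tau>1 z) (\<lambda>z. \<zeta> z + \<zeta>1 z)" by (rule pert_add[OF S(3) s1(3) S(1) s1(1)])
    show "\<forall>z\<in>Q. 0 < G1 z \<and> G1 z \<le> 1 \<and> (A z + (B z + B1 z), Z z + (\<zeta> z + \<zeta>1 z)) \<in> U (G1 z) \<and> (\<forall>\<^sub>F y in nhds z. G1 z \<le> G1 y)"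
      using s1(5) by (simp only: add.assoc)
  qed (use S(1,2) s1(1,2,6) g1 in auto)
  moreover have "gen Q A Z e k V B \<tau> \<zeta> G (\<lambda>z. V z + V1 z) (\<lambda>z. B z + B1 z) (\<lambda>z. \<tau> z + \<tau>1 z) (\<lambda>z. \<zeta> z + \<zeta>1 z) f N"
    unfolding gen_def add_diff_cancel_left'
  proof (intro conjI)
    show "\<forall>z. norm (V1 z) \<le> e * (1/2) ^ (k + 2) \<and> norm (\<tau>1 z) \<le> e * (1/2) ^ (k + 2)" using s1(4) dle(1) order_trans by blast
    show "\<forall>j<k. \<forall>i<5. (1 - (1/2) ^ (k + 2)) * wt (f j) i (\<lambda>z. Z z + \<zeta> z) \<le> wt (f j) i (\<lambda>z. Z z + (\<zeta> z + \<zeta>1 z))" using W by blast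
  qed (rule s1(9), rule s1(8), rule n1)
  ultimately show ?thesis by blast
qed

lemma iteration:
  fixes f :: "nat \<Rightarrow> pt \<Rightarrow> real" and f' :: "nat \<Rightarrow> pt \<Rightarrow> pt"
  assumes Q: "open Q" "bounded Q" and A: "continuous_on UNIV A" "continuous_on UNIV Z"
    and AU: "\<And>z. z \<in> Q \<Longrightarrow> (A z, Z z) \<in> U 1"
    and f: "\<And>j z. (f j has_derivative (\<lambda>y. f' j z \<bullet> y)) (at z)" "\<And>j. continuous_on UNIV (f' j)"
      "\<And>j. compact (K j)" "\<And>j. K j \<subseteq> Q" "\<And>j z. z \<notin> K j \<Longrightarrow> f j z = 0" "\<And>j z. 0 \<le> f j z" "\<And>j. 0 < f j (a j)"
    and e: "0 < e"
  obtains S V B \<tau> \<zeta> G N where "\<And>k. stage Q A Z k (S k) (V k) (B k) (\<tau> k) (\<zeta> k) (G k)"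
    "\<And>k. gen Q A Z e k (V k) (B k) (\<tau> k) (\<zeta> k) (G k) (V (Suc k)) (B (Suc k)) (\<tau> (Suc k)) (\<zeta> (Suc k)) f (N k)"
    "V 0 = (\<lambda>z. 0)" "\<tau> 0 = (\<lambda>z. 0)"
proof -
  define P where "P k x \<longleftrightarrow> (case x of (S, V, B, \<tau>, \<zeta>, G) \<Rightarrow> stage Q A Z k S V B \<tau> \<zeta> G \<and> (k = 0 \<longrightarrow> V = (\<lambda>z. 0) \<and> \<tau> = (\<lambda>z. 0)))" for k and x :: "pt set \<times> (pt \<Rightarrow> real^2) \<times> (pt \<Rightarrow> mat2) \<times> (pt \<Rightarrow> real^2) \<times> (pt \<Rightarrow> mat2) \<times> (pt \<Rightarrow> real)"
  define R where "R k x y \<longleftrightarrow> (case x of (S, V, B, \<tau>, \<zeta>, G) \<Rightarrow> case y of (S', V', B', \<tau>', \<zeta>', G') \<Rightarrow> \<exists>N. gen Q A Z e k V B \<tau> \<zeta> G V' B' \<tau>' \<zeta>' f N)" for k and x y :: "pt set \<times> (pt \<Rightarrow> real^2) \<times> (pt \<Rightarrow> mat2) \<times> (pt \<Rightarrow> real^2) \<times> (pt \<Rightarrow> mat2) \<times> (pt \<Rightarrow> real)"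
  have z: "stage Q A Z 0 {} (\<lambda>z. 0) (\<lambda>z. 0) (\<lambda>z. 0) (\<lambda>z. 0) (\<lambda>z. 1)"
    unfolding stage_def
  proof (intro conjI)
    have "emeasure lborel Q < \<infinity>" by (rule emeasure_bounded_finite[OF Q(2)])
    then show "(\<integral>z. indicator Q z * 1 \<partial>lborel) \<le> (measure lborel Q + 1) * (998 / 1000) ^ 0" using Q(1) by simp
    show "\<forall>z\<in>Q. 0 < (1::real) \<and> (1::real) \<le> 1 \<and> (A z + 0, Z z + 0) \<in> U 1 \<and> (\<forall>\<^sub>F y in nhds z. (1::real) \<le> 1)"
      using AU by (intro ballI conjI) simp_all
  qed (rule compact_empty empty_subsetI pert_zero borel_measurable_const)+
  have "\<exists>s. \<forall>k. P k (s k) \<and> R k (s k) (s (Suc k))"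
  proof (rule dependent_nat_choice)
    show "\<exists>x. P 0 x" using z unfolding P_def by (intro exI[of _ "({}, \<lambda>z. 0, \<lambda>z. 0, \<lambda>z. 0, \<lambda>z. 0, \<lambda>z. 1)"]) simp
    fix x k assume P: "P k x"
    obtain S V B \<tau> \<zeta> G where x: "x = (S, V, B, \<tau>, \<zeta>, G)" by (cases x) auto
    have stg: "stage Q A Z k S V B \<tau> \<zeta> G" using P by (simp add: P_def x)
    have "\<exists>S' V' B' \<tau>' \<zeta>' G' N. stage Q A Z (Suc k) S' V' B' \<tau>' \<zeta>' G' \<and> gen Q A Z e k V B \<tau> \<zeta> G V' B' \<tau>' \<zeta>' f N"
      by (rule next_stage[where f = f and f' = f' and K = K and a = a, OF Q A f e stg])
    then obtain S' V' B' \<tau>' \<zeta>' G' N where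
      "stage Q A Z (Suc k) S' V' B' \<tau>' \<zeta>' G'" "gen Q A Z e k V B \<tau> \<zeta> G V' B' \<tau>' \<zeta>' f N" by blast
    then show "\<exists>y. P (Suc k) y \<and> R k x y" unfolding P_def R_def x by (intro exI[of _ "(S', V', B', \<tau>', \<zeta>', G')"]) auto
  qed
  then obtain s where s: "\<And>k. P k (s k)" "\<And>k. R k (s k) (s (Suc k))" by blast
  define S where "S k = fst (s k)" for k
  define V where "V k = fst (snd (s k))" for k
  define B where "B k = fst (snd (snd (s k)))" for k
  define \<tau> where "\<tau> k = fst (snd (snd (snd (s k))))" for k
  define \<zeta> where "\<zeta> k = fst (snd (snd (snd (snd (s k)))))" for k
  define G where "G k = snd (snd (snd (snd (snd (s k)))))" for k
  note defs = S_def V_def B_def \<tau>_def \<zeta>_def G_def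
  have a1: "stage Q A Z k (S k) (V k) (B k) (\<tau> k) (\<zeta> k) (G k)" for k
    using s(1)[of k] by (simp add: P_def case_prod_unfold defs)
  have a2: "V 0 = (\<lambda>z. 0)" "\<tau> 0 = (\<lambda>z. 0)" using s(1)[of 0] by (simp_all add: P_def case_prod_unfold defs)
  have "\<forall>k. \<exists>N. gen Q A Z e k (V k) (B k) (\<tau> k) (\<zeta> k) (G k) (V (Suc k)) (B (Suc k)) (\<tau> (Suc k)) (\<zeta> (Suc k)) f N"
    using s(2) by (simp add: R_def case_prod_unfold defs)
  then obtain N where "\<forall>k. gen Q A Z e k (V k) (B k) (\<tau> k) (\<zeta> k) (G k) (V (Suc k)) (B (Suc k)) (\<tau> (Suc k)) (\<zeta> (Suc k)) f (N k)"
    by (rule choice[THEN exE])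
  then show ?thesis by (intro that[OF a1 _ a2]) blast
qed

end

section \<open>Bump functions on a countable family of balls\<close>

definition bump :: "pt \<Rightarrow> real \<Rightarrow> (pt \<Rightarrow> real) \<Rightarrow> (pt \<Rightarrow> pt) \<Rightarrow> bool" where
  "bump c \<rho> f f' \<longleftrightarrow> (\<forall>z. (f has_derivative (\<lambda>y. f' z \<bullet> y)) (at z)) \<and> continuous_on UNIV f' \<and> (\<forall>z. 0 \<le> f z) \<and>
     0 < f c \<and> (\<forall>z. z \<notin> cball c \<rho> \<longrightarrow> f z = 0)"

lemma bump_exists:
  assumes "0 < \<rho>"
  shows "\<exists>f f'. bump c \<rho> f f'"
proof -
  have r: "0 < \<rho> / 2" "\<rho> / 2 < \<rho>" using assms by auto
  obtain cf :: "pt \<Rightarrow> real" and X Y C where cf: "\<And>z. (cf has_derivative (\<lambda>y. X z \<bullet> y)) (at z)" "\<And>z. (X has_derivative Y z) (at z)"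
    "\<And>z. 0 \<le> cf z" "\<And>z. cf z \<le> 1" "\<And>z. z \<in> cball c (\<rho> / 2) \<Longrightarrow> cf z = 1"
    "\<And>z. z \<notin> cball c \<rho> \<Longrightarrow> cf z = 0 \<and> X z = 0" "\<And>y. continuous_on UNIV (\<lambda>z. Y z y)"
    "C > 0" "\<And>z. norm (X z) \<le> C" "\<And>z y. norm (Y z y) \<le> C * norm y"
    by (rule cutoff_exists[OF r, of c]) (assumption | rule that)+
  have "continuous_on UNIV X" by (rule has_derivative_continuous_UNIV[OF cf(2)])
  moreover have "0 < cf c" using cf(5)[of c] r by simp
  ultimately have "bump c \<rho> cf X" unfolding bump_def using cf(1,3,6) by blast
  then show ?thesis by blast
qed

text \<open>A sequence of balls such that every ball around a point of \<open>Q\<close> contains one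
  of them. It reduces the exclusion of constant germs on all balls to countably many
  averages.\<close>

lemma countable_ball_basis:
  fixes Q :: "pt set"
  assumes "open Q" "Q \<noteq> {}"
  obtains c :: "nat \<Rightarrow> pt" and \<rho> :: "nat \<Rightarrow> real" where "\<And>j. 0 < \<rho> j" "\<And>j. cball (c j) (\<rho> j) \<subseteq> Q"
    "\<And>z d. z \<in> Q \<Longrightarrow> 0 < d \<Longrightarrow> \<exists>j. cball (c j) (\<rho> j) \<subseteq> ball z d"
proof -
  obtain D :: "pt set" where D: "countable D" "\<And>X. open X \<Longrightarrow> X \<noteq> {} \<Longrightarrow> \<exists>x\<in>D. x \<in> X"
    using countable_dense_exists by blast
  define X where "X = {p \<in> D \<times> range (\<lambda>n. 1 / real (Suc n)). cball (fst p) (snd p) \<subseteq> Q}"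
  have "countable (D \<times> range (\<lambda>n. 1 / real (Suc n)))" by (intro countable_SIGMA D(1) countable_image countableI_type)
  then have cX: "countable X" by (rule countable_subset[rotated]) (auto simp: X_def)
  have ex: "\<exists>p\<in>X. cball (fst p) (snd p) \<subseteq> ball z d" if z: "z \<in> Q" "0 < d" for z d
  proof -
    obtain e where e: "0 < e" "ball z e \<subseteq> Q \<inter> ball z d"
      using openE[of "Q \<inter> ball z d" z] assms(1) z by (auto simp: open_Int)
    have e3: "0 < e / 3" using e(1) by simp
    obtain n where n: "1 / real (Suc n) < e / 3" using reals_Archimedean[OF e3] by (auto simp: inverse_eq_divide)
    have "\<exists>x\<in>D. x \<in> ball z (1 / real (Suc n))" by (rule D(2)) auto
    then obtain x where x: "x \<in> D" "dist z x < 1 / real (Suc n)" by auto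
    have sub: "cball x (1 / real (Suc n)) \<subseteq> ball z e"
    proof
      fix y assume "y \<in> cball x (1 / real (Suc n))"
      then have "dist x y \<le> 1 / real (Suc n)" by simp
      then show "y \<in> ball z e" using dist_triangle[of z y x] x(2) n e(1) by simp
    qed
    have "(x, 1 / real (Suc n)) \<in> X" unfolding X_def using x(1) sub e(2) by auto
    then show ?thesis using sub e(2) by (intro bexI[of _ "(x, 1 / real (Suc n))"]) auto
  qed
  have ne: "X \<noteq> {}"
  proof -
    obtain z where "z \<in> Q" using assms(2) by blast
    then show ?thesis using ex[of z 1] by auto
  qed
  define p where "p = from_nat_into X"
  have pX: "p j \<in> X" for j unfolding p_def by (rule from_nat_into[OF ne])
  have rp: "range p = X" unfolding p_def by (rule range_from_nat_into[OF ne cX])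
  show ?thesis
  proof (rule that[of "\<lambda>j. snd (p j)" "\<lambda>j. fst (p j)"])
    show "0 < snd (p j)" for j using pX[of j] by (auto simp: X_def)
    show "cball (fst (p j)) (snd (p j)) \<subseteq> Q" for j using pX[of j] by (simp add: X_def)
    show "\<exists>j. cball (fst (p j)) (snd (p j)) \<subseteq> ball z d" if zd: "z \<in> Q" "0 < d" for z d
    proof -
      obtain x where "x \<in> X" "cball (fst x) (snd x) \<subseteq> ball z d" using ex[OF zd] by blast
      then show ?thesis using rp by (metis imageE)
    qed
  qed
qed

lemma bounded_image_continuous:
  fixes A :: "'a::euclidean_space \<Rightarrow> 'b::real_normed_vector"
  assumes "continuous_on UNIV A" "bounded Q"
  obtains C where "C > 0" "\<And>z. z \<in> Q \<Longrightarrow> norm (A z) \<le> C"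
proof -
  have "compact (A ` closure Q)" using assms by (intro compact_continuous_image continuous_on_subset[OF assms(1)]) auto
  then obtain C where "C > 0" "\<And>x. x \<in> A ` closure Q \<Longrightarrow> norm x \<le> C" using compact_imp_bounded bounded_pos by metis
  then show ?thesis using that[of C] closure_subset[of Q] by blast
qed

section \<open>The limit of the iteration\<close>

context five_states
begin

text \<open>\<open>V k\<close> converges uniformly, while gradients and fluxes converge where both
  \<open>N k z\<close> and \<open>G k z\<close> are summable, that is almost everywhere. Pointwise
  convergence of the gradients is what allows the nonlinear relation to be read off in the limit.
  All supports lie in \<open>Q\<close>, so \<open>v\<close> leaves initial, final and lateral values
  unchanged.\<close>

lemma limit_field:
  fixes Q :: "pt set"
  assumes Q: "open Q" "bounded Q" "Q \<noteq> {}" and A: "continuous_on UNIV A" "continuous_on UNIV Z"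
    and AU: "\<And>z. z \<in> Q \<Longrightarrow> (A z, Z z) \<in> U 1" and e: "0 < e"
  obtains v :: "pt \<Rightarrow> real^2" and Bi \<zeta>i L where "\<And>z. z \<notin> Q \<Longrightarrow> v z = 0" "\<And>z. norm (v z) \<le> e" "L-lipschitz_on UNIV v"
    "AE z in lborel. z \<in> Q \<longrightarrow> ((\<lambda>y. v (y, snd z)) has_derivative (\<lambda>h. Bi z *v h)) (at (fst z)) \<and>
       (\<exists>i<5. dist (A z + Bi z) (As i) \<le> r \<and> Z z + \<zeta>i z = Zs i)"
    "\<And>\<psi>. C1_fun \<psi> \<Longrightarrow> \<exists>h. integrable lborel h \<and> (\<forall>z. z \<notin> Q \<longrightarrow> h z = 0) \<and> (\<integral>z. h z \<partial>lborel) = 0 \<and>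
       (AE z in lborel. z \<in> Q \<longrightarrow> h z = v z \<bullet> Dt \<psi> z - (Bi z + \<zeta>i z) \<bullet> Dx \<psi> z)"
    "\<And>z d i. z \<in> Q \<Longrightarrow> 0 < d \<Longrightarrow> i < 5 \<Longrightarrow> \<not> (AE w in lborel. w \<in> ball z d \<and> w \<in> Q \<longrightarrow> Z w + \<zeta>i w = Zs i)"
proof -
  obtain c :: "nat \<Rightarrow> pt" and \<rho> where c: "\<And>j. 0 < \<rho> j" "\<And>j. cball (c j) (\<rho> j) \<subseteq> Q"
    "\<And>z d. z \<in> Q \<Longrightarrow> 0 < d \<Longrightarrow> \<exists>j. cball (c j) (\<rho> j) \<subseteq> ball z d"
    by (rule countable_ball_basis[OF Q(1,3)]) (assumption | rule that)+
  have "\<forall>j. \<exists>f f'. bump (c j) (\<rho> j) f f'" using bump_exists[OF c(1)] by blast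
  then obtain f f' where ff: "\<And>j. bump (c j) (\<rho> j) (f j) (f' j)" by metis
  have f: "(f j has_derivative (\<lambda>y. f' j z \<bullet> y)) (at z)" "continuous_on UNIV (f' j)" "0 \<le> f j z" "0 < f j (c j)" for j z
    using ff[of j] unfolding bump_def by blast+
  have f0: "f j z = 0" if "z \<notin> cball (c j) (\<rho> j)" for j z using ff[of j] that unfolding bump_def by blast
  have cf: "continuous_on UNIV (f j)" for j by (rule has_derivative_continuous_UNIV[OF f(1)])
  obtain S V B \<tau> \<zeta> G N where st: "\<And>k. stage Q A Z k (S k) (V k) (B k) (\<tau> k) (\<zeta> k) (G k)"
    and ge: "\<And>k. gen Q A Z e k (V k) (B k) (\<tau> k) (\<zeta> k) (G k) (V (Suc k)) (B (Suc k)) (\<tau> (Suc k)) (\<zeta> (Suc k)) f (N k)"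
    and V0: "V 0 = (\<lambda>z. 0)" "\<tau> 0 = (\<lambda>z. 0)"
    by (rule iteration[where f = f and f' = f' and a = c, OF Q(1,2) A AU f(1,2) compact_cball c(2) f0 f(3,4) e]) (assumption | rule that)+
  have P: "S k \<subseteq> Q" "pert (S k) (V k) (B k) (\<tau> k) (\<zeta> k)" "G k \<in> borel_measurable borel"
    "(\<integral>z. indicator Q z * G k z \<partial>lborel) \<le> (measure lborel Q + 1) * (998/1000) ^ k" for k
    using st[of k] unfolding stage_def by blast+
  have GU: "0 < G k z" "G k z \<le> 1" "(A z + B k z, Z z + \<zeta> k z) \<in> U (G k z)" if "z \<in> Q" for k z
    using st[of k] that unfolding stage_def by blast+
  have U1: "(A z + B k z, Z z + \<zeta> k z) \<in> U 1" if "z \<in> Q" for k z using GU[OF that] U_mono by blast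
  have inc: "norm (V (Suc k) z - V k z) \<le> e * (1/2) ^ (k + 2)" "norm (\<tau> (Suc k) z - \<tau> k z) \<le> e * (1/2) ^ (k + 2)" for k z
    using ge[of k] unfolding gen_def by blast+
  have Nm: "N k \<in> borel_measurable borel" "(\<integral>z. indicator Q z * N k z \<partial>lborel) \<le> 12801 * (measure lborel Q + 1) * (998/1000) ^ k" for k
    using ge[of k] unfolding gen_def by blast+
  have Nb: "0 \<le> N k z" "N k z \<le> 13000" "norm (\<zeta> (Suc k) z - \<zeta> k z) \<le> N k z" "norm (B (Suc k) z - B k z) \<le> N k z"
    "norm ((V (Suc k) (y, snd z) - V k (y, snd z)) - (V (Suc k) z - V k z)) \<le> N k z * norm (y - fst z)" if "z \<in> Q" for k z y
    using ge[of k] that unfolding gen_def by blast+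
  have W: "(1 - (1/2) ^ (k + 2)) * wt (f j) i (\<lambda>z. Z z + \<zeta> k z) \<le> wt (f j) i (\<lambda>z. Z z + \<zeta> (Suc k) z)" if "j < k" "i < 5" for i j k
    using ge[of k] that unfolding gen_def by blast
  have out: "V k z = 0" "B k z = 0" "\<tau> k z = 0" "\<zeta> k z = 0" if "z \<notin> Q" for k z
    using pertD(5)[OF P(2)[of k], of z] P(1)[of k] that by auto
  have small: "norm (a k) \<le> e" if "a 0 = 0" "\<And>k. norm (a (Suc k) - a k) \<le> e * (1/2) ^ (k + 2)" for a :: "nat \<Rightarrow> real^2" and k
  proof -
    have "norm (a k) \<le> e * (1/2 - (1/2) ^ (k + 1))"
    proof (induction k)
      case (Suc k)
      have "norm (a (Suc k)) \<le> norm (a k) + norm (a (Suc k) - a k)" using norm_triangle_ineq[of "a k" "a (Suc k) - a k"] by simp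
      also have "\<dots> \<le> e * (1/2 - (1/2) ^ (k + 1)) + e * (1/2) ^ (k + 2)" using Suc that(2)[of k] by linarith
      finally show ?case by (simp add: algebra_simps)
    qed (simp add: that(1))
    also have "\<dots> \<le> e * 1"
    proof (rule mult_left_mono)
      have "0 \<le> (1/2 :: real) ^ (k + 1)" by simp
      then show "1/2 - (1/2 :: real) ^ (k + 1) \<le> 1" by linarith
    qed (use e in simp)
    finally show ?thesis by simp
  qed
  have Vn: "norm (V k z) \<le> e" for k z using small[of "\<lambda>k. V k z"] V0 inc by simp
  have Tn: "norm (\<tau> k z) \<le> e" for k z using small[of "\<lambda>k. \<tau> k z"] V0 inc by simp
  obtain Cu where Cu: "Cu > 0" "\<And>p. p \<in> U 1 \<Longrightarrow> norm p \<le> Cu" using U_bounded bounded_pos by metis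
  obtain Ca where Ca: "Ca > 0" "\<And>z. z \<in> Q \<Longrightarrow> norm (A z) \<le> Ca" by (rule bounded_image_continuous[OF A(1) Q(2)]) (assumption | rule that)+
  obtain Cz where Cz: "Cz > 0" "\<And>z. z \<in> Q \<Longrightarrow> norm (Z z) \<le> Cz" by (rule bounded_image_continuous[OF A(2) Q(2)]) (assumption | rule that)+
  have Bn: "norm (B k z) \<le> Cu + Ca" "norm (\<zeta> k z) \<le> Cu + Cz" for k z
  proof -
    have "norm (B k z) \<le> Cu + Ca \<and> norm (\<zeta> k z) \<le> Cu + Cz"
    proof (cases "z \<in> Q")
      case True
      have "norm (A z + B k z) \<le> Cu" "norm (Z z + \<zeta> k z) \<le> Cu"
        using Cu(2)[OF U1[OF True, of k]] norm_fst_le[of "A z + B k z" "Z z + \<zeta> k z"] norm_snd_le[of "Z z + \<zeta> k z" "A z + B k z"] by linarith+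
      moreover have "norm (B k z) \<le> norm (A z + B k z) + norm (A z)" "norm (\<zeta> k z) \<le> norm (Z z + \<zeta> k z) + norm (Z z)"
        using norm_triangle_ineq4[of "A z + B k z" "A z"] norm_triangle_ineq4[of "Z z + \<zeta> k z" "Z z"] by simp_all
      ultimately show ?thesis using Ca(2)[OF True] Cz(2)[OF True] by linarith
    qed (use out Cu(1) Ca(1) Cz(1) in simp)
    then show "norm (B k z) \<le> Cu + Ca" "norm (\<zeta> k z) \<le> Cu + Cz" by auto
  qed
  define v where "v z = lim (\<lambda>k. V k z)" for z
  have vl: "(\<lambda>k. V k z) \<longlonglongrightarrow> v z" for z
    unfolding v_def
  proof (rule increments_converge[where c = "\<lambda>k. e * (1/2) ^ (k + 2)"])
    show "norm (V (Suc k) z - V k z) \<le> e * (1/2) ^ (k + 2)" for k by (rule inc(1))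
    have "summable (\<lambda>k. (e * (1/2)^2) * (1/2 :: real) ^ k)" by (intro summable_mult summable_geometric) simp
    then show "summable (\<lambda>k. e * (1/2) ^ (k + 2))" by (simp add: power_add mult_ac)
  qed
  have v0: "v z = 0" if "z \<notin> Q" for z
    using vl[of z] out(1)[OF that] by (simp add: LIMSEQ_const_iff)
  have vn: "norm (v z) \<le> e" for z
    by (rule LIMSEQ_le_const2[OF tendsto_norm[OF vl]]) (use Vn in blast)
  define L where "L = 2 * (Cu + Ca) + e"
  have L0: "0 \<le> L" using Cu(1) Ca(1) e by (simp add: L_def)
  have VL: "norm (V k z - V k w) \<le> L * norm (z - w)" for k z w
  proof (rule differentiable_bound[where S = UNIV])
    show "(V k has_derivative (\<lambda>y. B k x *v fst y + snd y *\<^sub>R \<tau> k x)) (at x within UNIV)" for x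
      using pertD(1)[OF P(2)[of k], of x] .
    show "onorm (\<lambda>y. B k x *v fst y + snd y *\<^sub>R \<tau> k x) \<le> L" for x
    proof (rule onorm_bound[OF L0])
      fix y :: pt
      have "norm (B k x *v fst y + snd y *\<^sub>R \<tau> k x) \<le> norm (B k x *v fst y) + norm (snd y *\<^sub>R \<tau> k x)" by (rule norm_triangle_ineq)
      also have "norm (B k x *v fst y) \<le> 2 * norm (B k x) * norm (fst y)" by (rule norm_mv_le)
      also have "\<dots> \<le> 2 * (Cu + Ca) * norm y"
        using Bn(1)[of k x] norm_fst_le[of "fst y" "snd y"] Cu(1) Ca(1) by (intro mult_mono) auto
      also have "norm (snd y *\<^sub>R \<tau> k x) \<le> norm y * e"
        unfolding norm_scaleR using Tn[of k x] norm_snd_le[of "snd y" "fst y"] by (intro mult_mono) auto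
      finally show "norm (B k x *v fst y + snd y *\<^sub>R \<tau> k x) \<le> L * norm y" by (simp add: L_def algebra_simps)
    qed
  qed auto
  have vL: "L-lipschitz_on UNIV v"
  proof (rule lipschitz_onI)
    fix z w
    have "norm (v z - v w) \<le> L * norm (z - w)"
      by (rule LIMSEQ_le_const2[OF tendsto_norm[OF tendsto_diff[OF vl vl]]]) (use VL in blast)
    then show "dist (v z) (v w) \<le> L * dist z w" by (simp add: dist_norm)
  qed (rule L0)
  have Qs: "Q \<in> sets borel" "emeasure lborel Q < \<infinity>" using Q emeasure_bounded_finite[OF Q(2)] by auto
  have aeS: "AE z in lborel. summable (\<lambda>k. indicator Q z * H k z)"
    if "\<And>k. H k \<in> borel_measurable borel" "\<And>k z. z \<in> Q \<Longrightarrow> 0 \<le> H k z \<and> H k z \<le> c0" "\<And>k. (\<integral>z. indicator Q z * H k z \<partial>lborel) \<le> M * (998/1000) ^ k"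
    for H :: "nat \<Rightarrow> pt \<Rightarrow> real" and M c0
  proof (rule AE_summable)
    show "integrable lborel (\<lambda>z. indicator Q z * H k z)" for k
      by (rule integrable_bounded_on[where c = c0, OF that(1)[of k] Qs]) (use that(2) in \<open>simp add: abs_of_nonneg\<close>)
    show p: "0 \<le> indicator Q z * H k z" for k z using that(2)[of z k] by (cases "z \<in> Q") auto
    have q0: "summable (\<lambda>k. M * (998/1000 :: real) ^ k)" by (intro summable_mult summable_geometric) simp
    show "summable (\<lambda>k. \<integral>z. indicator Q z * H k z \<partial>lborel)"
    proof (rule summable_comparison_test'[OF q0, of 0])
      fix k
      have "0 \<le> (\<integral>z. indicator Q z * H k z \<partial>lborel)" using p by (intro integral_nonneg_AE AE_I2)
      then show "norm (\<integral>z. indicator Q z * H k z \<partial>lborel) \<le> M * (998/1000) ^ k" using that(3)[of k] by simp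
    qed
  qed
  define good where "good z \<longleftrightarrow> (z \<in> Q \<longrightarrow> summable (\<lambda>k. N k z) \<and> summable (\<lambda>k. G k z))" for z
  have aeg: "AE z in lborel. good z"
  proof -
    have "AE z in lborel. summable (\<lambda>k. indicator Q z * N k z)" by (rule aeS[OF Nm(1) _ Nm(2)]) (use Nb in blast)
    moreover have "AE z in lborel. summable (\<lambda>k. indicator Q z * G k z)" by (rule aeS[OF P(3) _ P(4)]) (use GU in \<open>blast intro: less_imp_le\<close>)
    ultimately show ?thesis
    proof eventually_elim
      case (elim z)
      then show ?case by (cases "z \<in> Q") (simp_all add: good_def)
    qed
  qed
  define Bi where "Bi z = lim (\<lambda>k. B k z)" for z
  define \<zeta>i where "\<zeta>i z = lim (\<lambda>k. \<zeta> k z)" for z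
  have Bl: "(\<lambda>k. B k z) \<longlonglongrightarrow> Bi z" "(\<lambda>k. \<zeta> k z) \<longlonglongrightarrow> \<zeta>i z" if "z \<in> Q" "good z" for z
  proof -
    have s: "summable (\<lambda>k. N k z)" using that by (simp add: good_def)
    show "(\<lambda>k. B k z) \<longlonglongrightarrow> Bi z" unfolding Bi_def by (rule increments_converge[where a = "\<lambda>k. B k z" and c = "\<lambda>k. N k z", OF Nb(4)[OF that(1)] s])
    show "(\<lambda>k. \<zeta> k z) \<longlonglongrightarrow> \<zeta>i z" unfolding \<zeta>i_def by (rule increments_converge[where a = "\<lambda>k. \<zeta> k z" and c = "\<lambda>k. N k z", OF Nb(3)[OF that(1)] s])
  qed
  have der: "((\<lambda>y. v (y, snd z)) has_derivative (\<lambda>h. Bi z *v h)) (at (fst z))" if z: "z \<in> Q" "good z" for z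
  proof (rule has_derivative_limit_increments[where f = "\<lambda>k y. V k (y, snd z)" and B = "\<lambda>k. B k z" and N = "\<lambda>k. N k z"])
    show "((\<lambda>y. V k (y, snd z)) has_derivative (\<lambda>h. B k z *v h)) (at (fst z))" for k
      using spatial_derivative[OF pertD(1)[OF P(2)[of k], of z]] by simp
    show "norm (V (Suc k) (y, snd z) - V k (y, snd z) - (V (Suc k) (fst z, snd z) - V k (fst z, snd z))) \<le> N k z * norm (y - fst z)" for k y
      using Nb(5)[OF z(1), of k y] by simp
    show "summable (\<lambda>k. N k z)" using z by (simp add: good_def)
  qed (use Nb(4)[OF z(1)] vl Bl[OF z] in auto)
  have lam: "\<exists>i<5. dist (A z + Bi z) (As i) \<le> r \<and> Z z + \<zeta>i z = Zs i" if z: "z \<in> Q" "good z" for z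
  proof -
    \<comment> \<open>The closed set of exact states. The distance of state \<open>k\<close> to it
      is at most \<open>3200 * G k z\<close>, which tends to zero as the term of a summable series,
      so the limit belongs to it.\<close>
    define X where "X = (\<Union>i\<in>{..<5}. cball (As i) r \<times> {Zs i})"
    have clX: "closed X" unfolding X_def by (intro closed_UN ballI closed_Times) auto
    define p where "p k = (A z + B k z, Z z + \<zeta> k z)" for k
    have "\<forall>k. \<exists>y. y \<in> X \<and> norm (y - p k) \<le> 3200 * G k z"
    proof
      fix k
      obtain i x where ix: "i < 5" "dist x (As i) < r" "norm (A z + B k z - x) \<le> 1600 * G k z" "norm (Z z + \<zeta> k z - Zs i) \<le> 1600 * G k z"
        using near[OF GU(3,1,2)[OF z(1), of k]] by blast
      have "norm ((x, Zs i) - p k) \<le> norm (x - (A z + B k z)) + norm (Zs i - (Z z + \<zeta> k z))"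
        unfolding p_def by (simp only: diff_Pair norm_Pair_le)
      then have "norm ((x, Zs i) - p k) \<le> 3200 * G k z" using ix(3,4) by (simp add: norm_minus_commute)
      moreover have "(x, Zs i) \<in> X" unfolding X_def
        using ix(1,2) by (intro UN_I[of i]) (auto simp: dist_commute)
      ultimately show "\<exists>y. y \<in> X \<and> norm (y - p k) \<le> 3200 * G k z" by blast
    qed
    then obtain y where y: "\<And>k. y k \<in> X" "\<And>k. norm (y k - p k) \<le> 3200 * G k z" by metis
    have sG: "summable (\<lambda>k. G k z)" using z by (simp add: good_def)
    have l0: "(\<lambda>k. 3200 * G k z) \<longlonglongrightarrow> 0"
      using tendsto_mult[OF tendsto_const[of 3200] summable_LIMSEQ_zero[OF sG]] by (simp only: mult_zero_right)
    have ev: "eventually (\<lambda>k. norm (y k - p k) \<le> 3200 * G k z) sequentially" by (intro always_eventually allI) (rule y(2))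
    have "(\<lambda>k. y k - p k) \<longlonglongrightarrow> 0" by (rule Lim_null_comparison[OF ev l0])
    moreover have "p \<longlonglongrightarrow> (A z + Bi z, Z z + \<zeta>i z)" unfolding p_def by (intro tendsto_Pair tendsto_add tendsto_const Bl z)
    ultimately have "(\<lambda>k. (y k - p k) + p k) \<longlonglongrightarrow> 0 + (A z + Bi z, Z z + \<zeta>i z)" by (rule tendsto_add)
    then have "y \<longlonglongrightarrow> (A z + Bi z, Z z + \<zeta>i z)" by simp
    then have "(A z + Bi z, Z z + \<zeta>i z) \<in> X" using closed_sequentially[OF clX] y(1) by blast
    then show ?thesis unfolding X_def by (auto simp: dist_commute)
  qed
  have ae: "AE z in lborel. z \<in> Q \<longrightarrow> ((\<lambda>y. v (y, snd z)) has_derivative (\<lambda>h. Bi z *v h)) (at (fst z)) \<and>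
       (\<exists>i<5. dist (A z + Bi z) (As i) \<le> r \<and> Z z + \<zeta>i z = Zs i)"
    using aeg by eventually_elim (use der lam in blast)
  have weak: "\<exists>h. integrable lborel h \<and> (\<forall>z. z \<notin> Q \<longrightarrow> h z = 0) \<and> (\<integral>z. h z \<partial>lborel) = 0 \<and>
       (AE z in lborel. z \<in> Q \<longrightarrow> h z = v z \<bullet> Dt \<psi> z - (Bi z + \<zeta>i z) \<bullet> Dx \<psi> z)" if psi: "C1_fun \<psi>" for \<psi>
  proof -
    define hk where "hk k z = V k z \<bullet> Dt \<psi> z - (B k z + \<zeta> k z) \<bullet> Dx \<psi> z" for k z
    \<comment> \<open>Defined from the approximating integrands to be measurable; it agrees with the
      expected integrand only at the good points.\<close>
    define h where "h z = lim (\<lambda>k. hk k z)" for z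
    have ck: "continuous_on UNIV (hk k)" for k unfolding hk_def[abs_def]
      by (intro continuous_on_diff continuous_on_inner continuous_on_add pert_continuous[OF P(2)] C1_fun_continuous[OF psi] pertD(2,4)[OF P(2)])
    have mk: "hk k \<in> borel_measurable borel" for k by (rule borel_measurable_continuous_onI[OF ck])
    have mh: "h \<in> borel_measurable borel" unfolding h_def[abs_def] by (rule borel_measurable_lim_metric[OF mk])
    obtain Ct where Ct: "Ct > 0" "\<And>z. z \<in> Q \<Longrightarrow> norm (Dt \<psi> z) \<le> Ct"
      by (rule bounded_image_continuous[OF C1_fun_continuous(2)[OF psi] Q(2)]) (assumption | rule that)+
    obtain Cx where Cx: "Cx > 0" "\<And>z. z \<in> Q \<Longrightarrow> norm (Dx \<psi> z) \<le> Cx"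
      by (rule bounded_image_continuous[OF C1_fun_continuous(3)[OF psi] Q(2)]) (assumption | rule that)+
    define cc where "cc = e * Ct + ((Cu + Ca) + (Cu + Cz)) * Cx"
    have h0: "hk k z = 0" if "z \<notin> Q" for k z using out[OF that] by (simp add: hk_def)
    have hb: "norm (hk k z) \<le> indicator Q z * cc" for k z
    proof (cases "z \<in> Q")
      case True
      have "\<bar>V k z \<bullet> Dt \<psi> z\<bar> \<le> norm (V k z) * norm (Dt \<psi> z)" by (rule Cauchy_Schwarz_ineq2)
      also have "\<dots> \<le> e * Ct" using Vn Ct(2)[OF True] e by (intro mult_mono) auto
      finally have 1: "\<bar>V k z \<bullet> Dt \<psi> z\<bar> \<le> e * Ct" .
      have "norm (B k z + \<zeta> k z) \<le> (Cu + Ca) + (Cu + Cz)" using norm_triangle_ineq[of "B k z" "\<zeta> k z"] Bn[of k z] by linarith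
      then have "norm (B k z + \<zeta> k z) * norm (Dx \<psi> z) \<le> ((Cu + Ca) + (Cu + Cz)) * Cx" using Cx(2)[OF True] Cu(1) Ca(1) Cz(1) by (intro mult_mono) auto
      then have "\<bar>(B k z + \<zeta> k z) \<bullet> Dx \<psi> z\<bar> \<le> ((Cu + Ca) + (Cu + Cz)) * Cx" using Cauchy_Schwarz_ineq2[of "B k z + \<zeta> k z" "Dx \<psi> z"] by linarith
      then show ?thesis using 1 True by (simp add: hk_def cc_def)
    qed (simp add: h0)
    have lk: "(\<lambda>k. hk k z) \<longlonglongrightarrow> v z \<bullet> Dt \<psi> z - (Bi z + \<zeta>i z) \<bullet> Dx \<psi> z" if "z \<in> Q" "good z" for z
      unfolding hk_def by (intro tendsto_diff tendsto_inner tendsto_add tendsto_const vl Bl that)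
    have hz: "h z = 0" if "z \<notin> Q" for z using h0[OF that] by (simp add: h_def)
    have hl: "h z = v z \<bullet> Dt \<psi> z - (Bi z + \<zeta>i z) \<bullet> Dx \<psi> z" if "z \<in> Q" "good z" for z unfolding h_def by (rule limI[OF lk[OF that]])
    have aeh: "AE z in lborel. (\<lambda>k. hk k z) \<longlonglongrightarrow> h z" using aeg
    proof eventually_elim
      case (elim z)
      show ?case
      proof (cases "z \<in> Q")
        case True
        then show ?thesis using lk[OF True elim] hl[OF True elim] by simp
      qed (simp add: h0 hz)
    qed
    have iw: "integrable lborel (\<lambda>z. indicator Q z * cc)" using Qs by (intro integrable_mult_left integrable_real_indicator) auto
    have mk': "hk k \<in> borel_measurable lborel" for k using mk by simp
    have mh': "h \<in> borel_measurable lborel" using mh by simp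
    have ih: "integrable lborel h"
      by (rule integrable_dominated_convergence[OF mh' mk' iw aeh]) (use hb in auto)
    have "(\<lambda>k. \<integral>z. hk k z \<partial>lborel) \<longlonglongrightarrow> (\<integral>z. h z \<partial>lborel)"
      by (rule integral_dominated_convergence[OF mh' mk' iw aeh]) (use hb in auto)
    moreover have "(\<integral>z. hk k z \<partial>lborel) = 0" for k unfolding hk_def by (rule pertD(6)[OF P(2) psi])
    ultimately have "(\<integral>z. h z \<partial>lborel) = 0" by (simp add: LIMSEQ_const_iff)
    moreover have "AE z in lborel. z \<in> Q \<longrightarrow> h z = v z \<bullet> Dt \<psi> z - (Bi z + \<zeta>i z) \<bullet> Dx \<psi> z"
      using aeg by eventually_elim (use hl in blast)
    ultimately show ?thesis using ih hz by blast
  qed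
  have nowhere: "\<not> (AE w in lborel. w \<in> ball z d \<and> w \<in> Q \<longrightarrow> Z w + \<zeta>i w = Zs i)" if z: "z \<in> Q" "0 < d" "i < 5" for z d i
  proof
    assume bad: "AE w in lborel. w \<in> ball z d \<and> w \<in> Q \<longrightarrow> Z w + \<zeta>i w = Zs i"
    obtain j where j: "cball (c j) (\<rho> j) \<subseteq> ball z d" using c(3)[OF z(1,2)] by blast
    define wk where "wk k w = f j w * (nr i \<bullet> (Z w + \<zeta> k w - Zs i))" for k w
    have cZ: "continuous_on UNIV (\<lambda>w. Z w + \<zeta> k w)" for k by (intro continuous_on_add A pertD(4)[OF P(2)])
    have iwk: "integrable lborel (wk k)" for k unfolding wk_def[abs_def]
      by (rule wt_integrable[OF cf compact_cball f0 cZ])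
    obtain Cf where Cf: "Cf > 0" "\<And>w. norm (f j w) \<le> Cf"
      by (rule compact_support_bounded[OF cf compact_cball f0]) (assumption | rule that)+
    define cc where "cc = Cf * (norm (nr i) * (Cz + (Cu + Cz) + norm (Zs i)))"
    have wb: "norm (wk k w) \<le> indicator Q w * cc" for k w
    proof (cases "w \<in> cball (c j) (\<rho> j)")
      case True
      then have wQ: "w \<in> Q" using c(2) by blast
      have "norm (Z w + \<zeta> k w - Zs i) \<le> norm (Z w) + norm (\<zeta> k w) + norm (Zs i)"
        using norm_triangle_ineq4[of "Z w + \<zeta> k w" "Zs i"] norm_triangle_ineq[of "Z w" "\<zeta> k w"] by linarith
      also have "\<dots> \<le> Cz + (Cu + Cz) + norm (Zs i)" using Cz(2)[OF wQ] Bn(2)[of k w] by linarith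
      finally have "norm (nr i) * norm (Z w + \<zeta> k w - Zs i) \<le> norm (nr i) * (Cz + (Cu + Cz) + norm (Zs i))" by (rule mult_left_mono) simp
      then have "\<bar>nr i \<bullet> (Z w + \<zeta> k w - Zs i)\<bar> \<le> norm (nr i) * (Cz + (Cu + Cz) + norm (Zs i))"
        using Cauchy_Schwarz_ineq2[of "nr i" "Z w + \<zeta> k w - Zs i"] by linarith
      then have "norm (f j w) * \<bar>nr i \<bullet> (Z w + \<zeta> k w - Zs i)\<bar> \<le> cc" unfolding cc_def using Cf by (intro mult_mono) auto
      then show ?thesis using wQ by (simp add: wk_def abs_mult)
    next
      case False
      have "0 \<le> cc" unfolding cc_def using Cf(1) Cz(1) Cu(1) by (intro mult_nonneg_nonneg add_nonneg_nonneg) auto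
      then show ?thesis using f0[OF False] by (simp add: wk_def)
    qed
    have iw: "integrable lborel (\<lambda>w. indicator Q w * cc)" using Qs by (intro integrable_mult_left integrable_real_indicator) auto
    have "AE w in lborel. (\<lambda>k. wk k w) \<longlonglongrightarrow> 0" using aeg bad
    proof eventually_elim
      case (elim w)
      show ?case
      proof (cases "w \<in> cball (c j) (\<rho> j)")
        case True
        then have wQ: "w \<in> Q" "w \<in> ball z d" using c(2) j by blast+
        have "(\<lambda>k. wk k w) \<longlonglongrightarrow> f j w * (nr i \<bullet> (Z w + \<zeta>i w - Zs i))" unfolding wk_def
          by (intro tendsto_mult tendsto_inner tendsto_diff tendsto_add tendsto_const Bl wQ(1) elim(1))
        moreover have "Z w + \<zeta>i w - Zs i = 0" using elim(2) wQ by simp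
        ultimately show ?thesis by (simp only: inner_zero_right mult_zero_right)
      next
        case False
        then show ?thesis using f0[OF False] by (simp add: wk_def)
      qed
    qed
    then have "(\<lambda>k. \<integral>w. wk k w \<partial>lborel) \<longlonglongrightarrow> (\<integral>w. 0 \<partial>(lborel :: pt measure))"
      by (intro integral_dominated_convergence[OF _ borel_measurable_integrable[OF iwk] iw]) (use wb in auto)
    then have l0: "(\<lambda>k. wt (f j) i (\<lambda>w. Z w + \<zeta> k w)) \<longlonglongrightarrow> 0" by (simp add: wt_def wk_def)
    \<comment> \<open>Bump \<open>j\<close> is monitored from step \<open>Suc j\<close> on, so the
      lower bound starts from the average at that stage.\<close>
    have pos: "0 < wt (f j) i (\<lambda>w. Z w + \<zeta> (Suc j) w)"
    proof (rule wt_pos[OF cf compact_cball f0 f(3,4) cZ])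
      show "0 < nr i \<bullet> (Z w + \<zeta> (Suc j) w - Zs i)" if "w \<in> cball (c j) (\<rho> j)" for w
        using side[OF U1 z(3)] c(2) that by blast
    qed
    define w0 where "w0 = wt (f j) i (\<lambda>w. Z w + \<zeta> (Suc j) w)"
    \<comment> \<open>The bound \<open>1/2\<close> alone would not reproduce itself. With
      \<open>x = (1/2) ^ (n + j + 2)\<close> the stronger value \<open>1/2 + x\<close> does, since
      \<open>(1 - x/2) * (1/2 + x) \<ge> 1/2 + x/2\<close> for
      \<open>0 \<le> x \<le> 1/2\<close>.\<close>
    have lower: "w0 * (1/2 + (1/2) ^ (n + Suc j + 1)) \<le> wt (f j) i (\<lambda>w. Z w + \<zeta> (n + Suc j) w)" for n
    proof (induction n)
      case 0
      have "(1/2 :: real) ^ (j + 2) \<le> (1/2) ^ 1" by (intro power_decreasing) auto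
      then have "w0 * (1/2 + (1/2) ^ (j + 2)) \<le> w0 * 1" using pos by (intro mult_left_mono) (auto simp: w0_def)
      then show ?case by (simp add: w0_def)
    next
      case (Suc n)
      define x :: real where "x = (1/2) ^ (n + Suc j + 1)"
      have x: "0 < x" "x \<le> 1/2" using power_decreasing[of 1 "n + Suc j + 1" "1/2::real"] by (auto simp: x_def)
      have xh: "(1/2 :: real) ^ (n + Suc j + 2) = x / 2" "(1/2 :: real) ^ (Suc n + Suc j + 1) = x / 2" by (simp_all add: x_def)
      have "x * x \<le> x * (1/2)" using x by (intro mult_left_mono) auto
      then have "1/2 + x / 2 \<le> (1 - x / 2) * (1/2 + x)" by (simp add: algebra_simps)
      then have "w0 * (1/2 + x / 2) \<le> w0 * ((1 - x / 2) * (1/2 + x))" using pos by (intro mult_left_mono) (auto simp: w0_def)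
      also have "\<dots> = (1 - x / 2) * (w0 * (1/2 + x))" by simp
      also have "\<dots> \<le> (1 - x / 2) * wt (f j) i (\<lambda>w. Z w + \<zeta> (n + Suc j) w)" using Suc x by (intro mult_left_mono) (auto simp: x_def)
      also have "\<dots> \<le> wt (f j) i (\<lambda>w. Z w + \<zeta> (Suc (n + Suc j)) w)" using W[of j "n + Suc j" i] z(3) unfolding xh by simp
      finally show ?case unfolding xh by simp
    qed
    have "w0 / 2 \<le> wt (f j) i (\<lambda>w. Z w + \<zeta> (n + Suc j) w)" for n
    proof -
      have "w0 * (1/2) \<le> w0 * (1/2 + (1/2) ^ (n + Suc j + 1))" using pos by (intro mult_left_mono) (auto simp: w0_def)
      then show ?thesis using lower[of n] by simp
    qed
    then have "w0 / 2 \<le> 0" by (intro LIMSEQ_le_const[OF LIMSEQ_ignore_initial_segment[OF l0, of "Suc j"]]) blast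
    then show False using pos by (simp add: w0_def)
  qed
  show ?thesis by (rule that[OF v0 vn vL ae weak nowhere])
qed

end

section \<open>The smooth flow that is perturbed\<close>

lemma integrable_translate:
  fixes f :: "'a::euclidean_space \<Rightarrow> real"
  assumes "integrable lborel f"
  shows "integrable lborel (\<lambda>x. f (x + c))"
proof -
  have "integrable (distr lborel borel ((+) c)) f" using assms by (simp only: lborel_distr_plus)
  then have "integrable lborel (\<lambda>x. f (c + x))"
    by (subst (asm) integrable_distr_eq) (use borel_measurable_integrable[OF assms] in auto)
  then show ?thesis by (simp add: add.commute)
qed

lemma AE_snd_neq: "AE z in lborel. snd (z :: pt) \<noteq> c"
proof -
  have eq: "{z :: pt. (0, 1) \<bullet> z = c} = {z. snd z = c}" by (auto simp: inner_prod_def)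
  have "negligible {z :: pt. (0, 1) \<bullet> z = c}" by (rule negligible_hyperplane) (simp add: zero_prod_def)
  then have n: "{z :: pt. snd z = c} \<in> null_sets (completion lborel)" unfolding eq negligible_iff_null_sets .
  have "closed {z :: pt. snd z = c}" by (intro closed_Collect_eq continuous_intros)
  then have "{z :: pt. snd z = c} \<in> sets lborel" by (simp add: borel_closed)
  then have "{z :: pt. snd z = c} \<in> null_sets lborel" using n by (simp only: null_sets_completion_iff)
  then show ?thesis by (rule AE_I') auto
qed

text \<open>A constant flux is divergence free. For constant \<open>g\<close> the right-hand side of
  \<open>slab_shift\<close> is the difference of two integrals that agree by translation.\<close>

lemma slab_shift_const:
  fixes \<psi> :: "pt \<Rightarrow> real^2" and w e :: "real^2"
  assumes d: "\<And>z. (\<psi> has_derivative \<psi>' z) (at z)" and c: "\<And>y. continuous_on UNIV (\<lambda>z. \<psi>' z y)"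
    and K: "compact K" "\<And>x t. x \<notin> K \<Longrightarrow> \<psi> (x, t) = 0"
  shows "(\<integral>z. indicator {0..T} (snd z) * (w \<bullet> \<psi>' z (e, 0)) \<partial>lborel) = 0"
proof -
  define h where "h z = indicator {0..T} (snd z) * (w \<bullet> \<psi> z)" for z
  have cp: "continuous_on UNIV \<psi>" by (rule has_derivative_continuous_UNIV[OF d])
  have hD: "h z = indicator (K \<times> {0..T}) z *\<^sub>R (w \<bullet> \<psi> z)" for z
    using K(2)[of "fst z" "snd z"] by (cases "fst z \<in> K") (simp_all add: h_def indicator_times)
  have ih: "integrable lborel h"
    unfolding hD[abs_def] by (rule borel_integrable_compact) (auto intro!: compact_Times K(1) continuous_on_inner continuous_on_subset[OF cp])
  have tr: "(\<integral>z. h (z + (e, 0)) \<partial>lborel) = (\<integral>z. h z \<partial>lborel)"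
    by (rule integral_translate) (use borel_measurable_integrable[OF ih] in simp)
  have it: "integrable lborel (\<lambda>z. h (z + (e, 0)))"
    by (rule integrable_translate[OF ih])
  have "(\<integral>z. indicator {0..T} (snd z) * (integral {0..1::real} (\<lambda>s. w) \<bullet> \<psi>' z (e, 0)) \<partial>lborel)
    = (\<integral>z. indicator {0..T} (snd z) * (w \<bullet> (\<psi> (fst z + 1 *\<^sub>R e, snd z) - \<psi> z)) \<partial>lborel)"
    by (rule slab_shift[where g = "\<lambda>x. w" and R = 1, OF d c K]) (assumption | simp)+
  also have "\<dots> = (\<integral>z. h (z + (e, 0)) - h z \<partial>lborel)"
    by (rule arg_cong[of _ _ "integral\<^sup>L lborel"], rule ext) (simp add: h_def inner_diff_right right_diff_distrib plus_prod_def)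
  also have "\<dots> = 0" using Bochner_Integration.integral_diff[OF it ih] tr by simp
  finally show ?thesis by simp
qed

text \<open>A primitive of \<open>\<phi>\<close> along the first axis over a finite length: its
  derivative is \<open>\<phi> x - \<phi> (x - R e)\<close> with \<open>e\<close> the first unit
  vector. When the translation by \<open>R\<close> carries the support of \<open>\<phi>\<close> out
  of the domain, the second term vanishes on the domain, and
  \<open>outer (shift_primitive \<phi> R x) (axis 1 1)\<close> is a bounded matrix field there with
  divergence \<open>\<phi>\<close>.\<close>

definition shift_primitive :: "(real^2 \<Rightarrow> real^2) \<Rightarrow> real \<Rightarrow> real^2 \<Rightarrow> real^2" where
  "shift_primitive \<phi> R x = integral {0..R} (\<lambda>s. \<phi> (x - s *\<^sub>R axis 1 1))"

lemma continuous_shift_primitive: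
  assumes "continuous_on UNIV \<phi>"
  shows "continuous_on UNIV (shift_primitive \<phi> R)"
proof -
  have "continuous_on (UNIV \<times> cbox 0 R) (\<lambda>(x, s). \<phi> (x - s *\<^sub>R axis 1 1))"
    unfolding case_prod_unfold by (intro continuous_on_compose2[OF assms]) (auto intro!: continuous_intros)
  from integral_continuous_on_param[OF this] show ?thesis unfolding shift_primitive_def[abs_def] by simp
qed

text \<open>The field \<open>\<epsilon> (t / T) \<phi>\<close> has constant speed, balanced by the
  shifted primitive; adding the constant \<open>Z0\<close> does not change the divergence. The only
  boundary term is the one at the final time, since the field vanishes at
  \<open>t = 0\<close>.\<close>

lemma base_weak:
  fixes \<psi> :: "pt \<Rightarrow> real^2" and \<phi> :: "real^2 \<Rightarrow> real^2"
  assumes psi: "C1_fun \<psi>" and K: "compact K" "\<And>x t. x \<notin> K \<Longrightarrow> \<psi> (x, t) = 0" "K \<subseteq> \<Omega>" and Om: "open \<Omega>"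
    and p: "continuous_on UNIV \<phi>" and T: "0 < T" and R: "0 \<le> R" "\<And>x. \<phi> x \<noteq> 0 \<Longrightarrow> x + R *\<^sub>R axis 1 1 \<notin> K"
  shows "\<exists>h. integrable lborel h \<and> (\<forall>z. z \<notin> \<Omega> \<times> {0<..<T} \<longrightarrow> h z = 0) \<and> (\<integral>z. h z \<partial>lborel) = \<epsilon> * (\<integral>x. \<phi> x \<bullet> \<psi> (x, T) \<partial>lborel) \<and>
    (\<forall>z\<in>\<Omega> \<times> {0<..<T}. h z = ((\<epsilon> * snd z / T) *\<^sub>R \<phi> (fst z)) \<bullet> Dt \<psi> z
      - ((\<epsilon> / T) *\<^sub>R outer (shift_primitive \<phi> R (fst z)) (axis 1 1) + Z0) \<bullet> Dx \<psi> z)"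
proof -
  obtain \<psi>' where d: "\<And>z. (\<psi> has_derivative \<psi>' z) (at z)" and c: "\<And>y. continuous_on UNIV (\<lambda>z. \<psi>' z y)"
    by (rule C1_fun_obtain[OF psi]) (assumption | rule that)+
  have cp: "continuous_on UNIV \<psi>" by (rule has_derivative_continuous_UNIV[OF d])
  note sup = spatial_support_deriv[OF d K(1,2)]
  define iT :: "pt \<Rightarrow> real" where "iT z = indicator {0..T} (snd z)" for z
  define e1 e2 :: "real^2" where "e1 = axis 1 1" and "e2 = axis 2 1"
  define w1 w2 :: "real^2" where "w1 = (\<chi> i. Z0 $ i $ 1)" and "w2 = (\<chi> i. Z0 $ i $ 2)"
  have int: "integrable lborel (\<lambda>z. iT z * g z)" if g: "continuous_on UNIV g" "\<And>z. fst z \<notin> K \<Longrightarrow> g z = 0" for g :: "pt \<Rightarrow> real"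
  proof -
    have e: "iT z * g z = indicator (K \<times> {0..T}) z *\<^sub>R g z" for z
      using g(2)[of z] by (cases "fst z \<in> K") (simp_all add: iT_def indicator_times)
    show ?thesis unfolding e
      by (rule borel_integrable_compact) (auto intro!: compact_Times K(1) continuous_on_subset[OF g(1)])
  qed
  have cfst: "continuous_on UNIV (\<lambda>z::pt. g (fst z))" if "continuous_on UNIV g" for g :: "real^2 \<Rightarrow> real^2"
    by (rule continuous_on_compose2[OF that]) (auto intro!: continuous_intros)
  define t1 where "t1 z = snd z / T * (\<phi> (fst z) \<bullet> \<psi>' z (0, 1)) + 1 / T * (\<phi> (fst z) \<bullet> \<psi> z)" for z
  define t2 where "t2 z = shift_primitive \<phi> R (fst z) \<bullet> \<psi>' z (e1, 0)" for z
  define t3 where "t3 z = \<phi> (fst z) \<bullet> \<psi> z" for z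
  define t4 where "t4 z = w1 \<bullet> \<psi>' z (e1, 0)" for z
  define t5 where "t5 z = w2 \<bullet> \<psi>' z (e2, 0)" for z
  have cont: "continuous_on UNIV t1" "continuous_on UNIV t2" "continuous_on UNIV t3" "continuous_on UNIV t4" "continuous_on UNIV t5"
  proof -
    have s: "continuous_on UNIV (\<lambda>z::pt. snd z / T)" using T by (intro continuous_intros) auto
    show "continuous_on UNIV t1" unfolding t1_def[abs_def]
      by (intro continuous_on_add continuous_on_mult continuous_on_inner continuous_on_const s cfst[OF p] c cp)
    show "continuous_on UNIV t2" unfolding t2_def[abs_def] by (intro continuous_on_inner cfst[OF continuous_shift_primitive[OF p]] c)
    show "continuous_on UNIV t3" unfolding t3_def[abs_def] by (intro continuous_on_inner cfst[OF p] cp)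
    show "continuous_on UNIV t4" "continuous_on UNIV t5" unfolding t4_def[abs_def] t5_def[abs_def] by (intro continuous_on_inner continuous_on_const c)+
  qed
  have z0: "\<psi> z = 0" if "fst z \<notin> K" for z using K(2)[OF that, of "snd z"] by simp
  have i1: "integrable lborel (\<lambda>z. iT z * t1 z)" by (rule int[OF cont(1)]) (simp add: t1_def sup z0)
  have i2: "integrable lborel (\<lambda>z. iT z * t2 z)" by (rule int[OF cont(2)]) (simp add: t2_def sup)
  have i3: "integrable lborel (\<lambda>z. iT z * t3 z)" by (rule int[OF cont(3)]) (simp add: t3_def z0)
  have i4: "integrable lborel (\<lambda>z. iT z * t4 z)" by (rule int[OF cont(4)]) (simp add: t4_def sup)
  have i5: "integrable lborel (\<lambda>z. iT z * t5 z)" by (rule int[OF cont(5)]) (simp add: t5_def sup)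
  have v1: "(\<integral>z. iT z * t1 z \<partial>lborel) = (\<integral>x. \<phi> x \<bullet> \<psi> (x, T) \<partial>lborel)"
    unfolding iT_def t1_def by (rule slab_time[OF d c K(1,2) p T])
  have "(\<integral>z. iT z * t2 z \<partial>lborel) = (\<integral>z. iT z * (\<phi> (fst z) \<bullet> (\<psi> (fst z + R *\<^sub>R e1, snd z) - \<psi> z)) \<partial>lborel)"
    unfolding iT_def t2_def shift_primitive_def e1_def by (rule slab_shift[OF d c K(1,2) p R(1)])
  also have "\<dots> = (\<integral>z. - (iT z * t3 z) \<partial>lborel)"
  proof (rule Bochner_Integration.integral_cong[OF refl])
    fix z :: pt
    show "iT z * (\<phi> (fst z) \<bullet> (\<psi> (fst z + R *\<^sub>R e1, snd z) - \<psi> z)) = - (iT z * t3 z)"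
    proof (cases "\<phi> (fst z) = 0")
      case False
      then have "\<psi> (fst z + R *\<^sub>R e1, snd z) = 0" using R(2)[OF False] K(2) unfolding e1_def by blast
      then show ?thesis by (simp add: t3_def)
    qed (simp add: t3_def)
  qed
  finally have v2: "(\<integral>z. iT z * t2 z \<partial>lborel) = - (\<integral>z. iT z * t3 z \<partial>lborel)" by simp
  have v45: "(\<integral>z. iT z * t4 z \<partial>lborel) = 0" "(\<integral>z. iT z * t5 z \<partial>lborel) = 0"
    unfolding iT_def t4_def t5_def by (rule slab_shift_const[OF d c K(1,2)], assumption)+
  define H where "H z = \<epsilon> * t1 z - \<epsilon> / T * t3 z - \<epsilon> / T * t2 z - t4 z - t5 z" for z
  have H: "H z = ((\<epsilon> * snd z / T) *\<^sub>R \<phi> (fst z)) \<bullet> Dt \<psi> z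
      - ((\<epsilon> / T) *\<^sub>R outer (shift_primitive \<phi> R (fst z)) (axis 1 1) + Z0) \<bullet> Dx \<psi> z" for z
  proof -
    have o: "outer b (axis 1 1) \<bullet> Dx \<psi> z = b \<bullet> \<psi>' z (e1, 0)" for b :: "real^2"
      by (simp add: inner_vec_def sum_2 outer_def Dx_eq[OF d] axis_def e1_def)
    have zz: "Z0 \<bullet> Dx \<psi> z = t4 z + t5 z"
      by (simp add: inner_vec_def sum_2 Dx_eq[OF d] t4_def t5_def w1_def w2_def e1_def e2_def)
    show ?thesis unfolding inner_add_left inner_scaleR_left o zz Dt_eq[OF d] H_def
      by (simp add: t1_def t2_def t3_def algebra_simps)
  qed
  have iH: "(\<lambda>z. iT z * H z) = (\<lambda>z. \<epsilon> * (iT z * t1 z) - \<epsilon> / T * (iT z * t3 z) - \<epsilon> / T * (iT z * t2 z) - iT z * t4 z - iT z * t5 z)"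
    by (rule ext) (simp add: H_def algebra_simps)
  have j: "integrable lborel (\<lambda>z. iT z * H z)" unfolding iH
    by (intro Bochner_Integration.integrable_diff integrable_mult_right i1 i2 i3 i4 i5)
  have "(\<integral>z. iT z * H z \<partial>lborel) = \<epsilon> * (\<integral>z. iT z * t1 z \<partial>lborel) - \<epsilon> / T * (\<integral>z. iT z * t3 z \<partial>lborel)
      - \<epsilon> / T * (\<integral>z. iT z * t2 z \<partial>lborel) - (\<integral>z. iT z * t4 z \<partial>lborel) - (\<integral>z. iT z * t5 z \<partial>lborel)"
    unfolding iH
    by (rule has_bochner_integral_integral_eq, intro has_bochner_integral_diff has_bochner_integral_mult_right
        has_bochner_integral_integrable i1 i2 i3 i4 i5)
  then have vH': "(\<integral>z. iT z * H z \<partial>lborel) = \<epsilon> * (\<integral>x. \<phi> x \<bullet> \<psi> (x, T) \<partial>lborel) - \<epsilon> / T * (\<integral>z. iT z * t3 z \<partial>lborel)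
      - \<epsilon> / T * (- (\<integral>z. iT z * t3 z \<partial>lborel)) - 0 - 0" unfolding v1 v2 v45 .
  have can: "p - a * b - a * (- b) - 0 - 0 = p" for p a b :: real by simp
  have vH: "(\<integral>z. iT z * H z \<partial>lborel) = \<epsilon> * (\<integral>x. \<phi> x \<bullet> \<psi> (x, T) \<partial>lborel)" using vH' unfolding can .
  define h where "h z = indicator (\<Omega> \<times> {0<..<T}) z * H z" for z
  have ae: "AE z in lborel. iT z * H z = h z"
    using AE_snd_neq[of 0] AE_snd_neq[of T]
  proof eventually_elim
    case (elim z)
    show ?case
    proof (cases "fst z \<in> K")
      case True
      then have "fst z \<in> \<Omega>" using K(3) by blast
      moreover have "indicator {0..T} (snd z) = (indicator {0<..<T} (snd z) :: real)" using elim by (auto simp: indicator_def)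
      ultimately show ?thesis by (simp add: iT_def h_def indicator_times)
    next
      case False
      then have "H z = 0" by (simp add: H_def t1_def t2_def t3_def t4_def t5_def sup z0)
      then show ?thesis by (simp add: h_def)
    qed
  qed
  have mh: "h \<in> borel_measurable lborel"
  proof -
    have "continuous_on UNIV H" unfolding H_def[abs_def]
      by (intro continuous_on_diff continuous_on_mult continuous_on_const cont)
    then have [measurable]: "H \<in> borel_measurable borel" by (rule borel_measurable_continuous_onI)
    have [measurable]: "\<Omega> \<times> {0<..<T} \<in> sets borel" using Om by (intro borel_open open_Times) auto
    show ?thesis unfolding h_def[abs_def] by measurable
  qed
  have "integrable lborel h" using integrable_cong_AE[OF borel_measurable_integrable[OF j] mh ae] j by simp
  moreover have "(\<integral>z. h z \<partial>lborel) = \<epsilon> * (\<integral>x. \<phi> x \<bullet> \<psi> (x, T) \<partial>lborel)"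
    using integral_cong_AE[OF borel_measurable_integrable[OF j] mh ae] vH by simp
  moreover have "\<forall>z. z \<notin> \<Omega> \<times> {0<..<T} \<longrightarrow> h z = 0" by (simp add: h_def)
  moreover have "\<forall>z\<in>\<Omega> \<times> {0<..<T}. h z = ((\<epsilon> * snd z / T) *\<^sub>R \<phi> (fst z)) \<bullet> Dt \<psi> z
      - ((\<epsilon> / T) *\<^sub>R outer (shift_primitive \<phi> R (fst z)) (axis 1 1) + Z0) \<bullet> Dx \<psi> z"
    unfolding H[symmetric] h_def by simp
  ultimately show ?thesis by blast
qed

section \<open>Solutions of the nonlinear problem\<close>

context five_states
begin

text \<open>Almost everywhere the germ gives \<open>DF F (Dx u) = (A + Bi) + (Zf + \<zeta>i) =
  \<sigma> + (Bi + \<zeta>i)\<close>, so the linear identities for the base flow and for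
  \<open>v\<close> add up to the nonlinear weak equation. The bound \<open>e\<close> on the distance
  to \<open>u0\<close> is what later produces infinitely many solutions.\<close>

lemma perturbed_solution:
  fixes \<Omega> :: "(real^2) set" and \<phi> :: "real^2 \<Rightarrow> real^2"
  assumes Om: "open \<Omega>" "bounded \<Omega>" "\<Omega> \<noteq> {}" and T: "0 < T"
    and p: "\<And>x. (\<phi> has_derivative (\<lambda>h. D x *v h)) (at x)" "continuous_on UNIV D"
    and K: "compact K" "K \<subseteq> \<Omega>" "\<And>x. x \<notin> K \<Longrightarrow> \<phi> x = 0" and R: "0 \<le> R" "\<And>x. x \<in> K \<Longrightarrow> x + R *\<^sub>R axis 1 1 \<notin> \<Omega>"
    and u0: "u0 = (\<lambda>z. (\<epsilon> * snd z / T) *\<^sub>R \<phi> (fst z))" and A: "A = (\<lambda>z. (\<epsilon> * snd z / T) *\<^sub>R D (fst z))"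
    and \<sigma>: "\<sigma> = (\<lambda>z. (\<epsilon> / T) *\<^sub>R outer (shift_primitive \<phi> R (fst z)) (axis 1 1) + Z0)"
    and AU: "\<And>z. z \<in> \<Omega> \<times> {0<..<T} \<Longrightarrow> (A z, \<sigma> z - A z) \<in> U 1" and e: "0 < e"
  shows "\<exists>u. weak_solution F \<Omega> T u \<and> (\<forall>x\<in>\<Omega>. u (x, T) = \<epsilon> *\<^sub>R \<phi> x) \<and> nowhere_continuous_grad \<Omega> T u \<and> (\<forall>z. norm (u z - u0 z) \<le> e)"
proof -
  define Q where "Q = \<Omega> \<times> {0<..<T}"
  have Q: "open Q" "bounded Q" "Q \<noteq> {}" using Om T by (auto simp: Q_def intro!: open_Times bounded_Times)
  have cp: "continuous_on UNIV \<phi>" by (rule has_derivative_continuous_UNIV[OF p(1)])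
  have ct: "continuous_on UNIV (\<lambda>z::pt. \<epsilon> * snd z / T)" using T by (intro continuous_intros) auto
  have cA: "continuous_on UNIV A" unfolding A
    by (intro continuous_on_scaleR ct continuous_on_compose2[OF p(2) continuous_on_fst[OF continuous_on_id]]) auto
  have co: "continuous_on UNIV (\<lambda>z::pt. outer (shift_primitive \<phi> R (fst z)) (axis 1 1))"
    unfolding outer_def
    by (intro continuous_on_vec_lambda continuous_on_mult continuous_on_const continuous_on_component
        continuous_on_compose2[OF continuous_shift_primitive[OF cp] continuous_on_fst[OF continuous_on_id]]) auto
  have cs: "continuous_on UNIV \<sigma>" unfolding \<sigma> by (intro continuous_on_add continuous_on_scaleR continuous_on_const co)
  define Zf where "Zf z = \<sigma> z - A z" for z
  have cZ: "continuous_on UNIV Zf" unfolding Zf_def[abs_def] by (intro continuous_on_diff cs cA)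
  have AU': "(A z, Zf z) \<in> U 1" if "z \<in> Q" for z using AU that by (simp only: Q_def Zf_def)
  obtain v Bi \<zeta>i L where v: "\<And>z. z \<notin> Q \<Longrightarrow> v z = (0 :: real^2)" "\<And>z. norm (v z) \<le> e" and vL: "L-lipschitz_on UNIV v"
    and ae: "AE z in lborel. z \<in> Q \<longrightarrow> ((\<lambda>y. v (y, snd z)) has_derivative (\<lambda>h. Bi z *v h)) (at (fst z)) \<and>
       (\<exists>i<5. dist (A z + Bi z) (As i) \<le> r \<and> Zf z + \<zeta>i z = Zs i)"
    and weak: "\<And>\<psi>. C1_fun \<psi> \<Longrightarrow> \<exists>h. integrable lborel h \<and> (\<forall>z. z \<notin> Q \<longrightarrow> h z = 0) \<and> (\<integral>z. h z \<partial>lborel) = 0 \<and>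
       (AE z in lborel. z \<in> Q \<longrightarrow> h z = v z \<bullet> Dt \<psi> z - (Bi z + \<zeta>i z) \<bullet> Dx \<psi> z)"
    and nowhere: "\<And>z d i. z \<in> Q \<Longrightarrow> 0 < d \<Longrightarrow> i < 5 \<Longrightarrow> \<not> (AE w in lborel. w \<in> ball z d \<and> w \<in> Q \<longrightarrow> Zf w + \<zeta>i w = Zs i)"
    by (rule limit_field[OF Q cA cZ AU' e]) (assumption | rule that)+
  define u where "u z = u0 z + v z" for z
  have Du: "Dx u z = A z + Bi z" if "((\<lambda>y. v (y, snd z)) has_derivative (\<lambda>h. Bi z *v h)) (at (fst z))" for z
  proof -
    have "((\<lambda>y. u0 (y, snd z)) has_derivative (\<lambda>h. A z *v h)) (at (fst z))"
      using has_derivative_scaleR_right[OF p(1)[of "fst z"], of "\<epsilon> * snd z / T"] by (simp add: u0 A scaleR_matrix_vector_assoc)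
    from has_derivative_add[OF this that] have "((\<lambda>y. u (y, snd z)) has_derivative (\<lambda>h. (A z + Bi z) *v h)) (at (fst z))"
      by (simp add: u_def matrix_vector_mult_add_rdistrib)
    from frechet_derivative_at[OF this] show ?thesis unfolding Dx_def by (metis matrix_of_matrix_vector_mul)
  qed
  have aeF: "AE z in lborel. z \<in> Q \<longrightarrow> Dx u z = A z + Bi z \<and> (\<exists>i<5. dist (Dx u z) (As i) \<le> r \<and> Zf z + \<zeta>i z = Zs i)"
    using ae by eventually_elim (use Du in auto)
  have "weak_solution F \<Omega> T u"
    unfolding weak_solution_def
  proof (intro conjI ballI allI impI)
    have D0: "D x = 0" if "x \<notin> K" for x
    proof -
      have "D x *v h = 0" for h by (rule deriv_outside_support[OF p(1) compact_imp_closed[OF K(1)] K(3) that])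
      then show ?thesis by (simp add: matrix_eq)
    qed
    obtain C1 where C1: "C1 > 0" "\<And>x. norm (D x) \<le> C1" by (rule compact_support_bounded[OF p(2) K(1) D0]) (assumption | rule that)+
    obtain C0 where C0: "C0 > 0" "\<And>x. norm (\<phi> x) \<le> C0" by (rule compact_support_bounded[OF cp K(1,3)]) (assumption | rule that)+
    have pl: "norm (\<phi> x - \<phi> y) \<le> 2 * C1 * norm (x - y)" for x y
    proof (rule differentiable_bound[where S = UNIV])
      show "(\<phi> has_derivative (\<lambda>h. D x *v h)) (at x within UNIV)" for x using p(1)[of x] .
      show "onorm (\<lambda>h. D x *v h) \<le> 2 * C1" for x
      proof (rule onorm_bound)
        fix h
        have "norm (D x *v h) \<le> 2 * norm (D x) * norm h" by (rule norm_mv_le)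
        also have "\<dots> \<le> 2 * C1 * norm h" using C1(2)[of x] by (intro mult_right_mono) auto
        finally show "norm (D x *v h) \<le> 2 * C1 * norm h" .
      qed (use C1 in simp)
    qed auto
    define M where "M = \<bar>\<epsilon>\<bar> * (2 * C1) + \<bar>\<epsilon>\<bar> / T * C0"
    have "M-lipschitz_on (closure \<Omega> \<times> {0..T}) u0"
    proof (rule lipschitz_onI)
      show "0 \<le> M" using C1(1) C0(1) T by (simp add: M_def)
      fix z w :: pt assume z: "z \<in> closure \<Omega> \<times> {0..T}" "w \<in> closure \<Omega> \<times> {0..T}"
      have "u0 z - u0 w = (\<epsilon> * snd z / T) *\<^sub>R (\<phi> (fst z) - \<phi> (fst w)) + (\<epsilon> / T * (snd z - snd w)) *\<^sub>R \<phi> (fst w)"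
        by (simp add: u0 algebra_simps diff_divide_distrib)
      then have "norm (u0 z - u0 w) \<le> norm ((\<epsilon> * snd z / T) *\<^sub>R (\<phi> (fst z) - \<phi> (fst w))) + norm ((\<epsilon> / T * (snd z - snd w)) *\<^sub>R \<phi> (fst w))"
        by (simp only: norm_triangle_ineq)
      also have "norm ((\<epsilon> * snd z / T) *\<^sub>R (\<phi> (fst z) - \<phi> (fst w))) \<le> \<bar>\<epsilon>\<bar> * (2 * C1 * norm (z - w))"
      proof -
        have "\<bar>\<epsilon> * snd z / T\<bar> = \<bar>\<epsilon>\<bar> * (snd z / T)" using z(1) T by (auto simp: abs_mult)
        also have "\<dots> \<le> \<bar>\<epsilon>\<bar> * 1" using z(1) T by (intro mult_left_mono) auto
        finally have 1: "\<bar>\<epsilon> * snd z / T\<bar> \<le> \<bar>\<epsilon>\<bar>" by simp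
        have "norm (fst (z - w)) \<le> norm (z - w)" using norm_fst_le[of "fst (z - w)" "snd (z - w)"] unfolding prod.collapse .
        then have "norm (fst z - fst w) \<le> norm (z - w)" unfolding fst_diff .
        then have "2 * C1 * norm (fst z - fst w) \<le> 2 * C1 * norm (z - w)" using C1(1) by (intro mult_left_mono) auto
        then have "norm (\<phi> (fst z) - \<phi> (fst w)) \<le> 2 * C1 * norm (z - w)" using pl[of "fst z" "fst w"] by linarith
        then show ?thesis unfolding norm_scaleR using 1 by (intro mult_mono) auto
      qed
      also have "norm ((\<epsilon> / T * (snd z - snd w)) *\<^sub>R \<phi> (fst w)) \<le> (\<bar>\<epsilon>\<bar> / T * norm (z - w)) * C0"
      proof -
        have "norm (snd (z - w)) \<le> norm (z - w)" using norm_snd_le[of "snd (z - w)" "fst (z - w)"] unfolding prod.collapse .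
        then have "\<bar>snd z - snd w\<bar> \<le> norm (z - w)" unfolding snd_diff real_norm_def .
        then have "\<bar>\<epsilon> / T * (snd z - snd w)\<bar> \<le> \<bar>\<epsilon>\<bar> / T * norm (z - w)" unfolding abs_mult using T by (intro mult_mono) auto
        then show ?thesis unfolding norm_scaleR using C0(2) T by (intro mult_mono) auto
      qed
      finally show "dist (u0 z) (u0 w) \<le> M * dist z w" by (simp add: M_def dist_norm algebra_simps)
    qed
    from lipschitz_on_add[OF this lipschitz_on_subset[OF vL]]
    show "\<exists>L. L-lipschitz_on (closure \<Omega> \<times> {0..T}) u" unfolding u_def[abs_def] by blast
  next
    fix x assume "x \<in> \<Omega>"
    show "u (x, 0) = 0" using v(1)[of "(x, 0)"] by (simp add: u_def u0 Q_def)
  next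
    fix x t assume x: "x \<in> frontier \<Omega>" "t \<in> {0<..<T}"
    then have "x \<notin> \<Omega>" using Om(1) by (simp add: frontier_def interior_open)
    then show "u (x, t) = 0" using v(1)[of "(x, t)"] K(2,3) by (auto simp: u_def u0 Q_def)
  next
    fix \<psi> assume "test_fun \<Omega> \<psi>"
    then obtain K' where psi: "C1_fun \<psi>" and K': "compact K'" "K' \<subseteq> \<Omega>" "\<And>x t. x \<notin> K' \<Longrightarrow> \<psi> (x, t) = 0" unfolding test_fun_def by blast
    have RK: "x + R *\<^sub>R axis 1 1 \<notin> K'" if "\<phi> x \<noteq> 0" for x using R(2)[of x] K(3)[of x] K'(2) that by blast
    obtain h1 where h1: "integrable lborel h1" "\<And>z. z \<notin> Q \<Longrightarrow> h1 z = 0" "(\<integral>z. h1 z \<partial>lborel) = \<epsilon> * (\<integral>x. \<phi> x \<bullet> \<psi> (x, T) \<partial>lborel)"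
      "\<And>z. z \<in> Q \<Longrightarrow> h1 z = u0 z \<bullet> Dt \<psi> z - \<sigma> z \<bullet> Dx \<psi> z"
      using base_weak[OF psi K'(1,3,2) Om(1) cp T R(1) RK, of \<epsilon> Z0] unfolding Q_def u0 \<sigma> by blast
    obtain h2 where h2: "integrable lborel h2" "\<And>z. z \<notin> Q \<Longrightarrow> h2 z = 0" "(\<integral>z. h2 z \<partial>lborel) = 0"
      "AE z in lborel. z \<in> Q \<longrightarrow> h2 z = v z \<bullet> Dt \<psi> z - (Bi z + \<zeta>i z) \<bullet> Dx \<psi> z"
      using weak[OF psi] by blast
    have "integral Q (\<lambda>z. u z \<bullet> Dt \<psi> z - DF F (Dx u z) \<bullet> Dx \<psi> z) = (\<integral>z. h1 z + h2 z \<partial>lborel)"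
    proof (rule integral_cong_AE_lborel)
      show "integrable lborel (\<lambda>z. h1 z + h2 z)" by (rule Bochner_Integration.integrable_add[OF h1(1) h2(1)])
      show "Q \<in> sets borel" using Q(1) by simp
      show "h1 z + h2 z = 0" if "z \<notin> Q" for z using h1(2) h2(2) that by simp
      show "AE z in lborel. z \<in> Q \<longrightarrow> u z \<bullet> Dt \<psi> z - DF F (Dx u z) \<bullet> Dx \<psi> z = h1 z + h2 z"
        using aeF h2(4)
      proof eventually_elim
        case (elim z)
        show ?case
        proof
          assume z: "z \<in> Q"
          obtain i where i: "i < 5" "dist (Dx u z) (As i) \<le> r" "Zf z + \<zeta>i z = Zs i" using elim(1) z by blast
          have "DF F (Dx u z) = (A z + Bi z) + (Zf z + \<zeta>i z)" using germ[OF i(1,2)] i(3) elim(1) z by simp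
          also have "\<dots> = \<sigma> z + (Bi z + \<zeta>i z)" by (simp add: Zf_def)
          finally show "u z \<bullet> Dt \<psi> z - DF F (Dx u z) \<bullet> Dx \<psi> z = h1 z + h2 z"
            using h1(4)[OF z] elim(2) z by (simp add: u_def inner_add_left)
        qed
      qed
    qed
    also have "\<dots> = \<epsilon> * (\<integral>x. \<phi> x \<bullet> \<psi> (x, T) \<partial>lborel)" using h1(1,3) h2(1,3) by simp
    also have "\<dots> = (\<integral>x. \<epsilon> * (\<phi> x \<bullet> \<psi> (x, T)) \<partial>lborel)" by simp
    also have "\<dots> = integral \<Omega> (\<lambda>x. u (x, T) \<bullet> \<psi> (x, T) - u (x, 0) \<bullet> \<psi> (x, 0))"
    proof (rule integral_cong_AE_lborel[symmetric])
      have "continuous_on UNIV (\<lambda>x. \<psi> (x, T))" by (rule continuous_on_compose2[OF C1_fun_continuous(1)[OF psi]]) (auto intro!: continuous_intros)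
      then have c2: "continuous_on UNIV (\<lambda>x. \<phi> x \<bullet> \<psi> (x, T))" by (rule continuous_on_inner[OF cp])
      have "integrable lborel (\<lambda>x. \<phi> x \<bullet> \<psi> (x, T))"
      proof (rule integrable_continuous_compact_support[OF c2 K(1)])
        show "\<phi> x \<bullet> \<psi> (x, T) = 0" if "x \<notin> K" for x by (simp only: K(3)[OF that] inner_zero_left)
      qed
      then show "integrable lborel (\<lambda>x. \<epsilon> * (\<phi> x \<bullet> \<psi> (x, T)))" by (intro integrable_mult_right)
      show "\<Omega> \<in> sets borel" using Om(1) by simp
      show "\<epsilon> * (\<phi> x \<bullet> \<psi> (x, T)) = 0" if "x \<notin> \<Omega>" for x
      proof -
        have "x \<notin> K" using K(2) that by blast
        then have "\<phi> x = 0" by (rule K(3))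
        then show ?thesis by simp
      qed
      show "AE x in lborel. x \<in> \<Omega> \<longrightarrow> u (x, T) \<bullet> \<psi> (x, T) - u (x, 0) \<bullet> \<psi> (x, 0) = \<epsilon> * (\<phi> x \<bullet> \<psi> (x, T))"
        using v(1)[of "(_, 0)"] v(1)[of "(_, T)"] T by (intro AE_I2) (simp add: u_def u0 Q_def)
    qed
    finally show "integral \<Omega> (\<lambda>x. u (x, T) \<bullet> \<psi> (x, T) - u (x, 0) \<bullet> \<psi> (x, 0)) =
        integral (\<Omega> \<times> {0<..<T}) (\<lambda>z. u z \<bullet> Dt \<psi> z - DF F (Dx u z) \<bullet> Dx \<psi> z)" by (simp only: Q_def)
  qed
  moreover have "\<forall>x\<in>\<Omega>. u (x, T) = \<epsilon> *\<^sub>R \<phi> x" using v(1)[of "(_, T)"] T by (simp add: u_def u0 Q_def)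
  moreover have "nowhere_continuous_grad \<Omega> T u"
    unfolding nowhere_continuous_grad_def Q_def[symmetric]
  proof (intro ballI notI)
    fix z assume z: "z \<in> Q" and "\<exists>L. \<forall>e>0. \<exists>\<delta>>0. AE w in lborel. w \<in> ball z \<delta> \<longrightarrow> norm (Dx u w - L) < e"
    then obtain L d where d: "d > 0" "AE w in lborel. w \<in> ball z d \<longrightarrow> norm (Dx u w - L) < r" using r_pos by blast
    \<comment> \<open>With the tolerance \<open>r\<close>, every germ that occurs near
      \<open>z\<close> has its centre within \<open>2 * r\<close> of the supposed limit
      \<open>L\<close>. Centres are more than \<open>4 * r\<close> apart, so at most one germ is
      left, and it would fill a ball.\<close>
    have close: "dist L (As i) < 2 * r" if "norm (Dx u w - L) < r" "dist (Dx u w) (As i) \<le> r" for w i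
      using dist_triangle[of L "As i" "Dx u w"] that by (simp add: dist_norm norm_minus_commute)
    have "\<exists>i<5. AE w in lborel. w \<in> ball z d \<and> w \<in> Q \<longrightarrow> Zf w + \<zeta>i w = Zs i"
    proof (cases "\<exists>i<5. dist L (As i) < 2 * r")
      case True
      then obtain i where i: "i < 5" "dist L (As i) < 2 * r" by blast
      have "AE w in lborel. w \<in> ball z d \<and> w \<in> Q \<longrightarrow> Zf w + \<zeta>i w = Zs i" using aeF d(2)
      proof eventually_elim
        case (elim w)
        show ?case
        proof
          assume w: "w \<in> ball z d \<and> w \<in> Q"
          then obtain j where j: "j < 5" "dist (Dx u w) (As j) \<le> r" "Zf w + \<zeta>i w = Zs j" using elim(1) by blast
          have "dist L (As j) < 2 * r" by (rule close[OF _ j(2)]) (use elim(2) w in blast)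
          then have "dist (As j) (As i) < 4 * r" using dist_triangle[of "As j" "As i" L] i(2) by (simp add: dist_commute)
          then have "j = i" using sep[OF j(1) i(1)] by force
          then show "Zf w + \<zeta>i w = Zs i" using j(3) by simp
        qed
      qed
      then show ?thesis using i(1) by blast
    next
      case False
      \<comment> \<open>No germ is close enough to \<open>L\<close>, so almost no point of the ball
        can satisfy the inclusion and the claim holds vacuously; index 0 is an arbitrary
        choice.\<close>
      have "AE w in lborel. w \<in> ball z d \<and> w \<in> Q \<longrightarrow> Zf w + \<zeta>i w = Zs 0" using aeF d(2)
      proof eventually_elim
        case (elim w)
        then show ?case using close[of w] False by blast
      qed
      moreover have "(0::nat) < 5" by simp
      ultimately show ?thesis by blast
    qed
    then show False using nowhere[OF z d(1)] by blast
  qed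
  moreover have "\<forall>z. norm (u z - u0 z) \<le> e" using v(2) by (simp add: u_def)
  ultimately show ?thesis by blast
qed

text \<open>Solutions exist at every prescribed uniform distance or less from \<open>u0\<close>, and
  none of them agrees with \<open>u0\<close> on the cylinder, because the gradient of
  \<open>u0\<close> is continuous. Finitely many restrictions would stay a positive distance away
  from \<open>u0\<close>.\<close>

lemma infinitely_many_solutions:
  fixes \<Omega> :: "(real^2) set" and \<phi> :: "real^2 \<Rightarrow> real^2"
  assumes Om: "open \<Omega>" "bounded \<Omega>" "\<Omega> \<noteq> {}" and T: "0 < T"
    and phi: "C1_fun \<phi>" and K: "compact K" "K \<subseteq> \<Omega>" "\<And>x. x \<notin> K \<Longrightarrow> \<phi> x = 0"
  shows "\<exists>\<epsilon>\<^sub>0 > 0. \<forall>\<epsilon>::real. \<bar>\<epsilon>\<bar> < \<epsilon>\<^sub>0 \<longrightarrow>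
          infinite ((\<lambda>u. restrict u (\<Omega> \<times> {0<..<T})) `
            {u. weak_solution F \<Omega> T u \<and> (\<forall>x\<in>\<Omega>. u (x, T) = \<epsilon> *\<^sub>R \<phi> x) \<and> nowhere_continuous_grad \<Omega> T u})"
proof -
  obtain \<phi>' where p': "\<And>x. (\<phi> has_derivative \<phi>' x) (at x)" "\<And>y. continuous_on UNIV (\<lambda>x. \<phi>' x y)"
    by (rule C1_fun_obtain[OF phi]) (assumption | rule that)+
  define D :: "real^2 \<Rightarrow> mat2" where "D x = (\<chi> i j. \<phi>' x (axis j 1) $ i)" for x
  have Dm: "\<phi>' x = (\<lambda>h. D x *v h)" for x
  proof -
    have lin: "linear (\<phi>' x)" by (rule has_derivative_linear[OF p'(1)])
    have "D x = matrix (\<phi>' x)" by (simp add: D_def matrix_def)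
    then show ?thesis using lin by (simp | metis matrix_vector_mul)
  qed
  have p: "(\<phi> has_derivative (\<lambda>h. D x *v h)) (at x)" for x using p'(1)[of x] by (simp only: Dm)
  have cD: "continuous_on UNIV D" unfolding D_def[abs_def] by (intro continuous_on_vec_lambda continuous_on_component p'(2))
  have cp: "continuous_on UNIV \<phi>" by (rule has_derivative_continuous_UNIV[OF p])
  obtain M where M: "M > 0" "\<And>x. x \<in> \<Omega> \<Longrightarrow> norm x \<le> M" using Om(2) bounded_pos by metis
  \<comment> \<open>Two points of the domain are at distance at most \<open>2 * M\<close>, so a
    translation by \<open>R\<close> takes every point of \<open>K\<close> out of it.\<close>
  define R where "R = 2 * M + 1"
  have R0: "0 \<le> R" using M(1) by (simp add: R_def)
  have R: "x + R *\<^sub>R axis 1 1 \<notin> \<Omega>" if "x \<in> K" for x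
  proof
    assume "x + R *\<^sub>R axis 1 1 \<in> \<Omega>"
    then have "norm (x + R *\<^sub>R axis 1 1) \<le> M" by (rule M(2))
    moreover have "norm x \<le> M" using M(2) K(2) that by blast
    moreover have "norm (R *\<^sub>R (axis 1 1 :: real^2)) \<le> norm (x + R *\<^sub>R axis 1 1) + norm x"
      using norm_triangle_ineq4[of "x + R *\<^sub>R axis 1 1" x] by simp
    ultimately show False using R0 by (simp add: R_def)
  qed
  obtain C1 where C1: "C1 > 0" "\<And>x. x \<in> \<Omega> \<Longrightarrow> norm (D x) \<le> C1" by (rule bounded_image_continuous[OF cD Om(2)]) (assumption | rule that)+
  obtain C2 where C2: "C2 > 0" "\<And>x. x \<in> \<Omega> \<Longrightarrow> norm (shift_primitive \<phi> R x) \<le> C2"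
    by (rule bounded_image_continuous[OF continuous_shift_primitive[OF cp] Om(2)]) (assumption | rule that)+
  obtain d where d: "d > 0" "ball (0, Z0) d \<subseteq> U 1" using U_open Z0 open_contains_ball by metis
  \<comment> \<open>\<open>\<bar>\<epsilon>\<bar> * c\<close> bounds the distance of the base state
    \<open>(A z, \<sigma> z - A z)\<close> from \<open>(0, Z0)\<close>; the condition
    \<open>\<bar>\<epsilon>\<bar> < d / c\<close> keeps it in a ball inside
    \<open>U 1\<close>.\<close>
  define c where "c = 2 * C1 + 2 * C2 / T"
  have c: "c > 0" using C1(1) C2(1) T by (simp add: c_def add_pos_pos)
  show ?thesis
  proof (intro exI[of _ "d / c"] conjI allI impI)
    show "0 < d / c" using d(1) c by simp
    fix \<epsilon> :: real assume ep: "\<bar>\<epsilon>\<bar> < d / c"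
    define Q where "Q = \<Omega> \<times> {0<..<T}"
    define u0 where "u0 = (\<lambda>z::pt. (\<epsilon> * snd z / T) *\<^sub>R \<phi> (fst z))"
    define A where "A = (\<lambda>z::pt. (\<epsilon> * snd z / T) *\<^sub>R D (fst z))"
    define \<sigma> where "\<sigma> = (\<lambda>z::pt. (\<epsilon> / T) *\<^sub>R outer (shift_primitive \<phi> R (fst z)) (axis 1 1) + Z0)"
    define X where "X = {u. weak_solution F \<Omega> T u \<and> (\<forall>x\<in>\<Omega>. u (x, T) = \<epsilon> *\<^sub>R \<phi> x) \<and> nowhere_continuous_grad \<Omega> T u}"
    have AU: "(A z, \<sigma> z - A z) \<in> U 1" if z: "z \<in> \<Omega> \<times> {0<..<T}" for z
    proof -
      have z': "fst z \<in> \<Omega>" "0 < snd z" "snd z < T" using z by auto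
      have "\<bar>\<epsilon> * snd z / T\<bar> = \<bar>\<epsilon>\<bar> * (snd z / T)" using z' T by (simp add: abs_mult)
      also have "\<dots> \<le> \<bar>\<epsilon>\<bar> * 1" using z' T by (intro mult_left_mono) auto
      finally have "\<bar>\<epsilon> * snd z / T\<bar> * norm (D (fst z)) \<le> \<bar>\<epsilon>\<bar> * C1" using C1(2)[OF z'(1)] by (intro mult_mono) auto
      then have nA: "norm (A z) \<le> \<bar>\<epsilon>\<bar> * C1" by (simp add: A_def)
      have "norm (outer (shift_primitive \<phi> R (fst z)) (axis 1 1)) \<le> 2 * norm (shift_primitive \<phi> R (fst z)) * norm (axis 1 1 :: real^2)" by (rule norm_outer_le)
      then have "norm (outer (shift_primitive \<phi> R (fst z)) (axis 1 1)) \<le> 2 * C2" using C2(2)[OF z'(1)] by simp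
      then have "\<bar>\<epsilon>\<bar> / T * norm (outer (shift_primitive \<phi> R (fst z)) (axis 1 1)) \<le> \<bar>\<epsilon>\<bar> / T * (2 * C2)" using T by (intro mult_left_mono) auto
      then have ns: "norm (\<sigma> z - Z0) \<le> \<bar>\<epsilon>\<bar> * (2 * C2 / T)" using T by (simp add: \<sigma>_def)
      have "norm ((A z, \<sigma> z - A z) - (0, Z0)) \<le> norm (A z) + norm ((\<sigma> z - Z0) - A z)"
        using norm_Pair_le[of "A z" "(\<sigma> z - Z0) - A z"] by (simp add: algebra_simps)
      also have "\<dots> \<le> \<bar>\<epsilon>\<bar> * c" using norm_triangle_ineq4[of "\<sigma> z - Z0" "A z"] nA ns by (simp add: c_def distrib_left)
      also have "\<dots> < d" using ep c by (simp add: field_simps)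
      finally have nb: "norm ((A z, \<sigma> z - A z) - (0, Z0)) < d" .
      have "dist (0, Z0) (A z, \<sigma> z - A z) = norm ((A z, \<sigma> z - A z) - (0, Z0))" by (subst dist_commute) (rule dist_norm)
      then have "(A z, \<sigma> z - A z) \<in> ball (0, Z0) d" using nb unfolding mem_ball by (rule ord_eq_less_trans)
      then show ?thesis using d(2) by blast
    qed
    have sol: "\<exists>u\<in>X. \<forall>z. norm (u z - u0 z) \<le> e" if "e > 0" for e
      using perturbed_solution[OF Om T p cD K R0 R u0_def A_def \<sigma>_def AU that] unfolding X_def by blast
    have neq: "restrict u Q \<noteq> restrict u0 Q" if "u \<in> X" for u
    proof
      assume eq: "restrict u Q = restrict u0 Q"
      have uu: "u z = u0 z" if "z \<in> Q" for z using fun_cong[OF eq, of z] that by simp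
      have DA: "Dx u w = A w" if w: "w \<in> Q" for w
      proof -
        have w': "fst w \<in> \<Omega>" "snd w \<in> {0<..<T}" using w by (auto simp: Q_def)
        have "((\<lambda>y. u0 (y, snd w)) has_derivative (\<lambda>h. A w *v h)) (at (fst w))"
          using has_derivative_scaleR_right[OF p[of "fst w"], of "\<epsilon> * snd w / T"] by (simp add: u0_def A_def scaleR_matrix_vector_assoc)
        then have "((\<lambda>y. u (y, snd w)) has_derivative (\<lambda>h. A w *v h)) (at (fst w))"
          by (rule has_derivative_transform_within_open[OF _ Om(1) w'(1)]) (use uu w'(2) in \<open>simp add: Q_def\<close>)
        from frechet_derivative_at[OF this] show ?thesis unfolding Dx_def by (metis matrix_of_matrix_vector_mul)
      qed
      have oQ: "open Q" using Om(1) by (auto simp: Q_def intro!: open_Times)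
      obtain x where "x \<in> \<Omega>" using Om(3) by blast
      then have z: "(x, T / 2) \<in> Q" using T by (simp add: Q_def)
      have "continuous_on UNIV A" unfolding A_def
        using T by (intro continuous_on_scaleR continuous_on_compose2[OF cD continuous_on_fst[OF continuous_on_id]]) (auto intro!: continuous_intros)
      then have cA: "isCont A (x, T / 2)" 
        by (rule continuous_on_eq_continuous_at[OF open_UNIV, THEN iffD1, rule_format, OF _ UNIV_I])
      have "\<exists>\<delta>>0. AE w in lborel. w \<in> ball (x, T / 2) \<delta> \<longrightarrow> norm (Dx u w - A (x, T / 2)) < e" if ge: "e > 0" for e
      proof -
        have "\<exists>d1>0. \<forall>w. dist w (x, T / 2) < d1 \<longrightarrow> dist (A w) (A (x, T / 2)) < e"
          by (rule cA[unfolded continuous_at_eps_delta, rule_format, OF ge])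
        then obtain d1 where d1: "d1 > 0" "\<forall>w. dist w (x, T / 2) < d1 \<longrightarrow> dist (A w) (A (x, T / 2)) < e"
          by (elim exE conjE) (rule that, assumption+)
        obtain d2 where d2: "d2 > 0" "ball (x, T / 2) d2 \<subseteq> Q" using oQ z open_contains_ball by metis
        have "norm (Dx u w - A (x, T / 2)) < e" if w: "w \<in> ball (x, T / 2) (min d1 d2)" for w
        proof -
          have w1: "dist w (x, T / 2) < d1" "w \<in> ball (x, T / 2) d2" using w by (simp_all add: dist_commute)
          have "dist (A w) (A (x, T / 2)) < e" by (rule d1(2)[THEN spec, THEN mp, OF w1(1)])
          moreover have "w \<in> Q" using w1(2) d2(2) by blast
          ultimately show ?thesis using DA[of w] by (simp only: dist_norm)
        qed
        moreover have "min d1 d2 > 0" using d1(1) d2(1) by simp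
        ultimately show ?thesis by (intro exI[of _ "min d1 d2"] conjI AE_I2 impI)
      qed
      moreover have "nowhere_continuous_grad \<Omega> T u" using that by (simp add: X_def)
      ultimately show False using z unfolding nowhere_continuous_grad_def Q_def by blast
    qed
    have "infinite ((\<lambda>u. restrict u Q) ` X)"
    proof
      assume fin: "finite ((\<lambda>u. restrict u Q) ` X)"
      \<comment> \<open>Each restriction differs from \<open>u0\<close> at some point by a positive
        amount, and the finite minimum of such amounts contradicts the solution that is closer to
        \<open>u0\<close>.\<close>
      obtain e where e: "e > 0" "\<And>g. g \<in> (\<lambda>u. restrict u Q) ` X \<Longrightarrow> \<exists>z\<in>Q. e < norm (g z - u0 z)"
      proof (rule uniform_radius[OF fin, where P = "\<lambda>g e. \<exists>z\<in>Q. e < norm (g z - u0 z)"])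
        fix g assume "g \<in> (\<lambda>u. restrict u Q) ` X"
        then obtain u where u: "u \<in> X" "g = restrict u Q" by blast
        obtain z where z: "restrict u Q z \<noteq> restrict u0 Q z" using neq[OF u(1)] by blast
        then have "z \<in> Q" by (cases "z \<in> Q") (simp_all add: restrict_def)
        then have "0 < norm (g z - u0 z)" using z u(2) by simp
        then show "\<exists>e>0. \<exists>z\<in>Q. e < norm (g z - u0 z)" using \<open>z \<in> Q\<close> by (meson dense)
      next
        show "\<exists>z\<in>Q. s < norm (g z - u0 z)" if "\<exists>z\<in>Q. t < norm (g z - u0 z)" "0 < s" "s \<le> t" for g and s t :: real
          using that by (meson le_less_trans)
      qed (rule that)
      obtain u where u: "u \<in> X" "\<And>z. norm (u z - u0 z) \<le> e" using sol[OF e(1)] by blast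
      obtain z where "z \<in> Q" "e < norm (restrict u Q z - u0 z)" using e(2)[of "restrict u Q"] u(1) by blast
      then show False using u(2)[of z] by simp
    qed
    then show "infinite ((\<lambda>u. restrict u (\<Omega> \<times> {0<..<T})) `
            {u. weak_solution F \<Omega> T u \<and> (\<forall>x\<in>\<Omega>. u (x, T) = \<epsilon> *\<^sub>R \<phi> x) \<and> nowhere_continuous_grad \<Omega> T u})"
      unfolding Q_def X_def .
  qed
qed

end

theorem theorem1p1:
  shows "\<exists>F :: mat2 \<Rightarrow> real. smooth_fun F \<and> strongly_polyconvex_form F \<and>
    (\<forall>(\<Omega> :: (real^2) set) (T::real) (\<phi> :: real^2 \<Rightarrow> real^2).
       open \<Omega> \<and> connected \<Omega> \<and> bounded \<Omega> \<and> \<Omega> \<noteq> {} \<and> T > 0 \<and>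
       C1_fun \<phi> \<and> (\<exists>K. compact K \<and> K \<subseteq> \<Omega> \<and> (\<forall>x. x \<notin> K \<longrightarrow> \<phi> x = 0)) \<longrightarrow>
       (\<exists>\<epsilon>\<^sub>0 > 0. \<forall>\<epsilon>::real. \<bar>\<epsilon>\<bar> < \<epsilon>\<^sub>0 \<longrightarrow>
          infinite ((\<lambda>u. restrict u (\<Omega> \<times> {0<..<T})) `
            {u. weak_solution F \<Omega> T u \<and> (\<forall>x\<in>\<Omega>. u (x, T) = \<epsilon> *\<^sub>R \<phi> x) \<and>
                nowhere_continuous_grad \<Omega> T u})))"
proof -
  obtain F :: "mat2 \<Rightarrow> real" and U :: "real \<Rightarrow> (mat2 \<times> mat2) set" and Z0 :: mat2
    and Zs As nr :: "nat \<Rightarrow> mat2" and r :: real where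
    F: "smooth_fun F" "strongly_polyconvex_form F" and r: "r > 0"
    and U: "\<And>c. open (U c)" "\<And>c d. 0 < c \<Longrightarrow> c \<le> d \<Longrightarrow> U c \<subseteq> U d" "\<And>c. bounded (U c)" "(0, Z0) \<in> U 1"
    and sp: "\<And>\<xi> c. \<xi> \<in> U c \<Longrightarrow> 0 < c \<Longrightarrow> c \<le> 1 \<Longrightarrow>
      \<exists>D v e1 e2. norm v = 1 \<and> 0 < e1 \<and> e1 \<le> 1 \<and> 0 < e2 \<and> e2 \<le> 1 \<and> e1 + e2 \<le> 2 * (199/200) * c \<and>
        norm D \<le> 1600 * c \<and> (\<forall>s. \<bar>s\<bar> \<le> 1 \<longrightarrow> \<xi> + s *\<^sub>R (- outer (D *v v) v, D) \<in> U 1) \<and>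
        \<xi> + (- outer (D *v v) v, D) \<in> U e1 \<and> \<xi> - (- outer (D *v v) v, D) \<in> U e2"
    and nr: "\<And>A' Z' c. (A', Z') \<in> U c \<Longrightarrow> 0 < c \<Longrightarrow> c \<le> 1 \<Longrightarrow>
      \<exists>i<5. \<exists>x. dist x (As i) < r \<and> norm (A' - x) \<le> 1600 * c \<and> norm (Z' - Zs i) \<le> 1600 * c"
    and sd: "\<And>A' Z' i. (A', Z') \<in> U 1 \<Longrightarrow> i < 5 \<Longrightarrow> nr i \<bullet> (Z' - Zs i) > 0"
    and gm: "\<And>i B. i < 5 \<Longrightarrow> dist B (As i) \<le> r \<Longrightarrow> DF F B = B + Zs i"
    and se: "\<And>i j. i < 5 \<Longrightarrow> j < 5 \<Longrightarrow> i \<noteq> j \<Longrightarrow> dist (As i) (As j) > 4 * r"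
    by (rule relaxation_exists) (rule that, assumption+)
  interpret five_states U F Z0 Zs As nr r
  proof unfold_locales
    show "open (U c)" for c by (rule U(1))
    show "U c \<subseteq> U d" if "0 < c" "c \<le> d" for c d using that by (rule U(2))
    show "bounded (U 1)" "(0, Z0) \<in> U 1" by (rule U)+
  qed ((rule sp, assumption+), rule r, (rule nr, assumption+), (rule sd, assumption+), (rule gm, assumption+), (rule se, assumption+))
  show ?thesis
  proof (intro exI[of _ F] conjI allI impI)
    fix \<Omega> :: "(real^2) set" and T :: real and \<phi> :: "real^2 \<Rightarrow> real^2"
    assume a: "open \<Omega> \<and> connected \<Omega> \<and> bounded \<Omega> \<and> \<Omega> \<noteq> {} \<and> T > 0 \<and>
       C1_fun \<phi> \<and> (\<exists>K. compact K \<and> K \<subseteq> \<Omega> \<and> (\<forall>x. x \<notin> K \<longrightarrow> \<phi> x = 0))"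
    then obtain K where K: "compact K" "K \<subseteq> \<Omega>" "\<And>x. x \<notin> K \<Longrightarrow> \<phi> x = 0" by blast
    show "\<exists>\<epsilon>\<^sub>0 > 0. \<forall>\<epsilon>::real. \<bar>\<epsilon>\<bar> < \<epsilon>\<^sub>0 \<longrightarrow>
          infinite ((\<lambda>u. restrict u (\<Omega> \<times> {0<..<T})) `
            {u. weak_solution F \<Omega> T u \<and> (\<forall>x\<in>\<Omega>. u (x, T) = \<epsilon> *\<^sub>R \<phi> x) \<and> nowhere_continuous_grad \<Omega> T u})"
      by (rule infinitely_many_solutions[where K = K]) (use a K in blast)+
  qed (rule F)+
qed

end
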